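(* Let $\Lambda$ be a row-finite $k$-graph with no sources. Let $\mathcal{G}_\Lambda=\mathcal{G}(\Lambda^\infty,\sigma)$ be the associated groupoid, and let $(A^\sigma_*,\partial_* )$ be the complex with $A^\sigma_p=\bigwedge^p\mathbb{Z}^k\otimes C_c(\Lambda^\infty,\mathbb{Z})$ associated to the shift $\sigma$ on $\Lambda^\infty$, and $(D^\Lambda_*,\partial_* )$ the complex with $D^\Lambda_p=\bigwedge^p\mathbb{Z}^k\otimes\mathbb{Z}\Lambda^0$ associated to the vertex matrices of $\Lambda$ (both as defined in the context). Then the homomorphism $\iota:\mathbb{Z}\Lambda^0\to C_c(\Lambda^\infty,\mathbb{Z})$ determined by $\iota(1_v)=1_{Z(v)}$ induces an isomorphism $H_*(D^\Lambda_* )\to H_*(A^\sigma_* )$. In particular, $H_*(\mathcal{G}(\Lambda^\infty,\sigma))\cong H_*(D^\Lambda_* )$.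
   Context: $k$-graphs. A $k$-graph is a non-empty countable small category $\Lambda$ with a functor $d:\Lambda\to\mathbb{N}^k$ such that whenever $d(\lambda)=m+n$ there are unique $\mu,\nu$ with $d(\mu)=m$, $d(\nu)=n$, $\lambda=\mu\nu$. $\Lambda^n=d^{-1}(n)$; $\Lambda^0$ is the set of vertices (identity morphisms); $r(\lambda),s(\lambda)$ are the codomain and domain; $v\Lambda^nw=\{\lambda\in\Lambda^n:r(\lambda)=v,s(\lambda)=w\}$. $\Lambda$ is row-finite with no sources if $0<|v\Lambda^n|<\infty$ for all $v\in\Lambda^0$, $n\in\mathbb{N}^k$, where $v\Lambda^n=\{\lambda\in\Lambda^n:r(\lambda)=v\}$. Let $\Omega_k=\{(m,n)\in\mathbb{N}^k\times\mathbb{N}^k:m\le n\}$ be the $k$-graph with $r(m,n)=(m,m)$, $s(m,n)=(n,n)$, $(m,n)(n,p)=(m,p)$, $d(m,n)=n-m$. $\Lambda^\infty$ is the set of degree-preserving functors $x:\Omega_k\to\Lambda$, with topology having basis the compact open sets $Z(\lambda)=\{x:x(0,d(\lambda))=\lambda\}$; the shift maps, which are local homeomorphisms, are $(\sigma^px)(m,n)=x(m+p,n+p)$. The groupoid is $\mathcal{G}_\Lambda=\{(x,m-n,y)\in\Lambda^\infty\times\mathbb{Z}^k\times\Lambda^\infty:m,n\in\mathbb{N}^k,\sigma^m(x)=\sigma^n(y)\}$ with $r(x,a,y)=x$, $s(x,a,y)=y$, $(x,a,y)(y,b,z)=(x,a+b,z)$, and topology with basis the sets $Z(\mu,\nu)=\{(\mu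 x,d(\mu)-d(\nu),\nu x):x\in Z(s(\mu))\}$, $s(\mu)=s(\nu)$; it is an ample Hausdorff groupoid with unit space $\Lambda^\infty$. For a local homeomorphism $\psi:Y\to X$ of locally compact Hausdorff zero-dimensional spaces, $\psi_*:C_c(Y,\mathbb{Z})\to C_c(X,\mathbb{Z})$ is $\psi_*(f)(x)=\sum_{\psi(y)=x}f(y)$. Complexes. $\varepsilon_1,\dots,\varepsilon_k$ generate $\mathbb{Z}^k$, $e_1,\dots,e_k$ generate $\mathbb{N}^k$, $\bigwedge^0\mathbb{Z}^k=\mathbb{Z}$. Given an abelian group $A$ with commuting endomorphisms $T_1,\dots,T_k$, form the complex $\bigwedge^*\mathbb{Z}^k\otimes A$ (zero in degrees $p>k$) with $\partial_1(\varepsilon_i\otimes a)=1\otimes(\mathrm{id}-T_i)a$ and, for $2\le p\le k$ and $i_1<\dots<i_p$, $\partial_p(\varepsilon_{i_1}\wedge\dots\wedge\varepsilon_{i_p}\otimes a)=\sum_{j=1}^p(-1)^{j+1}\varepsilon_{i_1}\wedge\dots\wedge\widehat{\varepsilon}_{i_j}\wedge\dots\wedge\varepsilon_{i_p}\otimes(\mathrm{id}-T_{i_j})a$. $A^\sigma_*$ is this complex for $A=C_c(\Lambda^\infty,\mathbb{Z})$, $T_i=\sigma^{e_i}_*$. $D^\Lambda_*$ is this complex for $A=\mathbb{Z}\Lambda^0$ (free abelian with generators $1_v$, $v\in\Lambda^0$) and $T_i=M_i^t$, where $M_i(v,w)=|v\Lambda^{e_i}w|$, so $M_i^t1_v=\sum_w|v\Lambda^{e_i}w|1_w$.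 The map on complexes induced by $\iota$ is $\mathrm{id}\otimes\iota$. Groupoid homology: for an ample Hausdorff groupoid $\mathcal{G}$ let $\mathcal{G}^{(n)}$ be the space of composable $n$-tuples ($\mathcal{G}^{(0)}$ the unit space). For $n\ge2$, $d_0(g_1,\dots,g_n)=(g_2,\dots,g_n)$, $d_i(g_1,\dots,g_n)=(g_1,\dots,g_ig_{i+1},\dots,g_n)$ for $1\le i\le n-1$, $d_n(g_1,\dots,g_n)=(g_1,\dots,g_{n-1})$. Put $\partial_0=0$, $\partial_1=s_*-r_*$, $\partial_n=\sum_{i=0}^n(-1)^i(d_i)_*$ for $n\ge2$; $H_*(\mathcal{G})$ is the homology of $(C_c(\mathcal{G}^{( * )},\mathbb{Z}),\partial_* )$. *)

theory Defs
  imports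
    "HOL-Analysis.Function_Topology"
    "HOL-Algebra.Free_Abelian_Groups"
    "HOL-Library.Function_Algebras"
begin

section \<open>Chain complexes of abelian groups and their homology\<close>

text \<open>The chain groups are subgroups of an additive group \<open>'c\<close>; the differential
  \<open>bdry C n\<close> maps \<open>chains C n\<close> to \<open>chains C (n - 1)\<close> and is zero for \<open>n = 0\<close>.\<close>

record 'c chain_complex =
  chains :: "nat \<Rightarrow> 'c set"
  bdry :: "nat \<Rightarrow> 'c \<Rightarrow> 'c"

definition additive_group :: "'c::ab_group_add set \<Rightarrow> 'c monoid" where
  "additive_group S = \<lparr>carrier = S, monoid.mult = (+), one = 0\<rparr>"

definition cycles :: "'c::ab_group_add chain_complex \<Rightarrow> nat \<Rightarrow> 'c set" where
  "cycles C n = {c \<in> chains C n. bdry C n c = 0}"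

definition boundaries :: "'c::ab_group_add chain_complex \<Rightarrow> nat \<Rightarrow> 'c set" where
  "boundaries C n = bdry C (Suc n) ` chains C (Suc n)"

definition homology :: "'c::ab_group_add chain_complex \<Rightarrow> nat \<Rightarrow> 'c set monoid" where
  "homology C n = additive_group (cycles C n) Mod boundaries C n"

definition homology_class :: "'c::ab_group_add chain_complex \<Rightarrow> nat \<Rightarrow> 'c \<Rightarrow> 'c set" where
  "homology_class C n c = boundaries C n #>\<^bsub>additive_group (cycles C n)\<^esub> c"

definition chain_map ::
  "'c::ab_group_add chain_complex \<Rightarrow> 'd::ab_group_add chain_complex \<Rightarrow> ('c \<Rightarrow> 'd) \<Rightarrow> bool" where
  "chain_map C D f \<longleftrightarrow>
     (\<forall>n. f \<in> hom (additive_group (chains C n)) (additive_group (chains D n))) \<and>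
     (\<forall>n. \<forall>c \<in> chains C (Suc n). f (bdry C (Suc n) c) = bdry D (Suc n) (f c))"

definition homology_iso_via ::
  "'c::ab_group_add chain_complex \<Rightarrow> 'd::ab_group_add chain_complex \<Rightarrow> ('c \<Rightarrow> 'd) \<Rightarrow> nat \<Rightarrow> bool" where
  "homology_iso_via C D f n \<longleftrightarrow>
     (\<exists>h \<in> iso (homology C n) (homology D n).
        \<forall>c \<in> cycles C n. h (homology_class C n c) = homology_class D n (f c))"

section \<open>The complex of commuting endomorphisms\<close>

text \<open>The indices $1,\dots,k$ are represented by \<open>{..<k}\<close>.  As the exterior power
  $\bigwedge^p \mathbb{Z}^k$ is free abelian on the elements
  $\varepsilon_{i_1} \wedge \dots \wedge \varepsilon_{i_p}$ with $i_1 < \dots < i_p$, its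
  tensor product with \<open>A\<close> is the group of finitely supported \<open>A\<close>-valued functions on the set of
  \<open>p\<close>-element subsets of \<open>{..<k}\<close>: for $I = \{i_1 < \dots < i_p\}$, the elementary tensor
  $\varepsilon_{i_1} \wedge \dots \wedge \varepsilon_{i_p} \otimes a$ is
  \<open>Poly_Mapping.single I a\<close>.  In the differential, \<open>j\<close> also counts from \<open>0\<close>, so that the sign
  $(-1)^{j+1}$ of the usual formula becomes $(-1)^j$.\<close>

definition exterior_chains :: "nat \<Rightarrow> 'b::ab_group_add set \<Rightarrow> nat \<Rightarrow> (nat set \<Rightarrow>\<^sub>0 'b) set" where
  "exterior_chains k A p =
     {c. Poly_Mapping.keys c \<subseteq> {I. I \<subseteq> {..<k} \<and> card I = p} \<and>
         (\<forall>I. Poly_Mapping.lookup c I \<in> A)}"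

definition exterior_bdry ::
  "(nat \<Rightarrow> 'b::ab_group_add \<Rightarrow> 'b) \<Rightarrow> nat \<Rightarrow> (nat set \<Rightarrow>\<^sub>0 'b) \<Rightarrow> (nat set \<Rightarrow>\<^sub>0 'b)" where
  "exterior_bdry T p c =
     (\<Sum>I\<in>Poly_Mapping.keys c. \<Sum>j<p.
        let i = sorted_list_of_set I ! j; a = Poly_Mapping.lookup c I; b = a - T i a
        in Poly_Mapping.single (I - {i}) (if even j then b else - b))"

definition exterior_complex ::
  "nat \<Rightarrow> 'b::ab_group_add set \<Rightarrow> (nat \<Rightarrow> 'b \<Rightarrow> 'b) \<Rightarrow> (nat set \<Rightarrow>\<^sub>0 'b) chain_complex" where
  "exterior_complex k A T = \<lparr>chains = exterior_chains k A, bdry = exterior_bdry T\<rparr>"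

section \<open>Compactly supported functions and push-forward\<close>

text \<open>Functions on \<open>topspace X\<close> are extended by zero.\<close>

definition Cc :: "'x topology \<Rightarrow> ('x \<Rightarrow> int) set" where
  "Cc X = {f. continuous_map X (discrete_topology UNIV) f \<and>
              (\<forall>x. x \<notin> topspace X \<longrightarrow> f x = 0) \<and>
              compactin X (X closure_of {x \<in> topspace X. f x \<noteq> 0})}"

text \<open>The fibre is cut down to the support of \<open>f\<close>, because a sum over an infinite set is
  zero by convention; for a local homeomorphism \<open>\<psi>\<close> and \<open>f \<in> Cc Y\<close> the remaining set is finite.\<close>

definition pushforward :: "'y topology \<Rightarrow> ('y \<Rightarrow> 'x) \<Rightarrow> ('y \<Rightarrow> int) \<Rightarrow> 'x \<Rightarrow> int" where
  "pushforward Y \<psi> f = (\<lambda>x. \<Sum>y | y \<in> topspace Y \<and> \<psi> y = x \<and> f y \<noteq> 0. f y)"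

section \<open>Groupoid homology\<close>

text \<open>The unit space is regarded as a subspace of the space of arrows, so that \<open>grng\<close> and
  \<open>gsrc\<close> take values in unit arrows.\<close>

record 'g top_groupoid =
  arrows :: "'g set"
  arrow_top :: "'g topology"
  grng :: "'g \<Rightarrow> 'g"
  gsrc :: "'g \<Rightarrow> 'g"
  gcomp :: "'g \<Rightarrow> 'g \<Rightarrow> 'g"

definition units :: "'g top_groupoid \<Rightarrow> 'g set" where
  "units G = gsrc G ` arrows G"

text \<open>A composable \<open>n\<close>-tuple $(g_1,\dots,g_n)$ is the extensional function on \<open>{..<n}\<close>
  with \<open>g i\<close> in the place of $g_{i+1}$.  In degree \<open>0\<close>, a unit \<open>u\<close> is represented by the
  one-element tuple \<open>(u)\<close>, so that all degrees have the same type.\<close>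

definition nerve :: "'g top_groupoid \<Rightarrow> nat \<Rightarrow> (nat \<Rightarrow> 'g) topology" where
  "nerve G n =
     (if n = 0
      then subtopology (product_topology (\<lambda>_. arrow_top G) {..<1}) {g. g 0 \<in> units G}
      else subtopology (product_topology (\<lambda>_. arrow_top G) {..<n})
             {g. (\<forall>i<n. g i \<in> arrows G) \<and> (\<forall>i. Suc i < n \<longrightarrow> gsrc G (g i) = grng G (g (Suc i)))})"

definition face :: "'g top_groupoid \<Rightarrow> nat \<Rightarrow> nat \<Rightarrow> (nat \<Rightarrow> 'g) \<Rightarrow> (nat \<Rightarrow> 'g)" where
  "face G n i g =
     (if i = 0 then (\<lambda>j\<in>{..<n - 1}. g (Suc j))
      else if i = n then (\<lambda>j\<in>{..<n - 1}. g j)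
      else (\<lambda>j\<in>{..<n - 1}. if j < i - 1 then g j
                           else if j = i - 1 then gcomp G (g (i - 1)) (g i)
                           else g (Suc j)))"

definition groupoid_bdry ::
  "'g top_groupoid \<Rightarrow> nat \<Rightarrow> ((nat \<Rightarrow> 'g) \<Rightarrow> int) \<Rightarrow> ((nat \<Rightarrow> 'g) \<Rightarrow> int)" where
  "groupoid_bdry G n f =
     (if n = 0 then 0
      else if n = 1
      then pushforward (nerve G 1) (\<lambda>g. \<lambda>j\<in>{..<1}. gsrc G (g 0)) f
           - pushforward (nerve G 1) (\<lambda>g. \<lambda>j\<in>{..<1}. grng G (g 0)) f
      else (\<lambda>x. \<Sum>i\<le>n. (- 1) ^ i * pushforward (nerve G n) (face G n i) f x))"

definition groupoid_complex :: "'g top_groupoid \<Rightarrow> ((nat \<Rightarrow> 'g) \<Rightarrow> int) chain_complex" where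
  "groupoid_complex G = \<lparr>chains = (\<lambda>n. Cc (nerve G n)), bdry = groupoid_bdry G\<rparr>"

section \<open>Higher-rank graphs\<close>

text \<open>$\mathbb{N}^k$ consists of the functions vanishing outside \<open>{..<k}\<close>; the order and the
  arithmetic operations on it are the pointwise ones of the function type.\<close>

definition Nk :: "nat \<Rightarrow> (nat \<Rightarrow> nat) set" where
  "Nk k = {m. \<forall>i\<ge>k. m i = 0}"

definition unit_vec :: "nat \<Rightarrow> nat \<Rightarrow> nat" where
  "unit_vec i = (\<lambda>j. if j = i then 1 else 0)"

definition degree_diff :: "(nat \<Rightarrow> nat) \<Rightarrow> (nat \<Rightarrow> nat) \<Rightarrow> (nat \<Rightarrow> int)" where
  "degree_diff m n = (\<lambda>i. int (m i) - int (n i))"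

text \<open>Categories are one-sorted: objects are identified with their identity morphisms, and
  \<open>comp \<Lambda> \<mu> \<nu>\<close> is the composite $\mu\nu$, meaningful if \<open>src \<Lambda> \<mu> = rng \<Lambda> \<nu>\<close>.\<close>

record 'a graded_cat =
  mor :: "'a set"
  rng :: "'a \<Rightarrow> 'a"
  src :: "'a \<Rightarrow> 'a"
  comp :: "'a \<Rightarrow> 'a \<Rightarrow> 'a"
  deg :: "'a \<Rightarrow> (nat \<Rightarrow> nat)"

locale k_graph =
  fixes k :: nat and \<Lambda> :: "'a graded_cat"
  assumes nonempty: "mor \<Lambda> \<noteq> {}"
    and countable_mor: "countable (mor \<Lambda>)"
    and rng_closed: "\<And>\<eta>. \<eta> \<in> mor \<Lambda> \<Longrightarrow> rng \<Lambda> \<eta> \<in> mor \<Lambda>"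
    and src_closed: "\<And>\<eta>. \<eta> \<in> mor \<Lambda> \<Longrightarrow> src \<Lambda> \<eta> \<in> mor \<Lambda>"
    and rng_rng: "\<And>\<eta>. \<eta> \<in> mor \<Lambda> \<Longrightarrow> rng \<Lambda> (rng \<Lambda> \<eta>) = rng \<Lambda> \<eta>"
    and src_rng: "\<And>\<eta>. \<eta> \<in> mor \<Lambda> \<Longrightarrow> src \<Lambda> (rng \<Lambda> \<eta>) = rng \<Lambda> \<eta>"
    and rng_src: "\<And>\<eta>. \<eta> \<in> mor \<Lambda> \<Longrightarrow> rng \<Lambda> (src \<Lambda> \<eta>) = src \<Lambda> \<eta>"
    and src_src: "\<And>\<eta>. \<eta> \<in> mor \<Lambda> \<Longrightarrow> src \<Lambda> (src \<Lambda> \<eta>) = src \<Lambda> \<eta>"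
    and comp_closed: "\<And>\<mu> \<nu>. \<lbrakk>\<mu> \<in> mor \<Lambda>; \<nu> \<in> mor \<Lambda>; src \<Lambda> \<mu> = rng \<Lambda> \<nu>\<rbrakk> \<Longrightarrow> comp \<Lambda> \<mu> \<nu> \<in> mor \<Lambda>"
    and rng_comp: "\<And>\<mu> \<nu>. \<lbrakk>\<mu> \<in> mor \<Lambda>; \<nu> \<in> mor \<Lambda>; src \<Lambda> \<mu> = rng \<Lambda> \<nu>\<rbrakk> \<Longrightarrow> rng \<Lambda> (comp \<Lambda> \<mu> \<nu>) = rng \<Lambda> \<mu>"
    and src_comp: "\<And>\<mu> \<nu>. \<lbrakk>\<mu> \<in> mor \<Lambda>; \<nu> \<in> mor \<Lambda>; src \<Lambda> \<mu> = rng \<Lambda> \<nu>\<rbrakk> \<Longrightarrow> src \<Lambda> (comp \<Lambda> \<mu> \<nu>) = src \<Lambda> \<nu>"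
    and comp_rng: "\<And>\<eta>. \<eta> \<in> mor \<Lambda> \<Longrightarrow> comp \<Lambda> (rng \<Lambda> \<eta>) \<eta> = \<eta>"
    and comp_src: "\<And>\<eta>. \<eta> \<in> mor \<Lambda> \<Longrightarrow> comp \<Lambda> \<eta> (src \<Lambda> \<eta>) = \<eta>"
    and comp_assoc: "\<And>\<kappa> \<mu> \<nu>. \<lbrakk>\<kappa> \<in> mor \<Lambda>; \<mu> \<in> mor \<Lambda>; \<nu> \<in> mor \<Lambda>; src \<Lambda> \<kappa> = rng \<Lambda> \<mu>; src \<Lambda> \<mu> = rng \<Lambda> \<nu>\<rbrakk>
           \<Longrightarrow> comp \<Lambda> (comp \<Lambda> \<kappa> \<mu>) \<nu> = comp \<Lambda> \<kappa> (comp \<Lambda> \<mu> \<nu>)"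
    and deg_closed: "\<And>\<eta>. \<eta> \<in> mor \<Lambda> \<Longrightarrow> deg \<Lambda> \<eta> \<in> Nk k"
    and deg_identity: "\<And>\<eta>. \<eta> \<in> mor \<Lambda> \<Longrightarrow> deg \<Lambda> (rng \<Lambda> \<eta>) = 0"
    and deg_comp: "\<And>\<mu> \<nu>. \<lbrakk>\<mu> \<in> mor \<Lambda>; \<nu> \<in> mor \<Lambda>; src \<Lambda> \<mu> = rng \<Lambda> \<nu>\<rbrakk>
           \<Longrightarrow> deg \<Lambda> (comp \<Lambda> \<mu> \<nu>) = deg \<Lambda> \<mu> + deg \<Lambda> \<nu>"
    and factorisation: "\<And>\<eta> m n. \<lbrakk>\<eta> \<in> mor \<Lambda>; m \<in> Nk k; n \<in> Nk k; deg \<Lambda> \<eta> = m + n\<rbrakk>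
           \<Longrightarrow> \<exists>!(\<mu>, \<nu>). \<mu> \<in> mor \<Lambda> \<and> \<nu> \<in> mor \<Lambda> \<and> src \<Lambda> \<mu> = rng \<Lambda> \<nu> \<and>
                 deg \<Lambda> \<mu> = m \<and> deg \<Lambda> \<nu> = n \<and> \<eta> = comp \<Lambda> \<mu> \<nu>"

definition vertices :: "'a graded_cat \<Rightarrow> 'a set" where
  "vertices \<Lambda> = {v \<in> mor \<Lambda>. deg \<Lambda> v = 0}"

definition paths_from :: "'a graded_cat \<Rightarrow> 'a \<Rightarrow> (nat \<Rightarrow> nat) \<Rightarrow> 'a set" where
  "paths_from \<Lambda> v n = {\<eta> \<in> mor \<Lambda>. deg \<Lambda> \<eta> = n \<and> rng \<Lambda> \<eta> = v}"

definition paths_between :: "'a graded_cat \<Rightarrow> 'a \<Rightarrow> (nat \<Rightarrow> nat) \<Rightarrow> 'a \<Rightarrow> 'a set" where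
  "paths_between \<Lambda> v n w = {\<eta> \<in> mor \<Lambda>. deg \<Lambda> \<eta> = n \<and> rng \<Lambda> \<eta> = v \<and> src \<Lambda> \<eta> = w}"

definition row_finite_no_sources :: "nat \<Rightarrow> 'a graded_cat \<Rightarrow> bool" where
  "row_finite_no_sources k \<Lambda> \<longleftrightarrow>
     (\<forall>v \<in> vertices \<Lambda>. \<forall>n \<in> Nk k. finite (paths_from \<Lambda> v n) \<and> paths_from \<Lambda> v n \<noteq> {})"

section \<open>Infinite paths\<close>

definition Omega :: "nat \<Rightarrow> ((nat \<Rightarrow> nat) \<times> (nat \<Rightarrow> nat)) graded_cat" where
  "Omega k =
     \<lparr>mor = {(m, n). m \<in> Nk k \<and> n \<in> Nk k \<and> m \<le> n},
      rng = (\<lambda>(m, n). (m, m)),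
      src = (\<lambda>(m, n). (n, n)),
      comp = (\<lambda>(m, n) (n', p). (m, p)),
      deg = (\<lambda>(m, n). n - m)\<rparr>"

definition graded_functor :: "'b graded_cat \<Rightarrow> 'a graded_cat \<Rightarrow> ('b \<Rightarrow> 'a) \<Rightarrow> bool" where
  "graded_functor E F x \<longleftrightarrow>
     (\<forall>\<alpha> \<in> mor E. x \<alpha> \<in> mor F \<and> x (rng E \<alpha>) = rng F (x \<alpha>) \<and> x (src E \<alpha>) = src F (x \<alpha>) \<and>
                  deg F (x \<alpha>) = deg E \<alpha>) \<and>
     (\<forall>\<alpha> \<in> mor E. \<forall>\<beta> \<in> mor E. src E \<alpha> = rng E \<beta> \<longrightarrow> x (comp E \<alpha> \<beta>) = comp F (x \<alpha>) (x \<beta>))"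

type_synonym 'a ipath = "(nat \<Rightarrow> nat) \<times> (nat \<Rightarrow> nat) \<Rightarrow> 'a"

definition infinite_paths :: "nat \<Rightarrow> 'a graded_cat \<Rightarrow> 'a ipath set" where
  "infinite_paths k \<Lambda> = {x \<in> extensional (mor (Omega k)). graded_functor (Omega k) \<Lambda> x}"

definition cylinder :: "nat \<Rightarrow> 'a graded_cat \<Rightarrow> 'a \<Rightarrow> 'a ipath set" where
  "cylinder k \<Lambda> \<eta> = {x \<in> infinite_paths k \<Lambda>. x (0, deg \<Lambda> \<eta>) = \<eta>}"

text \<open>The cylinders form a basis, not just a subbasis, of the topology they generate.\<close>

definition path_space :: "nat \<Rightarrow> 'a graded_cat \<Rightarrow> 'a ipath topology" where
  "path_space k \<Lambda> = topology_generated_by (cylinder k \<Lambda> ` mor \<Lambda>)"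

definition shift :: "nat \<Rightarrow> (nat \<Rightarrow> nat) \<Rightarrow> 'a ipath \<Rightarrow> 'a ipath" where
  "shift k p x = (\<lambda>(m, n)\<in>mor (Omega k). x (m + p, n + p))"

text \<open>For \<open>x \<in> cylinder k \<Lambda> (src \<Lambda> \<mu>)\<close>, the path $\mu x$ is the unique
  $y \in Z(\mu)$ with $\sigma^{d(\mu)}(y) = x$.\<close>

definition path_prepend :: "nat \<Rightarrow> 'a graded_cat \<Rightarrow> 'a \<Rightarrow> 'a ipath \<Rightarrow> 'a ipath" where
  "path_prepend k \<Lambda> \<mu> x = (THE y. y \<in> cylinder k \<Lambda> \<mu> \<and> shift k (deg \<Lambda> \<mu>) y = x)"

section \<open>The groupoid of a higher-rank graph\<close>

definition kgraph_arrows ::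
  "nat \<Rightarrow> 'a graded_cat \<Rightarrow> ('a ipath \<times> (nat \<Rightarrow> int) \<times> 'a ipath) set" where
  "kgraph_arrows k \<Lambda> =
     {(x, degree_diff m n, y) | x m n y.
        x \<in> infinite_paths k \<Lambda> \<and> y \<in> infinite_paths k \<Lambda> \<and> m \<in> Nk k \<and> n \<in> Nk k \<and>
        shift k m x = shift k n y}"

definition bisection ::
  "nat \<Rightarrow> 'a graded_cat \<Rightarrow> 'a \<Rightarrow> 'a \<Rightarrow> ('a ipath \<times> (nat \<Rightarrow> int) \<times> 'a ipath) set" where
  "bisection k \<Lambda> \<mu> \<nu> =
     (\<lambda>x. (path_prepend k \<Lambda> \<mu> x, degree_diff (deg \<Lambda> \<mu>) (deg \<Lambda> \<nu>), path_prepend k \<Lambda> \<nu> x))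
       ` cylinder k \<Lambda> (src \<Lambda> \<mu>)"

text \<open>The infinite path \<open>x\<close> is identified with the unit arrow \<open>(x, 0, x)\<close>.\<close>

definition kgraph_groupoid ::
  "nat \<Rightarrow> 'a graded_cat \<Rightarrow> ('a ipath \<times> (nat \<Rightarrow> int) \<times> 'a ipath) top_groupoid" where
  "kgraph_groupoid k \<Lambda> =
     \<lparr>arrows = kgraph_arrows k \<Lambda>,
      arrow_top = topology_generated_by
        {bisection k \<Lambda> \<mu> \<nu> | \<mu> \<nu>. \<mu> \<in> mor \<Lambda> \<and> \<nu> \<in> mor \<Lambda> \<and> src \<Lambda> \<mu> = src \<Lambda> \<nu>},
      grng = (\<lambda>(x, a, y). (x, 0, x)),
      gsrc = (\<lambda>(x, a, y). (y, 0, y)),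
      gcomp = (\<lambda>(x, a, y) (y', b, z). (x, a + b, z))\<rparr>"

section \<open>The two complexes of a higher-rank graph\<close>

definition shift_complex ::
  "nat \<Rightarrow> 'a graded_cat \<Rightarrow> (nat set \<Rightarrow>\<^sub>0 ('a ipath \<Rightarrow> int)) chain_complex" where
  "shift_complex k \<Lambda> =
     exterior_complex k (Cc (path_space k \<Lambda>))
       (\<lambda>i. pushforward (path_space k \<Lambda>) (shift k (unit_vec i)))"

definition vertex_matrix :: "'a graded_cat \<Rightarrow> nat \<Rightarrow> 'a \<Rightarrow> 'a \<Rightarrow> nat" where
  "vertex_matrix \<Lambda> i v w = card (paths_between \<Lambda> v (unit_vec i) w)"

text \<open>The sum over \<open>w\<close> is restricted to the nonzero matrix entries, which are finitely many
  in each row of a row-finite graph.\<close>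

definition vertex_matrix_transpose :: "'a graded_cat \<Rightarrow> nat \<Rightarrow> ('a \<Rightarrow>\<^sub>0 int) \<Rightarrow> ('a \<Rightarrow>\<^sub>0 int)" where
  "vertex_matrix_transpose \<Lambda> i =
     frag_extend (\<lambda>v. \<Sum>w | w \<in> vertices \<Lambda> \<and> vertex_matrix \<Lambda> i v w \<noteq> 0.
                        frag_cmul (int (vertex_matrix \<Lambda> i v w)) (frag_of w))"

definition vertex_complex :: "nat \<Rightarrow> 'a graded_cat \<Rightarrow> (nat set \<Rightarrow>\<^sub>0 ('a \<Rightarrow>\<^sub>0 int)) chain_complex" where
  "vertex_complex k \<Lambda> =
     exterior_complex k (carrier (free_Abelian_group (vertices \<Lambda>))) (vertex_matrix_transpose \<Lambda>)"

definition iota :: "nat \<Rightarrow> 'a graded_cat \<Rightarrow> ('a \<Rightarrow>\<^sub>0 int) \<Rightarrow> ('a ipath \<Rightarrow> int)" where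
  "iota k \<Lambda> c =
     (\<lambda>x. \<Sum>v\<in>Poly_Mapping.keys c. Poly_Mapping.lookup c v * indicator (cylinder k \<Lambda> v) x)"

text \<open>$\mathrm{id} \otimes \iota$ applies \<open>\<iota>\<close> to each coefficient.\<close>

definition iota_complex ::
  "nat \<Rightarrow> 'a graded_cat \<Rightarrow> (nat set \<Rightarrow>\<^sub>0 ('a \<Rightarrow>\<^sub>0 int)) \<Rightarrow> (nat set \<Rightarrow>\<^sub>0 ('a ipath \<Rightarrow> int))" where
  "iota_complex k \<Lambda> = Poly_Mapping.map (iota k \<Lambda>)"

end

theory Submission
  imports Defs
begin

text \<open>
  On the homology of the complex of commuting endomorphisms \<open>T\<^sub>i\<close> each \<open>T\<^sub>i\<close> acts as the identity,
  because \<open>\<epsilon>\<^sub>i \<and> -\<close> is a homotopy from \<open>T\<^sub>i\<close> to the identity.  Since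
  $\sigma^{d(\mu)}_* 1_{Z(\mu)} = 1_{Z(s(\mu))}$, every function in $C_c(\Lambda^\infty, \mathbb{Z})$ is
  moved into the image of $\iota$ by finitely many of the $\sigma^{e_i}_*$; as $\iota$ is injective, it is a
  quasi-isomorphism.

  For the groupoid, consider tuples $(\mu_0, \dots, \mu_n)$ of paths with a common source.  The sets of
  all points of the nerve with vertices $\mu_0 z, \dots, \mu_n z$ are compact open and form a base, and
  the faces of the nerve omit one of the $\mu_i$.  Let $Y_n$ be the set of these tuples and $\tau_i$ the
  endomorphism of $\mathbb{Z} Y_n$ that sends a tuple to the sum of its extensions
  $(\mu_0 \alpha, \dots, \mu_n \alpha)$ by the paths $\alpha$ of degree $e_i$.  The double complex
  $\bigwedge^p \mathbb{Z}^k \otimes \mathbb{Z} Y_n$ has exact columns, augmented to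
  $\bigwedge^p \mathbb{Z}^k \otimes \mathbb{Z} \Lambda^0$ by the common source, because putting the
  source in front of a tuple is a contraction.  Its rows, augmented to the chains of the groupoid, are
  exact because the $1 - \tau_i$ form a regular sequence: a tuple and its extensions have the same
  image in the groupoid chains, and tuples with $\mu_0$ of a fixed degree have linearly independent
  images.  Hence both augmentations compute the homology of the double complex.
\<close>

section \<open>Subgroups of additive groups and their quotients\<close>

text \<open>The contraction of the columns does not commute with the \<open>\<tau> i\<close>:
  extending a tuple by \<open>\<alpha>\<close> after its source was put in front gives a tuple that
  begins with \<open>\<alpha>\<close>, whereas the other order gives one that begins with
  \<open>src \<Lambda> \<alpha>\<close>. Hence it yields no chain map between the two augmentations,
  and the isomorphism arises from a relation between cycles.

  The linear independence comes from the degree cocycle of the groupoid: a point of the nerve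
  records the differences of the degrees of consecutive paths, so the degree of the first path
  determines all the others, and distinct paths of equal degree have disjoint cylinders. Regularity
  follows because each \<open>\<tau> i\<close> raises that first degree by one in the coordinate
  \<open>i\<close>: modulo the images of the 1 - \<open>\<tau> i\<close>, a finite combination can
  be moved to a single degree, where no relations remain.

  Push-forwards are computed only on combinations of indicator functions of sets on which the map is
  injective; for the shifts such a form is reached by refining cylinders.\<close>

definition add_closed :: "'b::ab_group_add set \<Rightarrow> bool" where
  "add_closed A \<longleftrightarrow> 0 \<in> A \<and> (\<forall>x\<in>A. \<forall>y\<in>A. x - y \<in> A)"

definition additive_on :: "'b::ab_group_add set \<Rightarrow> ('b \<Rightarrow> 'c::ab_group_add) \<Rightarrow> bool" where
  "additive_on A f \<longleftrightarrow> (\<forall>x\<in>A. \<forall>y\<in>A. f (x + y) = f x + f y)"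

lemma add_closed_zero: "add_closed A \<Longrightarrow> 0 \<in> A"
  by (simp add: add_closed_def)

lemma add_closed_diff: "\<lbrakk>add_closed A; x \<in> A; y \<in> A\<rbrakk> \<Longrightarrow> x - y \<in> A"
  by (simp add: add_closed_def)

lemma add_closed_minus: "\<lbrakk>add_closed A; x \<in> A\<rbrakk> \<Longrightarrow> - x \<in> A"
  using add_closed_diff[of A 0 x] by (simp add: add_closed_zero)

lemma add_closed_add: "\<lbrakk>add_closed A; x \<in> A; y \<in> A\<rbrakk> \<Longrightarrow> x + y \<in> A"
  using add_closed_diff[of A x "- y"] by (simp add: add_closed_minus)

lemma add_closed_sum:
  assumes "add_closed A" "\<And>i. i \<in> S \<Longrightarrow> f i \<in> A"
  shows "sum f S \<in> A"
  using assms(2)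
  by (induction S rule: infinite_finite_induct)
    (auto intro: add_closed_zero[OF assms(1)] add_closed_add[OF assms(1)])

lemma additive_onD: "\<lbrakk>additive_on A f; x \<in> A; y \<in> A\<rbrakk> \<Longrightarrow> f (x + y) = f x + f y"
  by (simp add: additive_on_def)

lemma additive_on_zero: "\<lbrakk>additive_on A f; 0 \<in> A\<rbrakk> \<Longrightarrow> f 0 = 0"
  using additive_onD[of A f 0 0] by simp

lemma additive_on_diff: "\<lbrakk>add_closed A; additive_on A f; x \<in> A; y \<in> A\<rbrakk> \<Longrightarrow> f (x - y) = f x - f y"
  using additive_onD[of A f "x - y" y] by (simp add: add_closed_diff)

lemma additive_on_minus: "\<lbrakk>add_closed A; additive_on A f; x \<in> A\<rbrakk> \<Longrightarrow> f (- x) = - f x"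
  using additive_on_diff[of A f 0 x] by (simp add: add_closed_zero additive_on_zero)

lemma additive_on_sum:
  assumes "add_closed A" "additive_on A f" "\<And>i. i \<in> S \<Longrightarrow> g i \<in> A"
  shows "f (sum g S) = (\<Sum>i\<in>S. f (g i))"
  using assms(3)
proof (induction S rule: infinite_finite_induct)
  case (insert i S)
  then show ?case
    by (simp add: additive_onD[OF assms(2)] add_closed_sum[OF assms(1)])
qed (use assms in \<open>auto simp: additive_on_zero add_closed_zero\<close>)

lemma add_closed_image:
  assumes "add_closed A" "additive_on A f"
  shows "add_closed (f ` A)"
  unfolding add_closed_def
proof (intro conjI ballI)
  show "0 \<in> f ` A"
    using additive_on_zero[OF assms(2)] add_closed_zero[OF assms(1)] by (metis image_eqI)
  fix x y assume "x \<in> f ` A" "y \<in> f ` A"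
  then obtain a b where "x = f a" "y = f b" "a \<in> A" "b \<in> A" by auto
  then show "x - y \<in> f ` A"
    using additive_on_diff[OF assms, of a b] add_closed_diff[OF assms(1), of a b]
    by (metis image_eqI)
qed

text \<open>The coset is a translate inside the whole type, because \<open>r_coset\<close> uses only
  the multiplication; \<open>Z\<close> thus disappears from all computations with cosets.\<close>

lemma coset_additive_group:
  "B #>\<^bsub>additive_group Z\<^esub> a = {x. x - a \<in> B}"
proof (intro Set.set_eqI iffI)
  fix x assume "x \<in> {x. x - a \<in> B}"
  then show "x \<in> B #>\<^bsub>additive_group Z\<^esub> a"
    by (auto simp: r_coset_def additive_group_def intro!: bexI[of _ "x - a"])
qed (auto simp: r_coset_def additive_group_def)

lemma set_mult_additive_group:
  assumes "add_closed B"
  shows "{x. x - a \<in> B} <#>\<^bsub>additive_group Z\<^esub> {x. x - a' \<in> B} = {x. x - (a + a') \<in> B}"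
proof (intro Set.set_eqI iffI)
  fix x assume "x \<in> {x. x - a \<in> B} <#>\<^bsub>additive_group Z\<^esub> {x. x - a' \<in> B}"
  then obtain u v where "u - a \<in> B" "v - a' \<in> B" "x = u + v"
    by (auto simp: set_mult_def additive_group_def)
  then show "x \<in> {x. x - (a + a') \<in> B}"
    using add_closed_add[OF assms, of "u - a" "v - a'"] by (simp add: algebra_simps)
next
  fix x assume "x \<in> {x. x - (a + a') \<in> B}"
  then have "x - a' \<in> {x. x - a \<in> B}" "a' \<in> {x. x - a' \<in> B}"
    using add_closed_zero[OF assms] by (simp_all add: diff_diff_eq add.commute)
  then have "(x - a') + a' \<in> {x. x - a \<in> B} <#>\<^bsub>additive_group Z\<^esub> {x. x - a' \<in> B}"
    unfolding set_mult_def additive_group_def by (simp only: monoid.simps) blast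
  then show "x \<in> {x. x - a \<in> B} <#>\<^bsub>additive_group Z\<^esub> {x. x - a' \<in> B}" by simp
qed

lemma coset_eq_iff:
  assumes "add_closed B"
  shows "{x. x - a \<in> B} = {x. x - a' \<in> B} \<longleftrightarrow> a - a' \<in> B"
proof
  assume *: "{x. x - a \<in> B} = {x. x - a' \<in> B}"
  have "a \<in> {x. x - a \<in> B}" using add_closed_zero[OF assms] by simp
  then show "a - a' \<in> B" using * by simp
next
  assume *: "a - a' \<in> B"
  have "x - a \<in> B \<longleftrightarrow> x - a' \<in> B" for x
    using add_closed_add[OF assms _ *, of "x - a"] add_closed_diff[OF assms _ *, of "x - a'"]
    by auto
  then show "{x. x - a \<in> B} = {x. x - a' \<in> B}" by simp
qed

text \<open>The isomorphism is induced by an additive relation \<open>R\<close> that may be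
  multivalued; this covers zigzags as well as cycles that correspond only up to a boundary.
  Condition \<open>bd\<close> makes the induced map both well defined and injective, and
  \<open>diff\<close> makes \<open>R\<close> a subgroup of the pairs.\<close>

lemma quotient_iso_of_relation:
  fixes Z :: "'c::ab_group_add set" and Z' :: "'d::ab_group_add set"
  assumes B: "add_closed B" "B \<subseteq> Z" and B': "add_closed B'" "B' \<subseteq> Z'"
    and Z: "add_closed Z" "add_closed Z'"
    and dom: "\<And>a b. R a b \<Longrightarrow> a \<in> Z \<and> b \<in> Z'"
    and diff: "\<And>a b a' b'. \<lbrakk>R a b; R a' b'\<rbrakk> \<Longrightarrow> R (a - a') (b - b')"
    and total: "\<And>a. a \<in> Z \<Longrightarrow> \<exists>b. R a b" "\<And>b. b \<in> Z' \<Longrightarrow> \<exists>a. R a b"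
    and bd: "\<And>a b. R a b \<Longrightarrow> a \<in> B \<longleftrightarrow> b \<in> B'"
  shows "\<exists>h \<in> iso (additive_group Z Mod B) (additive_group Z' Mod B').
           \<forall>a b. R a b \<longrightarrow> h (B #>\<^bsub>additive_group Z\<^esub> a) = B' #>\<^bsub>additive_group Z'\<^esub> b"
proof -
  have coset: "B #>\<^bsub>additive_group Z\<^esub> a = {x. x - a \<in> B}" for a
    by (rule coset_additive_group)
  have coset': "B' #>\<^bsub>additive_group Z'\<^esub> a = {x. x - a \<in> B'}" for a
    by (rule coset_additive_group)
  have add: "R (a + a') (b + b')" if "R a b" "R a' b'" for a b a' b'
    using diff[OF that(1) diff[OF diff[OF that(2) that(2)] that(2)]] by simp
  \<comment> \<open>The image of a coset under the relation is a full coset of \<open>B'\<close>: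
    every element of \<open>B'\<close> is related to some element, which lies in \<open>B\<close> by
    \<open>bd\<close>.\<close>
  define h where "h X = {b. \<exists>a\<in>X. R a b}" for X
  have h: "h {x. x - a \<in> B} = {y. y - b \<in> B'}" if "R a b" for a b
  proof (intro Set.set_eqI iffI)
    fix y assume "y \<in> h {x. x - a \<in> B}"
    then obtain x where "x - a \<in> B" "R x y" by (auto simp: h_def)
    then show "y \<in> {y. y - b \<in> B'}"
      using bd[OF diff[OF \<open>R x y\<close> that]] by simp
  next
    fix y assume y: "y \<in> {y. y - b \<in> B'}"
    then obtain c where c: "R c (y - b)" using total(2) B'(2) by blast
    then have "c \<in> B" using bd[OF c] y by simp
    moreover have "R (a + c) y" using add[OF that c] by simp
    ultimately show "y \<in> h {x. x - a \<in> B}" by (auto simp: h_def intro!: exI[of _ "a + c"])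
  qed
  note eqB = coset_eq_iff[OF B(1)] and eqB' = coset_eq_iff[OF B'(1)]
  note mult = set_mult_additive_group[OF B(1), of Z]
  note mult' = set_mult_additive_group[OF B'(1), of Z']
  have car: "carrier (additive_group Z Mod B) = (\<lambda>a. {x. x - a \<in> B}) ` Z"
    unfolding carrier_FactGroup coset by (simp add: additive_group_def)
  have car': "carrier (additive_group Z' Mod B') = (\<lambda>a. {x. x - a \<in> B'}) ` Z'"
    unfolding carrier_FactGroup coset' by (simp add: additive_group_def)
  have hZ: "h {x. x - a \<in> B} \<in> carrier (additive_group Z' Mod B')" if a: "a \<in> Z" for a
  proof -
    obtain b where "R a b" using total(1)[OF a] by blast
    then show ?thesis using h[OF \<open>R a b\<close>] dom[OF \<open>R a b\<close>] by (auto simp: car')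
  qed
  have "h \<in> iso (additive_group Z Mod B) (additive_group Z' Mod B')"
    unfolding iso_iff
  proof (intro conjI)
    show "h \<in> hom (additive_group Z Mod B) (additive_group Z' Mod B')"
    proof (rule homI)
      fix X assume "X \<in> carrier (additive_group Z Mod B)"
      then obtain a where "a \<in> Z" "X = {x. x - a \<in> B}" by (auto simp: car)
      then show "h X \<in> carrier (additive_group Z' Mod B')"
        using hZ by simp
    next
      fix X Y
      assume "X \<in> carrier (additive_group Z Mod B)" "Y \<in> carrier (additive_group Z Mod B)"
      then obtain a a' where a: "a \<in> Z" "X = {x. x - a \<in> B}" "a' \<in> Z" "Y = {x. x - a' \<in> B}"
        by (auto simp: car)
      obtain b b' where b: "R a b" "R a' b'" using a total(1) by blast
      show "h (X \<otimes>\<^bsub>additive_group Z Mod B\<^esub> Y) = h X \<otimes>\<^bsub>additive_group Z' Mod B'\<^esub> h Y"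
        by (simp only: mult_FactGroup a mult h[OF add[OF b]] h[OF b(1)] h[OF b(2)] mult')
    qed
    show "h ` carrier (additive_group Z Mod B) = carrier (additive_group Z' Mod B')"
    proof (intro Set.set_eqI iffI)
      fix Y assume "Y \<in> h ` carrier (additive_group Z Mod B)"
      then obtain a where "a \<in> Z" "Y = h {x. x - a \<in> B}" by (auto simp: car)
      then show "Y \<in> carrier (additive_group Z' Mod B')"
        using hZ by simp
    next
      fix Y assume "Y \<in> carrier (additive_group Z' Mod B')"
      then obtain b where "b \<in> Z'" "Y = {x. x - b \<in> B'}" by (auto simp: car')
      then obtain a where "R a b" using total(2) by blast
      then show "Y \<in> h ` carrier (additive_group Z Mod B)"
        unfolding car using h[OF \<open>R a b\<close>] \<open>Y = _\<close> dom[OF \<open>R a b\<close>]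
        by (intro image_eqI[of _ h "{x. x - a \<in> B}"]) auto
    qed
    show "inj_on h (carrier (additive_group Z Mod B))"
    proof (rule inj_onI)
      fix X Y
      assume "X \<in> carrier (additive_group Z Mod B)" "Y \<in> carrier (additive_group Z Mod B)"
        and eq: "h X = h Y"
      then obtain a a' where a: "a \<in> Z" "X = {x. x - a \<in> B}" "a' \<in> Z" "Y = {x. x - a' \<in> B}"
        by (auto simp: car)
      obtain b b' where b: "R a b" "R a' b'" using a total(1) by blast
      have "b - b' \<in> B'" using eq unfolding a h[OF b(1)] h[OF b(2)] eqB' .
      then show "X = Y" unfolding a eqB using bd[OF diff[OF b]] by simp
    qed
  qed
  then show ?thesis
    using h by (intro bexI[of _ h]) (auto simp: coset coset')
qed

section \<open>The double complex lemma\<close>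

definition additive_complex :: "'c::ab_group_add chain_complex \<Rightarrow> bool" where
  "additive_complex C \<longleftrightarrow>
     (\<forall>n. add_closed (chains C n)) \<and>
     (\<forall>n. additive_on (chains C n) (bdry C n)) \<and>
     (\<forall>n. bdry C (Suc n) ` chains C (Suc n) \<subseteq> chains C n) \<and>
     (\<forall>n. \<forall>c\<in>chains C (Suc (Suc n)). bdry C (Suc n) (bdry C (Suc (Suc n)) c) = 0) \<and>
     (\<forall>c\<in>chains C 0. bdry C 0 c = 0)"

lemma additive_complexD:
  assumes "additive_complex C"
  shows "add_closed (chains C n)" "additive_on (chains C n) (bdry C n)"
    "c \<in> chains C (Suc n) \<Longrightarrow> bdry C (Suc n) c \<in> chains C n"
    "c \<in> chains C (Suc (Suc n)) \<Longrightarrow> bdry C (Suc n) (bdry C (Suc (Suc n)) c) = 0"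
    "c \<in> chains C 0 \<Longrightarrow> bdry C 0 c = 0"
  using assms unfolding additive_complex_def by blast+

lemma add_closed_cycles:
  assumes "additive_complex C"
  shows "add_closed (cycles C n)"
  unfolding add_closed_def cycles_def
  using additive_on_zero[OF additive_complexD(2)[OF assms]]
    additive_on_diff[OF additive_complexD(1,2)[OF assms]]
    add_closed_zero[OF additive_complexD(1)[OF assms]]
    add_closed_diff[OF additive_complexD(1)[OF assms]] by simp

lemma add_closed_boundaries:
  assumes "additive_complex C"
  shows "add_closed (boundaries C n)" "boundaries C n \<subseteq> cycles C n"
proof -
  show "add_closed (boundaries C n)"
    unfolding boundaries_def by (intro add_closed_image additive_complexD[OF assms])
  show "boundaries C n \<subseteq> cycles C n"
    using additive_complexD(3-5)[OF assms] unfolding boundaries_def cycles_def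
    by (cases n) auto
qed

text \<open>The conditions under which zigzags through the double complex carry cycles of \<open>A\<close> to cycles
  of \<open>B\<close>; interchanging the two directions gives the conditions for the way back.\<close>

locale row_exact_double_complex =
  fixes A :: "'a::ab_group_add chain_complex" and B :: "'b::ab_group_add chain_complex"
    and K :: "nat \<Rightarrow> nat \<Rightarrow> 'c::ab_group_add set"
    and dh dv :: "nat \<Rightarrow> nat \<Rightarrow> 'c \<Rightarrow> 'c"
    and \<epsilon> :: "nat \<Rightarrow> 'c \<Rightarrow> 'a" and \<eta> :: "nat \<Rightarrow> 'c \<Rightarrow> 'b"
  assumes A: "additive_complex A" and B: "additive_complex B"
    and K: "\<And>p n. add_closed (K p n)"
    and dh: "\<And>p n c. c \<in> K (Suc p) n \<Longrightarrow> dh (Suc p) n c \<in> K p n"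
    and dv: "\<And>p n c. c \<in> K p (Suc n) \<Longrightarrow> dv p (Suc n) c \<in> K p n"
    and dv_additive: "\<And>p n. additive_on (K p (Suc n)) (dv p (Suc n))"
    and dh_additive: "\<And>p n. additive_on (K (Suc p) n) (dh (Suc p) n)"
    and dv_dv: "\<And>p n c. c \<in> K p (Suc (Suc n)) \<Longrightarrow> dv p (Suc n) (dv p (Suc (Suc n)) c) = 0"
    and dh_dv: "\<And>p n c. c \<in> K (Suc p) (Suc n) \<Longrightarrow>
                  dh (Suc p) n (dv (Suc p) (Suc n) c) = dv p (Suc n) (dh (Suc p) (Suc n) c)"
    and \<epsilon>: "\<And>n c. c \<in> K 0 n \<Longrightarrow> \<epsilon> n c \<in> chains A n"
    and \<eta>: "\<And>p c. c \<in> K p 0 \<Longrightarrow> \<eta> p c \<in> chains B p"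
    and \<epsilon>_additive: "\<And>n. additive_on (K 0 n) (\<epsilon> n)"
    and \<eta>_additive: "\<And>p. additive_on (K p 0) (\<eta> p)"
    and \<epsilon>_dv: "\<And>n c. c \<in> K 0 (Suc n) \<Longrightarrow> \<epsilon> n (dv 0 (Suc n) c) = bdry A (Suc n) (\<epsilon> (Suc n) c)"
    and \<eta>_dh: "\<And>p c. c \<in> K (Suc p) 0 \<Longrightarrow> \<eta> p (dh (Suc p) 0 c) = bdry B (Suc p) (\<eta> (Suc p) c)"
    and \<eta>_dv: "\<And>p c. c \<in> K p 1 \<Longrightarrow> \<eta> p (dv p 1 c) = 0"
    and \<epsilon>_surj: "\<And>n. chains A n \<subseteq> \<epsilon> n ` K 0 n"
    and exact_0: "\<And>n c. \<lbrakk>c \<in> K 0 n; \<epsilon> n c = 0\<rbrakk> \<Longrightarrow> c \<in> dh 1 n ` K 1 n"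
    and exact_Suc: "\<And>p n c. \<lbrakk>c \<in> K (Suc p) n; dh (Suc p) n c = 0\<rbrakk>
                      \<Longrightarrow> c \<in> dh (Suc (Suc p)) n ` K (Suc (Suc p)) n"
begin

text \<open>A cycle of the total complex in degree \<open>n\<close>, with one component in each
  bidegree \<open>(p, n - p)\<close>, whose two ends augment to \<open>a\<close> and
  \<open>b\<close>. The squares of the double complex commute, so neighbouring components are
  matched without signs.\<close>

definition zigzag :: "nat \<Rightarrow> 'a \<Rightarrow> 'b \<Rightarrow> bool" where
  "zigzag n a b \<longleftrightarrow>
     (\<exists>z. (\<forall>p\<le>n. z p \<in> K p (n - p)) \<and> \<epsilon> n (z 0) = a \<and> \<eta> n (z n) = b \<and>
          (\<forall>p<n. dv p (n - p) (z p) = dh (Suc p) (n - Suc p) (z (Suc p))))"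

text \<open>The components are chosen one after the other, beginning with a lift of \<open>a\<close>
  along the surjective \<open>\<epsilon> n\<close>; exactness of the rows supplies each next one. In
  positive degree the last component augments to a cycle of \<open>B\<close> because
  \<open>\<eta>\<close> kills the image of \<open>dv\<close>.\<close>

lemma zigzag_total:
  assumes a: "a \<in> cycles A n"
  shows "\<exists>b \<in> cycles B n. zigzag n a b"
proof -
  have "\<exists>z. (\<forall>p\<le>m. z p \<in> K p (n - p)) \<and> \<epsilon> n (z 0) = a \<and>
          (\<forall>p<m. dv p (n - p) (z p) = dh (Suc p) (n - Suc p) (z (Suc p)))" if "m \<le> n" for m
    using that
  proof (induction m)
    case 0
    have "a \<in> chains A n" using a by (simp add: cycles_def)
    then obtain c where "c \<in> K 0 n" "\<epsilon> n c = a" using \<epsilon>_surj by blast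
    then show ?case by (intro exI[of _ "\<lambda>_. c"]) simp
  next
    case (Suc m)
    then obtain z where z: "\<And>p. p \<le> m \<Longrightarrow> z p \<in> K p (n - p)" "\<epsilon> n (z 0) = a"
      "\<And>p. p < m \<Longrightarrow> dv p (n - p) (z p) = dh (Suc p) (n - Suc p) (z (Suc p))" by auto
    define l where "l = n - Suc m"
    have nm: "n - m = Suc l" using Suc.prems by (simp add: l_def)
    have zm: "z m \<in> K m (Suc l)" using z(1)[of m] nm by simp
    \<comment> \<open>The element to be lifted is annihilated by \<open>\<epsilon>\<close> if
      \<open>m = 0\<close>, because \<open>a\<close> is a cycle, and by \<open>dh\<close> otherwise,
      because its image there is \<open>dv\<close> applied twice to the preceding component.\<close>
    have "dv m (Suc l) (z m) \<in> dh (Suc m) l ` K (Suc m) l"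
    proof (cases m)
      case 0
      have "\<epsilon> l (dv 0 (Suc l) (z 0)) = bdry A n a"
        using \<epsilon>_dv[of "z 0" l] zm 0 nm z(2) by simp
      then show ?thesis using exact_0[of "dv 0 (Suc l) (z 0)" l] dv[OF zm] a 0 by (simp add: cycles_def)
    next
      case (Suc q)
      have nq: "n - q = Suc (Suc l)" using nm Suc by simp
      have zq: "z q \<in> K q (Suc (Suc l))" using z(1)[of q] Suc nq by simp
      have "dh (Suc q) l (dv (Suc q) (Suc l) (z (Suc q))) = dv q (Suc l) (dh (Suc q) (Suc l) (z (Suc q)))"
        using dh_dv[of "z m" q l] zm Suc by simp
      also have "dh (Suc q) (Suc l) (z (Suc q)) = dv q (Suc (Suc l)) (z q)"
        using z(3)[of q] Suc nq nm by simp
      also have "dv q (Suc l) (dv q (Suc (Suc l)) (z q)) = 0" by (rule dv_dv[OF zq])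
      finally show ?thesis using exact_Suc[of "dv m (Suc l) (z m)" q l] dv[OF zm] Suc by simp
    qed
    then obtain w where w: "w \<in> K (Suc m) l" "dv m (Suc l) (z m) = dh (Suc m) l w" by blast
    show ?case
    proof (intro exI[of _ "z(Suc m := w)"] conjI allI impI)
      fix p assume "p \<le> Suc m"
      then show "(z(Suc m := w)) p \<in> K p (n - p)"
        using z(1)[of p] w(1) by (cases "p = Suc m") (auto simp: l_def)
    next
      fix p assume "p < Suc m"
      then show "dv p (n - p) ((z(Suc m := w)) p) = dh (Suc p) (n - Suc p) ((z(Suc m := w)) (Suc p))"
        using z(3)[of p] w(2)[folded nm] by (cases "p = m") (auto simp: l_def)
    qed (use z in simp)
  qed
  from this[of n] obtain z where z: "\<forall>p\<le>n. z p \<in> K p (n - p)" "\<epsilon> n (z 0) = a"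
    "\<forall>p<n. dv p (n - p) (z p) = dh (Suc p) (n - Suc p) (z (Suc p))" by auto
  have zn: "z n \<in> K n 0" using z(1) by (metis diff_self_eq_0 order_refl)
  have "bdry B n (\<eta> n (z n)) = 0"
  proof (cases n)
    case 0
    then show ?thesis using additive_complexD(5)[OF B] \<eta>[OF zn] by simp
  next
    case (Suc m)
    have "dv m 1 (z m) = dh (Suc m) 0 (z n)" using z(3)[rule_format, of m] Suc by simp
    moreover have "z m \<in> K m 1" using z(1)[rule_format, of m] Suc by simp
    ultimately show ?thesis using \<eta>_dh[of "z n" m] \<eta>_dv[of "z m" m] zn Suc by simp
  qed
  then show ?thesis
    using z \<eta>[OF zn] unfolding zigzag_def cycles_def by blast
qed

text \<open>A second staircase \<open>y\<close>, one total degree higher, bounds \<open>z\<close>: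
  it begins with a lift of a chain whose boundary is \<open>a\<close>, and exactness of the rows
  extends it. Its last component augments to a chain of \<open>B\<close> with boundary
  \<open>b\<close>.\<close>

lemma zigzag_boundary:
  assumes "zigzag n a b" and a: "a \<in> boundaries A n"
  shows "b \<in> boundaries B n"
proof -
  obtain z where z: "\<And>p. p \<le> n \<Longrightarrow> z p \<in> K p (n - p)" "\<epsilon> n (z 0) = a" "\<eta> n (z n) = b"
    "\<And>p. p < n \<Longrightarrow> dv p (n - p) (z p) = dh (Suc p) (n - Suc p) (z (Suc p))"
    using assms(1) unfolding zigzag_def by blast
  have "\<exists>y. (\<forall>p\<le>m. y p \<in> K p (Suc n - p)) \<and> \<epsilon> n (z 0) = \<epsilon> n (dv 0 (Suc n) (y 0)) \<and>
          (\<forall>p<m. z p - dv p (Suc n - p) (y p) = dh (Suc p) (n - p) (y (Suc p)))" if "m \<le> Suc n" for m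
    using that
  proof (induction m)
    case 0
    obtain a' where a': "a' \<in> chains A (Suc n)" "a = bdry A (Suc n) a'"
      using a by (auto simp: boundaries_def)
    then obtain y where "y \<in> K 0 (Suc n)" "\<epsilon> (Suc n) y = a'" using \<epsilon>_surj by blast
    then show ?case using \<epsilon>_dv[of y n] a' z(2) by (intro exI[of _ "\<lambda>_. y"]) simp
  next
    case (Suc m)
    then obtain y where y: "\<And>p. p \<le> m \<Longrightarrow> y p \<in> K p (Suc n - p)"
      "\<epsilon> n (z 0) = \<epsilon> n (dv 0 (Suc n) (y 0))"
      "\<And>p. p < m \<Longrightarrow> z p - dv p (Suc n - p) (y p) = dh (Suc p) (n - p) (y (Suc p))" by auto
    define l where "l = n - m"
    have nm: "Suc n - m = Suc l" using Suc.prems by (simp add: l_def)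
    have ym: "y m \<in> K m (Suc l)" using y(1)[of m] nm by simp
    have zm: "z m \<in> K m l" using z(1)[of m] Suc.prems by (simp add: l_def)
    have d: "z m - dv m (Suc l) (y m) \<in> K m l" by (intro add_closed_diff K zm dv ym)
    have "z m - dv m (Suc l) (y m) \<in> dh (Suc m) l ` K (Suc m) l"
    proof (cases m)
      case 0
      have "\<epsilon> l (z m - dv m (Suc l) (y m)) = 0"
        using additive_on_diff[OF K \<epsilon>_additive, of "z 0" l "dv 0 (Suc l) (y 0)"] zm dv[OF ym] y(2) 0
        by (simp add: l_def)
      then show ?thesis using exact_0[of "z m - dv m (Suc l) (y m)" l] d 0 by simp
    next
      case (Suc q)
      have nq: "n - q = Suc l" "Suc n - q = Suc (Suc l)" "q < n" "q < m"
        using nm Suc Suc.prems by (auto simp: l_def)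
      have yq: "y q \<in> K q (Suc (Suc l))" using y(1)[of q] Suc nq by simp
      have zq: "z q \<in> K q (Suc l)" using z(1)[of q] nq by simp
      have e1: "z q - dv q (Suc (Suc l)) (y q) = dh (Suc q) (Suc l) (y (Suc q))" using y(3)[of q] nq by simp
      have "dh m l (z m - dv m (Suc l) (y m)) = dh m l (z m) - dh m l (dv m (Suc l) (y m))"
        using additive_on_diff[OF K dh_additive, of "z m" q l "dv m (Suc l) (y m)"] zm dv[OF ym] Suc by simp
      also have "dh m l (z m) = dv q (Suc l) (z q)"
        using z(4)[OF nq(3)] nq Suc by (simp add: l_def)
      also have "dh m l (dv m (Suc l) (y m)) = dv q (Suc l) (z q - dv q (Suc (Suc l)) (y q))"
        using dh_dv[of "y m" q l] ym Suc e1 by simp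
      also have "\<dots> = dv q (Suc l) (z q) - dv q (Suc l) (dv q (Suc (Suc l)) (y q))"
        by (intro additive_on_diff[OF K dv_additive] zq dv yq)
      also have "dv q (Suc l) (dv q (Suc (Suc l)) (y q)) = 0" by (rule dv_dv[OF yq])
      finally show ?thesis using exact_Suc[of "z m - dv m (Suc l) (y m)" q l] d Suc by simp
    qed
    then obtain w where w: "w \<in> K (Suc m) l" "z m - dv m (Suc l) (y m) = dh (Suc m) l w" by blast
    show ?case
    proof (intro exI[of _ "y(Suc m := w)"] conjI allI impI)
      fix p assume "p \<le> Suc m"
      then show "(y(Suc m := w)) p \<in> K p (Suc n - p)"
        using y(1)[of p] w(1) by (cases "p = Suc m") (auto simp: l_def)
    next
      fix p assume "p < Suc m"
      then show "z p - dv p (Suc n - p) ((y(Suc m := w)) p) = dh (Suc p) (n - p) ((y(Suc m := w)) (Suc p))"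
        using y(3)[of p] w(2)[folded nm] by (cases "p = m") (auto simp: l_def)
    qed (use y in simp)
  qed
  from this[of "Suc n"] obtain y where y: "\<And>p. p \<le> Suc n \<Longrightarrow> y p \<in> K p (Suc n - p)"
    "\<And>p. p \<le> n \<Longrightarrow> z p - dv p (Suc n - p) (y p) = dh (Suc p) (n - p) (y (Suc p))"
    by (auto simp: less_Suc_eq_le)
  have zn: "z n \<in> K n 0" using z(1)[of n] by simp
  have yn: "y n \<in> K n 1" "y (Suc n) \<in> K (Suc n) 0" using y(1)[of n] y(1)[of "Suc n"] by simp_all
  have "z n - dv n 1 (y n) = dh (Suc n) 0 (y (Suc n))" using y(2)[of n] by simp
  moreover have "\<eta> n (z n - dv n 1 (y n)) = \<eta> n (z n) - \<eta> n (dv n 1 (y n))"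
    using additive_on_diff[OF K \<eta>_additive zn] dv[of "y n" n 0] yn by simp
  ultimately have "b = bdry B (Suc n) (\<eta> (Suc n) (y (Suc n)))"
    using \<eta>_dv[OF yn(1)] \<eta>_dh[OF yn(2)] z(3) by simp
  then show ?thesis using \<eta>[OF yn(2)] by (auto simp: boundaries_def)
qed

lemma zigzag_diff:
  assumes "zigzag n a b" "zigzag n a' b'"
  shows "zigzag n (a - a') (b - b')"
proof -
  obtain z z' where z: "\<And>p. p \<le> n \<Longrightarrow> z p \<in> K p (n - p)" "\<epsilon> n (z 0) = a" "\<eta> n (z n) = b"
    "\<And>p. p < n \<Longrightarrow> dv p (n - p) (z p) = dh (Suc p) (n - Suc p) (z (Suc p))"
    and z': "\<And>p. p \<le> n \<Longrightarrow> z' p \<in> K p (n - p)" "\<epsilon> n (z' 0) = a'" "\<eta> n (z' n) = b'"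
    "\<And>p. p < n \<Longrightarrow> dv p (n - p) (z' p) = dh (Suc p) (n - Suc p) (z' (Suc p))"
    using assms unfolding zigzag_def by metis
  show ?thesis
    unfolding zigzag_def
  proof (intro exI[of _ "\<lambda>p. z p - z' p"] conjI allI impI)
    fix p assume "p \<le> n"
    then show "z p - z' p \<in> K p (n - p)" by (intro add_closed_diff K z z')
  next
    show "\<epsilon> n (z 0 - z' 0) = a - a'"
      using additive_on_diff[OF K \<epsilon>_additive] z(1)[of 0] z'(1)[of 0] z(2) z'(2) by simp
    show "\<eta> n (z n - z' n) = b - b'"
      using additive_on_diff[OF K \<eta>_additive] z(1)[of n] z'(1)[of n] z(3) z'(3) by simp
  next
    fix p assume p: "p < n"
    then obtain l where l: "n - p = Suc l" "n - Suc p = l" by (metis Suc_diff_Suc)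
    have "dv p (Suc l) (z p - z' p) = dv p (Suc l) (z p) - dv p (Suc l) (z' p)"
      using p l z(1)[of p] z'(1)[of p] by (intro additive_on_diff[OF K dv_additive]) auto
    moreover have "dh (Suc p) l (z (Suc p) - z' (Suc p)) = dh (Suc p) l (z (Suc p)) - dh (Suc p) l (z' (Suc p))"
      using p l z(1)[of "Suc p"] z'(1)[of "Suc p"] by (intro additive_on_diff[OF K dh_additive]) auto
    ultimately show "dv p (n - p) (z p - z' p) = dh (Suc p) (n - Suc p) (z (Suc p) - z' (Suc p))"
      using z(4)[OF p] z'(4)[OF p] l by simp
  qed
qed

end

text \<open>Reading a zigzag from its other end makes it a zigzag of the transposed double complex.
  Totality and the preservation of boundaries, both proved from exact rows, therefore hold in the
  two directions.\<close>

lemma double_complex_homology_iso: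
  assumes "row_exact_double_complex A B K dh dv \<epsilon> \<eta>"
    and "row_exact_double_complex B A (\<lambda>p n. K n p) (\<lambda>p n. dv n p) (\<lambda>p n. dh n p) \<eta> \<epsilon>"
  shows "homology A n \<cong> homology B n"
proof -
  interpret r: row_exact_double_complex A B K dh dv \<epsilon> \<eta> by fact
  interpret c: row_exact_double_complex B A "\<lambda>p n. K n p" "\<lambda>p n. dv n p" "\<lambda>p n. dh n p" \<eta> \<epsilon> by fact
  have transpose: "c.zigzag n b a" if "r.zigzag n a b" for a b
  proof -
    obtain z where z: "\<And>p. p \<le> n \<Longrightarrow> z p \<in> K p (n - p)" "\<epsilon> n (z 0) = a" "\<eta> n (z n) = b"
      "\<And>p. p < n \<Longrightarrow> dv p (n - p) (z p) = dh (Suc p) (n - Suc p) (z (Suc p))"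
      using \<open>r.zigzag n a b\<close> unfolding r.zigzag_def by blast
    show ?thesis
      unfolding c.zigzag_def
    proof (intro exI[of _ "\<lambda>p. z (n - p)"] conjI allI impI)
      fix p assume "p \<le> n"
      then show "z (n - p) \<in> K (n - p) p" using z(1)[of "n - p"] by simp
    next
      fix p assume p: "p < n"
      then have "n - (n - Suc p) = Suc p" "Suc (n - Suc p) = n - p" "n - (n - p) = p" by auto
      then show "dh (n - p) p (z (n - p)) = dv (n - Suc p) (Suc p) (z (n - Suc p))"
        using z(4)[of "n - Suc p"] p by simp
    qed (use z in auto)
  qed
  have transpose': "r.zigzag n a b" if "c.zigzag n b a" for a b
  proof -
    obtain z where z: "\<And>p. p \<le> n \<Longrightarrow> z p \<in> K (n - p) p" "\<eta> n (z 0) = b" "\<epsilon> n (z n) = a"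
      "\<And>p. p < n \<Longrightarrow> dh (n - p) p (z p) = dv (n - Suc p) (Suc p) (z (Suc p))"
      using \<open>c.zigzag n b a\<close> unfolding c.zigzag_def by blast
    show ?thesis
      unfolding r.zigzag_def
    proof (intro exI[of _ "\<lambda>p. z (n - p)"] conjI allI impI)
      fix p assume "p \<le> n"
      then show "z (n - p) \<in> K p (n - p)" using z(1)[of "n - p"] by simp
    next
      fix p assume p: "p < n"
      then have "n - (n - Suc p) = Suc p" "Suc (n - Suc p) = n - p" "n - (n - p) = p" by auto
      then show "dv p (n - p) (z (n - p)) = dh (Suc p) (n - Suc p) (z (n - Suc p))"
        using z(4)[of "n - Suc p"] p by simp
    qed (use z in auto)
  qed
  have "\<exists>h \<in> iso (homology A n) (homology B n).
     \<forall>a b. (r.zigzag n a b \<and> a \<in> cycles A n \<and> b \<in> cycles B n) \<longrightarrow>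
        h (boundaries A n #>\<^bsub>additive_group (cycles A n)\<^esub> a) = boundaries B n #>\<^bsub>additive_group (cycles B n)\<^esub> b"
    unfolding homology_def
  proof (rule quotient_iso_of_relation)
    show "r.zigzag n (a - a') (b - b') \<and> a - a' \<in> cycles A n \<and> b - b' \<in> cycles B n"
      if "r.zigzag n a b \<and> a \<in> cycles A n \<and> b \<in> cycles B n"
        "r.zigzag n a' b' \<and> a' \<in> cycles A n \<and> b' \<in> cycles B n" for a b a' b'
      using that by (simp add: r.zigzag_diff add_closed_diff add_closed_cycles r.A r.B)
    show "\<exists>b. r.zigzag n a b \<and> a \<in> cycles A n \<and> b \<in> cycles B n" if "a \<in> cycles A n" for a
      using r.zigzag_total[OF that] that by blast
    show "\<exists>a. r.zigzag n a b \<and> a \<in> cycles A n \<and> b \<in> cycles B n" if "b \<in> cycles B n" for b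
      using c.zigzag_total[OF that] transpose' that by blast
    show "a \<in> boundaries A n \<longleftrightarrow> b \<in> boundaries B n"
      if "r.zigzag n a b \<and> a \<in> cycles A n \<and> b \<in> cycles B n" for a b
      using that r.zigzag_boundary c.zigzag_boundary transpose by blast
  qed (auto simp: r.A r.B add_closed_cycles add_closed_boundaries)
  then show ?thesis unfolding is_iso_def by blast
qed

section \<open>Koszul complexes\<close>

definition alt :: "nat \<Rightarrow> 'b::ab_group_add \<Rightarrow> 'b" where
  "alt n b = (if even n then b else - b)"

lemma alt_zero [simp]: "alt n 0 = 0"
  by (simp add: alt_def)

lemma alt_0 [simp]: "alt 0 b = b"
  by (simp add: alt_def)

lemma alt_add: "alt n (a + b) = alt n a + alt n b"
  by (simp add: alt_def)

lemma alt_diff: "alt n (a - b) = alt n a - alt n b"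
  by (simp add: alt_def)

lemma alt_alt: "alt m (alt n b) = alt (m + n) b"
  by (simp add: alt_def)

lemma alt_opposite: "odd (m + n) \<Longrightarrow> alt m b = - alt n b"
  by (auto simp: alt_def)

lemma alt_sum: "alt n (sum f S) = (\<Sum>i\<in>S. alt n (f i))"
  by (simp add: alt_def sum_negf)

lemma alt_closed: "\<lbrakk>add_closed A; a \<in> A\<rbrakk> \<Longrightarrow> alt n a \<in> A"
  by (simp add: alt_def add_closed_minus)

lemma additive_on_alt: "\<lbrakk>add_closed A; additive_on A f; a \<in> A\<rbrakk> \<Longrightarrow> f (alt n a) = alt n (f a)"
  by (simp add: alt_def additive_on_minus)

text \<open>The differential on coefficient functions: \<open>card {j\<in>J. j < i}\<close> is the position of \<open>i\<close> in
  \<open>insert i J\<close>, counted from \<open>0\<close>.\<close>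

definition kdiff :: "nat \<Rightarrow> (nat \<Rightarrow> 'b::ab_group_add \<Rightarrow> 'b) \<Rightarrow> (nat set \<Rightarrow> 'b) \<Rightarrow> nat set \<Rightarrow> 'b" where
  "kdiff k T f J =
     (\<Sum>i\<in>{..<k} - J. alt (card {j\<in>J. j < i}) (f (insert i J) - T i (f (insert i J))))"

text \<open>Coefficient functions are total and vanish off the \<open>p\<close>-element subsets of
  \<open>{..<k}\<close>, so that sums and wedge products can be written pointwise before they are
  turned into finitely supported maps.\<close>

definition ext_funs :: "nat \<Rightarrow> 'b::ab_group_add set \<Rightarrow> nat \<Rightarrow> (nat set \<Rightarrow> 'b) set" where
  "ext_funs k A p = {f. (\<forall>J. f J \<in> A) \<and> (\<forall>J. \<not> (J \<subseteq> {..<k} \<and> card J = p) \<longrightarrow> f J = 0)}"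

lemma ext_funsD:
  assumes "f \<in> ext_funs k A p"
  shows "f J \<in> A" "f J \<noteq> 0 \<Longrightarrow> J \<subseteq> {..<k}" "f J \<noteq> 0 \<Longrightarrow> card J = p"
  using assms unfolding ext_funs_def by auto

text \<open>In a sorted list without repetitions the position of an element is the number of smaller
  elements; this trades the positional signs of the differential for signs that depend on the set
  alone.\<close>

lemma sum_nth_sorted_list_of_set:
  fixes I :: "nat set"
  assumes "finite I"
  shows "(\<Sum>j<card I. g (sorted_list_of_set I ! j) j) = (\<Sum>i\<in>I. g i (card {l\<in>I. l < i}))"
proof -
  let ?s = "sorted_list_of_set I"
  have len: "length ?s = card I" and set: "set ?s = I" and dist: "distinct ?s"
    and srt: "sorted_wrt (<) ?s" using assms by simp_all
  have bij: "bij_betw ((!) ?s) {..<card I} I"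
    using bij_betw_nth[OF dist, of "{..<card I}" I] len set by simp
  have "card {l\<in>I. l < ?s ! j} = j" if "j < card I" for j
  proof -
    have "{l\<in>I. l < ?s ! j} = (!) ?s ` {..<j}"
    proof (intro Set.set_eqI iffI)
      fix l assume "l \<in> {l\<in>I. l < ?s ! j}"
      then obtain i where i: "i < card I" "l = ?s ! i" "?s ! i < ?s ! j"
        using set len by (metis (mono_tags, lifting) in_set_conv_nth mem_Collect_eq)
      then have "i < j"
        using sorted_wrt_nth_less[OF srt, of j i] len that by (metis linorder_neqE_nat order_less_asym)
      then show "l \<in> (!) ?s ` {..<j}" using i by auto
    next
      fix l assume "l \<in> (!) ?s ` {..<j}"
      then obtain i where "i < j" "l = ?s ! i" by auto
      then show "l \<in> {l\<in>I. l < ?s ! j}"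
        using sorted_wrt_nth_less[OF srt, of i j] len that set nth_mem[of i ?s] by auto
    qed
    moreover have "inj_on ((!) ?s) {..<j}"
      using dist len that by (auto simp: inj_on_def nth_eq_iff_index_eq)
    ultimately show ?thesis by (simp add: card_image)
  qed
  then have "(\<Sum>j<card I. g (?s ! j) j) = (\<Sum>j<card I. g (?s ! j) (card {l\<in>I. l < ?s ! j}))"
    by simp
  also have "\<dots> = (\<Sum>i\<in>I. g i (card {l\<in>I. l < i}))"
    by (rule sum.reindex_bij_betw[OF bij])
  finally show ?thesis .
qed

text \<open>The coefficient at \<open>J\<close> collects the pairs \<open>(I, i)\<close> with
  \<open>I = insert i J\<close>. The assumption \<open>T i 0 = 0\<close> lets the sum run over all
  \<open>i\<close> outside \<open>J\<close>, also those for which \<open>insert i J\<close> has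
  coefficient zero.\<close>

lemma lookup_exterior_bdry:
  assumes keys: "Poly_Mapping.keys c \<subseteq> {I. I \<subseteq> {..<k} \<and> card I = p}"
    and T0: "\<And>i. i < k \<Longrightarrow> T i 0 = 0"
  shows "Poly_Mapping.lookup (exterior_bdry T p c) J = kdiff k T (Poly_Mapping.lookup c) J"
proof -
  let ?c = "Poly_Mapping.lookup c"
  let ?D = "\<lambda>i I. ?c I - T i (?c I)"
  let ?n = "\<lambda>i I. card {l\<in>I. l < i}"
  have fin: "finite I" "I \<subseteq> {..<k}" "card I = p" if "I \<in> Poly_Mapping.keys c" for I
    using keys that finite_subset[of I "{..<k}"] by auto
  have *: "Poly_Mapping.lookup (Poly_Mapping.single (I - {i}) (if even j then b else - b)) J
      = (if I - {i} = J then alt j b else 0)" for I i j and b :: 'a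
    by (simp add: lookup_single when_def alt_def)
  have "Poly_Mapping.lookup (exterior_bdry T p c) J =
      (\<Sum>I\<in>Poly_Mapping.keys c. \<Sum>j<p. (\<lambda>i j. if I - {i} = J then alt j (?D i I) else 0)
          (sorted_list_of_set I ! j) j)"
    by (simp only: exterior_bdry_def lookup_sum Let_def *)
  also have "\<dots> = (\<Sum>I\<in>Poly_Mapping.keys c. \<Sum>i\<in>I. if I - {i} = J then alt (?n i I) (?D i I) else 0)"
  proof (rule sum.cong[OF refl])
    fix I assume I: "I \<in> Poly_Mapping.keys c"
    show "(\<Sum>j<p. (\<lambda>i j. if I - {i} = J then alt j (?D i I) else 0) (sorted_list_of_set I ! j) j)
      = (\<Sum>i\<in>I. if I - {i} = J then alt (?n i I) (?D i I) else 0)"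
      using sum_nth_sorted_list_of_set[OF fin(1)[OF I], of "\<lambda>i j. if I - {i} = J then alt j (?D i I) else 0"]
        fin(3)[OF I] by simp
  qed
  also have "\<dots> = (\<Sum>I\<in>Poly_Mapping.keys c. \<Sum>i | i \<in> I \<and> I - {i} = J. alt (?n i I) (?D i I))"
    using fin(1) by (intro sum.cong[OF refl] sum.inter_filter[symmetric])
  also have "\<dots> = (\<Sum>(I, i) \<in> (SIGMA I:Poly_Mapping.keys c. {i. i \<in> I \<and> I - {i} = J}). alt (?n i I) (?D i I))"
    using fin(1) by (intro sum.Sigma) auto
  also have "\<dots> = (\<Sum>i | i \<in> {..<k} - J \<and> insert i J \<in> Poly_Mapping.keys c. alt (?n i J) (?D i (insert i J)))"
  proof (rule sum.reindex_bij_witness[of _ "\<lambda>i. (insert i J, i)" snd])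
    fix x assume "x \<in> (SIGMA I:Poly_Mapping.keys c. {i. i \<in> I \<and> I - {i} = J})"
    then obtain I i where x: "x = (I, i)" "I \<in> Poly_Mapping.keys c" "i \<in> I" "J = I - {i}" by auto
    then have I: "insert i J = I" by auto
    show "(insert (snd x) J, snd x) = x" using x I by simp
    show "snd x \<in> {i \<in> {..<k} - J. insert i J \<in> Poly_Mapping.keys c}"
      using x I fin(2)[OF x(2)] by auto
    have "{l \<in> J. l < i} = {l \<in> I. l < i}" using x by auto
    then show "alt (?n (snd x) J) (?D (snd x) (insert (snd x) J)) = (case x of (I, i) \<Rightarrow> alt (?n i I) (?D i I))"
      using x I by simp
  qed auto
  also have "\<dots> = kdiff k T ?c J"
    unfolding kdiff_def
    by (rule sum.mono_neutral_left) (auto simp: T0 in_keys_iff)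
  finally show ?thesis .
qed

text \<open>Exchanging the two summations would only show that twice the sum vanishes. In a group
  that may have torsion the terms have to be cancelled in pairs, which the induction on
  \<open>S\<close> does.\<close>

lemma sum_antisymmetric:
  fixes F :: "'i \<Rightarrow> 'i \<Rightarrow> 'b::ab_group_add"
  assumes "finite S" and "\<And>i l. \<lbrakk>i \<in> S; l \<in> S; i \<noteq> l\<rbrakk> \<Longrightarrow> F l i = - F i l"
  shows "(\<Sum>i\<in>S. \<Sum>l\<in>S - {i}. F i l) = 0"
  using assms
proof (induction S rule: finite_induct)
  case (insert x S)
  have IH: "(\<Sum>i\<in>S. \<Sum>l\<in>S - {i}. F i l) = 0"
    by (rule insert.IH) (rule insert.prems, auto)
  have "(\<Sum>i\<in>S. \<Sum>l\<in>insert x S - {i}. F i l) = (\<Sum>i\<in>S. F i x + (\<Sum>l\<in>S - {i}. F i l))"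
  proof (rule sum.cong[OF refl])
    fix i assume i: "i \<in> S"
    then have "insert x S - {i} = insert x (S - {i})" using insert.hyps by auto
    then show "(\<Sum>l\<in>insert x S - {i}. F i l) = F i x + (\<Sum>l\<in>S - {i}. F i l)"
      using insert.hyps by simp
  qed
  also have "\<dots> = (\<Sum>i\<in>S. F i x)" by (simp only: sum.distrib IH) simp
  also have "\<dots> = (\<Sum>i\<in>S. - F x i)" using insert.hyps by (intro sum.cong[OF refl] insert.prems) auto
  finally show ?case using insert.hyps by (simp add: sum_negf)
qed simp

lemma card_less_insert:
  fixes i l :: nat
  assumes "finite J" "i \<notin> J"
  shows "card {j\<in>insert i J. j < l} = card {j\<in>J. j < l} + (if i < l then 1 else 0)"
proof -
  have "{j\<in>insert i J. j < l} = (if i < l then insert i {j\<in>J. j < l} else {j\<in>J. j < l})" by auto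
  then show ?thesis using assms by simp
qed

locale commuting_endos =
  fixes k :: nat and A :: "'b::ab_group_add set" and T :: "nat \<Rightarrow> 'b \<Rightarrow> 'b"
  assumes A: "add_closed A"
    and T: "\<And>i a. \<lbrakk>i < k; a \<in> A\<rbrakk> \<Longrightarrow> T i a \<in> A"
    and T_additive: "\<And>i. i < k \<Longrightarrow> additive_on A (T i)"
    and T_commute: "\<And>i l a. \<lbrakk>i < k; l < k; a \<in> A\<rbrakk> \<Longrightarrow> T i (T l a) = T l (T i a)"
begin

abbreviation D :: "nat \<Rightarrow> 'b \<Rightarrow> 'b" where "D i a \<equiv> a - T i a"

lemma T_zero: "i < k \<Longrightarrow> T i 0 = 0"
  using additive_on_zero[OF T_additive] add_closed_zero[OF A] by blast

lemma D_closed: "\<lbrakk>i < k; a \<in> A\<rbrakk> \<Longrightarrow> D i a \<in> A"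
  by (intro add_closed_diff A T)

lemma D_additive: "i < k \<Longrightarrow> additive_on A (D i)"
  unfolding additive_on_def by (auto simp: additive_onD[OF T_additive])

lemma D_commute: "\<lbrakk>i < k; l < k; a \<in> A\<rbrakk> \<Longrightarrow> D i (D l a) = D l (D i a)"
  by (simp add: additive_on_diff[OF A T_additive] T T_commute)

lemma ext_funs_diff: "\<lbrakk>f \<in> ext_funs k A p; g \<in> ext_funs k A p\<rbrakk> \<Longrightarrow> (\<lambda>J. f J - g J) \<in> ext_funs k A p"
  unfolding ext_funs_def by (auto intro: add_closed_diff[OF A])

lemma ext_funs_add: "\<lbrakk>f \<in> ext_funs k A p; g \<in> ext_funs k A p\<rbrakk> \<Longrightarrow> (\<lambda>J. f J + g J) \<in> ext_funs k A p"
  unfolding ext_funs_def by (auto intro: add_closed_add[OF A])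

lemma kdiff_diff:
  assumes "f \<in> ext_funs k A p" "g \<in> ext_funs k A p"
  shows "kdiff k T (\<lambda>J. f J - g J) J = kdiff k T f J - kdiff k T g J"
proof -
  have "alt n (D i (f I - g I)) = alt n (D i (f I)) - alt n (D i (g I))" if "i < k" for n i I
    using additive_on_diff[OF A D_additive[OF that] ext_funsD(1)[OF assms(1)] ext_funsD(1)[OF assms(2)]]
    by (simp only: alt_diff)
  then show ?thesis unfolding kdiff_def by (simp add: sum_subtractf)
qed

lemma kdiff_add:
  assumes "f \<in> ext_funs k A p" "g \<in> ext_funs k A p"
  shows "kdiff k T (\<lambda>J. f J + g J) J = kdiff k T f J + kdiff k T g J"
  using kdiff_diff[OF ext_funs_add[OF assms] assms(2), of J] by (simp add: algebra_simps)

lemma kdiff_zero_outside: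
  assumes "f \<in> ext_funs k A (Suc p)" "\<not> (J \<subseteq> {..<k} \<and> card J = p)"
  shows "kdiff k T f J = 0"
proof -
  have "f (insert i J) = 0" if "i \<in> {..<k} - J" for i
  proof (rule ccontr)
    assume "f (insert i J) \<noteq> 0"
    then have *: "insert i J \<subseteq> {..<k}" "card (insert i J) = Suc p" using ext_funsD[OF assms(1)] by auto
    then have "finite J" using finite_subset[of "insert i J" "{..<k}"] by auto
    then show False using * that assms(2) by auto
  qed
  then show ?thesis unfolding kdiff_def by (intro sum.neutral) (auto simp: T_zero)
qed

lemma kdiff_closed:
  assumes "f \<in> ext_funs k A (Suc p)"
  shows "kdiff k T f \<in> ext_funs k A p"
  unfolding ext_funs_def
proof (intro CollectI conjI allI impI)
  show "kdiff k T f J \<in> A" for J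
    unfolding kdiff_def
    by (intro add_closed_sum[OF A] alt_closed[OF A] D_closed ext_funsD(1)[OF assms]) auto
qed (rule kdiff_zero_outside[OF assms])

text \<open>Inserting \<open>i\<close> and \<open>l\<close> in the two possible orders gives the
  same coefficient, as the operators commute, but opposite signs: exactly one of the two indices is
  the smaller one and shifts the position of the other.\<close>

lemma kdiff_kdiff:
  assumes f: "f \<in> ext_funs k A (Suc (Suc p))"
  shows "kdiff k T (kdiff k T f) J = 0"
proof (cases "J \<subseteq> {..<k}")
  case False
  then show ?thesis using kdiff_zero_outside[OF kdiff_closed[OF f]] by blast
next
  case True
  then have fin: "finite J" using finite_subset by blast
  let ?n = "\<lambda>i J. card {j\<in>J. j < i}"
  define F where "F i l = alt (?n i J + ?n l (insert i J)) (D i (D l (f (insert l (insert i J)))))" for i l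
  have fA: "f I \<in> A" for I by (rule ext_funsD(1)[OF f])
  have "kdiff k T (kdiff k T f) J = (\<Sum>i\<in>{..<k} - J. \<Sum>l\<in>({..<k} - J) - {i}. F i l)"
    unfolding kdiff_def[of k T _ J]
  proof (rule sum.cong[OF refl])
    fix i assume i: "i \<in> {..<k} - J"
    have "D i (kdiff k T f (insert i J)) =
        (\<Sum>l\<in>{..<k} - insert i J. D i (alt (?n l (insert i J)) (D l (f (insert l (insert i J))))))"
      unfolding kdiff_def
      using i by (intro additive_on_sum[OF A D_additive] alt_closed[OF A] D_closed fA) auto
    also have "\<dots> = (\<Sum>l\<in>{..<k} - insert i J. alt (?n l (insert i J)) (D i (D l (f (insert l (insert i J))))))"
      using i by (intro sum.cong refl additive_on_alt[OF A D_additive] D_closed fA) auto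
    finally have eq: "D i (kdiff k T f (insert i J)) =
        (\<Sum>l\<in>{..<k} - insert i J. alt (?n l (insert i J)) (D i (D l (f (insert l (insert i J))))))" .
    have "{..<k} - insert i J = ({..<k} - J) - {i}" by blast
    then show "alt (?n i J) (D i (kdiff k T f (insert i J))) = (\<Sum>l\<in>({..<k} - J) - {i}. F i l)"
      unfolding eq by (simp only: alt_sum alt_alt F_def)
  qed
  also have "\<dots> = 0"
  proof (rule sum_antisymmetric)
    fix i l assume il: "i \<in> {..<k} - J" "l \<in> {..<k} - J" "i \<noteq> l"
    have "D i (D l (f (insert l (insert i J)))) = D l (D i (f (insert i (insert l J))))"
      using il D_commute[OF _ _ fA, of i l "insert l (insert i J)"] by (simp add: insert_commute)
    moreover have "?n l (insert i J) = ?n l J + (if i < l then 1 else 0)"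
      "?n i (insert l J) = ?n i J + (if l < i then 1 else 0)"
      using il fin card_less_insert[of J i l] card_less_insert[of J l i] by blast+
    ultimately show "F l i = - F i l"
      unfolding F_def using il(3) by (simp only:) (rule alt_opposite, auto)
  qed simp
  finally show ?thesis .
qed

text \<open>Left multiplication by the exterior generator with index \<open>l\<close>; the sign
  moves this generator past the smaller indices to its place in \<open>I\<close>.\<close>

definition wedge :: "nat \<Rightarrow> (nat set \<Rightarrow> 'b) \<Rightarrow> nat set \<Rightarrow> 'b" where
  "wedge l f I = (if l \<in> I then alt (card {j\<in>I. j < l}) (f (I - {l})) else 0)"

lemma wedge_closed:
  assumes l: "l < k" and f: "f \<in> ext_funs k A p"
  shows "wedge l f \<in> ext_funs k A (Suc p)"
  unfolding ext_funs_def
proof (intro CollectI conjI allI impI)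
  show "wedge l f J \<in> A" for J
    by (simp add: wedge_def alt_closed[OF A] add_closed_zero[OF A] ext_funsD(1)[OF f])
  fix J assume J: "\<not> (J \<subseteq> {..<k} \<and> card J = Suc p)"
  show "wedge l f J = 0"
  proof (rule ccontr)
    assume "wedge l f J \<noteq> 0"
    then have "l \<in> J" "f (J - {l}) \<noteq> 0" by (auto simp: wedge_def split: if_splits)
    then have "J - {l} \<subseteq> {..<k}" "card (J - {l}) = p" "l \<in> J" using ext_funsD[OF f] by auto
    moreover from this have "finite J" using finite_subset[of "J - {l}" "{..<k}"] by auto
    ultimately have "J \<subseteq> {..<k}" "card J = Suc p" using l card_Suc_Diff1[of J l] by auto
    then show False using J by blast
  qed
qed

text \<open>If \<open>l\<close> lies outside \<open>J\<close>, the second summand is zero and only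
  the term \<open>i = l\<close> of the first is present. If \<open>l\<close> belongs to
  \<open>J\<close>, all terms with \<open>i \<noteq> l\<close> cancel between the two summands, and
  the term \<open>i = l\<close> of the second one remains.\<close>

lemma kdiff_wedge:
  assumes l: "l < k" and f: "f \<in> ext_funs k A p" and J: "finite J"
  shows "kdiff k T (wedge l f) J + wedge l (kdiff k T f) J = D l (f J)"
proof (cases "l \<in> J")
  case False
  have "kdiff k T (wedge l f) J = (\<Sum>i\<in>{l}. alt (card {j\<in>J. j < i}) (D i (wedge l f (insert i J))))"
    unfolding kdiff_def using l False
    by (intro sum.mono_neutral_right) (auto simp: wedge_def T_zero)
  also have "\<dots> = D l (f J)"
  proof -
    have *: "{j \<in> insert l J. j < l} = {j \<in> J. j < l}" by auto
    have "insert l J - {l} = J" using False by auto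
    then have "wedge l f (insert l J) = alt (card {j\<in>J. j < l}) (f J)" by (simp only: wedge_def * insertI1 if_True)
    then show ?thesis
      using additive_on_alt[OF A D_additive[OF l] ext_funsD(1)[OF f]] by (simp add: alt_alt) (simp add: alt_def)
  qed
  finally show ?thesis using False by (simp add: wedge_def)
next
  case True
  define J' where "J' = J - {l}"
  have J': "J = insert l J'" "l \<notin> J'" "finite J'" using True J by (auto simp: J'_def)
  let ?n = "\<lambda>i J. card {j\<in>J. j < i}"
  have fA: "f I \<in> A" for I by (rule ext_funsD(1)[OF f])
  have "kdiff k T (wedge l f) J = (\<Sum>i\<in>{..<k} - J. alt (?n i J) (alt (?n l (insert i J)) (D i (f (insert i J')))))"
    unfolding kdiff_def
  proof (rule sum.cong[OF refl])
    fix i assume i: "i \<in> {..<k} - J"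
    then have "insert i J - {l} = insert i J'" using J' by auto
    then show "alt (?n i J) (D i (wedge l f (insert i J))) = alt (?n i J) (alt (?n l (insert i J)) (D i (f (insert i J'))))"
      using J' i additive_on_alt[OF A D_additive fA, of i] by (simp add: wedge_def)
  qed
  also have "\<dots> = (\<Sum>i\<in>{..<k} - J. - alt (?n l J) (alt (?n i J') (D i (f (insert i J')))))"
  proof (rule sum.cong[OF refl])
    fix i assume i: "i \<in> {..<k} - J"
    then have "i \<noteq> l" "i \<notin> J'" using J' by auto
    moreover have "?n l (insert i J) = ?n l J + (if i < l then 1 else 0)"
      using i J by (intro card_less_insert) auto
    moreover have "?n i J = ?n i J' + (if l < i then 1 else 0)"
      unfolding J'(1) using J' by (intro card_less_insert) auto
    ultimately show "alt (?n i J) (alt (?n l (insert i J)) (D i (f (insert i J'))))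
        = - alt (?n l J) (alt (?n i J') (D i (f (insert i J'))))"
      by (cases "i < l") (simp_all add: alt_def)
  qed
  finally have 1: "kdiff k T (wedge l f) J =
      - alt (?n l J) (\<Sum>i\<in>{..<k} - J. alt (?n i J') (D i (f (insert i J'))))"
    by (simp add: alt_sum sum_negf)
  \<comment> \<open>The second summand has the terms of the first with the opposite sign and, in
    addition, the one for \<open>i = l\<close>.\<close>
  have "{..<k} - J' = insert l ({..<k} - J)" using l by (auto simp: J'_def)
  then have "kdiff k T f J' = alt (?n l J') (D l (f J)) + (\<Sum>i\<in>{..<k} - J. alt (?n i J') (D i (f (insert i J'))))"
    unfolding kdiff_def J'(1)[symmetric]
    using True by (simp only:) (subst sum.insert, auto simp: J'(1)[symmetric])
  moreover have "?n l J' = ?n l J" unfolding J'(1) using J' by (subst card_less_insert) auto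
  ultimately have "wedge l (kdiff k T f) J = D l (f J) + alt (?n l J) (\<Sum>i\<in>{..<k} - J. alt (?n i J') (D i (f (insert i J'))))"
    using True by (simp add: wedge_def J'_def[symmetric] alt_add alt_alt) (simp add: alt_def)
  with 1 show ?thesis by simp
qed

end

text \<open>The operators $1 - T_0, \dots, 1 - T_{k-1}$ form a regular sequence on \<open>A\<close>, except that the last
  quotient may vanish.\<close>

definition regular_up_to :: "nat \<Rightarrow> 'b::ab_group_add set \<Rightarrow> (nat \<Rightarrow> 'b \<Rightarrow> 'b) \<Rightarrow> bool" where
  "regular_up_to k A T \<longleftrightarrow>
     (\<forall>j<k. \<forall>a\<in>A. (\<exists>x. (\<forall>i. x i \<in> A) \<and> a - T j a = (\<Sum>i<j. x i - T i (x i))) \<longrightarrow>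
                  (\<exists>x. (\<forall>i. x i \<in> A) \<and> a = (\<Sum>i<j. x i - T i (x i))))"

section \<open>Exactness of the Koszul complex of a regular sequence\<close>

lemma commuting_endos_mono: "\<lbrakk>commuting_endos k A T; l \<le> k\<rbrakk> \<Longrightarrow> commuting_endos l A T"
  unfolding commuting_endos_def by auto

lemma kdiff_Suc_eq:
  assumes "\<And>I. k \<in> I \<Longrightarrow> f I = 0" and "T k 0 = 0"
  shows "kdiff (Suc k) T f J = kdiff k T f J"
  unfolding kdiff_def
  by (rule sum.mono_neutral_right) (auto simp: assms less_Suc_eq)

lemma kdiff_Suc_insert:
  assumes J: "k \<notin> J"
  shows "kdiff (Suc k) T f (insert k J) =
    (\<Sum>i\<in>{..<k} - J. alt (card {j\<in>J. j < i}) (f (insert k (insert i J)) - T i (f (insert k (insert i J)))))"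
proof -
  have "{..<Suc k} - insert k J = {..<k} - J" by auto
  moreover have "{j \<in> insert k J. j < i} = {j \<in> J. j < i}" if "i < k" for i using that by auto
  moreover have "insert i (insert k J) = insert k (insert i J)" for i by auto
  ultimately show ?thesis
    unfolding kdiff_def by (intro sum.cong) (simp_all only: lessThan_iff Diff_iff)
qed

text \<open>Induction on the number of operators. The coefficients of \<open>f\<close> at sets
  containing the largest index \<open>k\<close> form a cycle \<open>b\<close> for the first
  \<open>k\<close> operators. A primitive of \<open>b\<close>, placed at sets containing
  \<open>k\<close>, is used to subtract a boundary from \<open>f\<close> so that what remains does
  not involve \<open>k\<close>. The primitive of \<open>b\<close> comes from the induction
  hypothesis if \<open>p > 0\<close> and from regularity in the bottom degree.\<close>

lemma regular_exact:
  assumes "commuting_endos k A T" and "regular_up_to k A T"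
    and "f \<in> ext_funs k A (Suc p)" and "\<And>J. kdiff k T f J = 0"
  shows "\<exists>g \<in> ext_funs k A (Suc (Suc p)). kdiff k T g = f"
  using assms
proof (induction k arbitrary: p f)
  case 0
  interpret commuting_endos 0 A T by fact
  have "f J = 0" for J
  proof (rule ccontr)
    assume "f J \<noteq> 0"
    then have "J \<subseteq> {..<0}" "card J = Suc p" using ext_funsD[OF 0(3)] by blast+
    then show False by simp
  qed
  then show ?case
    by (intro bexI[of _ "\<lambda>_. 0"]) (auto simp: kdiff_def ext_funs_def add_closed_zero[OF A])
next
  case (Suc k)
  interpret S: commuting_endos "Suc k" A T by fact
  have endo: "commuting_endos k A T" using Suc.prems(1) commuting_endos_mono le_SucI by blast
  interpret commuting_endos k A T by fact
  have reg: "regular_up_to k A T" using Suc.prems(2) unfolding regular_up_to_def by simp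
  have Tk: "T k 0 = 0" by (simp add: S.T_zero)
  note f = Suc.prems(3) and df = Suc.prems(4)
  have A0: "0 \<in> A" by (rule add_closed_zero[OF A])
  \<comment> \<open>As \<open>k\<close> is the largest index, inserting it leaves the positions of
    the other indices, and so their signs, unchanged.\<close>
  define b where "b J = (if k \<in> J then 0 else f (insert k J))" for J
  have b: "b \<in> ext_funs k A p"
    unfolding ext_funs_def
  proof (intro CollectI conjI allI impI)
    show "b J \<in> A" for J by (simp add: b_def A0 ext_funsD(1)[OF f])
    fix J assume J: "\<not> (J \<subseteq> {..<k} \<and> card J = p)"
    show "b J = 0"
    proof (rule ccontr)
      assume "b J \<noteq> 0"
      then have *: "k \<notin> J" "insert k J \<subseteq> {..<Suc k}" "card (insert k J) = Suc p"
        using ext_funsD(2,3)[OF f, of "insert k J"] by (auto simp: b_def split: if_splits)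
      then have "finite J" using finite_subset[of J "{..<Suc k}"] by auto
      then have "card J = p" using * by simp
      moreover have "J \<subseteq> {..<k}" using * by (auto simp: less_Suc_eq subset_iff)
      ultimately show False using J by blast
    qed
  qed
  have db: "kdiff k T b J = 0" for J
  proof (cases "k \<in> J")
    case True
    then show ?thesis by (simp add: kdiff_def b_def T_zero)
  next
    case False
    then have "kdiff k T b J = kdiff (Suc k) T f (insert k J)"
      by (subst kdiff_Suc_insert[OF False], unfold kdiff_def) (intro sum.cong refl, auto simp: b_def)
    then show ?thesis using df by simp
  qed
  have "\<exists>b' \<in> ext_funs k A (Suc p). kdiff k T b' = b"
  proof (cases p)
    case (Suc q)
    show ?thesis using Suc.IH[OF endo reg b[unfolded Suc] db] Suc by simp
  next
    case 0
    have fA: "f J \<in> A" for J by (rule ext_funsD(1)[OF f])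
    have "kdiff (Suc k) T f {} = (\<Sum>i<k. f {i} - T i (f {i})) + (f {k} - T k (f {k}))"
      by (simp add: kdiff_def)
    \<comment> \<open>The cycle condition at the empty set puts the image of \<open>f {k}\<close>
      under the last operator into the sum of the images of the others; regularity then puts
      \<open>f {k}\<close> itself there.\<close>
    then have "f {k} - T k (f {k}) = - (\<Sum>i<k. f {i} - T i (f {i}))"
      using df[of "{}"] by (simp add: add_eq_0_iff)
    also have "\<dots> = (\<Sum>i<k. - f {i} - T i (- f {i}))"
      unfolding sum_negf[symmetric]
      by (intro sum.cong refl) (simp add: additive_on_minus[OF A T_additive fA])
    finally have "\<exists>x. (\<forall>i. x i \<in> A) \<and> f {k} - T k (f {k}) = (\<Sum>i<k. x i - T i (x i))"
      by (intro exI[of _ "\<lambda>i. - f {i}"]) (auto intro: add_closed_minus[OF A fA])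
    then obtain x where x: "\<And>i. x i \<in> A" "f {k} = (\<Sum>i<k. x i - T i (x i))"
      using Suc.prems(2)[unfolded regular_up_to_def, rule_format, of k "f {k}"] fA by auto
    define b' where "b' J = (if \<exists>i<k. J = {i} then x (the_elem J) else 0)" for J
    have "b' \<in> ext_funs k A (Suc p)"
      unfolding ext_funs_def b'_def 0 using x(1) A0 by auto
    moreover have "kdiff k T b' J = b J" for J
    proof (cases "J = {}")
      case True
      then show ?thesis using x(2) by (simp add: kdiff_def b_def b'_def)
    next
      case False
      have "b' (insert i J) = 0" if "i \<notin> J" for i
        using False that by (auto simp: b'_def)
      then have "kdiff k T b' J = 0"
        unfolding kdiff_def by (intro sum.neutral) (auto simp: T_zero)
      moreover have "b J = 0"
      proof (rule ccontr)
        assume "b J \<noteq> 0"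
        then have "card J = 0" "J \<subseteq> {..<k}" using ext_funsD[OF b] 0 by auto
        then show False using False finite_subset[of J "{..<k}"] by auto
      qed
      ultimately show ?thesis by simp
    qed
    ultimately show ?thesis by blast
  qed
  then obtain b' where b': "b' \<in> ext_funs k A (Suc p)" "\<And>J. kdiff k T b' J = b J" by auto
  define c where "c J = (if k \<in> J then b' (J - {k}) else 0)" for J
  have c: "c \<in> ext_funs (Suc k) A (Suc (Suc p))"
    unfolding ext_funs_def
  proof (intro CollectI conjI allI impI)
    show "c J \<in> A" for J by (simp add: c_def A0 ext_funsD(1)[OF b'(1)])
    fix J assume J: "\<not> (J \<subseteq> {..<Suc k} \<and> card J = Suc (Suc p))"
    show "c J = 0"
    proof (rule ccontr)
      assume "c J \<noteq> 0"
      then have *: "k \<in> J" "J - {k} \<subseteq> {..<k}" "card (J - {k}) = Suc p"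
        using ext_funsD(2,3)[OF b'(1), of "J - {k}"] by (auto simp: c_def split: if_splits)
      then have "finite J" using finite_subset[of "J - {k}" "{..<k}"] by auto
      then have "card J = Suc (Suc p)" using * card_Suc_Diff1[of J k] by simp
      moreover have "J \<subseteq> {..<Suc k}" using * by (auto simp: less_Suc_eq subset_iff)
      ultimately show False using J by blast
    qed
  qed
  have dc: "kdiff (Suc k) T c (insert k J) = f (insert k J)" if J: "k \<notin> J" for J
  proof -
    have "kdiff (Suc k) T c (insert k J) = kdiff k T b' J"
    proof (subst kdiff_Suc_insert[OF J], unfold kdiff_def, intro sum.cong refl)
      fix i assume "i \<in> {..<k} - J"
      then have "insert k (insert i J) - {k} = insert i J" using J by auto
      then show "alt (card {j \<in> J. j < i}) (c (insert k (insert i J)) - T i (c (insert k (insert i J)))) =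
        alt (card {j \<in> J. j < i}) (b' (insert i J) - T i (b' (insert i J)))"
        by (simp add: c_def)
    qed
    then show ?thesis using b'(2)[of J] J by (simp add: b_def)
  qed
  \<comment> \<open>All components at sets containing \<open>k\<close> cancel, so \<open>f1\<close>
    is a cycle for the first \<open>k\<close> operators alone.\<close>
  define f1 where "f1 J = f J - kdiff (Suc k) T c J" for J
  have f1: "f1 \<in> ext_funs (Suc k) A (Suc p)"
    unfolding f1_def by (rule S.ext_funs_diff[OF f S.kdiff_closed[OF c]])
  have f1k: "f1 J = 0" if "k \<in> J" for J
    using dc[of "J - {k}"] that by (simp add: f1_def insert_absorb)
  have f1': "f1 \<in> ext_funs k A (Suc p)"
    unfolding ext_funs_def
  proof (intro CollectI conjI allI impI)
    show "f1 J \<in> A" for J by (rule ext_funsD(1)[OF f1])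
    fix J assume J: "\<not> (J \<subseteq> {..<k} \<and> card J = Suc p)"
    show "f1 J = 0"
    proof (rule ccontr)
      assume "f1 J \<noteq> 0"
      then have "J \<subseteq> {..<Suc k}" "card J = Suc p" "k \<notin> J"
        using ext_funsD(2,3)[OF f1, of J] f1k by auto
      then show False using J by (auto simp: less_Suc_eq subset_iff)
    qed
  qed
  have "kdiff k T f1 J = 0" for J
  proof -
    have "kdiff (Suc k) T f1 J = 0"
      unfolding f1_def S.kdiff_diff[OF f S.kdiff_closed[OF c]] df S.kdiff_kdiff[OF c] by simp
    then show ?thesis using kdiff_Suc_eq[of k f1 T J] f1k Tk by simp
  qed
  from Suc.IH[OF endo reg f1' this]
  obtain g where g: "g \<in> ext_funs k A (Suc (Suc p))" "kdiff k T g = f1" by blast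
  have g': "g \<in> ext_funs (Suc k) A (Suc (Suc p))"
    using g(1) unfolding ext_funs_def by (auto simp: less_Suc_eq subset_iff)
  have "g I = 0" if "k \<in> I" for I
    using ext_funsD(2)[OF g(1), of I] that by auto
  then have dg: "kdiff (Suc k) T g J = f1 J" for J
    using kdiff_Suc_eq[of k g T J] Tk g(2) by simp
  show ?case
  proof (intro bexI ext)
    show "kdiff (Suc k) T (\<lambda>J. g J + c J) J = f J" for J
      unfolding S.kdiff_add[OF g' c] dg by (simp add: f1_def)
  qed (rule S.ext_funs_add[OF g' c])
qed

section \<open>Exterior chains as finitely supported maps\<close>

lemma lookup_minus_fun:
  "Poly_Mapping.lookup (c - d) = (\<lambda>J. Poly_Mapping.lookup c J - Poly_Mapping.lookup d J)"
  by (simp add: fun_eq_iff lookup_minus)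

lemma lookup_add_fun:
  "Poly_Mapping.lookup (c + d) = (\<lambda>J. Poly_Mapping.lookup c J + Poly_Mapping.lookup d J)"
  by (simp add: fun_eq_iff lookup_add)

context commuting_endos
begin

lemma lookup_exterior_chains: "c \<in> exterior_chains k A p \<Longrightarrow> Poly_Mapping.lookup c \<in> ext_funs k A p"
  unfolding exterior_chains_def ext_funs_def by (auto simp: in_keys_iff subset_iff)

lemma exterior_chains_of_fun:
  assumes "f \<in> ext_funs k A p"
  obtains c where "c \<in> exterior_chains k A p" "Poly_Mapping.lookup c = f"
proof -
  have "{J. f J \<noteq> 0} \<subseteq> Pow {..<k}" using ext_funsD(2)[OF assms] by blast
  then have "finite {J. f J \<noteq> 0}" by (rule finite_subset) simp
  then have "Poly_Mapping.lookup (Abs_poly_mapping f) = f" by simp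
  moreover have "Abs_poly_mapping f \<in> exterior_chains k A p"
    unfolding exterior_chains_def mem_Collect_eq calculation
    using calculation ext_funsD[OF assms] by (force simp: in_keys_iff)
  ultimately show ?thesis using that by blast
qed

lemma lookup_bdry:
  assumes "c \<in> exterior_chains k A p"
  shows "Poly_Mapping.lookup (exterior_bdry T p c) = kdiff k T (Poly_Mapping.lookup c)"
  using assms T_zero by (intro ext lookup_exterior_bdry) (auto simp: exterior_chains_def)

lemma exterior_chainsI:
  assumes "Poly_Mapping.lookup c \<in> ext_funs k A p"
  shows "c \<in> exterior_chains k A p"
  using ext_funsD[OF assms] unfolding exterior_chains_def by (auto simp: in_keys_iff)

lemma add_closed_exterior_chains: "add_closed (exterior_chains k A p)"
  unfolding add_closed_def
proof (intro conjI ballI)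
  show "0 \<in> exterior_chains k A p" by (simp add: exterior_chains_def add_closed_zero[OF A])
  fix c d assume "c \<in> exterior_chains k A p" "d \<in> exterior_chains k A p"
  then have "(\<lambda>J. Poly_Mapping.lookup c J - Poly_Mapping.lookup d J) \<in> ext_funs k A p"
    by (intro ext_funs_diff lookup_exterior_chains)
  then show "c - d \<in> exterior_chains k A p"
    by (intro exterior_chainsI) (simp add: lookup_minus_fun)
qed

lemma exterior_bdry_closed: "c \<in> exterior_chains k A (Suc p) \<Longrightarrow> exterior_bdry T (Suc p) c \<in> exterior_chains k A p"
  by (intro exterior_chainsI) (simp add: lookup_bdry kdiff_closed lookup_exterior_chains)

lemma exterior_bdry_additive: "additive_on (exterior_chains k A p) (exterior_bdry T p)"
  unfolding additive_on_def
proof (intro ballI)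
  fix c d assume cd: "c \<in> exterior_chains k A p" "d \<in> exterior_chains k A p"
  then have "c + d \<in> exterior_chains k A p" by (rule add_closed_add[OF add_closed_exterior_chains])
  then show "exterior_bdry T p (c + d) = exterior_bdry T p c + exterior_bdry T p d"
    using cd kdiff_add[OF lookup_exterior_chains lookup_exterior_chains, OF cd]
    by (intro poly_mapping_eqI) (simp add: lookup_bdry lookup_add_fun)
qed

lemma exterior_bdry_bdry:
  assumes "c \<in> exterior_chains k A (Suc (Suc p))"
  shows "exterior_bdry T (Suc p) (exterior_bdry T (Suc (Suc p)) c) = 0"
  using assms
  by (intro poly_mapping_eqI)
    (simp add: lookup_bdry exterior_bdry_closed kdiff_kdiff[OF lookup_exterior_chains])

lemma additive_exterior_complex: "additive_complex (exterior_complex k A T)"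
  unfolding additive_complex_def exterior_complex_def
  by (auto simp: add_closed_exterior_chains exterior_bdry_additive exterior_bdry_closed exterior_bdry_bdry)
    (simp add: exterior_bdry_def)

lemma exterior_exact_Suc:
  assumes "regular_up_to k A T"
    and c: "c \<in> exterior_chains k A (Suc p)" "exterior_bdry T (Suc p) c = 0"
  shows "c \<in> exterior_bdry T (Suc (Suc p)) ` exterior_chains k A (Suc (Suc p))"
proof -
  have "kdiff k T (Poly_Mapping.lookup c) J = 0" for J
    using lookup_bdry[OF c(1)] c(2) by (metis lookup_zero)
  with regular_exact[OF commuting_endos_axioms assms(1) lookup_exterior_chains[OF c(1)]]
  obtain g where g: "g \<in> ext_funs k A (Suc (Suc p))" "kdiff k T g = Poly_Mapping.lookup c" by blast
  obtain d where d: "d \<in> exterior_chains k A (Suc (Suc p))" "Poly_Mapping.lookup d = g"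
    using exterior_chains_of_fun[OF g(1)] .
  have "exterior_bdry T (Suc (Suc p)) d = c"
    using lookup_bdry[OF d(1)] d(2) g(2) by (intro poly_mapping_eqI) simp
  then show ?thesis using d(1) by blast
qed

text \<open>In degree 0 only the empty set carries a coefficient; the \<open>x i\<close> serve as
  the coefficients of the one-element sets in a chain with boundary \<open>c\<close>.\<close>

lemma exterior_exact_0:
  assumes c: "c \<in> exterior_chains k A 0"
    and x: "\<And>i. x i \<in> A" "Poly_Mapping.lookup c {} = (\<Sum>i<k. x i - T i (x i))"
  shows "c \<in> exterior_bdry T 1 ` exterior_chains k A 1"
proof -
  define g where "g J = (if \<exists>i<k. J = {i} then x (the_elem J) else 0)" for J
  have "g \<in> ext_funs k A 1"
    unfolding ext_funs_def g_def using x(1) add_closed_zero[OF A] by auto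
  then obtain d where d: "d \<in> exterior_chains k A 1" "Poly_Mapping.lookup d = g"
    using exterior_chains_of_fun by blast
  have "Poly_Mapping.lookup (exterior_bdry T 1 d) J = Poly_Mapping.lookup c J" for J
  proof (cases "J = {}")
    case True
    then show ?thesis using x(2) d(2) lookup_bdry[OF d(1)] by (simp add: kdiff_def g_def)
  next
    case False
    have "exterior_bdry T 1 d \<in> exterior_chains k A 0"
      using exterior_bdry_closed[of d 0] d(1) by simp
    moreover have "J \<notin> {I. I \<subseteq> {..<k} \<and> card I = 0}"
      using False finite_subset[of J "{..<k}"] by auto
    ultimately show ?thesis
      using c unfolding exterior_chains_def by (metis (no_types, lifting) in_keys_iff mem_Collect_eq subsetD)
  qed
  then have "exterior_bdry T 1 d = c" by (rule poly_mapping_eqI)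
  then show ?thesis using d(1) by blast
qed

end

section \<open>Coefficientwise maps and homotopies\<close>

lemma lookup_map_zero: "f 0 = 0 \<Longrightarrow> Poly_Mapping.lookup (Poly_Mapping.map f c) J = f (Poly_Mapping.lookup c J)"
  by (simp add: Poly_Mapping.map.rep_eq when_def)

lemma lookup_map_fun:
  "f 0 = 0 \<Longrightarrow> Poly_Mapping.lookup (Poly_Mapping.map f c) = (\<lambda>J. f (Poly_Mapping.lookup c J))"
  by (simp add: fun_eq_iff lookup_map_zero)

lemma map_exterior_chains:
  assumes "f 0 = 0" "\<And>a. a \<in> A \<Longrightarrow> f a \<in> A'" "c \<in> exterior_chains k A p"
  shows "Poly_Mapping.map f c \<in> exterior_chains k A' p"
  using assms unfolding exterior_chains_def
  by (auto simp: in_keys_iff lookup_map_zero subset_iff) metis+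

lemma additive_on_map:
  assumes "additive_on A f" "0 \<in> A"
  shows "additive_on (exterior_chains k A p) (Poly_Mapping.map f)"
  unfolding additive_on_def
proof (intro ballI)
  fix c d assume "c \<in> exterior_chains k A p" "d \<in> exterior_chains k A p"
  then show "Poly_Mapping.map f (c + d) = Poly_Mapping.map f c + Poly_Mapping.map f d"
    by (intro poly_mapping_eqI)
      (simp add: lookup_map_zero[where f = f, OF additive_on_zero[OF assms]] lookup_add exterior_chains_def
         additive_onD[OF assms(1)])
qed

lemma exterior_bdry_map:
  assumes A: "commuting_endos k A T" and A': "commuting_endos k A' T'"
    and f: "additive_on A f" "\<And>a. a \<in> A \<Longrightarrow> f a \<in> A'"
    and fT: "\<And>i a. \<lbrakk>i < k; a \<in> A\<rbrakk> \<Longrightarrow> f (T i a) = T' i (f a)"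
    and c: "c \<in> exterior_chains k A p"
  shows "exterior_bdry T' p (Poly_Mapping.map f c) = Poly_Mapping.map f (exterior_bdry T p c)"
proof -
  interpret A: commuting_endos k A T by fact
  interpret A': commuting_endos k A' T' by fact
  have f0: "f 0 = 0" using additive_on_zero[OF f(1) add_closed_zero[OF A.A]] .
  have c': "Poly_Mapping.map f c \<in> exterior_chains k A' p"
    by (rule map_exterior_chains[where f = f, OF f0 f(2) c])
  have cA: "Poly_Mapping.lookup c J \<in> A" for J using c by (auto simp: exterior_chains_def)
  show ?thesis
  proof (rule poly_mapping_eqI)
    fix J
    have "f (kdiff k T (Poly_Mapping.lookup c) J) = kdiff k T' (\<lambda>J. f (Poly_Mapping.lookup c J)) J"
      unfolding kdiff_def
    proof (subst additive_on_sum[OF A.A f(1)], goal_cases)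
      case (1 i)
      then show ?case by (intro alt_closed[OF A.A] A.D_closed cA) auto
    next
      case 2
      show ?case
        by (intro sum.cong refl)
          (simp add: additive_on_alt[OF A.A f(1)] A.D_closed cA additive_on_diff[OF A.A f(1)] A.T fT)
    qed
    then show "Poly_Mapping.lookup (exterior_bdry T' p (Poly_Mapping.map f c)) J =
        Poly_Mapping.lookup (Poly_Mapping.map f (exterior_bdry T p c)) J"
      by (simp add: A'.lookup_bdry[OF c'] A.lookup_bdry[OF c] lookup_map_fun[where f = f, OF f0])
  qed
qed

context commuting_endos
begin

text \<open>The bounding chain is \<open>wedge l\<close> applied to \<open>c\<close>: the second
  summand of the homotopy formula vanishes because \<open>c\<close> is a cycle.\<close>

lemma T_homotopic_id:
  assumes l: "l < k" and c: "c \<in> cycles (exterior_complex k A T) p"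
  shows "c - Poly_Mapping.map (T l) c \<in> boundaries (exterior_complex k A T) p"
proof -
  have c': "c \<in> exterior_chains k A p" "exterior_bdry T p c = 0"
    using c by (auto simp: cycles_def exterior_complex_def)
  let ?f = "Poly_Mapping.lookup c"
  have f: "?f \<in> ext_funs k A p" by (rule lookup_exterior_chains[OF c'(1)])
  obtain d where d: "d \<in> exterior_chains k A (Suc p)" "Poly_Mapping.lookup d = wedge l ?f"
    using exterior_chains_of_fun[OF wedge_closed[OF l f]] .
  have 0: "kdiff k T ?f J = 0" for J using lookup_bdry[OF c'(1)] c'(2) by (metis lookup_zero)
  have "kdiff k T (wedge l ?f) J = D l (?f J)" for J
  proof (cases "finite J")
    case True
    have "wedge l (kdiff k T ?f) J = 0" by (simp add: wedge_def 0)
    then show ?thesis using kdiff_wedge[OF l f True] by simp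
  next
    case False
    \<comment> \<open>The homotopy formula is stated for finite \<open>J\<close>; for infinite
      \<open>J\<close> both sides are zero.\<close>
    then have "\<not> J \<subseteq> {..<k}" using finite_subset by blast
    then show ?thesis
      using kdiff_zero_outside[OF wedge_closed[OF l f]] ext_funsD(2)[OF f, of J] T_zero[OF l]
      by (metis diff_zero)
  qed
  then have "exterior_bdry T (Suc p) d = c - Poly_Mapping.map (T l) c"
    by (intro poly_mapping_eqI) (simp add: lookup_bdry[OF d(1)] d(2) lookup_minus lookup_map_zero T_zero l)
  then show ?thesis using d(1) by (auto simp: boundaries_def exterior_complex_def intro!: image_eqI)
qed

end

section \<open>Cofinal subcomplexes\<close>

lemma map_map:
  assumes "f 0 = 0" "g 0 = 0"
  shows "Poly_Mapping.map g (Poly_Mapping.map f c) = Poly_Mapping.map (\<lambda>a. g (f a)) c"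
  using assms by (intro poly_mapping_eqI) (simp add: lookup_map_zero)

context commuting_endos
begin

text \<open>A word \<open>w\<close> in the indices encodes a product of the operators
  \<open>T i\<close>, of which the head of the word acts first.\<close>

lemma fold_T:
  assumes "set w \<subseteq> {..<k}"
  shows "a \<in> A \<Longrightarrow> fold T w a \<in> A" "additive_on A (fold T w)"
    "i < k \<Longrightarrow> a \<in> A \<Longrightarrow> fold T w (T i a) = T i (fold T w a)"
proof -
  have "(\<forall>a\<in>A. fold T w a \<in> A) \<and> additive_on A (fold T w) \<and>
    (\<forall>i<k. \<forall>a\<in>A. fold T w (T i a) = T i (fold T w a))"
    using assms
  proof (induction w)
    case Nil
    then show ?case by (simp add: additive_on_def)
  next
    case (Cons l w)
    then show ?case by (auto simp: additive_on_def T additive_onD[OF T_additive] T_commute)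
  qed
  then show "a \<in> A \<Longrightarrow> fold T w a \<in> A" "additive_on A (fold T w)"
    "i < k \<Longrightarrow> a \<in> A \<Longrightarrow> fold T w (T i a) = T i (fold T w a)" by blast+
qed

text \<open>The differences between a cycle and its successive translates by single operators
  telescope along the word.\<close>

lemma fold_T_homotopic_id:
  assumes "set w \<subseteq> {..<k}" "c \<in> cycles (exterior_complex k A T) p"
  shows "c - Poly_Mapping.map (fold T w) c \<in> boundaries (exterior_complex k A T) p"
  using assms
proof (induction w arbitrary: c)
  case Nil
  have "Poly_Mapping.map (fold T []) c = c" by (intro poly_mapping_eqI) (simp add: lookup_map_zero)
  then have "c - Poly_Mapping.map (fold T []) c = 0" by (simp only: diff_self)
  then show ?case
    by (simp only: add_closed_zero[OF add_closed_boundaries(1)[OF additive_exterior_complex]])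
next
  case (Cons l w)
  then have l: "l < k" and w: "set w \<subseteq> {..<k}" by auto
  let ?C = "exterior_complex k A T"
  let ?c = "Poly_Mapping.map (T l) c"
  note bd = add_closed_boundaries[OF additive_exterior_complex]
  have 1: "c - ?c \<in> boundaries ?C p" by (rule T_homotopic_id[OF l Cons.prems(2)])
  then have "c - ?c \<in> cycles ?C p" using bd(2) by blast
  then have "c - (c - ?c) \<in> cycles ?C p"
    by (rule add_closed_diff[OF add_closed_cycles[OF additive_exterior_complex] Cons.prems(2)])
  then have "?c \<in> cycles ?C p" by simp
  then have "?c - Poly_Mapping.map (fold T w) ?c \<in> boundaries ?C p" by (rule Cons.IH[OF w])
  from add_closed_add[OF bd(1) 1 this]
  show ?case
    by (simp add: map_map[where f = "T l", OF T_zero[OF l]] additive_on_zero[OF fold_T(2)[OF w] add_closed_zero[OF A]])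
qed

lemma map_fold_T_commute:
  assumes w: "set w \<subseteq> {..<k}" and c: "c \<in> exterior_chains k A p"
  shows "exterior_bdry T p (Poly_Mapping.map (fold T w) c) = Poly_Mapping.map (fold T w) (exterior_bdry T p c)"
  by (rule exterior_bdry_map[where f = "fold T w" and T = T and T' = T, OF commuting_endos_axioms commuting_endos_axioms fold_T(2)[OF w] fold_T(1)[OF w] fold_T(3)[OF w] c])

text \<open>Words are concatenated: an element that has reached \<open>S\<close> stays there, so a
  word found for a further element can be applied after the earlier ones.\<close>

lemma finite_cofinal:
  assumes cof: "\<And>a. a \<in> A \<Longrightarrow> \<exists>w. set w \<subseteq> {..<k} \<and> fold T w a \<in> S"
    and S: "\<And>i a. \<lbrakk>i < k; a \<in> S\<rbrakk> \<Longrightarrow> T i a \<in> S"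
    and F: "finite F" "F \<subseteq> A"
  shows "\<exists>w. set w \<subseteq> {..<k} \<and> (\<forall>a\<in>F. fold T w a \<in> S)"
  using F
proof (induction F rule: finite_induct)
  case empty
  show ?case by (intro exI[of _ "[]"]) simp
next
  case (insert x F)
  then obtain w where w: "set w \<subseteq> {..<k}" "\<And>a. a \<in> F \<Longrightarrow> fold T w a \<in> S" by auto
  obtain v where v: "set v \<subseteq> {..<k}" "fold T v (fold T w x) \<in> S"
    using cof[OF fold_T(1)[OF w(1)], of x] insert.prems by blast
  have "fold T v a \<in> S" if "a \<in> S" for a
    using v(1) that by (induction v arbitrary: a) (auto simp: S)
  then show ?case using v w by (intro exI[of _ "w @ v"]) auto
qed

end

text \<open>Each cycle of the large complex is homologous to its translate by a word, and one word
  moves all its finitely many coefficients into the image of \<open>\<phi>\<close>. Translation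
  likewise carries a bounding chain into the image, where injectivity of \<open>\<phi>\<close>
  allows it to be pulled back.\<close>

lemma cofinal_homology_iso:
  fixes A :: "'b::ab_group_add set" and A' :: "'c::ab_group_add set"
  assumes A: "commuting_endos k A S" and A': "commuting_endos k A' T"
    and \<phi>: "additive_on A \<phi>" "\<And>a. a \<in> A \<Longrightarrow> \<phi> a \<in> A'"
    and \<phi>T: "\<And>i a. \<lbrakk>i < k; a \<in> A\<rbrakk> \<Longrightarrow> \<phi> (S i a) = T i (\<phi> a)"
    and inj: "\<And>a. \<lbrakk>a \<in> A; \<phi> a = 0\<rbrakk> \<Longrightarrow> a = 0"
    and cofinal: "\<And>a. a \<in> A' \<Longrightarrow> \<exists>w. set w \<subseteq> {..<k} \<and> fold T w a \<in> \<phi> ` A"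
  shows "homology_iso_via (exterior_complex k A S) (exterior_complex k A' T) (Poly_Mapping.map \<phi>) p"
proof -
  interpret A: commuting_endos k A S by fact
  interpret A': commuting_endos k A' T by fact
  let ?C = "exterior_complex k A S" and ?C' = "exterior_complex k A' T"
  let ?m = "Poly_Mapping.map \<phi>"
  have \<phi>0: "\<phi> 0 = 0" by (rule additive_on_zero[OF \<phi>(1) add_closed_zero[OF A.A]])
  have m: "?m c \<in> exterior_chains k A' q" if "c \<in> exterior_chains k A q" for c q
    by (rule map_exterior_chains[where f = \<phi>, OF \<phi>0 \<phi>(2) that])
  have bm: "exterior_bdry T q (?m c) = ?m (exterior_bdry S q c)" if "c \<in> exterior_chains k A q" for c q
    by (rule exterior_bdry_map[where f = \<phi>, OF A A' \<phi> \<phi>T that])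
  have m_additive: "additive_on (exterior_chains k A q) ?m" for q
    by (rule additive_on_map[OF \<phi>(1) add_closed_zero[OF A.A]])
  have m_inj: "c = 0" if "c \<in> exterior_chains k A q" "?m c = 0" for c q
  proof (rule poly_mapping_eqI)
    fix J
    have "\<phi> (Poly_Mapping.lookup c J) = 0" using that(2) by (metis lookup_map_zero[where f = \<phi>, OF \<phi>0] lookup_zero)
    then show "Poly_Mapping.lookup c J = Poly_Mapping.lookup 0 J"
      using inj that(1) by (simp add: exterior_chains_def)
  qed
  have lift: "\<exists>w d. set w \<subseteq> {..<k} \<and> d \<in> exterior_chains k A q \<and> ?m d = Poly_Mapping.map (fold T w) c"
    if c: "c \<in> exterior_chains k A' q" for c q
  proof -
    have cA: "Poly_Mapping.lookup c ` Poly_Mapping.keys c \<subseteq> A'" using c by (auto simp: exterior_chains_def)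
    have "\<exists>w. set w \<subseteq> {..<k} \<and> (\<forall>a\<in>Poly_Mapping.lookup c ` Poly_Mapping.keys c. fold T w a \<in> \<phi> ` A)"
      by (rule A'.finite_cofinal[OF cofinal _ _ cA]) (auto simp: \<phi>T[symmetric] A.T)
    then obtain w where w: "set w \<subseteq> {..<k}"
      "\<And>J. J \<in> Poly_Mapping.keys c \<Longrightarrow> fold T w (Poly_Mapping.lookup c J) \<in> \<phi> ` A" by auto
    have w0: "fold T w 0 = 0"
      by (rule additive_on_zero[OF A'.fold_T(2)[OF w(1)] add_closed_zero[OF A'.A]])
    \<comment> \<open>The preimages are chosen to be zero off the keys, so that \<open>g\<close> has
      the support of an exterior chain.\<close>
    define g where "g J = (if J \<in> Poly_Mapping.keys c then SOME a. a \<in> A \<and> fold T w (Poly_Mapping.lookup c J) = \<phi> a else 0)" for J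
    have g: "g J \<in> A \<and> fold T w (Poly_Mapping.lookup c J) = \<phi> (g J)" for J
    proof (cases "J \<in> Poly_Mapping.keys c")
      case True
      then have "\<exists>a. a \<in> A \<and> fold T w (Poly_Mapping.lookup c J) = \<phi> a" using w(2) by blast
      from someI_ex[OF this] show ?thesis using True by (simp add: g_def)
    next
      case False
      then show ?thesis by (simp add: g_def in_keys_iff w0 \<phi>0 add_closed_zero[OF A.A])
    qed
    have "g \<in> ext_funs k A q"
      unfolding ext_funs_def
    proof (intro CollectI conjI allI impI)
      fix J assume J: "\<not> (J \<subseteq> {..<k} \<and> card J = q)"
      then have "J \<notin> Poly_Mapping.keys c" using c by (auto simp: exterior_chains_def)
      then show "g J = 0" by (simp add: g_def)
    qed (use g in blast)
    then obtain d where "d \<in> exterior_chains k A q" "Poly_Mapping.lookup d = g"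
      by (rule A.exterior_chains_of_fun)
    moreover from this have "?m d = Poly_Mapping.map (fold T w) c"
      using g by (intro poly_mapping_eqI) (simp add: lookup_map_zero[where f = \<phi>, OF \<phi>0] lookup_map_zero[where f = "fold T w", OF w0])
    ultimately show ?thesis using w(1) by blast
  qed
  have bdA: "add_closed (boundaries ?C p)" "boundaries ?C p \<subseteq> cycles ?C p"
    "add_closed (boundaries ?C' p)" "boundaries ?C' p \<subseteq> cycles ?C' p"
    "add_closed (cycles ?C p)" "add_closed (cycles ?C' p)"
    by (auto simp: add_closed_boundaries add_closed_cycles A.additive_exterior_complex A'.additive_exterior_complex)
  have m_cyc: "?m c \<in> cycles ?C' p" if "c \<in> cycles ?C p" for c
    using that m bm \<phi>0
    by (auto simp: cycles_def exterior_complex_def) (metis map_eq_zero_iff keys_zero empty_iff)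
  have m_bd: "?m c \<in> boundaries ?C' p \<longleftrightarrow> c \<in> boundaries ?C p" if c: "c \<in> cycles ?C p" for c
  proof
    assume "c \<in> boundaries ?C p"
    then show "?m c \<in> boundaries ?C' p"
      using m bm[symmetric] by (auto simp: boundaries_def exterior_complex_def)
  next
    assume "?m c \<in> boundaries ?C' p"
    then obtain a where a: "a \<in> exterior_chains k A' (Suc p)" "?m c = exterior_bdry T (Suc p) a"
      by (auto simp: boundaries_def exterior_complex_def)
    obtain w d where w: "set w \<subseteq> {..<k}" "d \<in> exterior_chains k A (Suc p)" "?m d = Poly_Mapping.map (fold T w) a"
      using lift[OF a(1)] by blast
    have cA: "c \<in> exterior_chains k A p" using c by (simp add: cycles_def exterior_complex_def)
    have S0: "fold S w 0 = 0" and T0: "fold T w 0 = 0"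
      using additive_on_zero[OF A.fold_T(2)[OF w(1)] add_closed_zero[OF A.A]]
        additive_on_zero[OF A'.fold_T(2)[OF w(1)] add_closed_zero[OF A'.A]] by auto
    have fold: "\<phi> (fold S w b) = fold T w (\<phi> b)" if "b \<in> A" for b
      using w(1) that by (induction w arbitrary: b) (auto simp: A.T \<phi>T)
    have "?m (exterior_bdry S (Suc p) d) = exterior_bdry T (Suc p) (Poly_Mapping.map (fold T w) a)"
      using bm[OF w(2)] w(3) by simp
    also have "\<dots> = Poly_Mapping.map (fold T w) (?m c)"
      by (simp add: A'.map_fold_T_commute[OF w(1) a(1)] a(2))
    also have "\<dots> = ?m (Poly_Mapping.map (fold S w) c)"
      using cA by (intro poly_mapping_eqI)
        (simp add: lookup_map_zero[where f = \<phi>, OF \<phi>0] lookup_map_zero[where f = "fold T w", OF T0]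
          lookup_map_zero[where f = "fold S w", OF S0] fold exterior_chains_def)
    finally have eq: "?m (exterior_bdry S (Suc p) d) = ?m (Poly_Mapping.map (fold S w) c)" .
    have d': "exterior_bdry S (Suc p) d \<in> exterior_chains k A p" by (rule A.exterior_bdry_closed[OF w(2)])
    have c': "Poly_Mapping.map (fold S w) c \<in> exterior_chains k A p"
      by (rule map_exterior_chains[where f = "fold S w", OF S0 A.fold_T(1)[OF w(1)] cA])
    have "?m (exterior_bdry S (Suc p) d - Poly_Mapping.map (fold S w) c) = 0"
      using additive_on_diff[OF A.add_closed_exterior_chains m_additive d' c'] eq by simp
    then have "exterior_bdry S (Suc p) d = Poly_Mapping.map (fold S w) c"
      using m_inj[OF add_closed_diff[OF A.add_closed_exterior_chains d' c']] by simp
    then have "Poly_Mapping.map (fold S w) c \<in> boundaries ?C p"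
      using w(2) by (auto simp: boundaries_def exterior_complex_def intro!: image_eqI[of _ _ d])
    with add_closed_add[OF bdA(1) A.fold_T_homotopic_id[OF w(1) c]] show "c \<in> boundaries ?C p" by fastforce
  qed
  have surj: "\<exists>d \<in> cycles ?C p. c - ?m d \<in> boundaries ?C' p" if c: "c \<in> cycles ?C' p" for c
  proof -
    have c': "c \<in> exterior_chains k A' p" "exterior_bdry T p c = 0"
      using c by (auto simp: cycles_def exterior_complex_def)
    obtain w d where w: "set w \<subseteq> {..<k}" "d \<in> exterior_chains k A p" "?m d = Poly_Mapping.map (fold T w) c"
      using lift[OF c'(1)] by blast
    have "?m (exterior_bdry S p d) = exterior_bdry T p (Poly_Mapping.map (fold T w) c)"
      using bm[OF w(2)] w(3) by simp
    also have "\<dots> = 0"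
      unfolding A'.map_fold_T_commute[OF w(1) c'(1)] c'(2) by (simp add: map_eq_zero_iff)
    finally have "exterior_bdry S p d = 0"
    proof (cases p)
      case 0
      then show ?thesis by (simp add: exterior_bdry_def)
    next
      case (Suc q)
      assume "?m (exterior_bdry S p d) = 0"
      then show ?thesis using m_inj A.exterior_bdry_closed[of d q] w(2) Suc by blast
    qed
    then have "d \<in> cycles ?C p" using w(2) by (simp add: cycles_def exterior_complex_def)
    moreover have "c - ?m d \<in> boundaries ?C' p"
      unfolding w(3) by (rule A'.fold_T_homotopic_id[OF w(1) c])
    ultimately show ?thesis by blast
  qed
  \<comment> \<open>The relation that \<open>b\<close> is homologous to \<open>?m a\<close> takes
    the place of the graph of \<open>?m\<close>, because a cycle of the large complex need only be
    homologous to an image.\<close>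
  have "\<exists>h \<in> iso (homology ?C p) (homology ?C' p). \<forall>a b. (a \<in> cycles ?C p \<and> b \<in> cycles ?C' p \<and> b - ?m a \<in> boundaries ?C' p) \<longrightarrow>
     h (boundaries ?C p #>\<^bsub>additive_group (cycles ?C p)\<^esub> a) = boundaries ?C' p #>\<^bsub>additive_group (cycles ?C' p)\<^esub> b"
    unfolding homology_def
  proof (rule quotient_iso_of_relation)
    fix a b a' b'
    assume 1: "a \<in> cycles ?C p \<and> b \<in> cycles ?C' p \<and> b - ?m a \<in> boundaries ?C' p"
      and 2: "a' \<in> cycles ?C p \<and> b' \<in> cycles ?C' p \<and> b' - ?m a' \<in> boundaries ?C' p"
    have "?m (a - a') = ?m a - ?m a'"
      using 1 2 by (intro additive_on_diff[OF A.add_closed_exterior_chains m_additive])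
        (auto simp: cycles_def exterior_complex_def)
    then have eq: "(b - b') - ?m (a - a') = (b - ?m a) - (b' - ?m a')" by simp
    show "a - a' \<in> cycles ?C p \<and> b - b' \<in> cycles ?C' p \<and> (b - b') - ?m (a - a') \<in> boundaries ?C' p"
      unfolding eq
      using 1 2 add_closed_diff[OF bdA(5), of a a'] add_closed_diff[OF bdA(6), of b b']
        add_closed_diff[OF bdA(3), of "b - ?m a" "b' - ?m a'"] by blast
  next
    fix a b
    assume *: "a \<in> cycles ?C p \<and> b \<in> cycles ?C' p \<and> b - ?m a \<in> boundaries ?C' p"
    have "b \<in> boundaries ?C' p \<longleftrightarrow> ?m a \<in> boundaries ?C' p"
      using * add_closed_diff[OF bdA(3), of b "b - ?m a"] add_closed_add[OF bdA(3), of "b - ?m a" "?m a"] by auto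
    then show "a \<in> boundaries ?C p \<longleftrightarrow> b \<in> boundaries ?C' p" using m_bd * by blast
  next
    fix a assume "a \<in> cycles ?C p"
    then show "\<exists>b. a \<in> cycles ?C p \<and> b \<in> cycles ?C' p \<and> b - ?m a \<in> boundaries ?C' p"
      using m_cyc add_closed_zero[OF bdA(3)] by (intro exI[of _ "?m a"]) simp
  next
    fix b assume "b \<in> cycles ?C' p"
    then show "\<exists>a. a \<in> cycles ?C p \<and> b \<in> cycles ?C' p \<and> b - ?m a \<in> boundaries ?C' p"
      using surj by blast
  qed (use bdA in auto)
  then obtain h where h: "h \<in> iso (homology ?C p) (homology ?C' p)"
    "\<And>a b. a \<in> cycles ?C p \<and> b \<in> cycles ?C' p \<and> b - ?m a \<in> boundaries ?C' p \<Longrightarrow>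
       h (boundaries ?C p #>\<^bsub>additive_group (cycles ?C p)\<^esub> a) = boundaries ?C' p #>\<^bsub>additive_group (cycles ?C' p)\<^esub> b"
    by blast
  show ?thesis
    unfolding homology_iso_via_def homology_class_def
  proof (intro bexI[OF _ h(1)] ballI h(2))
    fix c assume "c \<in> cycles ?C p"
    then show "c \<in> cycles ?C p \<and> ?m c \<in> cycles ?C' p \<and> ?m c - ?m c \<in> boundaries ?C' p"
      using m_cyc add_closed_zero[OF bdA(3)] by simp
  qed
qed

section \<open>Graded regularity\<close>

definition frag_restrict :: "('y \<Rightarrow> bool) \<Rightarrow> ('y \<Rightarrow>\<^sub>0 int) \<Rightarrow> ('y \<Rightarrow>\<^sub>0 int)" where
  "frag_restrict P = frag_extend (\<lambda>y. if P y then frag_of y else 0)"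

lemma frag_restrict_diff: "frag_restrict P (a - b) = frag_restrict P a - frag_restrict P b"
  by (simp add: frag_restrict_def frag_extend_diff)

lemma frag_restrict_zero [simp]: "frag_restrict P 0 = 0"
  by (simp add: frag_restrict_def)

lemma lookup_frag_restrict:
  "Poly_Mapping.lookup (frag_restrict P c) y = (if P y then Poly_Mapping.lookup c y else 0)"
  using subset_UNIV
  by (induction c rule: frag_induction)
    (auto simp: frag_restrict_diff lookup_minus, auto simp: frag_restrict_def)

lemma keys_frag_restrict: "Poly_Mapping.keys (frag_restrict P c) = {y \<in> Poly_Mapping.keys c. P y}"
  by (auto simp: in_keys_iff lookup_frag_restrict split: if_splits)

lemma frag_restrict_all: "(\<And>y. y \<in> Poly_Mapping.keys c \<Longrightarrow> P y) \<Longrightarrow> frag_restrict P c = c"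
  by (intro poly_mapping_eqI) (auto simp: lookup_frag_restrict in_keys_iff)

lemma frag_restrict_none: "(\<And>y. y \<in> Poly_Mapping.keys c \<Longrightarrow> \<not> P y) \<Longrightarrow> frag_restrict P c = 0"
  by (intro poly_mapping_eqI) (auto simp: lookup_frag_restrict in_keys_iff)

text \<open>An abstract form of the tuples: \<open>dg\<close> is the degree of the first path,
  \<open>\<tau> i\<close> the extension by paths of degree \<open>e_i\<close>, and
  \<open>\<epsilon>\<close> the passage to groupoid chains. Assumption \<open>inj\<close> expresses
  that the generators of any one degree have linearly independent images.\<close>

locale graded_frags =
  fixes k :: nat and Y :: "'y set" and dg :: "'y \<Rightarrow> nat \<Rightarrow> nat"
    and \<tau> :: "nat \<Rightarrow> ('y \<Rightarrow>\<^sub>0 int) \<Rightarrow> ('y \<Rightarrow>\<^sub>0 int)" and \<epsilon> :: "('y \<Rightarrow>\<^sub>0 int) \<Rightarrow> 'm::ab_group_add"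
  assumes \<tau>_diff: "\<And>i a b. i < k \<Longrightarrow> \<tau> i (a - b) = \<tau> i a - \<tau> i b"
    and \<tau>_of: "\<And>i y. \<lbrakk>i < k; y \<in> Y\<rbrakk> \<Longrightarrow>
                 Poly_Mapping.keys (\<tau> i (frag_of y)) \<subseteq> {y' \<in> Y. dg y' = (dg y)(i := Suc (dg y i))}"
    and \<epsilon>_diff: "\<And>a b. \<epsilon> (a - b) = \<epsilon> a - \<epsilon> b"
    and \<epsilon>_of: "\<And>i y. \<lbrakk>i < k; y \<in> Y\<rbrakk> \<Longrightarrow> \<epsilon> (\<tau> i (frag_of y)) = \<epsilon> (frag_of y)"
    and inj: "\<And>c q. \<lbrakk>Poly_Mapping.keys c \<subseteq> {y \<in> Y. dg y = q}; \<epsilon> c = 0\<rbrakk> \<Longrightarrow> c = 0"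
    and dg_outside: "\<And>i y. \<lbrakk>y \<in> Y; i \<ge> k\<rbrakk> \<Longrightarrow> dg y i = 0"
begin

definition K :: "('y \<Rightarrow>\<^sub>0 int) set" where
  "K = {c. Poly_Mapping.keys c \<subseteq> Y}"

lemma add_closed_K: "add_closed K"
  unfolding add_closed_def K_def using keys_diff by fastforce

lemma \<tau>_zero: "i < k \<Longrightarrow> \<tau> i 0 = 0"
  using \<tau>_diff[of i 0 0] by simp

lemma \<epsilon>_zero: "\<epsilon> 0 = 0"
  using \<epsilon>_diff[of 0 0] by simp

lemma diff_imp_add:
  fixes f :: "'c::ab_group_add \<Rightarrow> 'd::ab_group_add"
  assumes "\<And>a b. f (a - b) = f a - f b"
  shows "f (a + b) = f a + f b"
  using assms[of a "- b"] assms[of 0 b] assms[of 0 0] by simp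

lemma \<tau>_add: "i < k \<Longrightarrow> \<tau> i (a + b) = \<tau> i a + \<tau> i b"
  by (rule diff_imp_add) (rule \<tau>_diff)

lemma keys_\<tau>:
  assumes "i < k" "c \<in> K"
  shows "Poly_Mapping.keys (\<tau> i c) \<subseteq> {y' \<in> Y. \<exists>y\<in>Poly_Mapping.keys c. dg y' = (dg y)(i := Suc (dg y i))}"
proof -
  have "Poly_Mapping.keys (\<tau> i b) \<subseteq> {y' \<in> Y. \<exists>y\<in>Poly_Mapping.keys c. dg y' = (dg y)(i := Suc (dg y i))}"
    if "Poly_Mapping.keys b \<subseteq> Poly_Mapping.keys c" for b
    using that
  proof (induction b rule: frag_induction)
    case zero
    then show ?case by (simp add: \<tau>_zero[OF assms(1)])
  next
    case (one y)
    then have "y \<in> Y" using assms(2) by (auto simp: K_def)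
    from \<tau>_of[OF assms(1) this] one show ?case by blast
  next
    case (diff a b)
    then show ?case unfolding \<tau>_diff[OF assms(1)] using keys_diff by fast
  qed
  then show ?thesis by simp
qed

lemma \<tau>_closed: "\<lbrakk>i < k; c \<in> K\<rbrakk> \<Longrightarrow> \<tau> i c \<in> K"
  using keys_\<tau> unfolding K_def by blast

lemma \<epsilon>_\<tau>:
  assumes "i < k" "c \<in> K"
  shows "\<epsilon> (\<tau> i c) = \<epsilon> c"
  using assms(2)[unfolded K_def mem_Collect_eq]
  by (induction c rule: frag_induction) (simp_all add: \<tau>_zero \<tau>_diff \<epsilon>_diff \<epsilon>_of assms(1))

lemma frag_restrict_\<tau>:
  assumes "i < k" "c \<in> K"
    and "\<And>y y'. \<lbrakk>y \<in> Y; y' \<in> Y; dg y' = (dg y)(i := Suc (dg y i))\<rbrakk> \<Longrightarrow> P y' \<longleftrightarrow> Q y"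
  shows "frag_restrict P (\<tau> i c) = \<tau> i (frag_restrict Q c)"
  using assms(2)[unfolded K_def mem_Collect_eq]
proof (induction c rule: frag_induction)
  case zero
  then show ?case by (simp add: \<tau>_zero[OF assms(1)])
next
  case (one y)
  show ?case
  proof (cases "Q y")
    case True
    have "frag_restrict P (\<tau> i (frag_of y)) = \<tau> i (frag_of y)"
      using \<tau>_of[OF assms(1) one] assms(3)[OF one] True by (intro frag_restrict_all) auto
    then show ?thesis using True by (simp add: frag_restrict_def)
  next
    case False
    have "frag_restrict P (\<tau> i (frag_of y)) = 0"
      using \<tau>_of[OF assms(1) one] assms(3)[OF one] False by (intro frag_restrict_none) auto
    then show ?thesis using False by (simp add: frag_restrict_def \<tau>_zero[OF assms(1)])
  qed
next
  case (diff a b)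
  then show ?case by (simp add: frag_restrict_diff \<tau>_diff assms(1))
qed

text \<open>Both composites of a generator lie in one degree and have the same image under
  \<open>\<epsilon>\<close>, so \<open>inj\<close> identifies them.\<close>

lemma \<tau>_commute:
  assumes "i < k" "l < k" "c \<in> K"
  shows "\<tau> i (\<tau> l c) = \<tau> l (\<tau> i c)"
  using assms(3)[unfolded K_def mem_Collect_eq]
proof (induction c rule: frag_induction)
  case (one y)
  define q where "q j = dg y j + (if j = i then 1 else 0) + (if j = l then 1 else 0)" for j
  have y: "frag_of y \<in> K" using one by (simp add: K_def)
  have "Poly_Mapping.keys (\<tau> i (\<tau> l (frag_of y))) \<subseteq> {y \<in> Y. dg y = q}"
    using keys_\<tau>[OF assms(1) \<tau>_closed[OF assms(2) y]] \<tau>_of[OF assms(2) one] by (fastforce simp: q_def)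
  moreover have "Poly_Mapping.keys (\<tau> l (\<tau> i (frag_of y))) \<subseteq> {y \<in> Y. dg y = q}"
    using keys_\<tau>[OF assms(2) \<tau>_closed[OF assms(1) y]] \<tau>_of[OF assms(1) one] by (fastforce simp: q_def)
  ultimately have "Poly_Mapping.keys (\<tau> i (\<tau> l (frag_of y)) - \<tau> l (\<tau> i (frag_of y))) \<subseteq> {y \<in> Y. dg y = q}"
    using keys_diff by fast
  moreover have "\<epsilon> (\<tau> i (\<tau> l (frag_of y)) - \<tau> l (\<tau> i (frag_of y))) = 0"
    using \<epsilon>_\<tau> \<tau>_closed y assms by (simp add: \<epsilon>_diff)
  ultimately have "\<tau> i (\<tau> l (frag_of y)) - \<tau> l (\<tau> i (frag_of y)) = 0" by (rule inj)
  then show ?case by simp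
qed (simp_all add: \<tau>_zero \<tau>_diff assms)

lemma commuting_endos_K: "commuting_endos k K \<tau>"
  by unfold_locales (auto simp: add_closed_K \<tau>_closed \<tau>_commute additive_on_def \<tau>_add)

text \<open>The part of \<open>c\<close> in which the coordinate \<open>i\<close> has the least
  admissible value is replaced by its image under \<open>\<tau> i\<close>, which raises that value
  by one; this is repeated until \<open>N\<close> is reached. \<open>Q\<close> carries along
  conditions on the other coordinates.\<close>

lemma push_up:
  assumes i: "i < k" and Q: "\<And>y y'. \<lbrakk>y \<in> Y; y' \<in> Y; dg y' = (dg y)(i := Suc (dg y i)); Q y\<rbrakk> \<Longrightarrow> Q y'"
    and "c \<in> K" "\<And>y. y \<in> Poly_Mapping.keys c \<Longrightarrow> N - d \<le> dg y i \<and> dg y i \<le> N \<and> Q y"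
  shows "\<exists>a\<in>K. c - (a - \<tau> i a) \<in> K \<and>
           (\<forall>y\<in>Poly_Mapping.keys (c - (a - \<tau> i a)). dg y i = N \<and> Q y)"
  using assms(3,4)
proof (induction d arbitrary: c)
  case 0
  then show ?case
    by (intro bexI[of _ 0]) (auto simp: \<tau>_zero[OF i] add_closed_zero[OF add_closed_K] intro: antisym)
next
  case (Suc d)
  show ?case
  proof (cases "N \<le> d")
    \<comment> \<open>With truncated subtraction \<open>N - d\<close> and \<open>N - Suc d\<close>
      are both zero here, so there is nothing to raise at this stage.\<close>
    case True
    then show ?thesis using Suc.IH[OF Suc.prems(1)] Suc.prems(2) by auto
  next
    case False
    define m where "m = N - Suc d"
    have m: "N - d = Suc m" "m < N" using False by (auto simp: m_def)
    define a where "a = frag_restrict (\<lambda>y. dg y i = m) c"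
    have a: "a \<in> K" using Suc.prems(1) by (auto simp: K_def a_def keys_frag_restrict)
    define b where "b = c - a"
    have bk: "y \<in> Poly_Mapping.keys c \<and> dg y i \<noteq> m" if "y \<in> Poly_Mapping.keys b" for y
      using that by (auto simp: b_def a_def in_keys_iff lookup_minus lookup_frag_restrict split: if_splits)
    have ky: "Suc m \<le> dg y i \<and> dg y i \<le> N \<and> Q y" if y: "y \<in> Poly_Mapping.keys (b + \<tau> i a)" for y
    proof -
      from y keys_add[of b "\<tau> i a"] consider "y \<in> Poly_Mapping.keys b" | "y \<in> Poly_Mapping.keys (\<tau> i a)" by blast
      then show ?thesis
      proof cases
        case 1
        then show ?thesis using bk[OF 1] Suc.prems(2)[of y] by (auto simp: m_def)
      next
        case 2
        then obtain z where z: "y \<in> Y" "z \<in> Poly_Mapping.keys a" "dg y = (dg z)(i := Suc (dg z i))"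
          using keys_\<tau>[OF i a] by auto
        then have "z \<in> Poly_Mapping.keys c" "dg z i = m" "z \<in> Y" using a by (auto simp: a_def keys_frag_restrict K_def)
        then show ?thesis using z Q[of z y] Suc.prems(2)[of z] m by auto
      qed
    qed
    have c': "c - (a - \<tau> i a) = b + \<tau> i a" by (simp add: b_def)
    have "b + \<tau> i a \<in> K"
      unfolding b_def
      by (intro add_closed_add[OF add_closed_K] add_closed_diff[OF add_closed_K] \<tau>_closed i Suc.prems a)
    from Suc.IH[OF this] ky m(1)
    obtain a' where a': "a' \<in> K" "b + \<tau> i a - (a' - \<tau> i a') \<in> K"
      "\<forall>y\<in>Poly_Mapping.keys (b + \<tau> i a - (a' - \<tau> i a')). dg y i = N \<and> Q y" by auto
    have "c - ((a + a') - \<tau> i (a + a')) = b + \<tau> i a - (a' - \<tau> i a')"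
      unfolding b_def \<tau>_add[OF i] by (simp add: algebra_simps)
    with a'(2,3) show ?thesis
      by (intro bexI[OF _ add_closed_add[OF add_closed_K a a'(1)]]) (simp only: simp_thms)
  qed
qed

text \<open>The coordinates are treated one at a time; those already equal to \<open>N\<close> are
  preserved because \<open>\<tau> j\<close> changes only the coordinate \<open>j\<close>.\<close>

lemma push_up_all:
  assumes c: "c \<in> K" and N: "\<And>y i. y \<in> Poly_Mapping.keys c \<Longrightarrow> dg y i \<le> N" and "j \<le> k"
  shows "\<exists>x. (\<forall>i. x i \<in> K) \<and> c - (\<Sum>i<j. x i - \<tau> i (x i)) \<in> K \<and>
     (\<forall>y\<in>Poly_Mapping.keys (c - (\<Sum>i<j. x i - \<tau> i (x i))). (\<forall>i<j. dg y i = N) \<and> (\<forall>i. dg y i \<le> N))"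
  using \<open>j \<le> k\<close>
proof (induction j)
  case 0
  then show ?case using c N by (intro exI[of _ "\<lambda>_. 0"]) (auto simp: add_closed_zero[OF add_closed_K])
next
  case (Suc j)
  then obtain x where x: "\<And>i. x i \<in> K" "c - (\<Sum>i<j. x i - \<tau> i (x i)) \<in> K"
    "\<And>y. y \<in> Poly_Mapping.keys (c - (\<Sum>i<j. x i - \<tau> i (x i))) \<Longrightarrow> (\<forall>i<j. dg y i = N) \<and> (\<forall>i. dg y i \<le> N)"
    using Suc_leD[OF Suc.prems] by blast
  have "\<exists>a\<in>K. c - (\<Sum>i<j. x i - \<tau> i (x i)) - (a - \<tau> j a) \<in> K \<and>
     (\<forall>y\<in>Poly_Mapping.keys (c - (\<Sum>i<j. x i - \<tau> i (x i)) - (a - \<tau> j a)).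
        dg y j = N \<and> (\<forall>i<j. dg y i = N) \<and> (\<forall>i. i \<noteq> j \<longrightarrow> dg y i \<le> N))"
    by (rule push_up[where d = N]) (use Suc.prems x in auto)
  then obtain a where a: "a \<in> K" "c - (\<Sum>i<j. x i - \<tau> i (x i)) - (a - \<tau> j a) \<in> K"
     "\<And>y. y \<in> Poly_Mapping.keys (c - (\<Sum>i<j. x i - \<tau> i (x i)) - (a - \<tau> j a)) \<Longrightarrow>
        dg y j = N \<and> (\<forall>i<j. dg y i = N) \<and> (\<forall>i. i \<noteq> j \<longrightarrow> dg y i \<le> N)" by blast
  define x' where "x' = x(j := a)"
  have eq: "c - (\<Sum>i<Suc j. x' i - \<tau> i (x' i)) = c - (\<Sum>i<j. x i - \<tau> i (x i)) - (a - \<tau> j a)"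
    by (simp add: x'_def)
  have "dg y i \<le> N" if "y \<in> Poly_Mapping.keys (c - (\<Sum>i<j. x i - \<tau> i (x i)) - (a - \<tau> j a))" for y i
    using a(3)[OF that] by (cases "i = j") auto
  then show ?case
    using x(1) a by (intro exI[of _ x'], unfold eq) (auto simp: x'_def less_Suc_eq)
qed

text \<open>The value of \<open>\<epsilon>\<close> on the part of \<open>c\<close> in which the degrees have the coordinates \<open>r i\<close> for \<open>i \<ge> j\<close>.
  These values vanish for all \<open>r\<close> precisely when \<open>c\<close> is a sum of elements $a_i - \tau_i a_i$ with \<open>i < j\<close>:
  modulo such elements \<open>c\<close> can be moved to a single degree in the coordinates below \<open>j\<close>.\<close>

definition part :: "nat \<Rightarrow> (nat \<Rightarrow> nat) \<Rightarrow> ('y \<Rightarrow>\<^sub>0 int) \<Rightarrow> 'm" where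
  "part j r c = \<epsilon> (frag_restrict (\<lambda>y. \<forall>i\<ge>j. dg y i = r i) c)"

lemma part_diff: "part j r (a - b) = part j r a - part j r b"
  by (simp add: part_def frag_restrict_diff \<epsilon>_diff)

text \<open>For \<open>i < j\<close> the operator \<open>\<tau> i\<close> changes only a coordinate
  on which \<open>part j\<close> imposes no condition, so it commutes with the selection, and
  \<open>\<epsilon>\<close> does not see it.\<close>

lemma part_\<tau>:
  assumes "i < j" "j \<le> k" "a \<in> K"
  shows "part j r (\<tau> i a) = part j r a"
proof -
  let ?P = "\<lambda>y. \<forall>i\<ge>j. dg y i = r i"
  have "frag_restrict ?P (\<tau> i a) = \<tau> i (frag_restrict ?P a)"
    using assms by (intro frag_restrict_\<tau>) auto
  moreover have "frag_restrict ?P a \<in> K" using assms(3) by (auto simp: K_def keys_frag_restrict)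
  ultimately show ?thesis using assms by (simp add: part_def \<epsilon>_\<tau>)
qed

lemma part_sum_zero:
  assumes "j \<le> k" "\<And>i. x i \<in> K"
  shows "part j r (\<Sum>i<j. x i - \<tau> i (x i)) = 0"
proof -
  have "part j r (\<Sum>i<l. x i - \<tau> i (x i)) = 0" if "l \<le> j" for l
    using that
  proof (induction l)
    case 0
    then show ?case by (simp add: part_def \<epsilon>_zero)
  next
    case (Suc l)
    have "part j r (\<Sum>i<Suc l. x i - \<tau> i (x i)) = part j r (\<Sum>i<l. x i - \<tau> i (x i)) + part j r (x l - \<tau> l (x l))"
      by (subst diff_imp_add[of "part j r", OF part_diff, symmetric]) simp
    then show ?case using Suc part_\<tau>[of l j "x l" r] assms by (simp add: part_diff)
  qed
  then show ?thesis by simp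
qed

text \<open>After a sum of the permitted form is subtracted, all coordinates below \<open>j\<close>
  equal \<open>N\<close>. Fixing the remaining coordinates then singles out one degree, where the
  vanishing of \<open>\<epsilon>\<close> forces the vanishing of the element.\<close>

lemma part_zero_imp:
  assumes "j \<le> k" "c \<in> K" "\<And>r. part j r c = 0"
  shows "\<exists>x. (\<forall>i. x i \<in> K) \<and> c = (\<Sum>i<j. x i - \<tau> i (x i))"
proof -
  \<comment> \<open>A crude common bound for all coordinates of all degrees that occur; a total
    needs no separate treatment of empty sets, as a maximum would.\<close>
  define N where "N = (\<Sum>y\<in>Poly_Mapping.keys c. \<Sum>i<k. dg y i)"
  have N: "dg y i \<le> N" if "y \<in> Poly_Mapping.keys c" for y i
  proof (cases "i < k")
    case True
    then have "dg y i \<le> (\<Sum>i<k. dg y i)" by (intro member_le_sum) auto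
    also have "\<dots> \<le> N" unfolding N_def using that by (intro member_le_sum) auto
    finally show ?thesis .
  next
    case False
    then show ?thesis using dg_outside[of y i] assms(2) that by (auto simp: K_def)
  qed
  obtain x where x: "\<And>i. x i \<in> K" "c - (\<Sum>i<j. x i - \<tau> i (x i)) \<in> K"
    "\<And>y i. \<lbrakk>y \<in> Poly_Mapping.keys (c - (\<Sum>i<j. x i - \<tau> i (x i))); i < j\<rbrakk> \<Longrightarrow> dg y i = N"
    using push_up_all[OF assms(2) N assms(1)] by blast
  define c' where "c' = c - (\<Sum>i<j. x i - \<tau> i (x i))"
  have "c' = 0"
  proof (rule ccontr)
    assume "c' \<noteq> 0"
    then obtain y where y: "y \<in> Poly_Mapping.keys c'" by fastforce
    let ?P = "\<lambda>y'. \<forall>i\<ge>j. dg y' i = dg y i"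
    have "part j (dg y) c' = 0"
      unfolding c'_def part_diff by (simp add: assms(1,3) part_sum_zero x(1))
    moreover have "Poly_Mapping.keys (frag_restrict ?P c') \<subseteq> {y' \<in> Y. dg y' = dg y}"
    proof
      fix z assume "z \<in> Poly_Mapping.keys (frag_restrict ?P c')"
      then have z: "z \<in> Poly_Mapping.keys c'" "\<forall>i\<ge>j. dg z i = dg y i" by (auto simp: keys_frag_restrict)
      have "dg z i = dg y i" for i
        using z x(3)[of z i] x(3)[of y i] y by (cases "i < j") (auto simp: c'_def)
      then show "z \<in> {y' \<in> Y. dg y' = dg y}" using z x(2) by (auto simp: c'_def K_def)
    qed
    ultimately have "frag_restrict ?P c' = 0" using inj unfolding part_def by blast
    moreover have "y \<in> Poly_Mapping.keys (frag_restrict ?P c')" using y by (simp add: keys_frag_restrict)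
    ultimately show False by simp
  qed
  then show ?thesis using x(1) unfolding c'_def by (intro exI[of _ x]) simp
qed

text \<open>Applying \<open>part j r\<close> to the hypothesis annihilates the right-hand side, so
  \<open>a\<close> and \<open>\<tau> j a\<close> have equal parts. The part of
  \<open>\<tau> j a\<close> at \<open>r\<close> is that of \<open>a\<close> with \<open>r j\<close>
  lowered by one, and it is zero if \<open>r j = 0\<close>; by descent on \<open>r j\<close> all
  parts of \<open>a\<close> vanish.\<close>

lemma regular_K: "regular_up_to k K \<tau>"
  unfolding regular_up_to_def
proof (intro allI impI ballI)
  fix j a assume j: "j < k" and a: "a \<in> K"
    and "\<exists>x. (\<forall>i. x i \<in> K) \<and> a - \<tau> j a = (\<Sum>i<j. x i - \<tau> i (x i))"
  then have eq: "part j r a = part j r (\<tau> j a)" for r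
    using part_sum_zero[of j _ r] part_diff[of j r a "\<tau> j a"] by auto
  have "part j r a = 0" for r
  proof (induction "r j" arbitrary: r)
    case 0
    have "frag_restrict (\<lambda>y. \<forall>i\<ge>j. dg y i = r i) (\<tau> j a) = 0"
      using keys_\<tau>[OF j a] 0 by (intro frag_restrict_none) fastforce
    then show ?case unfolding eq by (simp add: part_def \<epsilon>_zero)
  next
    case (Suc m)
    have "frag_restrict (\<lambda>y. \<forall>i\<ge>j. dg y i = r i) (\<tau> j a) =
        \<tau> j (frag_restrict (\<lambda>y. \<forall>i\<ge>j. dg y i = (r(j := m)) i) a)"
    proof (rule frag_restrict_\<tau>[OF j a])
      fix y y' assume y': "dg y' = (dg y)(j := Suc (dg y j))"
      have "(dg y' i = r i) = (dg y i = (r(j := m)) i)" for i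
        unfolding y' using Suc(2) by auto
      then show "(\<forall>i\<ge>j. dg y' i = r i) = (\<forall>i\<ge>j. dg y i = (r(j := m)) i)" by simp
    qed
    moreover have "frag_restrict (\<lambda>y. \<forall>i\<ge>j. dg y i = (r(j := m)) i) a \<in> K"
      using a by (auto simp: K_def keys_frag_restrict)
    ultimately have "part j r (\<tau> j a) = part j (r(j := m)) a"
      unfolding part_def using \<epsilon>_\<tau>[OF j] by simp
    then have "part j r a = part j (r(j := m)) a" using eq[of r] by simp
    also have "\<dots> = 0" by (rule Suc(1)) simp
    finally show ?case .
  qed
  then show "\<exists>x. (\<forall>i. x i \<in> K) \<and> a = (\<Sum>i<j. x i - \<tau> i (x i))"
    using part_zero_imp[OF _ a] j by simp
qed

text \<open>Degrees vanish in the coordinates from \<open>k\<close> on, so the only part for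
  \<open>j = k\<close> that could be nonzero is \<open>\<epsilon> c\<close> itself.\<close>

lemma kernel_\<epsilon>:
  assumes "c \<in> K" "\<epsilon> c = 0"
  shows "\<exists>x. (\<forall>i. x i \<in> K) \<and> c = (\<Sum>i<k. x i - \<tau> i (x i))"
proof (rule part_zero_imp[OF order_refl assms(1)])
  fix r :: "nat \<Rightarrow> nat"
  show "part k r c = 0"
  proof (cases "\<forall>i\<ge>k. r i = 0")
    case True
    then have "frag_restrict (\<lambda>y. \<forall>i\<ge>k. dg y i = r i) c = c"
      using assms(1) dg_outside by (intro frag_restrict_all) (auto simp: K_def)
    then show ?thesis using assms(2) by (simp add: part_def)
  next
    case False
    then have "frag_restrict (\<lambda>y. \<forall>i\<ge>k. dg y i = r i) c = 0"
      using assms(1) dg_outside by (intro frag_restrict_none) (force simp: K_def)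
    then show ?thesis by (simp add: part_def \<epsilon>_zero)
  qed
qed

end

section \<open>Locally constant functions with compact support\<close>

text \<open>One definition serves the cylinders of vertices, of paths and of tuples. The sets
  \<open>Z i\<close> may overlap, so different combinations can represent the same function.\<close>

definition ind_comb :: "('i \<Rightarrow> 'x set) \<Rightarrow> ('i \<Rightarrow>\<^sub>0 int) \<Rightarrow> 'x \<Rightarrow> int" where
  "ind_comb Z c = (\<lambda>x. \<Sum>i\<in>Poly_Mapping.keys c. Poly_Mapping.lookup c i * indicator (Z i) x)"

lemma ind_comb_superset:
  assumes "finite F" "Poly_Mapping.keys c \<subseteq> F"
  shows "ind_comb Z c x = (\<Sum>i\<in>F. Poly_Mapping.lookup c i * indicator (Z i) x)"
  unfolding ind_comb_def using assms by (intro sum.mono_neutral_left) (auto simp: in_keys_iff)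

lemma ind_comb_diff: "ind_comb Z (a - b) = ind_comb Z a - ind_comb Z b"
proof
  fix x
  let ?F = "Poly_Mapping.keys a \<union> Poly_Mapping.keys b"
  have "ind_comb Z (a - b) x = (\<Sum>i\<in>?F. Poly_Mapping.lookup (a - b) i * indicator (Z i) x)"
    by (rule ind_comb_superset) (auto dest: subsetD[OF keys_diff])
  moreover have "ind_comb Z a x = (\<Sum>i\<in>?F. Poly_Mapping.lookup a i * indicator (Z i) x)"
    "ind_comb Z b x = (\<Sum>i\<in>?F. Poly_Mapping.lookup b i * indicator (Z i) x)"
    by (rule ind_comb_superset; simp)+
  ultimately show "ind_comb Z (a - b) x = (ind_comb Z a - ind_comb Z b) x"
    by (simp add: lookup_minus left_diff_distrib sum_subtractf)
qed

lemma ind_comb_zero [simp]: "ind_comb Z 0 = 0"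
  by (simp add: ind_comb_def fun_eq_iff)

lemma ind_comb_of [simp]: "ind_comb Z (frag_of i) = indicator (Z i)"
  by (simp add: ind_comb_def fun_eq_iff)

lemma ind_comb_add: "ind_comb Z (a + b) = ind_comb Z a + ind_comb Z b"
  using ind_comb_diff[of Z "a + b" b] by simp

lemma additive_on_ind_comb: "additive_on A (ind_comb Z)"
  by (simp add: additive_on_def ind_comb_add)

lemma ind_comb_cong: "(\<And>i. i \<in> Poly_Mapping.keys c \<Longrightarrow> Z i = Z' i) \<Longrightarrow> ind_comb Z c = ind_comb Z' c"
  by (simp add: ind_comb_def)

lemma ind_comb_frag_extend:
  assumes "\<And>i. i \<in> Poly_Mapping.keys c \<Longrightarrow> ind_comb Z (g i) = indicator (Z' i)"
  shows "ind_comb Z (frag_extend g c) = ind_comb Z' c"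
proof -
  have "ind_comb Z (frag_extend g b) = ind_comb Z' b" if "Poly_Mapping.keys b \<subseteq> Poly_Mapping.keys c" for b
    using that by (induction b rule: frag_induction) (simp_all add: assms frag_extend_diff ind_comb_diff)
  then show ?thesis by simp
qed

text \<open>At a point of \<open>Z i\<close> only the coefficient of \<open>i\<close>
  contributes.\<close>

lemma ind_comb_eq_zeroD:
  assumes "ind_comb Z c = 0"
    and ne: "\<And>i. i \<in> Poly_Mapping.keys c \<Longrightarrow> Z i \<noteq> {}"
    and dis: "\<And>i j. \<lbrakk>i \<in> Poly_Mapping.keys c; j \<in> Poly_Mapping.keys c; i \<noteq> j\<rbrakk> \<Longrightarrow> Z i \<inter> Z j = {}"
  shows "c = 0"
proof (rule ccontr)
  assume "c \<noteq> 0"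
  then obtain i where i: "i \<in> Poly_Mapping.keys c" by fastforce
  then obtain x where x: "x \<in> Z i" using ne by blast
  have "ind_comb Z c x = (\<Sum>j\<in>{i}. Poly_Mapping.lookup c j * indicator (Z j) x)"
    unfolding ind_comb_def using i x dis
    by (intro sum.mono_neutral_right) (auto simp: indicator_def)
  then show False using assms(1) i x by (simp add: in_keys_iff)
qed

lemma ind_comb_frag_sum:
  assumes "finite D"
  shows "ind_comb Z (\<Sum>d\<in>D. frag_of (f d)) x = (\<Sum>d\<in>D. indicator (Z (f d)) x)"
  using assms by (induction D rule: finite_induct) (simp_all add: ind_comb_add)

lemma sum_fun_apply: "(\<Sum>d\<in>D. f d) x = (\<Sum>d\<in>D. f d x)"
  by (induction D rule: infinite_finite_induct) auto

lemma indicator_disjoint_UN: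
  assumes "finite D" "\<And>d e. \<lbrakk>d \<in> D; e \<in> D; d \<noteq> e\<rbrakk> \<Longrightarrow> Z d \<inter> Z e = {}"
  shows "indicator (\<Union>d\<in>D. Z d) x = (\<Sum>d\<in>D. indicator (Z d) x :: int)"
  using assms
proof (induction D rule: finite_induct)
  case (insert d D)
  have "Z d \<inter> (\<Union>e\<in>D. Z e) = {}" using insert.prems[of d] insert.hyps(2) by auto
  then have "indicator (\<Union>e\<in>insert d D. Z e) x = (indicator (Z d) x + indicator (\<Union>e\<in>D. Z e) x :: int)"
    by (auto simp: indicator_def)
  then show ?case using insert by simp
qed simp

text \<open>A fibre of \<open>\<psi>\<close> meets each \<open>Z i\<close> in at most one point, so
  each indicator function is pushed forward to the indicator function of the image.\<close>

lemma pushforward_ind_comb: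
  assumes sub: "\<And>i. i \<in> Poly_Mapping.keys c \<Longrightarrow> Z i \<subseteq> topspace Y"
    and inj: "\<And>i. i \<in> Poly_Mapping.keys c \<Longrightarrow> inj_on \<psi> (Z i)"
  shows "pushforward Y \<psi> (ind_comb Z c) = ind_comb (\<lambda>i. \<psi> ` Z i) c"
proof
  fix x
  let ?K = "Poly_Mapping.keys c"
  let ?f = "ind_comb Z c"
  \<comment> \<open>A finite set containing the support of \<open>?f\<close> over \<open>x\<close>.
    It replaces the index set in the definition of \<open>pushforward\<close>, which depends on the
    cancellations in \<open>?f\<close> and does not split into the contributions of the
    \<open>Z i\<close>.\<close>
  define S where "S = (\<Union>i\<in>?K. {y \<in> Z i. \<psi> y = x})"
  have fib: "finite {y \<in> Z i. \<psi> y = x} \<and> int (card {y \<in> Z i. \<psi> y = x}) = indicator (\<psi> ` Z i) x"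
    if i: "i \<in> ?K" for i
  proof (cases "x \<in> \<psi> ` Z i")
    case True
    then obtain y where y: "y \<in> Z i" "\<psi> y = x" by blast
    then have *: "{y \<in> Z i. \<psi> y = x} = {y}" using inj_onD[OF inj[OF i]] by blast
    show ?thesis unfolding * using True by simp
  next
    case False
    then have *: "{y \<in> Z i. \<psi> y = x} = {}" by blast
    show ?thesis unfolding * using False by simp
  qed
  have fin: "finite S" unfolding S_def using fib by auto
  have "pushforward Y \<psi> ?f x = (\<Sum>y\<in>S. ?f y)"
    unfolding pushforward_def
  proof (rule sum.mono_neutral_left[OF fin])
    show "{y \<in> topspace Y. \<psi> y = x \<and> ?f y \<noteq> 0} \<subseteq> S"
    proof clarify
      fix y assume y: "?f y \<noteq> 0" "x = \<psi> y"
      then obtain i where "i \<in> ?K" "Poly_Mapping.lookup c i * indicator (Z i) y \<noteq> 0"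
        unfolding ind_comb_def by (meson sum.neutral)
      then show "y \<in> S" unfolding S_def using y by (auto simp: indicator_def split: if_splits)
    qed
    show "\<forall>y\<in>S - {y \<in> topspace Y. \<psi> y = x \<and> ?f y \<noteq> 0}. ?f y = 0"
      using sub by (auto simp: S_def)
  qed
  also have "\<dots> = (\<Sum>i\<in>?K. \<Sum>y\<in>S. Poly_Mapping.lookup c i * indicator (Z i) y)"
    unfolding ind_comb_def by (rule sum.swap)
  also have "\<dots> = (\<Sum>i\<in>?K. Poly_Mapping.lookup c i * indicator (\<psi> ` Z i) x)"
  proof (rule sum.cong[OF refl])
    fix i assume i: "i \<in> ?K"
    have "(\<Sum>y\<in>S. Poly_Mapping.lookup c i * indicator (Z i) y) =
        (\<Sum>y\<in>{y \<in> Z i. \<psi> y = x}. Poly_Mapping.lookup c i)"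
      using i by (intro sum.mono_neutral_cong_right fin) (auto simp: S_def indicator_def)
    also have "\<dots> = Poly_Mapping.lookup c i * indicator (\<psi> ` Z i) x"
      using fib[OF i] by simp
    finally show "(\<Sum>y\<in>S. Poly_Mapping.lookup c i * indicator (Z i) y) = \<dots>" .
  qed
  finally show "pushforward Y \<psi> ?f x = ind_comb (\<lambda>i. \<psi> ` Z i) c x"
    by (simp add: ind_comb_def)
qed

text \<open>A continuous function into a discrete space has open level sets, so its nonvanishing set
  is already closed and the closure in \<open>Cc\<close> has no effect.\<close>

lemma Cc_iff:
  "f \<in> Cc X \<longleftrightarrow> (\<forall>v. openin X {x \<in> topspace X. f x = v}) \<and> (\<forall>x. x \<notin> topspace X \<longrightarrow> f x = 0) \<and>
     compactin X {x \<in> topspace X. f x \<noteq> 0}"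
proof -
  have 1: "continuous_map X (discrete_topology UNIV) f \<longleftrightarrow> (\<forall>v. openin X {x \<in> topspace X. f x = v})"
  proof
    assume *: "continuous_map X (discrete_topology UNIV) f"
    show "\<forall>v. openin X {x \<in> topspace X. f x = v}"
    proof
      fix v
      show "openin X {x \<in> topspace X. f x = v}"
        using openin_continuous_map_preimage[OF *, of "{v}"] by simp
    qed
  next
    assume *: "\<forall>v. openin X {x \<in> topspace X. f x = v}"
    have "openin X {x \<in> topspace X. f x \<in> U}" for U
    proof -
      have "{x \<in> topspace X. f x \<in> U} = (\<Union>v\<in>U. {x \<in> topspace X. f x = v})" by auto
      then show ?thesis using * by auto
    qed
    then show "continuous_map X (discrete_topology UNIV) f" by (simp add: continuous_map_def)
  qed
  have 2: "X closure_of {x \<in> topspace X. f x \<noteq> 0} = {x \<in> topspace X. f x \<noteq> 0}"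
    if "\<forall>v. openin X {x \<in> topspace X. f x = v}"
  proof -
    have "topspace X - {x \<in> topspace X. f x \<noteq> 0} = {x \<in> topspace X. f x = 0}" by auto
    then have "closedin X {x \<in> topspace X. f x \<noteq> 0}" using that by (auto simp: closedin_def)
    then show ?thesis by (simp add: closure_of_eq)
  qed
  show ?thesis unfolding Cc_def mem_Collect_eq 1 using 2 by metis
qed

lemma add_closed_Cc: "add_closed (Cc X)"
  unfolding add_closed_def
proof (intro conjI ballI)
  have "openin X {x \<in> topspace X. 0 = v}" for v :: int by (cases "0 = v") auto
  then show "0 \<in> Cc X" by (simp add: Cc_iff)
  fix f g assume f: "f \<in> Cc X" and g: "g \<in> Cc X"
  have op: "openin X {x \<in> topspace X. (f - g) x = v}" for v
  proof -
    have "{x \<in> topspace X. (f - g) x = v} =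
        (\<Union>a. {x \<in> topspace X. f x = a} \<inter> {x \<in> topspace X. g x = a - v})" by auto
    also have "openin X \<dots>" using f g by (auto simp: Cc_iff)
    finally show ?thesis .
  qed
  have "compactin X {x \<in> topspace X. (f - g) x \<noteq> 0}"
  proof (rule closed_compactin)
    show "compactin X ({x \<in> topspace X. f x \<noteq> 0} \<union> {x \<in> topspace X. g x \<noteq> 0})"
      using f g by (intro compactin_Un) (auto simp: Cc_iff)
    have "topspace X - {x \<in> topspace X. (f - g) x \<noteq> 0} = {x \<in> topspace X. (f - g) x = 0}" by auto
    then show "closedin X {x \<in> topspace X. (f - g) x \<noteq> 0}"
      unfolding closedin_def using op[of 0] by auto
  qed auto
  then show "f - g \<in> Cc X" using op f g unfolding Cc_iff[of "f - g"] by (auto simp: Cc_iff)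
qed

text \<open>Condition \<open>refinement\<close> cuts \<open>Z i\<close> into finitely many disjoint
  basic pieces, each inside \<open>Z j\<close> or disjoint from it. It yields that basic sets are
  closed and that products of their indicator functions are again combinations of such
  functions.\<close>

locale compact_open_base =
  fixes X :: "'x topology" and I :: "'i set" and Z :: "'i \<Rightarrow> 'x set"
  assumes openin_Z: "\<And>i. i \<in> I \<Longrightarrow> openin X (Z i)"
    and compactin_Z: "\<And>i. i \<in> I \<Longrightarrow> compactin X (Z i)"
    and base: "\<And>U x. \<lbrakk>openin X U; x \<in> U\<rbrakk> \<Longrightarrow> \<exists>i\<in>I. x \<in> Z i \<and> Z i \<subseteq> U"
    and refinement: "\<And>i j. \<lbrakk>i \<in> I; j \<in> I\<rbrakk> \<Longrightarrow>
      \<exists>D\<subseteq>I. finite D \<and> (\<Union>d\<in>D. Z d) = Z i \<and> (\<forall>d\<in>D. \<forall>e\<in>D. d \<noteq> e \<longrightarrow> Z d \<inter> Z e = {}) \<and>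
        (\<forall>d\<in>D. Z d \<subseteq> Z j \<or> Z d \<inter> Z j = {})"
begin

lemma Z_subset: "i \<in> I \<Longrightarrow> Z i \<subseteq> topspace X"
  using openin_Z openin_subset by blast

lemma closedin_Z:
  assumes i: "i \<in> I"
  shows "closedin X (Z i)"
  unfolding closedin_def
proof (intro conjI Z_subset i)
  show "openin X (topspace X - Z i)"
  proof (subst openin_subopen, intro ballI)
    fix x assume x: "x \<in> topspace X - Z i"
    then obtain j where j: "j \<in> I" "x \<in> Z j" using base[of "topspace X" x] by auto
    obtain D where D: "D \<subseteq> I" "(\<Union>d\<in>D. Z d) = Z j" "\<forall>d\<in>D. Z d \<subseteq> Z i \<or> Z d \<inter> Z i = {}"
      using refinement[OF j(1) i] by blast
    obtain d where d: "d \<in> D" "x \<in> Z d" using D(2) j(2) by blast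
    then have "Z d \<inter> Z i = {}" using D(3) x by blast
    then show "\<exists>T. openin X T \<and> x \<in> T \<and> T \<subseteq> topspace X - Z i"
      using d D(1) openin_Z Z_subset by (intro exI[of _ "Z d"]) blast
  qed
qed

lemma indicator_in_Cc:
  assumes i: "i \<in> I"
  shows "indicator (Z i) \<in> Cc X"
proof -
  have "{x \<in> topspace X. indicator (Z i) x = (v::int)} =
      (if v = 1 then Z i else if v = 0 then topspace X - Z i else {})" for v
    using Z_subset[OF i] by (auto simp: indicator_def)
  moreover have "{x \<in> topspace X. indicator (Z i) x \<noteq> (0::int)} = Z i"
    using Z_subset[OF i] by (auto simp: indicator_def)
  ultimately show ?thesis
    unfolding Cc_iff using Z_subset[OF i] openin_Z[OF i] closedin_Z[OF i] compactin_Z[OF i]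
    by (auto simp: closedin_def indicator_def)
qed

lemma ind_comb_in_Cc: "Poly_Mapping.keys c \<subseteq> I \<Longrightarrow> ind_comb Z c \<in> Cc X"
proof (induction c rule: frag_induction)
  case zero
  show ?case unfolding ind_comb_zero by (rule add_closed_zero[OF add_closed_Cc])
next
  case (one i)
  then show ?case by (simp add: indicator_in_Cc)
next
  case (diff a b)
  then show ?case unfolding ind_comb_diff by (rule add_closed_diff[OF add_closed_Cc])
qed

definition combs :: "('x \<Rightarrow> int) set" where
  "combs = ind_comb Z ` {c. Poly_Mapping.keys c \<subseteq> I}"

lemma add_closed_combs: "add_closed combs"
  unfolding combs_def
  by (rule add_closed_image[OF _ additive_on_ind_comb])
    (use keys_diff in \<open>fastforce simp: add_closed_def\<close>)

lemma indicator_in_combs: "i \<in> I \<Longrightarrow> indicator (Z i) \<in> combs"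
  unfolding combs_def by (intro image_eqI[of _ _ "frag_of i"]) auto

lemma scaled_combs: "f \<in> combs \<Longrightarrow> (\<lambda>x. n * f x) \<in> combs"
proof -
  assume f: "f \<in> combs"
  have nat: "(\<lambda>x. int m * f x) \<in> combs" for m
  proof (induction m)
    case 0
    then show ?case using add_closed_zero[OF add_closed_combs] by (simp add: zero_fun_def)
  next
    case (Suc m)
    show ?case using add_closed_add[OF add_closed_combs Suc f] by (simp add: plus_fun_def algebra_simps)
  qed
  show ?thesis
  proof (cases "n \<ge> 0")
    case True
    then show ?thesis using nat[of "nat n"] by simp
  next
    case False
    then show ?thesis using add_closed_minus[OF add_closed_combs nat[of "nat (- n)"]]
      by (simp add: fun_Compl_def)
  qed
qed

lemma combs_times_indicator:
  assumes "f \<in> combs" and j: "j \<in> I"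
  shows "(\<lambda>x. f x * indicator (Z j) x) \<in> combs"
proof -
  have *: "(\<lambda>x. indicator (Z i) x * indicator (Z j) x) \<in> combs" if i: "i \<in> I" for i
  proof -
    obtain D where D: "D \<subseteq> I" "finite D" "(\<Union>d\<in>D. Z d) = Z i"
      "\<forall>d\<in>D. \<forall>e\<in>D. d \<noteq> e \<longrightarrow> Z d \<inter> Z e = {}" "\<forall>d\<in>D. Z d \<subseteq> Z j \<or> Z d \<inter> Z j = {}"
      using refinement[OF i j] by blast
    define D' where "D' = {d \<in> D. Z d \<subseteq> Z j}"
    have "Z i \<inter> Z j = (\<Union>d\<in>D'. Z d)"
    proof (intro Set.set_eqI iffI)
      fix x assume x: "x \<in> Z i \<inter> Z j"
      then obtain d where d: "d \<in> D" "x \<in> Z d" using D(3) by blast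
      then have "Z d \<subseteq> Z j" using bspec[OF D(5) d(1)] x by blast
      then show "x \<in> (\<Union>d\<in>D'. Z d)" using d by (auto simp: D'_def)
    next
      fix x assume "x \<in> (\<Union>d\<in>D'. Z d)"
      then obtain d where "d \<in> D" "Z d \<subseteq> Z j" "x \<in> Z d" by (auto simp: D'_def)
      then show "x \<in> Z i \<inter> Z j" using D(3) by blast
    qed
    then have "indicator (Z i) x * indicator (Z j) x = (indicator (\<Union>d\<in>D'. Z d) x :: int)" for x
      by (metis indicator_inter_arith)
    also have "indicator (\<Union>d\<in>D'. Z d) x = (\<Sum>d\<in>D'. indicator (Z d) x :: int)" for x
      using D by (intro indicator_disjoint_UN) (auto simp: D'_def)
    finally have "(\<lambda>x. indicator (Z i) x * indicator (Z j) x :: int) = (\<Sum>d\<in>D'. indicator (Z d))"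
      by (simp add: fun_eq_iff sum_fun_apply)
    then show ?thesis
      using D(1) by (auto simp: D'_def intro!: add_closed_sum[OF add_closed_combs] indicator_in_combs)
  qed
  obtain c where c: "Poly_Mapping.keys c \<subseteq> I" "f = ind_comb Z c" using assms(1) by (auto simp: combs_def)
  have "(\<lambda>x. ind_comb Z c x * indicator (Z j) x) \<in> combs"
    using c(1)
  proof (induction c rule: frag_induction)
    case zero
    then show ?case using add_closed_zero[OF add_closed_combs] by (simp add: zero_fun_def)
  next
    case (one i)
    then show ?case using * by simp
  next
    case (diff a b)
    show ?case using add_closed_diff[OF add_closed_combs diff] by (simp add: ind_comb_diff left_diff_distrib fun_diff_def)
  qed
  then show ?thesis by (simp add: c(2))
qed

text \<open>Induction over the cover: the new set contributes its constant value, and the part of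
  \<open>f\<close> on the earlier sets is corrected on the overlap by multiplication with an
  indicator function.\<close>

lemma locally_constant_in_combs:
  assumes "finite F" "F \<subseteq> I" "\<And>x. x \<notin> (\<Union>i\<in>F. Z i) \<Longrightarrow> f x = 0"
    and "\<And>i x y. \<lbrakk>i \<in> F; x \<in> Z i; y \<in> Z i\<rbrakk> \<Longrightarrow> f x = f y"
  shows "f \<in> combs"
  using assms
proof (induction F arbitrary: f rule: finite_induct)
  case empty
  then have "f = 0" by auto
  then show ?case using add_closed_zero[OF add_closed_combs] by (simp only:)
next
  case (insert j F)
  let ?U = "\<Union>i\<in>F. Z i"
  define g where "g x = f x * indicator ?U x" for x
  have g: "g \<in> combs"
  proof (rule insert.IH)
    show "g x = g y" if "i \<in> F" "x \<in> Z i" "y \<in> Z i" for i x y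
      using that insert.prems(3)[of i x y] by (auto simp: g_def indicator_def)
  qed (use insert.prems in \<open>auto simp: g_def indicator_def\<close>)
  have j: "j \<in> I" using insert.prems by auto
  obtain v where v: "\<And>x. x \<in> Z j \<Longrightarrow> f x = v" using insert.prems(3)[of j] by (metis insertI1)
  have "(\<lambda>x. v * indicator (Z j) x) + (g - (\<lambda>x. g x * indicator (Z j) x)) \<in> combs"
    by (intro add_closed_add[OF add_closed_combs] add_closed_diff[OF add_closed_combs] scaled_combs
        indicator_in_combs j g combs_times_indicator)
  also have "(\<lambda>x. v * indicator (Z j) x) + (g - (\<lambda>x. g x * indicator (Z j) x)) = f"
  proof
    fix x
    show "((\<lambda>x. v * indicator (Z j) x) + (g - (\<lambda>x. g x * indicator (Z j) x))) x = f x"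
      using v[of x] insert.prems(2)[of x] by (auto simp: g_def indicator_def)
  qed
  finally show ?case .
qed

text \<open>The compact support is covered by basic sets on which \<open>f\<close> is constant, and
  finitely many of them suffice.\<close>

theorem Cc_eq: "Cc X = ind_comb Z ` {c. Poly_Mapping.keys c \<subseteq> I}"
proof
  show "ind_comb Z ` {c. Poly_Mapping.keys c \<subseteq> I} \<subseteq> Cc X" using ind_comb_in_Cc by blast
  show "Cc X \<subseteq> ind_comb Z ` {c. Poly_Mapping.keys c \<subseteq> I}"
  proof
    fix f assume f: "f \<in> Cc X"
    let ?S = "{x \<in> topspace X. f x \<noteq> 0}"
    define J where "J = {i \<in> I. \<forall>x\<in>Z i. \<forall>y\<in>Z i. f x = f y}"
    have "?S \<subseteq> \<Union>(Z ` J)"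
    proof
      fix x assume x: "x \<in> ?S"
      then have "openin X {y \<in> topspace X. f y = f x}" using f by (simp add: Cc_iff)
      from base[OF this, of x] x obtain i where i: "i \<in> I" "x \<in> Z i" "Z i \<subseteq> {y \<in> topspace X. f y = f x}" by auto
      have "f y = f x" if "y \<in> Z i" for y using i(3) that by blast
      then have "\<forall>x\<in>Z i. \<forall>y\<in>Z i. f x = f y" by simp
      then have "i \<in> J" using i(1) unfolding J_def by blast
      then show "x \<in> \<Union>(Z ` J)" using i(2) by blast
    qed
    moreover have "compactin X ?S" using f by (simp add: Cc_iff)
    moreover have "openin X U" if "U \<in> Z ` J" for U using that openin_Z by (auto simp: J_def)
    ultimately have "\<exists>\<F>. finite \<F> \<and> \<F> \<subseteq> Z ` J \<and> ?S \<subseteq> \<Union>\<F>"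
      by (intro compactinD[of X ?S "Z ` J"])
    then obtain \<F> where \<F>: "finite \<F>" "\<F> \<subseteq> Z ` J" "?S \<subseteq> \<Union>\<F>" by blast
    obtain F where F: "finite F" "F \<subseteq> J" "\<F> = Z ` F" using finite_subset_image[OF \<F>(1,2)] by blast
    have "f \<in> combs"
    proof (rule locally_constant_in_combs[OF F(1)])
      show "F \<subseteq> I" using F(2) by (auto simp: J_def)
      show "f x = 0" if "x \<notin> (\<Union>i\<in>F. Z i)" for x
        using that \<F>(3) F(3) f by (auto simp: Cc_iff)
      show "f x = f y" if "i \<in> F" "x \<in> Z i" "y \<in> Z i" for i x y
        using that F(2) unfolding J_def by blast
    qed
    then show "f \<in> ind_comb Z ` {c. Poly_Mapping.keys c \<subseteq> I}" by (simp add: combs_def)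
  qed
qed

end

section \<open>Infinite paths\<close>

lemma Nk_zero [simp]: "0 \<in> Nk k"
  by (simp add: Nk_def)

lemma Nk_add: "\<lbrakk>m \<in> Nk k; n \<in> Nk k\<rbrakk> \<Longrightarrow> m + n \<in> Nk k"
  by (simp add: Nk_def)

lemma Nk_diff: "m \<in> Nk k \<Longrightarrow> m - n \<in> Nk k"
  by (simp add: Nk_def fun_diff_def)

lemma Nk_unit_vec: "i < k \<Longrightarrow> unit_vec i \<in> Nk k"
  by (simp add: Nk_def unit_vec_def)

lemma fun_le_add: "m \<le> m + (n :: nat \<Rightarrow> nat)" "n \<le> m + n"
  by (simp_all add: le_fun_def)

lemma fun_add_diff_inverse: "m \<le> n \<Longrightarrow> m + (n - m) = (n :: nat \<Rightarrow> nat)"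
  by (simp add: le_fun_def fun_eq_iff fun_diff_def)

lemma fun_le_diff: "m + n \<le> p \<Longrightarrow> n \<le> p - (m :: nat \<Rightarrow> nat)"
  by (simp add: le_fun_def fun_diff_def) (metis add.commute add_le_imp_le_diff)

section \<open>Initial and final segments of finite paths\<close>

context k_graph
begin

abbreviation M :: "'a set" where "M \<equiv> mor \<Lambda>"

abbreviation cmp :: "'a \<Rightarrow> 'a \<Rightarrow> 'a" (infixl "\<cdot>" 70) where "\<mu> \<cdot> \<nu> \<equiv> comp \<Lambda> \<mu> \<nu>"

abbreviation composable :: "'a \<Rightarrow> 'a \<Rightarrow> bool" where
  "composable \<mu> \<nu> \<equiv> \<mu> \<in> M \<and> \<nu> \<in> M \<and> src \<Lambda> \<mu> = rng \<Lambda> \<nu>"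

lemma deg_src: "\<eta> \<in> M \<Longrightarrow> deg \<Lambda> (src \<Lambda> \<eta>) = 0"
  using deg_identity[OF src_closed] rng_src by metis

lemma factor_unique:
  assumes "composable \<mu> \<nu>" "composable \<mu>' \<nu>'" "\<mu> \<cdot> \<nu> = \<mu>' \<cdot> \<nu>'" "deg \<Lambda> \<mu> = deg \<Lambda> \<mu>'"
  shows "\<mu> = \<mu>' \<and> \<nu> = \<nu>'"
proof -
  have d: "deg \<Lambda> (\<mu> \<cdot> \<nu>) = deg \<Lambda> \<mu> + deg \<Lambda> \<nu>" "deg \<Lambda> (\<mu> \<cdot> \<nu>) = deg \<Lambda> \<mu> + deg \<Lambda> \<nu>'"
    using assms deg_comp by metis+
  then have d': "deg \<Lambda> \<nu>' = deg \<Lambda> \<nu>" by simp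
  have "\<exists>!(\<alpha>, \<beta>). \<alpha> \<in> M \<and> \<beta> \<in> M \<and> src \<Lambda> \<alpha> = rng \<Lambda> \<beta> \<and> deg \<Lambda> \<alpha> = deg \<Lambda> \<mu> \<and> deg \<Lambda> \<beta> = deg \<Lambda> \<nu> \<and> \<mu> \<cdot> \<nu> = \<alpha> \<cdot> \<beta>"
    using assms(1) d(1) by (intro factorisation comp_closed deg_closed) auto
  then show ?thesis using assms d' by (metis (mono_tags, lifting) case_prodI prod.inject)
qed

text \<open>The initial segment of degree \<open>m\<close>, with \<open>post\<close> as the
  complementary final segment. Both are meaningful only for
  \<open>m \<le> deg \<Lambda> \<eta>\<close>; the factorisation property then determines
  them.\<close>

definition pre :: "'a \<Rightarrow> (nat \<Rightarrow> nat) \<Rightarrow> 'a" where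
  "pre \<eta> m = (SOME \<mu>. \<exists>\<nu>. composable \<mu> \<nu> \<and> deg \<Lambda> \<mu> = m \<and> \<mu> \<cdot> \<nu> = \<eta>)"

definition post :: "'a \<Rightarrow> (nat \<Rightarrow> nat) \<Rightarrow> 'a" where
  "post \<eta> m = (SOME \<nu>. composable (pre \<eta> m) \<nu> \<and> pre \<eta> m \<cdot> \<nu> = \<eta>)"

lemma factor:
  assumes "\<eta> \<in> M" "m \<in> Nk k" "m \<le> deg \<Lambda> \<eta>"
  shows "composable (pre \<eta> m) (post \<eta> m)" "deg \<Lambda> (pre \<eta> m) = m" "deg \<Lambda> (post \<eta> m) = deg \<Lambda> \<eta> - m"
    "pre \<eta> m \<cdot> post \<eta> m = \<eta>"
proof -
  have "\<exists>!(\<mu>, \<nu>). \<mu> \<in> M \<and> \<nu> \<in> M \<and> src \<Lambda> \<mu> = rng \<Lambda> \<nu> \<and> deg \<Lambda> \<mu> = m \<and> deg \<Lambda> \<nu> = deg \<Lambda> \<eta> - m \<and> \<eta> = \<mu> \<cdot> \<nu>"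
    using assms by (intro factorisation Nk_diff deg_closed) (simp_all add: fun_add_diff_inverse)
  then have "\<exists>\<mu> \<nu>. composable \<mu> \<nu> \<and> deg \<Lambda> \<mu> = m \<and> \<mu> \<cdot> \<nu> = \<eta>"
    by (auto dest!: ex1_implies_ex)
  then have "\<exists>\<nu>. composable (pre \<eta> m) \<nu> \<and> deg \<Lambda> (pre \<eta> m) = m \<and> pre \<eta> m \<cdot> \<nu> = \<eta>"
    unfolding pre_def by (rule someI_ex)
  then have 1: "deg \<Lambda> (pre \<eta> m) = m" and "\<exists>\<nu>. composable (pre \<eta> m) \<nu> \<and> pre \<eta> m \<cdot> \<nu> = \<eta>" by blast+
  from this(2) have 2: "composable (pre \<eta> m) (post \<eta> m) \<and> pre \<eta> m \<cdot> post \<eta> m = \<eta>"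
    unfolding post_def by (rule someI_ex)
  show "composable (pre \<eta> m) (post \<eta> m)" "deg \<Lambda> (pre \<eta> m) = m" "pre \<eta> m \<cdot> post \<eta> m = \<eta>"
    using 1 2 by auto
  have "deg \<Lambda> \<eta> = m + deg \<Lambda> (post \<eta> m)" using 1 2 deg_comp by metis
  then show "deg \<Lambda> (post \<eta> m) = deg \<Lambda> \<eta> - m" by (simp add: fun_eq_iff fun_diff_def)
qed

lemma factor_comp:
  assumes "composable \<mu> \<nu>"
  shows "pre (\<mu> \<cdot> \<nu>) (deg \<Lambda> \<mu>) = \<mu>" "post (\<mu> \<cdot> \<nu>) (deg \<Lambda> \<mu>) = \<nu>"
proof -
  have *: "\<mu> \<cdot> \<nu> \<in> M" "deg \<Lambda> \<mu> \<in> Nk k" "deg \<Lambda> \<mu> \<le> deg \<Lambda> (\<mu> \<cdot> \<nu>)"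
    using assms by (simp_all add: comp_closed deg_closed deg_comp fun_le_add)
  show "pre (\<mu> \<cdot> \<nu>) (deg \<Lambda> \<mu>) = \<mu>" "post (\<mu> \<cdot> \<nu>) (deg \<Lambda> \<mu>) = \<nu>"
    using factor_unique[OF factor(1)[OF *] assms factor(4)[OF *] factor(2)[OF *]] by auto
qed

lemma factor_comp_le:
  assumes c: "composable \<mu> \<nu>" and m: "m \<in> Nk k" "m \<le> deg \<Lambda> \<mu>"
  shows "pre (\<mu> \<cdot> \<nu>) m = pre \<mu> m" "post (\<mu> \<cdot> \<nu>) m = post \<mu> m \<cdot> \<nu>" "composable (post \<mu> m) \<nu>"
proof -
  note f = factor[OF _ m]
  have 1: "composable (post \<mu> m) \<nu>" using f c by (metis src_comp)
  then have 2: "composable (pre \<mu> m) (post \<mu> m \<cdot> \<nu>)" using f c by (simp add: comp_closed rng_comp)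
  have "\<mu> \<cdot> \<nu> = pre \<mu> m \<cdot> (post \<mu> m \<cdot> \<nu>)" using f 1 c comp_assoc by metis
  then show "pre (\<mu> \<cdot> \<nu>) m = pre \<mu> m" "post (\<mu> \<cdot> \<nu>) m = post \<mu> m \<cdot> \<nu>" "composable (post \<mu> m) \<nu>"
    using factor_comp[OF 2] f c 1 by auto
qed

lemma pre_pre:
  assumes "\<eta> \<in> M" "m \<in> Nk k" "n \<in> Nk k" "m \<le> n" "n \<le> deg \<Lambda> \<eta>"
  shows "pre (pre \<eta> n) m = pre \<eta> m"
  using factor_comp_le(1)[OF factor(1)[OF assms(1,3,5)] assms(2)] factor[OF assms(1,3,5)] assms(4) by simp

lemma post_post:
  assumes "\<eta> \<in> M" "m \<in> Nk k" "n \<in> Nk k" "m + n \<le> deg \<Lambda> \<eta>"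
  shows "post (post \<eta> m) n = post \<eta> (m + n)"
proof -
  have m: "m \<le> deg \<Lambda> \<eta>" using assms(4) fun_le_add(1) order_trans by metis
  note f = factor[OF assms(1,2) m]
  have n: "n \<le> deg \<Lambda> (post \<eta> m)" using f(3) assms(4) fun_le_diff by simp
  note g = factor[OF _ assms(3) n]
  have c: "composable (pre \<eta> m) (pre (post \<eta> m) n)" using f g by (metis rng_comp)
  then have c': "composable (pre \<eta> m \<cdot> pre (post \<eta> m) n) (post (post \<eta> m) n)"
    using g f by (simp add: comp_closed src_comp)
  have "\<eta> = (pre \<eta> m \<cdot> pre (post \<eta> m) n) \<cdot> post (post \<eta> m) n"
    using c g f comp_assoc by metis
  moreover have "deg \<Lambda> (pre \<eta> m \<cdot> pre (post \<eta> m) n) = m + n" using c f g deg_comp by simp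
  ultimately show ?thesis using factor_comp(2)[OF c'] by simp
qed

lemma pre_self: "\<eta> \<in> M \<Longrightarrow> pre \<eta> (deg \<Lambda> \<eta>) = \<eta>" and post_self: "\<eta> \<in> M \<Longrightarrow> post \<eta> (deg \<Lambda> \<eta>) = src \<Lambda> \<eta>"
  using factor_comp[of \<eta> "src \<Lambda> \<eta>"] by (simp_all add: src_closed rng_src comp_src)

lemma pre_zero: "\<eta> \<in> M \<Longrightarrow> pre \<eta> 0 = rng \<Lambda> \<eta>" and post_zero: "\<eta> \<in> M \<Longrightarrow> post \<eta> 0 = \<eta>"
  using factor_comp[of "rng \<Lambda> \<eta>" \<eta>] by (simp_all add: rng_closed src_rng comp_rng deg_identity)

lemma vertex_eq: "\<lbrakk>\<eta> \<in> M; deg \<Lambda> \<eta> = 0\<rbrakk> \<Longrightarrow> src \<Lambda> \<eta> = \<eta> \<and> rng \<Lambda> \<eta> = \<eta>"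
  using pre_self pre_zero post_self post_zero by metis

lemma verticesI: "\<eta> \<in> M \<Longrightarrow> src \<Lambda> \<eta> \<in> vertices \<Lambda>"
  by (simp add: vertices_def src_closed deg_src)

section \<open>Infinite paths, cylinders and shifts\<close>

abbreviation IP :: "'a ipath set" where "IP \<equiv> infinite_paths k \<Lambda>"
abbreviation Z :: "'a \<Rightarrow> 'a ipath set" where "Z \<equiv> cylinder k \<Lambda>"
abbreviation sh :: "(nat \<Rightarrow> nat) \<Rightarrow> 'a ipath \<Rightarrow> 'a ipath" where "sh \<equiv> shift k"

lemma mor_Omega: "(m, n) \<in> mor (Omega k) \<longleftrightarrow> m \<in> Nk k \<and> n \<in> Nk k \<and> m \<le> n"
  by (simp add: Omega_def)

lemma path_segment:
  assumes "x \<in> IP" "m \<in> Nk k" "n \<in> Nk k" "m \<le> n"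
  shows "x (m, n) \<in> M" "rng \<Lambda> (x (m, n)) = x (m, m)" "src \<Lambda> (x (m, n)) = x (n, n)" "deg \<Lambda> (x (m, n)) = n - m"
proof -
  have "graded_functor (Omega k) \<Lambda> x" using assms(1) by (simp add: infinite_paths_def)
  moreover have "(m, n) \<in> mor (Omega k)" using assms by (simp add: mor_Omega)
  ultimately have "x (m, n) \<in> M \<and> x (rng (Omega k) (m, n)) = rng \<Lambda> (x (m, n)) \<and>
      x (src (Omega k) (m, n)) = src \<Lambda> (x (m, n)) \<and> deg \<Lambda> (x (m, n)) = deg (Omega k) (m, n)"
    unfolding graded_functor_def by blast
  then show "x (m, n) \<in> M" "rng \<Lambda> (x (m, n)) = x (m, m)" "src \<Lambda> (x (m, n)) = x (n, n)" "deg \<Lambda> (x (m, n)) = n - m"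
    by (simp_all add: Omega_def)
qed

lemma path_comp:
  assumes "x \<in> IP" "m \<in> Nk k" "n \<in> Nk k" "p \<in> Nk k" "m \<le> n" "n \<le> p"
  shows "x (m, n) \<cdot> x (n, p) = x (m, p)" "composable (x (m, n)) (x (n, p))"
proof -
  have "graded_functor (Omega k) \<Lambda> x" using assms(1) by (simp add: infinite_paths_def)
  moreover have "(m, n) \<in> mor (Omega k)" "(n, p) \<in> mor (Omega k)" "src (Omega k) (m, n) = rng (Omega k) (n, p)"
    using assms by (simp_all add: Omega_def)
  ultimately have "x (comp (Omega k) (m, n) (n, p)) = x (m, n) \<cdot> x (n, p)"
    unfolding graded_functor_def by blast
  then show "x (m, n) \<cdot> x (n, p) = x (m, p)" by (simp add: Omega_def)
  show "composable (x (m, n)) (x (n, p))" using assms by (simp add: path_segment)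
qed

lemma deg_initial: "\<lbrakk>x \<in> IP; n \<in> Nk k\<rbrakk> \<Longrightarrow> deg \<Lambda> (x (0, n)) = n"
  using path_segment(4)[of x 0 n] by (simp add: le_fun_def fun_diff_def)

lemma initial_in_M: "\<lbrakk>x \<in> IP; n \<in> Nk k\<rbrakk> \<Longrightarrow> x (0, n) \<in> M"
  using path_segment(1)[of x 0 n] by (simp add: le_fun_def)

lemma path_pre_post:
  assumes "x \<in> IP" "m \<in> Nk k" "n \<in> Nk k" "m \<le> n"
  shows "pre (x (0, n)) m = x (0, m)" "post (x (0, n)) m = x (m, n)"
  using factor_comp[OF path_comp(2)[of x 0 m n]] path_comp(1)[of x 0 m n] deg_initial[of x m] assms
  by (auto simp: le_fun_def)

text \<open>Initial segments of cofinally many degrees determine a path, since all its other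
  segments are factors of these.\<close>

lemma path_eqI:
  assumes x: "x \<in> IP" and y: "y \<in> IP"
    and "\<And>n. n \<in> Nk k \<Longrightarrow> \<exists>n'\<in>Nk k. n \<le> n' \<and> x (0, n') = y (0, n')"
  shows "x = y"
proof (rule extensionalityI[of _ "mor (Omega k)"])
  show "x \<in> extensional (mor (Omega k))" "y \<in> extensional (mor (Omega k))"
    using x y by (auto simp: infinite_paths_def)
  fix p assume "p \<in> mor (Omega k)"
  then obtain m n where p: "p = (m, n)" "m \<in> Nk k" "n \<in> Nk k" "m \<le> n" by (auto simp: Omega_def)
  obtain n' where n': "n' \<in> Nk k" "n \<le> n'" "x (0, n') = y (0, n')" using assms(3)[OF p(3)] by blast
  have "x (0, n) = y (0, n)" using path_pre_post(1)[OF x p(3) n'(1,2)] path_pre_post(1)[OF y p(3) n'(1,2)] n'(3) by simp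
  then show "x p = y p" using path_pre_post(2)[OF x p(2-4)] path_pre_post(2)[OF y p(2-4)] p(1) by simp
qed

text \<open>A coherent family of initial segments determines the whole functor: the segment from
  \<open>m\<close> to \<open>n\<close> has to be what remains of \<open>P n\<close> after degree
  \<open>m\<close>.\<close>

lemma path_exists:
  assumes P: "\<And>n. n \<in> Nk k \<Longrightarrow> P n \<in> M \<and> deg \<Lambda> (P n) = n"
    and coh: "\<And>m n. \<lbrakk>m \<in> Nk k; n \<in> Nk k; m \<le> n\<rbrakk> \<Longrightarrow> pre (P n) m = P m"
  shows "\<exists>x\<in>IP. \<forall>n\<in>Nk k. x (0, n) = P n"
proof -
  define x where "x = (\<lambda>(m, n)\<in>mor (Omega k). post (P n) m)"
  have x: "x (m, n) = post (P n) m" if "m \<in> Nk k" "n \<in> Nk k" "m \<le> n" for m n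
    using that by (simp add: x_def mor_Omega)
  have seg: "composable (P m) (post (P n) m)" "deg \<Lambda> (post (P n) m) = n - m" "P m \<cdot> post (P n) m = P n"
    if "m \<in> Nk k" "n \<in> Nk k" "m \<le> n" for m n
    using factor[of "P n" m] P[OF that(2)] coh[OF that] that by auto
  have diag: "post (P n) n = src \<Lambda> (P n)" if "n \<in> Nk k" for n
    using post_self P[OF that] by metis
  have "graded_functor (Omega k) \<Lambda> x"
    unfolding graded_functor_def
  proof (intro conjI ballI impI)
    fix \<alpha> assume "\<alpha> \<in> mor (Omega k)"
    then obtain m n where mn: "\<alpha> = (m, n)" "m \<in> Nk k" "n \<in> Nk k" "m \<le> n" by (auto simp: Omega_def)
    show "x \<alpha> \<in> M" "deg \<Lambda> (x \<alpha>) = deg (Omega k) \<alpha>"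
      using seg[OF mn(2-4)] mn x by (simp_all add: Omega_def)
    show "x (rng (Omega k) \<alpha>) = rng \<Lambda> (x \<alpha>)"
      using seg[OF mn(2-4)] mn x diag by (simp add: Omega_def)
    show "x (src (Omega k) \<alpha>) = src \<Lambda> (x \<alpha>)"
      using seg[OF mn(2-4)] mn x diag src_comp by (simp add: Omega_def) metis
  next
    fix \<alpha> \<beta> assume "\<alpha> \<in> mor (Omega k)" "\<beta> \<in> mor (Omega k)" "src (Omega k) \<alpha> = rng (Omega k) \<beta>"
    then obtain m n p where mnp: "\<alpha> = (m, n)" "\<beta> = (n, p)" "m \<in> Nk k" "n \<in> Nk k" "p \<in> Nk k" "m \<le> n" "n \<le> p"
      by (auto simp: Omega_def)
    have mp: "m \<le> p" using mnp by (meson order_trans)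
    have "post (P n \<cdot> post (P p) n) m = post (P n) m \<cdot> post (P p) n"
      using seg(1)[OF mnp(4,5,7)] mnp P by (intro factor_comp_le) auto
    then show "x (comp (Omega k) \<alpha> \<beta>) = x \<alpha> \<cdot> x \<beta>"
      using seg(3)[OF mnp(4,5,7)] mnp mp x by (simp add: Omega_def)
  qed
  moreover have "x \<in> extensional (mor (Omega k))" by (simp add: x_def)
  ultimately have "x \<in> IP" by (simp add: infinite_paths_def)
  moreover have "x (0, n) = P n" if "n \<in> Nk k" for n
    using x[of 0 n] post_zero P[OF that] that by (simp add: le_fun_def)
  ultimately show ?thesis by blast
qed

lemma shift_apply: "\<lbrakk>m \<in> Nk k; n \<in> Nk k; m \<le> n\<rbrakk> \<Longrightarrow> sh p x (m, n) = x (m + p, n + p)"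
  by (simp add: shift_def mor_Omega)

lemma shift_in_IP:
  assumes x: "x \<in> IP" and p: "p \<in> Nk k"
  shows "sh p x \<in> IP"
proof -
  have le: "m + p \<le> n + p" if "m \<le> n" for m n :: "nat \<Rightarrow> nat" using that by (simp add: le_fun_def)
  have "graded_functor (Omega k) \<Lambda> (sh p x)"
    unfolding graded_functor_def
  proof (intro conjI ballI impI)
    fix \<alpha> assume "\<alpha> \<in> mor (Omega k)"
    then obtain m n where mn: "\<alpha> = (m, n)" "m \<in> Nk k" "n \<in> Nk k" "m \<le> n" by (auto simp: Omega_def)
    note seg = path_segment[OF x Nk_add[OF mn(2) p] Nk_add[OF mn(3) p] le[OF mn(4)]]
    have d: "n + p - (m + p) = n - m" by (simp add: fun_eq_iff fun_diff_def)
    show "sh p x \<alpha> \<in> M" "sh p x (rng (Omega k) \<alpha>) = rng \<Lambda> (sh p x \<alpha>)"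
      "sh p x (src (Omega k) \<alpha>) = src \<Lambda> (sh p x \<alpha>)" "deg \<Lambda> (sh p x \<alpha>) = deg (Omega k) \<alpha>"
      using seg mn d by (simp_all add: shift_apply) (simp_all add: Omega_def shift_apply)
  next
    fix \<alpha> \<beta> assume "\<alpha> \<in> mor (Omega k)" "\<beta> \<in> mor (Omega k)" "src (Omega k) \<alpha> = rng (Omega k) \<beta>"
    then obtain m n q where mnq: "\<alpha> = (m, n)" "\<beta> = (n, q)" "m \<in> Nk k" "n \<in> Nk k" "q \<in> Nk k" "m \<le> n" "n \<le> q"
      by (auto simp: Omega_def)
    have "x (m + p, n + p) \<cdot> x (n + p, q + p) = x (m + p, q + p)"
      using mnq p by (intro path_comp x Nk_add le)
    moreover have "m \<le> q" using mnq by (meson order_trans)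
    ultimately show "sh p x (comp (Omega k) \<alpha> \<beta>) = sh p x \<alpha> \<cdot> sh p x \<beta>"
      using mnq by (simp add: shift_apply) (simp add: Omega_def shift_apply)
  qed
  then show ?thesis by (simp add: infinite_paths_def shift_def)
qed

lemma shift_initial: "n \<in> Nk k \<Longrightarrow> sh p x (0, n) = x (p, p + n)"
  by (simp add: shift_apply le_fun_def add.commute)

lemma shift_shift:
  assumes "p \<in> Nk k"
  shows "sh p (sh q x) = sh (p + q) x"
proof (rule extensionalityI[of _ "mor (Omega k)"])
  fix \<alpha> assume "\<alpha> \<in> mor (Omega k)"
  then obtain m n where mn: "\<alpha> = (m, n)" "m \<in> Nk k" "n \<in> Nk k" "m \<le> n" by (auto simp: Omega_def)
  moreover have "m + p \<le> n + p" using mn by (simp add: le_fun_def)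
  ultimately show "sh p (sh q x) \<alpha> = sh (p + q) x \<alpha>"
    using assms by (simp add: shift_apply Nk_add add.assoc)
qed (simp_all add: shift_def)

lemma cylinderD: "y \<in> Z \<mu> \<Longrightarrow> y \<in> IP" "y \<in> Z \<mu> \<Longrightarrow> y (0, deg \<Lambda> \<mu>) = \<mu>"
  by (simp_all add: cylinder_def)

lemma cylinder_initial: "\<lbrakk>x \<in> IP; n \<in> Nk k\<rbrakk> \<Longrightarrow> x \<in> Z (x (0, n))"
  by (simp add: cylinder_def deg_initial)

lemma cylinder_src_iff: "\<eta> \<in> M \<Longrightarrow> x \<in> Z (src \<Lambda> \<eta>) \<longleftrightarrow> x \<in> IP \<and> x (0, 0) = src \<Lambda> \<eta>"
  by (simp add: cylinder_def deg_src)

lemma cylinder_rng: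
  assumes "\<eta> \<in> M" "z \<in> Z \<eta>"
  shows "z \<in> Z (rng \<Lambda> \<eta>)"
  using path_segment(2)[of z 0 "deg \<Lambda> \<eta>"] cylinderD[OF assms(2)] assms(1) deg_identity[OF assms(1)]
  by (simp add: deg_closed le_fun_def cylinder_def)

lemma shift_in_src:
  assumes "\<mu> \<in> M" "y \<in> Z \<mu>"
  shows "sh (deg \<Lambda> \<mu>) y \<in> Z (src \<Lambda> \<mu>)"
proof -
  have "sh (deg \<Lambda> \<mu>) y (0, 0) = y (deg \<Lambda> \<mu>, deg \<Lambda> \<mu>)" by (simp add: shift_initial)
  also have "\<dots> = src \<Lambda> (y (0, deg \<Lambda> \<mu>))"
    using path_segment(3)[of y 0 "deg \<Lambda> \<mu>"] cylinderD[OF assms(2)] deg_closed[OF assms(1)] by (simp add: le_fun_def)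
  finally show ?thesis using assms cylinderD[OF assms(2)] shift_in_IP deg_closed by (simp add: cylinder_src_iff)
qed

lemma cylinder_apply_add:
  assumes "\<mu> \<in> M" "y \<in> Z \<mu>" "n \<in> Nk k"
  shows "y (0, deg \<Lambda> \<mu> + n) = \<mu> \<cdot> sh (deg \<Lambda> \<mu>) y (0, n)"
    "composable \<mu> (sh (deg \<Lambda> \<mu>) y (0, n))"
proof -
  note y = cylinderD[OF assms(2)]
  have *: "deg \<Lambda> \<mu> \<in> Nk k" "deg \<Lambda> \<mu> + n \<in> Nk k" "0 \<le> deg \<Lambda> \<mu>" "deg \<Lambda> \<mu> \<le> deg \<Lambda> \<mu> + n"
    using assms by (auto simp: deg_closed Nk_add le_fun_def)
  note c = path_comp[OF y(1) Nk_zero *]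
  show "y (0, deg \<Lambda> \<mu> + n) = \<mu> \<cdot> sh (deg \<Lambda> \<mu>) y (0, n)" "composable \<mu> (sh (deg \<Lambda> \<mu>) y (0, n))"
    using c assms(3) by (simp_all add: y(2) shift_initial)
qed

lemma cylinder_shift_inj:
  assumes "\<mu> \<in> M" "y \<in> Z \<mu>" "y' \<in> Z \<mu>" "sh (deg \<Lambda> \<mu>) y = sh (deg \<Lambda> \<mu>) y'"
  shows "y = y'"
proof (rule path_eqI)
  show "y \<in> IP" "y' \<in> IP" using assms cylinderD by auto
  fix n assume n: "n \<in> Nk k"
  then show "\<exists>n'\<in>Nk k. n \<le> n' \<and> y (0, n') = y' (0, n')"
    using cylinder_apply_add(1)[OF assms(1,2) n] cylinder_apply_add(1)[OF assms(1,3) n] assms(4)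
    by (intro bexI[of _ "deg \<Lambda> \<mu> + n"]) (simp_all add: fun_le_add Nk_add deg_closed assms(1))
qed

text \<open>The composites of \<open>\<mu>\<close> with the initial segments of \<open>x\<close>
  have degrees \<open>deg \<Lambda> \<mu> + n\<close> only. Their initial segments of degree
  \<open>n\<close> exist for every \<open>n\<close> and form the coherent family that defines the
  new path.\<close>

lemma prepend_exists:
  assumes \<mu>: "\<mu> \<in> M" and x: "x \<in> Z (src \<Lambda> \<mu>)"
  shows "\<exists>y\<in>Z \<mu>. sh (deg \<Lambda> \<mu>) y = x"
proof -
  have xIP: "x \<in> IP" "x (0, 0) = src \<Lambda> \<mu>" using x \<mu> by (auto simp: cylinder_src_iff)
  have d: "deg \<Lambda> \<mu> \<in> Nk k" by (rule deg_closed[OF \<mu>])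
  define L where "L n = \<mu> \<cdot> x (0, n)" for n
  have c: "composable \<mu> (x (0, n))" if "n \<in> Nk k" for n
    using path_segment(1,2)[OF xIP(1), of 0 n] that xIP(2) \<mu> by (simp add: le_fun_def)
  have L: "L n \<in> M" "deg \<Lambda> (L n) = deg \<Lambda> \<mu> + n" if "n \<in> Nk k" for n
    using c[OF that] deg_initial[OF xIP(1) that] by (simp_all add: L_def comp_closed deg_comp)
  have Lpre: "pre (L n) (deg \<Lambda> \<mu> + m) = L m" if "m \<in> Nk k" "n \<in> Nk k" "m \<le> n" for m n
  proof -
    have xc: "x (0, m) \<cdot> x (m, n) = x (0, n)" "composable (x (0, m)) (x (m, n))"
      using path_comp[OF xIP(1), of 0 m n] that by (simp_all add: le_fun_def)
    have "L n = L m \<cdot> x (m, n)" unfolding L_def xc(1)[symmetric] using c[OF that(1)] xc(2) comp_assoc by simp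
    moreover have "composable (L m) (x (m, n))" using c[OF that(1)] xc(2) by (simp add: L_def comp_closed src_comp)
    ultimately show ?thesis using factor_comp(1) L(2)[OF that(1)] by metis
  qed
  define P where "P n = pre (L n) n" for n
  have coh: "pre (L n) m = P m" if "m \<in> Nk k" "n \<in> Nk k" "m \<le> n" for m n
  proof -
    have "pre (L n) m = pre (pre (L n) (deg \<Lambda> \<mu> + m)) m"
      using that L[OF that(2)] d by (intro pre_pre[symmetric] Nk_add) (auto simp: le_fun_def)
    then show ?thesis by (simp add: Lpre[OF that] P_def)
  qed
  have "\<exists>y\<in>IP. \<forall>n\<in>Nk k. y (0, n) = P n"
  proof (rule path_exists)
    fix n assume n: "n \<in> Nk k"
    show "P n \<in> M \<and> deg \<Lambda> (P n) = n"
      using factor(1,2)[OF L(1)[OF n] n] L(2)[OF n] by (simp add: P_def fun_le_add)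
  next
    fix m n assume mn: "m \<in> Nk k" "n \<in> Nk k" "m \<le> n"
    have "pre (P n) m = pre (L n) m"
      unfolding P_def using mn L[OF mn(2)] by (intro pre_pre) (auto simp: fun_le_add)
    then show "pre (P n) m = P m" using coh[OF mn] by simp
  qed
  then obtain y where y: "y \<in> IP" "\<And>n. n \<in> Nk k \<Longrightarrow> y (0, n) = P n" by blast
  have yadd: "y (0, deg \<Lambda> \<mu> + n) = L n" if "n \<in> Nk k" for n
  proof -
    have "pre (L (deg \<Lambda> \<mu> + n)) (deg \<Lambda> \<mu> + n) = L n"
      using that d by (intro Lpre Nk_add) (auto simp: fun_le_add)
    then show ?thesis using y(2)[of "deg \<Lambda> \<mu> + n"] that d by (simp add: P_def Nk_add)
  qed
  have y0: "y (0, deg \<Lambda> \<mu>) = \<mu>"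
    using yadd[OF Nk_zero] by (simp add: L_def xIP(2) comp_src[OF \<mu>])
  then have yZ: "y \<in> Z \<mu>" using y(1) by (simp add: cylinder_def)
  have "sh (deg \<Lambda> \<mu>) y = x"
  proof (rule path_eqI[OF shift_in_IP[OF y(1) d] xIP(1)])
    fix n assume n: "n \<in> Nk k"
    have "\<mu> \<cdot> sh (deg \<Lambda> \<mu>) y (0, n) = \<mu> \<cdot> x (0, n)"
      using cylinder_apply_add(1)[OF \<mu> yZ n] yadd[OF n] by (simp add: L_def)
    then have "sh (deg \<Lambda> \<mu>) y (0, n) = x (0, n)"
      using factor_unique[OF cylinder_apply_add(2)[OF \<mu> yZ n] c[OF n]] by simp
    then show "\<exists>n'\<in>Nk k. n \<le> n' \<and> sh (deg \<Lambda> \<mu>) y (0, n') = x (0, n')" using n by blast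
  qed
  then show ?thesis using yZ by blast
qed

abbreviation prepend :: "'a \<Rightarrow> 'a ipath \<Rightarrow> 'a ipath" where "prepend \<equiv> path_prepend k \<Lambda>"

text \<open>The definite description behind \<open>prepend\<close> is proper: existence was shown
  above, and the shift by \<open>deg \<Lambda> \<mu>\<close> is injective on
  \<open>Z \<mu>\<close>.\<close>

lemma prepend:
  assumes "\<mu> \<in> M" "x \<in> Z (src \<Lambda> \<mu>)"
  shows "prepend \<mu> x \<in> Z \<mu>" "sh (deg \<Lambda> \<mu>) (prepend \<mu> x) = x"
proof -
  have "\<exists>!y. y \<in> Z \<mu> \<and> sh (deg \<Lambda> \<mu>) y = x"
    using prepend_exists[OF assms] cylinder_shift_inj[OF assms(1)] by (metis (no_types))
  from theI'[OF this] show "prepend \<mu> x \<in> Z \<mu>" "sh (deg \<Lambda> \<mu>) (prepend \<mu> x) = x"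
    unfolding path_prepend_def by auto
qed

lemma prepend_shift:
  assumes "\<mu> \<in> M" "y \<in> Z \<mu>"
  shows "prepend \<mu> (sh (deg \<Lambda> \<mu>) y) = y"
  using cylinder_shift_inj[OF assms(1) prepend(1)[OF assms(1)] assms(2)] prepend(2)[OF assms(1)] shift_in_src[OF assms] by metis

lemma cylinder_comp:
  assumes c: "composable \<mu> \<alpha>"
  shows "y \<in> Z (\<mu> \<cdot> \<alpha>) \<longleftrightarrow> y \<in> Z \<mu> \<and> sh (deg \<Lambda> \<mu>) y \<in> Z \<alpha>"
proof
  assume y: "y \<in> Z (\<mu> \<cdot> \<alpha>)"
  have d: "deg \<Lambda> (\<mu> \<cdot> \<alpha>) = deg \<Lambda> \<mu> + deg \<Lambda> \<alpha>" using c by (simp add: deg_comp)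
  have yI: "y \<in> IP" "y (0, deg \<Lambda> \<mu> + deg \<Lambda> \<alpha>) = \<mu> \<cdot> \<alpha>" using cylinderD[OF y] d by auto
  have "y (0, deg \<Lambda> \<mu>) = pre (\<mu> \<cdot> \<alpha>) (deg \<Lambda> \<mu>)"
    using path_pre_post(1)[OF yI(1), of "deg \<Lambda> \<mu>" "deg \<Lambda> \<mu> + deg \<Lambda> \<alpha>"] c yI(2)
    by (simp add: deg_closed Nk_add fun_le_add)
  then have y1: "y \<in> Z \<mu>" using factor_comp(1)[OF c] yI(1) by (simp add: cylinder_def)
  have a: "deg \<Lambda> \<alpha> \<in> Nk k" using c by (simp add: deg_closed)
  have "sh (deg \<Lambda> \<mu>) y (0, deg \<Lambda> \<alpha>) = \<alpha>"
    using cylinder_apply_add[OF _ y1 a] c yI(2) factor_unique[of \<mu> "sh (deg \<Lambda> \<mu>) y (0, deg \<Lambda> \<alpha>)" \<mu> \<alpha>] by simp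
  then show "y \<in> Z \<mu> \<and> sh (deg \<Lambda> \<mu>) y \<in> Z \<alpha>"
    using y1 shift_in_IP[OF yI(1)] c by (simp add: cylinder_def deg_closed)
next
  assume y: "y \<in> Z \<mu> \<and> sh (deg \<Lambda> \<mu>) y \<in> Z \<alpha>"
  then have "y (0, deg \<Lambda> \<mu> + deg \<Lambda> \<alpha>) = \<mu> \<cdot> \<alpha>"
    using cylinder_apply_add(1)[of \<mu> y "deg \<Lambda> \<alpha>"] cylinderD(2)[of "sh (deg \<Lambda> \<mu>) y" \<alpha>] c by (simp add: deg_closed)
  then show "y \<in> Z (\<mu> \<cdot> \<alpha>)" using y c by (simp add: cylinder_def deg_comp)
qed

lemma prepend_comp:
  assumes c: "composable \<mu> \<alpha>" and z: "z \<in> Z (src \<Lambda> \<alpha>)"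
  shows "prepend (\<mu> \<cdot> \<alpha>) z = prepend \<mu> (prepend \<alpha> z)" "prepend \<alpha> z \<in> Z (src \<Lambda> \<mu>)"
proof -
  have \<mu>\<alpha>: "\<mu> \<cdot> \<alpha> \<in> M" "src \<Lambda> (\<mu> \<cdot> \<alpha>) = src \<Lambda> \<alpha>" "deg \<Lambda> (\<mu> \<cdot> \<alpha>) = deg \<Lambda> \<mu> + deg \<Lambda> \<alpha>"
    using c by (simp_all add: comp_closed src_comp deg_comp)
  have a: "prepend \<alpha> z \<in> Z \<alpha>" "sh (deg \<Lambda> \<alpha>) (prepend \<alpha> z) = z" using prepend c z by auto
  show a': "prepend \<alpha> z \<in> Z (src \<Lambda> \<mu>)" using cylinder_rng[OF _ a(1)] c by metis
  have b: "prepend \<mu> (prepend \<alpha> z) \<in> Z \<mu>" "sh (deg \<Lambda> \<mu>) (prepend \<mu> (prepend \<alpha> z)) = prepend \<alpha> z"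
    using prepend c a' by auto
  have 1: "prepend \<mu> (prepend \<alpha> z) \<in> Z (\<mu> \<cdot> \<alpha>)" using cylinder_comp[OF c] a b by simp
  have "sh (deg \<Lambda> (\<mu> \<cdot> \<alpha>)) (prepend \<mu> (prepend \<alpha> z)) = sh (deg \<Lambda> \<alpha>) (sh (deg \<Lambda> \<mu>) (prepend \<mu> (prepend \<alpha> z)))"
    using c by (simp add: \<mu>\<alpha>(3) shift_shift deg_closed add.commute)
  then have "sh (deg \<Lambda> (\<mu> \<cdot> \<alpha>)) (prepend \<mu> (prepend \<alpha> z)) = z" using a b by simp
  with cylinder_shift_inj[OF \<mu>\<alpha>(1) prepend(1)[OF \<mu>\<alpha>(1)] 1] prepend(2)[OF \<mu>\<alpha>(1)] z \<mu>\<alpha>(2)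
  show "prepend (\<mu> \<cdot> \<alpha>) z = prepend \<mu> (prepend \<alpha> z)" by metis
qed

lemma cylinder_split:
  assumes \<mu>: "\<mu> \<in> M" and m: "m \<in> Nk k"
  shows "(\<Union>\<alpha>\<in>paths_from \<Lambda> (src \<Lambda> \<mu>) m. Z (\<mu> \<cdot> \<alpha>)) = Z \<mu>"
proof (intro Set.set_eqI iffI)
  fix y assume "y \<in> (\<Union>\<alpha>\<in>paths_from \<Lambda> (src \<Lambda> \<mu>) m. Z (\<mu> \<cdot> \<alpha>))"
  then obtain \<alpha> where "\<alpha> \<in> M" "rng \<Lambda> \<alpha> = src \<Lambda> \<mu>" "y \<in> Z (\<mu> \<cdot> \<alpha>)" by (auto simp: paths_from_def)
  then show "y \<in> Z \<mu>" using cylinder_comp[of \<mu> \<alpha>] \<mu> by simp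
next
  fix y assume y: "y \<in> Z \<mu>"
  define \<alpha> where "\<alpha> = sh (deg \<Lambda> \<mu>) y (0, m)"
  have shI: "sh (deg \<Lambda> \<mu>) y \<in> IP" using shift_in_IP cylinderD(1)[OF y] deg_closed[OF \<mu>] by blast
  have c: "composable \<mu> \<alpha>" unfolding \<alpha>_def by (rule cylinder_apply_add(2)[OF \<mu> y m])
  have "\<alpha> \<in> paths_from \<Lambda> (src \<Lambda> \<mu>) m" using c deg_initial[OF shI m] by (simp add: paths_from_def \<alpha>_def)
  moreover have "y \<in> Z (\<mu> \<cdot> \<alpha>)"
    unfolding cylinder_comp[OF c] using y cylinder_initial[OF shI m] by (simp add: \<alpha>_def)
  ultimately show "y \<in> (\<Union>\<alpha>\<in>paths_from \<Lambda> (src \<Lambda> \<mu>) m. Z (\<mu> \<cdot> \<alpha>))" by blast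
qed

lemma cylinder_disjoint: "\<lbrakk>deg \<Lambda> \<mu> = deg \<Lambda> \<nu>; \<mu> \<noteq> \<nu>\<rbrakk> \<Longrightarrow> Z \<mu> \<inter> Z \<nu> = {}"
  by (auto simp: cylinder_def)

lemma comp_inj: "\<lbrakk>\<mu> \<in> M; \<alpha> \<in> paths_from \<Lambda> (src \<Lambda> \<mu>) m; \<beta> \<in> paths_from \<Lambda> (src \<Lambda> \<mu>) m; \<mu> \<cdot> \<alpha> = \<mu> \<cdot> \<beta>\<rbrakk> \<Longrightarrow> \<alpha> = \<beta>"
  unfolding paths_from_def mem_Collect_eq by (metis factor_unique)

lemma comp_paths_from:
  assumes "\<mu> \<in> M" "\<alpha> \<in> paths_from \<Lambda> (src \<Lambda> \<mu>) m"
  shows "composable \<mu> \<alpha>" "\<mu> \<cdot> \<alpha> \<in> M" "deg \<Lambda> (\<mu> \<cdot> \<alpha>) = deg \<Lambda> \<mu> + m" "src \<Lambda> (\<mu> \<cdot> \<alpha>) = src \<Lambda> \<alpha>"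
  using assms by (auto simp: paths_from_def comp_closed deg_comp src_comp)

text \<open>On a cylinder of degree at least \<open>m\<close> the shift removes the fixed segment
  \<open>pre \<eta> m\<close>; this gives the injectivity that pushing forward indicator functions
  requires.\<close>

lemma shift_bij_cylinder:
  assumes \<eta>: "\<eta> \<in> M" and m: "m \<in> Nk k" "m \<le> deg \<Lambda> \<eta>"
  shows "inj_on (sh m) (Z \<eta>)" "sh m ` Z \<eta> = Z (post \<eta> m)"
proof -
  note f = factor[OF \<eta> m]
  have iff: "y \<in> Z \<eta> \<longleftrightarrow> y \<in> Z (pre \<eta> m) \<and> sh m y \<in> Z (post \<eta> m)" for y
    using cylinder_comp[OF f(1), of y] f(2,4) by simp
  show "inj_on (sh m) (Z \<eta>)"
    using cylinder_shift_inj[of "pre \<eta> m"] f(1,2) iff by (auto simp: inj_on_def)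
  show "sh m ` Z \<eta> = Z (post \<eta> m)"
  proof (intro Set.set_eqI iffI)
    fix z assume z: "z \<in> Z (post \<eta> m)"
    have "z \<in> Z (src \<Lambda> (pre \<eta> m))" using cylinder_rng[OF _ z] f(1) by metis
    from prepend[OF conjunct1[OF f(1)] this] have "prepend (pre \<eta> m) z \<in> Z (pre \<eta> m)" "sh m (prepend (pre \<eta> m) z) = z"
      using f(2) by auto
    then show "z \<in> sh m ` Z \<eta>" using z iff by (metis image_eqI)
  qed (use iff in auto)
qed

end

section \<open>Existence of infinite paths and compactness of cylinders\<close>

locale row_finite_k_graph = k_graph +
  assumes row_finite: "row_finite_no_sources k \<Lambda>"
begin

lemma paths_from_src:
  assumes "\<eta> \<in> M" "m \<in> Nk k"
  shows "finite (paths_from \<Lambda> (src \<Lambda> \<eta>) m)" "paths_from \<Lambda> (src \<Lambda> \<eta>) m \<noteq> {}"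
  using row_finite verticesI[OF assms(1)] assms(2) unfolding row_finite_no_sources_def by auto

text \<open>The constant degrees form a cofinal sequence in \<open>Nk k\<close>, along which finite
  paths are extended.\<close>

definition ones :: "nat \<Rightarrow> nat \<Rightarrow> nat" where
  "ones j = (\<lambda>i. if i < k then j else 0)"

lemma ones_Nk: "ones j \<in> Nk k"
  by (simp add: ones_def Nk_def)

lemma le_ones_sum: "m \<in> Nk k \<Longrightarrow> m \<le> ones (\<Sum>i<k. m i)"
  by (auto simp: le_fun_def ones_def Nk_def intro: member_le_sum)

text \<open>Koenig's lemma.  It is applied with a trivial \<open>Q\<close> to obtain infinite paths and with
  \<open>Q \<eta>\<close> saying that $Z(\eta)$ has no finite subcover to obtain compactness.\<close>

lemma exhausting_path:
  assumes \<mu>: "\<mu> \<in> M" "Q \<mu>"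
    and step: "\<And>\<eta>. \<lbrakk>\<eta> \<in> M; Q \<eta>\<rbrakk> \<Longrightarrow> \<exists>\<alpha>\<in>paths_from \<Lambda> (src \<Lambda> \<eta>) (ones 1). Q (\<eta> \<cdot> \<alpha>)"
  shows "\<exists>x\<in>Z \<mu>. \<forall>m\<in>Nk k. \<exists>\<eta>\<in>M. Q \<eta> \<and> x \<in> Z \<eta> \<and> m \<le> deg \<Lambda> \<eta>"
proof -
  have "\<exists>L. \<forall>n. (L n \<in> M \<and> Q (L n) \<and> (n = 0 \<longrightarrow> L n = \<mu>)) \<and>
      (\<exists>\<alpha>\<in>paths_from \<Lambda> (src \<Lambda> (L n)) (ones 1). L (Suc n) = L n \<cdot> \<alpha>)"
  proof (rule dependent_nat_choice)
    show "\<exists>\<eta>. \<eta> \<in> M \<and> Q \<eta> \<and> (0 = (0::nat) \<longrightarrow> \<eta> = \<mu>)" using \<mu> by blast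
    fix \<eta> and n :: nat
    assume \<eta>: "\<eta> \<in> M \<and> Q \<eta> \<and> (n = 0 \<longrightarrow> \<eta> = \<mu>)"
    then obtain \<alpha> where \<alpha>: "\<alpha> \<in> paths_from \<Lambda> (src \<Lambda> \<eta>) (ones 1)" "Q (\<eta> \<cdot> \<alpha>)" using step by blast
    then have "\<eta> \<cdot> \<alpha> \<in> M" using comp_paths_from(2) \<eta> by blast
    then show "\<exists>\<zeta>. (\<zeta> \<in> M \<and> Q \<zeta> \<and> (Suc n = 0 \<longrightarrow> \<zeta> = \<mu>)) \<and>
        (\<exists>\<alpha>\<in>paths_from \<Lambda> (src \<Lambda> \<eta>) (ones 1). \<zeta> = \<eta> \<cdot> \<alpha>)" using \<alpha> by blast
  qed
  then obtain L where L: "\<And>n. L n \<in> M" "\<And>n. Q (L n)" "L 0 = \<mu>"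
    "\<And>n. \<exists>\<alpha>\<in>paths_from \<Lambda> (src \<Lambda> (L n)) (ones 1). L (Suc n) = L n \<cdot> \<alpha>" by blast
  have degL: "ones n \<le> deg \<Lambda> (L n)" for n
  proof (induction n)
    case 0
    show ?case by (simp add: ones_def le_fun_def)
  next
    case (Suc n)
    obtain \<alpha> where \<alpha>: "\<alpha> \<in> paths_from \<Lambda> (src \<Lambda> (L n)) (ones 1)" "L (Suc n) = L n \<cdot> \<alpha>" using L(4) by blast
    have "deg \<Lambda> (L (Suc n)) = deg \<Lambda> (L n) + ones 1" using comp_paths_from(3)[OF L(1) \<alpha>(1)] \<alpha>(2) by simp
    then have "deg \<Lambda> (L (Suc n)) i = deg \<Lambda> (L n) i + ones 1 i" for i by simp
    moreover have "ones n i \<le> deg \<Lambda> (L n) i" for i using Suc by (simp add: le_fun_def)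
    moreover have "ones (Suc n) i = ones n i + ones 1 i" for i by (simp add: ones_def)
    ultimately show ?case by (simp add: le_fun_def)
  qed
  \<comment> \<open>Each \<open>L n\<close> is extended by its successor, so the initial segment of
    degree \<open>m\<close> is the same for all terms that are long enough.\<close>
  have mono: "m \<le> deg \<Lambda> (L n') \<and> pre (L n') m = pre (L n) m"
    if "n \<le> n'" "m \<in> Nk k" "m \<le> deg \<Lambda> (L n)" for n n' m
    using that(1)
  proof (induction n' rule: dec_induct)
    case base
    then show ?case using that(3) by blast
  next
    case (step l)
    obtain \<alpha> where \<alpha>: "\<alpha> \<in> paths_from \<Lambda> (src \<Lambda> (L l)) (ones 1)" "L (Suc l) = L l \<cdot> \<alpha>" using L(4) by blast
    have "deg \<Lambda> (L l) \<le> deg \<Lambda> (L (Suc l))" using comp_paths_from(3)[OF L(1) \<alpha>(1)] \<alpha>(2) fun_le_add by simp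
    moreover have "pre (L l \<cdot> \<alpha>) m = pre (L l) m"
      using comp_paths_from(1)[OF L(1) \<alpha>(1)] that(2) step.IH by (intro factor_comp_le(1)) blast+
    ultimately show ?case using step.IH \<alpha>(2) order_trans by metis
  qed
  have agree: "pre (L n) m = pre (L n') m" if "m \<in> Nk k" "m \<le> deg \<Lambda> (L n)" "m \<le> deg \<Lambda> (L n')" for n n' m
    using mono[of n n' m] mono[of n' n m] that by (cases "n \<le> n'") auto
  define N where "N m = (\<Sum>i<k. m i)" for m :: "nat \<Rightarrow> nat"
  have N: "m \<le> deg \<Lambda> (L (N m))" if "m \<in> Nk k" for m
    using le_ones_sum[OF that] degL[of "N m"] unfolding N_def by (rule order_trans)
  have "\<exists>x\<in>IP. \<forall>n\<in>Nk k. x (0, n) = pre (L (N n)) n"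
  proof (rule path_exists)
    show "pre (L (N n)) n \<in> M \<and> deg \<Lambda> (pre (L (N n)) n) = n" if "n \<in> Nk k" for n
      using factor(1,2)[OF L(1) that N[OF that]] by blast
    fix m n assume mn: "m \<in> Nk k" "n \<in> Nk k" "m \<le> n"
    have "m \<le> deg \<Lambda> (L (N n))" using mn N order_trans by blast
    then have "pre (L (N n)) m = pre (L (N m)) m" using agree mn N by blast
    then show "pre (pre (L (N n)) n) m = pre (L (N m)) m"
      using pre_pre[OF L(1) mn N[OF mn(2)]] by simp
  qed
  then obtain x where x: "x \<in> IP" "\<And>n. n \<in> Nk k \<Longrightarrow> x (0, n) = pre (L (N n)) n" by blast
  have xL: "x \<in> Z (L n)" for n
  proof -
    have d: "deg \<Lambda> (L n) \<in> Nk k" by (rule deg_closed[OF L(1)])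
    have "x (0, deg \<Lambda> (L n)) = pre (L n) (deg \<Lambda> (L n))"
      unfolding x(2)[OF d] by (rule agree[OF d N[OF d] order_refl])
    then show ?thesis using x(1) pre_self[OF L(1)] by (simp add: cylinder_def)
  qed
  have "\<exists>\<eta>\<in>M. Q \<eta> \<and> x \<in> Z \<eta> \<and> m \<le> deg \<Lambda> \<eta>" if "m \<in> Nk k" for m
    using L(1,2) xL N[OF that] by blast
  moreover have "x \<in> Z \<mu>" using xL[of 0] L(3) by simp
  ultimately show ?thesis by blast
qed

lemma cylinder_nonempty: "\<mu> \<in> M \<Longrightarrow> Z \<mu> \<noteq> {}"
  using exhausting_path[of \<mu> "\<lambda>_. True"] paths_from_src(2)[OF _ ones_Nk] by blast

lemma cylinder_subset:
  assumes "\<alpha> \<in> M" "x \<in> Z \<eta>" "x \<in> Z \<alpha>" "\<eta> \<in> M" "deg \<Lambda> \<alpha> \<le> deg \<Lambda> \<eta>"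
  shows "Z \<eta> \<subseteq> Z \<alpha>"
proof
  fix y assume y: "y \<in> Z \<eta>"
  have "z (0, deg \<Lambda> \<alpha>) = pre \<eta> (deg \<Lambda> \<alpha>)" if "z \<in> Z \<eta>" for z
    using path_pre_post(1)[OF cylinderD(1)[OF that], of "deg \<Lambda> \<alpha>" "deg \<Lambda> \<eta>"] cylinderD(2)[OF that] assms
    by (simp add: deg_closed)
  then have "y (0, deg \<Lambda> \<alpha>) = \<alpha>" using y assms(2) cylinderD(2)[OF assms(3)] by metis
  then show "y \<in> Z \<alpha>" using cylinderD(1)[OF y] by (simp add: cylinder_def)
qed

lemma cylinder_cover:
  assumes \<mu>: "\<mu> \<in> M" and S: "S \<subseteq> M" and cover: "\<And>x. x \<in> Z \<mu> \<Longrightarrow> \<exists>\<alpha>\<in>S. x \<in> Z \<alpha>"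
  shows "\<exists>F\<subseteq>S. finite F \<and> Z \<mu> \<subseteq> (\<Union>\<alpha>\<in>F. Z \<alpha>)"
proof (rule ccontr)
  define Q where "Q \<eta> \<longleftrightarrow> \<not> (\<exists>F\<subseteq>S. finite F \<and> Z \<eta> \<subseteq> (\<Union>\<alpha>\<in>F. Z \<alpha>))" for \<eta>
  assume "\<not> ?thesis"
  then have "Q \<mu>" by (simp add: Q_def)
  \<comment> \<open>If the cylinders of all extensions of \<open>\<eta>\<close> by degree
    \<open>ones 1\<close> had finite subcovers, the union of these, again finite by row-finiteness,
    would cover \<open>Z \<eta>\<close>.\<close>
  have step: "\<exists>\<alpha>\<in>paths_from \<Lambda> (src \<Lambda> \<eta>) (ones 1). Q (\<eta> \<cdot> \<alpha>)" if \<eta>: "\<eta> \<in> M" "Q \<eta>" for \<eta>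
  proof (rule ccontr)
    let ?P = "paths_from \<Lambda> (src \<Lambda> \<eta>) (ones 1)"
    assume "\<not> ?thesis"
    then have "\<forall>\<alpha>\<in>?P. \<exists>F. F \<subseteq> S \<and> finite F \<and> Z (\<eta> \<cdot> \<alpha>) \<subseteq> (\<Union>\<alpha>\<in>F. Z \<alpha>)"
      unfolding Q_def by (metis (no_types, lifting))
    then obtain F where F: "\<And>\<alpha>. \<alpha> \<in> ?P \<Longrightarrow> F \<alpha> \<subseteq> S \<and> finite (F \<alpha>) \<and> Z (\<eta> \<cdot> \<alpha>) \<subseteq> (\<Union>\<beta>\<in>F \<alpha>. Z \<beta>)"
      by metis
    have "(\<Union>\<alpha>\<in>?P. F \<alpha>) \<subseteq> S" "finite (\<Union>\<alpha>\<in>?P. F \<alpha>)" using F paths_from_src(1)[OF \<eta>(1) ones_Nk] by auto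
    moreover have "Z \<eta> \<subseteq> (\<Union>\<beta>\<in>(\<Union>\<alpha>\<in>?P. F \<alpha>). Z \<beta>)"
    proof
      fix y assume "y \<in> Z \<eta>"
      then obtain \<alpha> where \<alpha>: "\<alpha> \<in> ?P" "y \<in> Z (\<eta> \<cdot> \<alpha>)" using cylinder_split[OF \<eta>(1) ones_Nk] by blast
      then obtain \<beta> where "\<beta> \<in> F \<alpha>" "y \<in> Z \<beta>" using F by blast
      then show "y \<in> (\<Union>\<beta>\<in>(\<Union>\<alpha>\<in>?P. F \<alpha>). Z \<beta>)" using \<alpha>(1) by blast
    qed
    ultimately show False using \<eta>(2) unfolding Q_def by blast
  qed
  obtain x where x: "x \<in> Z \<mu>" "\<And>m. m \<in> Nk k \<Longrightarrow> \<exists>\<eta>\<in>M. Q \<eta> \<and> x \<in> Z \<eta> \<and> m \<le> deg \<Lambda> \<eta>"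
    using exhausting_path[of \<mu> Q, OF \<mu> \<open>Q \<mu>\<close> step] by blast
  obtain \<alpha> where \<alpha>: "\<alpha> \<in> S" "x \<in> Z \<alpha>" using cover[OF x(1)] by blast
  then have \<alpha>M: "\<alpha> \<in> M" using S by blast
  \<comment> \<open>The limit path lies in a set \<open>Z \<alpha>\<close> of the cover, and a
    sufficiently long initial segment \<open>\<eta>\<close> has its whole cylinder inside it: a
    subcover by a single set.\<close>
  obtain \<eta> where \<eta>: "\<eta> \<in> M" "Q \<eta>" "x \<in> Z \<eta>" "deg \<Lambda> \<alpha> \<le> deg \<Lambda> \<eta>" using x(2) deg_closed[OF \<alpha>M] by blast
  have "Z \<eta> \<subseteq> Z \<alpha>" by (rule cylinder_subset[OF \<alpha>M \<eta>(3) \<alpha>(2) \<eta>(1,4)])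
  then have "{\<alpha>} \<subseteq> S \<and> finite {\<alpha>} \<and> Z \<eta> \<subseteq> (\<Union>\<alpha>\<in>{\<alpha>}. Z \<alpha>)" using \<alpha>(1) by simp
  then show False using \<eta>(2) unfolding Q_def by blast
qed

section \<open>The space of infinite paths\<close>

abbreviation PS :: "'a ipath topology" where "PS \<equiv> path_space k \<Lambda>"

lemma openin_cylinder: "\<mu> \<in> M \<Longrightarrow> openin PS (Z \<mu>)"
  unfolding path_space_def by (intro topology_generated_by_Basis) simp

text \<open>The claim for all sufficiently large \<open>m\<close>, rather than for one, is stable
  under intersections, so the induction over the generated topology goes through.\<close>

lemma path_space_base:
  assumes "openin PS U" "x \<in> U"
  shows "x \<in> IP \<and> (\<exists>m0\<in>Nk k. \<forall>m\<in>Nk k. m0 \<le> m \<longrightarrow> Z (x (0, m)) \<subseteq> U)"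
proof -
  have "generate_topology_on (Z ` M) U" using assms(1) unfolding path_space_def by (rule openin_topology_generated_by)
  then show ?thesis using assms(2)
  proof (induction U)
    case (Int a b)
    then obtain m0 m1 where m: "m0 \<in> Nk k" "m1 \<in> Nk k" "\<forall>m\<in>Nk k. m0 \<le> m \<longrightarrow> Z (x (0, m)) \<subseteq> a"
      "\<forall>m\<in>Nk k. m1 \<le> m \<longrightarrow> Z (x (0, m)) \<subseteq> b" by blast
    have "Z (x (0, m)) \<subseteq> a \<inter> b" if "m \<in> Nk k" "m0 + m1 \<le> m" for m
    proof -
      have "m0 \<le> m" "m1 \<le> m" using that(2) fun_le_add order_trans by metis+
      then show ?thesis using m that(1) by blast
    qed
    then show ?case using Int Nk_add[OF m(1,2)] by blast
  next
    case (UN K)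
    then obtain a where a: "a \<in> K" "x \<in> a" by blast
    then show ?case using UN.IH[OF a] by (meson Union_upper order_trans)
  next
    case (Basis a)
    then obtain \<mu> where \<mu>: "\<mu> \<in> M" "a = Z \<mu>" by blast
    have x: "x \<in> IP" "x \<in> Z \<mu>" using Basis.prems \<mu>(2) cylinderD(1) by auto
    have "Z (x (0, m)) \<subseteq> a" if "m \<in> Nk k" "deg \<Lambda> \<mu> \<le> m" for m
      unfolding \<mu>(2) using that x \<mu>(1)
      by (intro cylinder_subset[OF \<mu>(1) cylinder_initial[OF x(1) that(1)]]) (auto simp: initial_in_M deg_initial)
    then show ?case using x(1) deg_closed[OF \<mu>(1)] by blast
  qed simp
qed

lemma cylinder_refinement:
  assumes \<mu>: "\<mu> \<in> M" and \<nu>: "\<nu> \<in> M" and \<alpha>: "\<alpha> \<in> paths_from \<Lambda> (src \<Lambda> \<mu>) (deg \<Lambda> \<nu>)"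
  shows "Z (\<mu> \<cdot> \<alpha>) \<subseteq> Z \<nu> \<or> Z (\<mu> \<cdot> \<alpha>) \<inter> Z \<nu> = {}"
proof (cases "Z (\<mu> \<cdot> \<alpha>) \<inter> Z \<nu> = {}")
  case False
  then obtain x where "x \<in> Z (\<mu> \<cdot> \<alpha>)" "x \<in> Z \<nu>" by blast
  then show ?thesis
    using cylinder_subset[OF \<nu> _ _ comp_paths_from(2)[OF \<mu> \<alpha>]] comp_paths_from(3)[OF \<mu> \<alpha>] fun_le_add(2) by metis
qed simp

text \<open>The refinement uses all extensions \<open>\<mu> \<cdot> \<alpha>\<close> with
  \<open>\<alpha>\<close> of degree \<open>deg \<Lambda> \<nu>\<close>: their degrees dominate that
  of \<open>\<nu>\<close>, so each of their cylinders lies in \<open>Z \<nu>\<close> or misses it.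
  Compactness reduces to covers by cylinders.\<close>

sublocale paths: compact_open_base "path_space k \<Lambda>" "mor \<Lambda>" "cylinder k \<Lambda>"
proof
  show "openin PS (Z \<mu>)" if "\<mu> \<in> M" for \<mu> by (rule openin_cylinder[OF that])
  show base: "\<exists>\<mu>\<in>M. x \<in> Z \<mu> \<and> Z \<mu> \<subseteq> U" if "openin PS U" "x \<in> U" for U x
  proof -
    from path_space_base[OF that] obtain m where "x \<in> IP" "m \<in> Nk k" "Z (x (0, m)) \<subseteq> U" by blast
    then show ?thesis using initial_in_M cylinder_initial by blast
  qed
  show "compactin PS (Z \<mu>)" if \<mu>: "\<mu> \<in> M" for \<mu>
    unfolding compactin_def
  proof (intro conjI allI impI)
    show "Z \<mu> \<subseteq> topspace PS" by (rule openin_subset[OF openin_cylinder[OF \<mu>]])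
    fix \<U> assume U: "Ball \<U> (openin PS) \<and> Z \<mu> \<subseteq> \<Union>\<U>"
    define S where "S = {\<alpha> \<in> M. \<exists>V\<in>\<U>. Z \<alpha> \<subseteq> V}"
    have "\<exists>\<alpha>\<in>S. x \<in> Z \<alpha>" if "x \<in> Z \<mu>" for x
    proof -
      obtain V where V: "V \<in> \<U>" "x \<in> V" using U \<open>x \<in> Z \<mu>\<close> by blast
      then have "openin PS V" using U by blast
      from base[OF this V(2)] V(1) show ?thesis unfolding S_def by blast
    qed
    then obtain F where F: "F \<subseteq> S" "finite F" "Z \<mu> \<subseteq> (\<Union>\<alpha>\<in>F. Z \<alpha>)"
      using cylinder_cover[OF \<mu>, of S] unfolding S_def by blast
    have "\<forall>\<alpha>\<in>F. \<exists>V. V \<in> \<U> \<and> Z \<alpha> \<subseteq> V" using F(1) unfolding S_def by blast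
    then obtain V where V: "\<And>\<alpha>. \<alpha> \<in> F \<Longrightarrow> V \<alpha> \<in> \<U> \<and> Z \<alpha> \<subseteq> V \<alpha>" by metis
    have "Z \<mu> \<subseteq> \<Union>(V ` F)" using F(3) V by blast
    then show "\<exists>\<F>. finite \<F> \<and> \<F> \<subseteq> \<U> \<and> Z \<mu> \<subseteq> \<Union>\<F>" using F(2) V by (intro exI[of _ "V ` F"]) auto
  qed
  show "\<exists>D\<subseteq>M. finite D \<and> (\<Union>d\<in>D. Z d) = Z \<mu> \<and> (\<forall>d\<in>D. \<forall>e\<in>D. d \<noteq> e \<longrightarrow> Z d \<inter> Z e = {}) \<and>
      (\<forall>d\<in>D. Z d \<subseteq> Z \<nu> \<or> Z d \<inter> Z \<nu> = {})" if \<mu>: "\<mu> \<in> M" and \<nu>: "\<nu> \<in> M" for \<mu> \<nu>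
  proof (intro exI[of _ "(\<lambda>\<alpha>. \<mu> \<cdot> \<alpha>) ` paths_from \<Lambda> (src \<Lambda> \<mu>) (deg \<Lambda> \<nu>)"] conjI)
    let ?P = "paths_from \<Lambda> (src \<Lambda> \<mu>) (deg \<Lambda> \<nu>)"
    have d: "deg \<Lambda> \<nu> \<in> Nk k" by (rule deg_closed[OF \<nu>])
    show "(\<lambda>\<alpha>. \<mu> \<cdot> \<alpha>) ` ?P \<subseteq> M" using comp_paths_from(2)[OF \<mu>] by blast
    show "finite ((\<lambda>\<alpha>. \<mu> \<cdot> \<alpha>) ` ?P)" using paths_from_src(1)[OF \<mu> d] by simp
    show "(\<Union>d\<in>(\<lambda>\<alpha>. \<mu> \<cdot> \<alpha>) ` ?P. Z d) = Z \<mu>" using cylinder_split[OF \<mu> d] by simp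
    show "\<forall>d\<in>(\<lambda>\<alpha>. \<mu> \<cdot> \<alpha>) ` ?P. \<forall>e\<in>(\<lambda>\<alpha>. \<mu> \<cdot> \<alpha>) ` ?P. d \<noteq> e \<longrightarrow> Z d \<inter> Z e = {}"
      using comp_paths_from(3)[OF \<mu>] cylinder_disjoint by auto
    show "\<forall>d\<in>(\<lambda>\<alpha>. \<mu> \<cdot> \<alpha>) ` ?P. Z d \<subseteq> Z \<nu> \<or> Z d \<inter> Z \<nu> = {}"
      using cylinder_refinement[OF \<mu> \<nu>] by blast
  qed
qed

section \<open>The operators induced by the shifts on locally constant functions\<close>

abbreviation CX :: "('a ipath \<Rightarrow> int) set" where "CX \<equiv> Cc (path_space k \<Lambda>)"

text \<open>The subdivision of a cylinder into those of its extensions by degree \<open>m\<close>,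
  recorded as a formal sum before passing to functions.\<close>

definition refine :: "(nat \<Rightarrow> nat) \<Rightarrow> 'a \<Rightarrow> ('a \<Rightarrow>\<^sub>0 int)" where
  "refine m \<mu> = (\<Sum>\<alpha>\<in>paths_from \<Lambda> (src \<Lambda> \<mu>) m. frag_of (\<mu> \<cdot> \<alpha>))"

lemma keys_refine:
  assumes "\<mu> \<in> M" "m \<in> Nk k"
  shows "Poly_Mapping.keys (refine m \<mu>) \<subseteq> {\<eta> \<in> M. m \<le> deg \<Lambda> \<eta>}"
proof -
  have "Poly_Mapping.keys (refine m \<mu>) \<subseteq> (\<Union>\<alpha>\<in>paths_from \<Lambda> (src \<Lambda> \<mu>) m. {\<mu> \<cdot> \<alpha>})"
    unfolding refine_def using keys_sum by fastforce
  moreover have "\<mu> \<cdot> \<alpha> \<in> {\<eta> \<in> M. m \<le> deg \<Lambda> \<eta>}" if "\<alpha> \<in> paths_from \<Lambda> (src \<Lambda> \<mu>) m" for \<alpha>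
    using comp_paths_from(2,3)[OF assms(1) that] by (simp add: fun_le_add)
  ultimately show ?thesis by blast
qed

lemma ind_comb_refine:
  assumes "\<mu> \<in> M" "m \<in> Nk k"
  shows "ind_comb Z (refine m \<mu>) = indicator (Z \<mu>)"
proof
  fix x
  let ?P = "paths_from \<Lambda> (src \<Lambda> \<mu>) m"
  have "ind_comb Z (refine m \<mu>) x = (\<Sum>\<alpha>\<in>?P. indicator (Z (\<mu> \<cdot> \<alpha>)) x)"
    unfolding refine_def by (rule ind_comb_frag_sum[OF paths_from_src(1)[OF assms]])
  also have "\<dots> = indicator (\<Union>\<alpha>\<in>?P. Z (\<mu> \<cdot> \<alpha>)) x"
  proof (rule indicator_disjoint_UN[symmetric, OF paths_from_src(1)[OF assms]])
    fix \<alpha> \<beta> assume "\<alpha> \<in> ?P" "\<beta> \<in> ?P" "\<alpha> \<noteq> \<beta>"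
    then have "\<mu> \<cdot> \<alpha> \<noteq> \<mu> \<cdot> \<beta>" "deg \<Lambda> (\<mu> \<cdot> \<alpha>) = deg \<Lambda> (\<mu> \<cdot> \<beta>)"
      using comp_inj[OF assms(1)] comp_paths_from(3)[OF assms(1)] by auto
    then show "Z (\<mu> \<cdot> \<alpha>) \<inter> Z (\<mu> \<cdot> \<beta>) = {}" by (intro cylinder_disjoint)
  qed
  finally show "ind_comb Z (refine m \<mu>) x = indicator (Z \<mu>) x" by (simp only: cylinder_split[OF assms])
qed

text \<open>Subdividing cylinders makes all degrees in a representation of \<open>f\<close> as large
  as a computation with shifts requires.\<close>

lemma CX_refined:
  assumes "f \<in> CX" "m \<in> Nk k"
  obtains c where "Poly_Mapping.keys c \<subseteq> {\<eta> \<in> M. m \<le> deg \<Lambda> \<eta>}" "f = ind_comb Z c"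
proof -
  obtain b where b: "Poly_Mapping.keys b \<subseteq> M" "f = ind_comb Z b" using assms(1) paths.Cc_eq by blast
  have "Poly_Mapping.keys (frag_extend (refine m) b) \<subseteq> {\<eta> \<in> M. m \<le> deg \<Lambda> \<eta>}"
    using keys_frag_extend[of "refine m" b] keys_refine[OF _ assms(2)] b(1) by blast
  moreover have "ind_comb Z (frag_extend (refine m) b) = ind_comb Z b"
    by (rule ind_comb_frag_extend) (use b(1) ind_comb_refine[OF _ assms(2)] in blast)
  ultimately show ?thesis using that b(2) by simp
qed

lemma pushforward_shift:
  assumes "m \<in> Nk k" "Poly_Mapping.keys c \<subseteq> {\<eta> \<in> M. m \<le> deg \<Lambda> \<eta>}"
  shows "pushforward PS (sh m) (ind_comb Z c) = ind_comb (\<lambda>\<eta>. Z (post \<eta> m)) c"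
proof -
  have "pushforward PS (sh m) (ind_comb Z c) = ind_comb (\<lambda>\<eta>. sh m ` Z \<eta>) c"
    using assms(2) paths.Z_subset shift_bij_cylinder(1)[OF _ assms(1)] by (intro pushforward_ind_comb) blast+
  also have "\<dots> = ind_comb (\<lambda>\<eta>. Z (post \<eta> m)) c"
    using assms(2) shift_bij_cylinder(2)[OF _ assms(1)] by (intro ind_comb_cong) blast
  finally show ?thesis .
qed

lemma ind_comb_post: "ind_comb (\<lambda>\<eta>. Z (post \<eta> m)) c = ind_comb Z (frag_extend (\<lambda>\<eta>. frag_of (post \<eta> m)) c)"
  by (rule ind_comb_frag_extend[symmetric]) simp

lemma keys_frag_post:
  assumes "m \<in> Nk k" "n \<in> Nk k" "Poly_Mapping.keys c \<subseteq> {\<eta> \<in> M. m + n \<le> deg \<Lambda> \<eta>}"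
  shows "Poly_Mapping.keys (frag_extend (\<lambda>\<eta>. frag_of (post \<eta> m)) c) \<subseteq> {\<eta> \<in> M. n \<le> deg \<Lambda> \<eta>}"
proof -
  have "post \<eta> m \<in> M \<and> n \<le> deg \<Lambda> (post \<eta> m)" if "\<eta> \<in> Poly_Mapping.keys c" for \<eta>
  proof -
    have \<eta>: "\<eta> \<in> M" "m + n \<le> deg \<Lambda> \<eta>" using that assms(3) by auto
    then have "m \<le> deg \<Lambda> \<eta>" using fun_le_add(1) order_trans by blast
    from factor(1,3)[OF \<eta>(1) assms(1) this] show ?thesis using fun_le_diff[OF \<eta>(2)] by simp
  qed
  then show ?thesis using keys_frag_extend[of "\<lambda>\<eta>. frag_of (post \<eta> m)" c] by fastforce
qed

text \<open>All cylinders are long enough for both shifts, so each push-forward acts by taking final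
  segments. The result depends on \<open>m + n\<close> alone, which is the reason why the operators
  \<open>T i\<close> commute.\<close>

lemma pushforward_shift_shift:
  assumes m: "m \<in> Nk k" and n: "n \<in> Nk k" and c: "Poly_Mapping.keys c \<subseteq> {\<eta> \<in> M. m + n \<le> deg \<Lambda> \<eta>}"
  shows "pushforward PS (sh n) (pushforward PS (sh m) (ind_comb Z c)) = ind_comb (\<lambda>\<eta>. Z (post \<eta> (m + n))) c"
proof -
  have "Poly_Mapping.keys c \<subseteq> {\<eta> \<in> M. m \<le> deg \<Lambda> \<eta>}" using c fun_le_add(1) order_trans by blast
  then have "pushforward PS (sh n) (pushforward PS (sh m) (ind_comb Z c)) =
      ind_comb (\<lambda>\<eta>. Z (post \<eta> n)) (frag_extend (\<lambda>\<eta>. frag_of (post \<eta> m)) c)"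
    using pushforward_shift[OF n keys_frag_post[OF m n c]] pushforward_shift[OF m] ind_comb_post by simp
  also have "\<dots> = ind_comb (\<lambda>\<eta>. Z (post (post \<eta> m) n)) c"
    by (rule ind_comb_frag_extend) simp
  also have "\<dots> = ind_comb (\<lambda>\<eta>. Z (post \<eta> (m + n))) c"
    using c post_post[OF _ m n] by (intro ind_comb_cong) fastforce
  finally show ?thesis .
qed

abbreviation T :: "nat \<Rightarrow> ('a ipath \<Rightarrow> int) \<Rightarrow> ('a ipath \<Rightarrow> int)" where
  "T \<equiv> \<lambda>i. pushforward (path_space k \<Lambda>) (shift k (unit_vec i))"

lemma commuting_endos_T: "commuting_endos k CX T"
proof
  show "add_closed CX" by (rule add_closed_Cc)
  fix i assume i: "i < k"
  note ui = Nk_unit_vec[OF i]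
  show "T i f \<in> CX" if f: "f \<in> CX" for f
  proof -
    obtain c where c: "Poly_Mapping.keys c \<subseteq> {\<eta> \<in> M. unit_vec i \<le> deg \<Lambda> \<eta>}" "f = ind_comb Z c"
      using CX_refined[OF f ui] .
    have "Poly_Mapping.keys (frag_extend (\<lambda>\<eta>. frag_of (post \<eta> (unit_vec i))) c) \<subseteq> M"
      using keys_frag_post[OF ui Nk_zero, of c] c(1) by auto
    then show ?thesis
      unfolding c(2) pushforward_shift[OF ui c(1)] ind_comb_post by (rule paths.ind_comb_in_Cc)
  qed
  show "additive_on CX (T i)"
    unfolding additive_on_def
  proof (intro ballI)
    fix f g assume f: "f \<in> CX" and g: "g \<in> CX"
    obtain a where a: "Poly_Mapping.keys a \<subseteq> {\<eta> \<in> M. unit_vec i \<le> deg \<Lambda> \<eta>}" "f = ind_comb Z a"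
      using CX_refined[OF f ui] .
    obtain b where b: "Poly_Mapping.keys b \<subseteq> {\<eta> \<in> M. unit_vec i \<le> deg \<Lambda> \<eta>}" "g = ind_comb Z b"
      using CX_refined[OF g ui] .
    have ab: "Poly_Mapping.keys (a + b) \<subseteq> {\<eta> \<in> M. unit_vec i \<le> deg \<Lambda> \<eta>}"
      using a(1) b(1) keys_add[of a b] by blast
    have "f + g = ind_comb Z (a + b)" by (simp only: a(2) b(2) ind_comb_add)
    then have "T i (f + g) = ind_comb (\<lambda>\<eta>. Z (post \<eta> (unit_vec i))) (a + b)"
      using pushforward_shift[OF ui ab] by (simp only:)
    then show "T i (f + g) = T i f + T i g"
      unfolding a(2) b(2) pushforward_shift[OF ui a(1)] pushforward_shift[OF ui b(1)] ind_comb_add .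
  qed
next
  fix i l f assume i: "i < k" and l: "l < k" and f: "f \<in> CX"
  note ui = Nk_unit_vec[OF i] and ul = Nk_unit_vec[OF l]
  obtain c where c: "Poly_Mapping.keys c \<subseteq> {\<eta> \<in> M. unit_vec i + unit_vec l \<le> deg \<Lambda> \<eta>}" "f = ind_comb Z c"
    using CX_refined[OF f Nk_add[OF ui ul]] .
  show "T i (T l f) = T l (T i f)"
    unfolding c(2) using pushforward_shift_shift[OF ui ul c(1)] pushforward_shift_shift[OF ul ui, of c] c(1)
    by (simp add: add.commute)
qed

section \<open>The complex of the vertex matrices\<close>

definition ZV :: "('a \<Rightarrow>\<^sub>0 int) set" where
  "ZV = {c. Poly_Mapping.keys c \<subseteq> vertices \<Lambda>}"

lemma carrier_ZV: "carrier (free_Abelian_group (vertices \<Lambda>)) = ZV"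
  by (auto simp: ZV_def)

lemma iota_eq: "iota k \<Lambda> = ind_comb Z"
  by (simp add: fun_eq_iff iota_def ind_comb_def)

abbreviation S :: "nat \<Rightarrow> ('a \<Rightarrow>\<^sub>0 int) \<Rightarrow> ('a \<Rightarrow>\<^sub>0 int)" where
  "S \<equiv> vertex_matrix_transpose \<Lambda>"

lemma vertexD: "v \<in> vertices \<Lambda> \<Longrightarrow> v \<in> M" "v \<in> vertices \<Lambda> \<Longrightarrow> deg \<Lambda> v = 0"
  "v \<in> vertices \<Lambda> \<Longrightarrow> src \<Lambda> v = v" "v \<in> vertices \<Lambda> \<Longrightarrow> rng \<Lambda> v = v"
  using vertex_eq[of v] by (auto simp: vertices_def)

text \<open>The paths of degree \<open>e_i\<close> with range \<open>v\<close> are grouped by their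
  sources; the group with source \<open>w\<close> has \<open>vertex_matrix \<Lambda> i v w\<close>
  elements.\<close>

lemma vertex_matrix_transpose_of:
  assumes v: "v \<in> vertices \<Lambda>" and i: "i < k"
  shows "S i (frag_of v) = (\<Sum>\<alpha>\<in>paths_from \<Lambda> v (unit_vec i). frag_of (src \<Lambda> \<alpha>))"
proof (rule poly_mapping_eqI)
  fix u
  let ?P = "paths_from \<Lambda> v (unit_vec i)"
  let ?W = "{w \<in> vertices \<Lambda>. vertex_matrix \<Lambda> i v w \<noteq> 0}"
  have fin: "finite ?P"
    using paths_from_src(1)[OF vertexD(1)[OF v] Nk_unit_vec[OF i]] vertexD(3)[OF v] by simp
  have btw: "paths_between \<Lambda> v (unit_vec i) w = {\<alpha> \<in> ?P. src \<Lambda> \<alpha> = w}" for w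
    by (auto simp: paths_between_def paths_from_def)
  have "?W \<subseteq> src \<Lambda> ` ?P"
  proof
    fix w assume "w \<in> ?W"
    then have "paths_between \<Lambda> v (unit_vec i) w \<noteq> {}" by (auto simp: vertex_matrix_def)
    then show "w \<in> src \<Lambda> ` ?P" unfolding btw by blast
  qed
  then have finW: "finite ?W" using fin finite_surj by blast
  have zero: "vertex_matrix \<Lambda> i v u = 0" if "u \<notin> vertices \<Lambda>"
  proof -
    have "paths_between \<Lambda> v (unit_vec i) u = {}"
      using that verticesI by (auto simp: paths_between_def)
    then show ?thesis by (simp add: vertex_matrix_def)
  qed
  have "Poly_Mapping.lookup (S i (frag_of v)) u = (\<Sum>w\<in>?W. int (vertex_matrix \<Lambda> i v w) * (if u = w then 1 else 0))"
    by (simp add: vertex_matrix_transpose_def lookup_sum lookup_single when_def)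
  also have "\<dots> = int (vertex_matrix \<Lambda> i v u)"
    using finW zero by (cases "u \<in> vertices \<Lambda>") (simp_all add: if_distrib[where f = "(*) _"] cong: if_cong)
  also have "\<dots> = (\<Sum>\<alpha>\<in>?P. if u = src \<Lambda> \<alpha> then 1 else 0)"
    unfolding vertex_matrix_def btw using fin by (simp add: sum.inter_filter[symmetric] eq_commute[of u])
  also have "\<dots> = Poly_Mapping.lookup (\<Sum>\<alpha>\<in>?P. frag_of (src \<Lambda> \<alpha>)) u"
    by (simp add: lookup_sum lookup_single when_def)
  finally show "Poly_Mapping.lookup (S i (frag_of v)) u = \<dots>" .
qed

lemma S_diff: "S i (a - b) = S i a - S i b"
  unfolding vertex_matrix_transpose_def by (rule frag_extend_diff)

lemma S_zero: "S i 0 = 0"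
  unfolding vertex_matrix_transpose_def by simp

lemma add_closed_ZV: "add_closed ZV"
  unfolding add_closed_def ZV_def using keys_diff by fastforce

lemma S_closed:
  assumes "i < k" "c \<in> ZV"
  shows "S i c \<in> ZV"
  using assms(2)[unfolded ZV_def mem_Collect_eq]
proof (induction c rule: frag_induction)
  case zero
  show ?case by (simp add: S_zero ZV_def)
next
  case (one v)
  have "Poly_Mapping.keys (\<Sum>\<alpha>\<in>paths_from \<Lambda> v (unit_vec i). frag_of (src \<Lambda> \<alpha>))
      \<subseteq> (\<Union>\<alpha>\<in>paths_from \<Lambda> v (unit_vec i). {src \<Lambda> \<alpha>})" using keys_sum by fastforce
  also have "\<dots> \<subseteq> vertices \<Lambda>" using verticesI by (auto simp: paths_from_def)
  finally show ?case by (simp add: ZV_def vertex_matrix_transpose_of[OF one assms(1)])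
next
  case (diff a b)
  then show ?case unfolding S_diff by (rule add_closed_diff[OF add_closed_ZV])
qed

lemma vertices_subset: "vertices \<Lambda> \<subseteq> M"
  by (auto simp: vertices_def)

lemma iota_closed: "c \<in> ZV \<Longrightarrow> ind_comb Z c \<in> CX"
  using vertices_subset by (intro paths.ind_comb_in_Cc) (auto simp: ZV_def)

text \<open>Cylinders of distinct vertices are disjoint, as all vertices have degree 0, and none of
  them is empty.\<close>

lemma iota_inj: "\<lbrakk>c \<in> ZV; ind_comb Z c = 0\<rbrakk> \<Longrightarrow> c = 0"
proof (erule ind_comb_eq_zeroD)
  fix v w assume "c \<in> ZV" "v \<in> Poly_Mapping.keys c" "w \<in> Poly_Mapping.keys c" "v \<noteq> w"
  then show "Z v \<inter> Z w = {}" using vertexD(2) by (intro cylinder_disjoint) (auto simp: ZV_def subset_iff)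
qed (use vertices_subset cylinder_nonempty in \<open>auto simp: ZV_def\<close>)

text \<open>The cylinder of \<open>v\<close> is the disjoint union of the \<open>Z \<alpha>\<close>
  over the paths \<open>\<alpha>\<close> of degree \<open>e_i\<close> with range \<open>v\<close>,
  and the shift maps each \<open>Z \<alpha>\<close> bijectively onto
  \<open>Z (src \<Lambda> \<alpha>)\<close>.\<close>

lemma T_iota:
  assumes i: "i < k" and "c \<in> ZV"
  shows "ind_comb Z (S i c) = T i (ind_comb Z c)"
proof -
  interpret endos: commuting_endos k CX T by (rule commuting_endos_T)
  note ui = Nk_unit_vec[OF i]
  \<comment> \<open>Membership in \<open>ZV\<close> is carried along, since additivity of
    \<open>T i\<close> is known only on \<open>CX\<close>.\<close>
  have "c \<in> ZV \<and> ind_comb Z (S i c) = T i (ind_comb Z c)"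
    using assms(2)[unfolded ZV_def mem_Collect_eq]
  proof (induction c rule: frag_induction)
    case zero
    show ?case by (simp only: S_zero ind_comb_zero endos.T_zero[OF i]) (simp add: ZV_def)
  next
    case (one v)
    let ?P = "paths_from \<Lambda> v (unit_vec i)"
    have fin: "finite ?P" using paths_from_src(1)[OF vertexD(1)[OF one] ui] vertexD(3)[OF one] by simp
    have "refine (unit_vec i) v = (\<Sum>\<alpha>\<in>?P. frag_of \<alpha>)"
      unfolding refine_def vertexD(3)[OF one] using comp_rng by (intro sum.cong refl) (auto simp: paths_from_def)
    then have r: "ind_comb Z (frag_of v) = ind_comb Z (\<Sum>\<alpha>\<in>?P. frag_of \<alpha>)"
      "Poly_Mapping.keys (\<Sum>\<alpha>\<in>?P. frag_of \<alpha>) \<subseteq> {\<eta> \<in> M. unit_vec i \<le> deg \<Lambda> \<eta>}"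
      using ind_comb_refine[OF vertexD(1)[OF one] ui] keys_refine[OF vertexD(1)[OF one] ui] by simp_all
    have "T i (ind_comb Z (frag_of v)) = ind_comb (\<lambda>\<eta>. Z (post \<eta> (unit_vec i))) (\<Sum>\<alpha>\<in>?P. frag_of \<alpha>)"
      unfolding r(1) by (rule pushforward_shift[OF ui r(2)])
    also have "\<dots> = ind_comb Z (frag_extend (\<lambda>\<eta>. frag_of (post \<eta> (unit_vec i))) (\<Sum>\<alpha>\<in>?P. frag_of \<alpha>))"
      by (rule ind_comb_post)
    also have "frag_extend (\<lambda>\<eta>. frag_of (post \<eta> (unit_vec i))) (\<Sum>\<alpha>\<in>?P. frag_of \<alpha>) = (\<Sum>\<alpha>\<in>?P. frag_of (src \<Lambda> \<alpha>))"
      unfolding frag_extend_sum[OF fin]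
    proof (intro sum.cong refl)
      fix \<alpha> assume "\<alpha> \<in> ?P"
      then show "(frag_extend (\<lambda>\<eta>. frag_of (post \<eta> (unit_vec i))) \<circ> frag_of) \<alpha> = frag_of (src \<Lambda> \<alpha>)"
        using post_self[of \<alpha>] by (simp add: paths_from_def)
    qed
    finally show ?case
      using one by (simp add: vertex_matrix_transpose_of[OF one i] ZV_def del: ind_comb_of)
  next
    case (diff a b)
    then have "a - b \<in> ZV" using add_closed_diff[OF add_closed_ZV] by blast
    then show ?case
      using diff additive_on_diff[OF endos.A endos.T_additive[OF i] iota_closed iota_closed, of a b]
      by (simp add: S_diff ind_comb_diff del: minus_apply)
  qed
  then show ?thesis by blast
qed

text \<open>Commutation of the vertex matrices is inherited from that of the \<open>T i\<close>
  through the injective \<open>ind_comb Z\<close>.\<close>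

lemma commuting_endos_S: "commuting_endos k ZV S"
proof
  interpret endos: commuting_endos k CX T by (rule commuting_endos_T)
  show "add_closed ZV" by (rule add_closed_ZV)
  show "S i c \<in> ZV" if "i < k" "c \<in> ZV" for i c by (rule S_closed[OF that])
  show "additive_on ZV (S i)" for i
    unfolding vertex_matrix_transpose_def by (simp add: additive_on_def frag_extend_add)
  fix i l c assume il: "i < k" "l < k" and c: "c \<in> ZV"
  have "ind_comb Z (S i (S l c)) = T i (T l (ind_comb Z c))"
    using T_iota[OF il(1) S_closed[OF il(2) c]] T_iota[OF il(2) c] by simp
  also have "\<dots> = ind_comb Z (S l (S i c))"
    using T_iota[OF il(2) S_closed[OF il(1) c]] T_iota[OF il(1) c] endos.T_commute[OF il iota_closed[OF c]] by simp
  finally have "ind_comb Z (S i (S l c) - S l (S i c)) = 0" unfolding ind_comb_diff by simp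
  moreover have "S i (S l c) - S l (S i c) \<in> ZV"
    by (intro add_closed_diff[OF add_closed_ZV] S_closed il c)
  ultimately show "S i (S l c) = S l (S i c)" using iota_inj[of "S i (S l c) - S l (S i c)"] by simp
qed

text \<open>Applying \<open>T i\<close> for a coordinate \<open>i\<close> that occurs in the degree
  of \<open>\<mu>\<close> removes an edge of degree \<open>e_i\<close> from its front; the total
  degree drops until a vertex is left.\<close>

lemma cylinder_eventually_iota:
  assumes "\<mu> \<in> M"
  shows "\<exists>w. set w \<subseteq> {..<k} \<and> fold T w (indicator (Z \<mu>)) \<in> ind_comb Z ` ZV"
  using assms
proof (induction "\<Sum>i<k. deg \<Lambda> \<mu> i" arbitrary: \<mu> rule: less_induct)
  case less
  show ?case
  proof (cases "\<exists>i<k. deg \<Lambda> \<mu> i \<noteq> 0")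
    case False
    then have "deg \<Lambda> \<mu> j = 0" for j using deg_closed[OF less.prems] by (cases "j < k") (auto simp: Nk_def)
    then have "\<mu> \<in> vertices \<Lambda>" using less.prems by (simp add: vertices_def fun_eq_iff)
    then have "indicator (Z \<mu>) \<in> ind_comb Z ` ZV"
      by (intro image_eqI[of _ _ "frag_of \<mu>"]) (simp_all add: ZV_def)
    then show ?thesis by (intro exI[of _ "[]"]) simp
  next
    case True
    then obtain i where i: "i < k" "deg \<Lambda> \<mu> i \<noteq> 0" by blast
    note ui = Nk_unit_vec[OF i(1)]
    have le: "unit_vec i \<le> deg \<Lambda> \<mu>" using i(2) by (simp add: le_fun_def unit_vec_def)
    note f = factor[OF less.prems ui le]
    have "T i (ind_comb Z (frag_of \<mu>)) = ind_comb (\<lambda>\<eta>. Z (post \<eta> (unit_vec i))) (frag_of \<mu>)"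
      using le less.prems by (intro pushforward_shift ui) simp
    then have T: "T i (indicator (Z \<mu>)) = indicator (Z (post \<mu> (unit_vec i)))" by simp
    have "(\<Sum>j<k. deg \<Lambda> (post \<mu> (unit_vec i)) j) < (\<Sum>j<k. deg \<Lambda> \<mu> j)"
      unfolding f(3) using i by (intro sum_strict_mono_ex1) (auto simp: unit_vec_def fun_diff_def)
    from less.hyps[OF this] f(1) obtain w where
      "set w \<subseteq> {..<k}" "fold T w (indicator (Z (post \<mu> (unit_vec i)))) \<in> ind_comb Z ` ZV" by blast
    then show ?thesis using T i(1) by (intro exI[of _ "i # w"]) simp
  qed
qed

text \<open>For a difference the two words are concatenated: the operators commute, and the image of
  \<open>ZV\<close> is stable under them.\<close>

lemma CX_eventually_iota:
  assumes "f \<in> CX"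
  shows "\<exists>w. set w \<subseteq> {..<k} \<and> fold T w f \<in> ind_comb Z ` ZV"
proof -
  interpret endos: commuting_endos k CX T by (rule commuting_endos_T)
  have stable: "fold T v g \<in> ind_comb Z ` ZV" if "set v \<subseteq> {..<k}" "g \<in> ind_comb Z ` ZV" for v g
    using that
  proof (induction v arbitrary: g)
    case (Cons i v)
    then have "T i g \<in> ind_comb Z ` ZV" using T_iota S_closed by (auto simp flip: T_iota)
    then show ?case using Cons by simp
  qed simp
  have closed: "add_closed (ind_comb Z ` ZV)" by (rule add_closed_image[OF add_closed_ZV additive_on_ind_comb])
  obtain c where c: "Poly_Mapping.keys c \<subseteq> M" "f = ind_comb Z c" using assms paths.Cc_eq by blast
  have "ind_comb Z c \<in> CX \<and> (\<exists>w. set w \<subseteq> {..<k} \<and> fold T w (ind_comb Z c) \<in> ind_comb Z ` ZV)"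
    using c(1)
  proof (induction c rule: frag_induction)
    case zero
    have "ind_comb Z 0 \<in> ind_comb Z ` ZV" by (rule imageI) (simp add: ZV_def)
    moreover have "ind_comb Z 0 \<in> CX" by (rule paths.ind_comb_in_Cc) simp
    ultimately show ?case by (intro conjI exI[of _ "[]"]) (simp_all del: ind_comb_zero)
  next
    case (one \<mu>)
    then show ?case using cylinder_eventually_iota[OF one] paths.indicator_in_Cc[OF one] by simp
  next
    case (diff a b)
    then obtain w where w: "set w \<subseteq> {..<k}" "fold T w (ind_comb Z a) \<in> ind_comb Z ` ZV" by blast
    have b: "ind_comb Z b \<in> CX" and a: "ind_comb Z a \<in> CX" using diff by auto
    obtain v where v: "set v \<subseteq> {..<k}" "fold T v (ind_comb Z b) \<in> ind_comb Z ` ZV" using diff by blast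
    have comm: "fold T w (fold T v (ind_comb Z b)) \<in> ind_comb Z ` ZV" by (rule stable[OF w(1) v(2)])
    have swap: "fold T v (fold T w g) = fold T w (fold T v g)" if "g \<in> CX" for g
      using v(1) that
    proof (induction v arbitrary: g)
      case (Cons i v)
      then have "T i (fold T w g) = fold T w (T i g)" "T i g \<in> CX" "set v \<subseteq> {..<k}"
        using endos.fold_T(3)[OF w(1), of i g] endos.T by auto
      then show ?case using Cons.IH by simp
    qed simp
    have "fold T (w @ v) (ind_comb Z (a - b)) = fold T (w @ v) (ind_comb Z a) - fold T (w @ v) (ind_comb Z b)"
      unfolding ind_comb_diff using w v
      by (intro additive_on_diff[OF endos.A endos.fold_T(2) a b]) auto
    also have "\<dots> \<in> ind_comb Z ` ZV"
      using stable[OF v(1) w(2)] comm swap[OF b] by (intro add_closed_diff[OF closed]) simp_all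
    finally have "\<exists>w. set w \<subseteq> {..<k} \<and> fold T w (ind_comb Z (a - b)) \<in> ind_comb Z ` ZV"
      using w v by (intro exI[of _ "w @ v"]) simp
    moreover have "ind_comb Z (a - b) \<in> CX" unfolding ind_comb_diff by (rule add_closed_diff[OF add_closed_Cc a b])
    ultimately show ?case by blast
  qed
  then show ?thesis using c(2) by simp
qed

lemma vertex_complex_eq: "vertex_complex k \<Lambda> = exterior_complex k ZV S"
  by (simp only: vertex_complex_def carrier_ZV)

lemma shift_complex_eq: "shift_complex k \<Lambda> = exterior_complex k CX T"
  by (simp only: shift_complex_def)

lemma iota_homology_iso: "homology_iso_via (vertex_complex k \<Lambda>) (shift_complex k \<Lambda>) (iota_complex k \<Lambda>) p"
  unfolding vertex_complex_eq shift_complex_eq iota_complex_def iota_eq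
  by (rule cofinal_homology_iso[where \<phi> = "ind_comb Z", OF commuting_endos_S commuting_endos_T additive_on_ind_comb
        iota_closed T_iota iota_inj CX_eventually_iota])

lemma iota_chain_map: "chain_map (vertex_complex k \<Lambda>) (shift_complex k \<Lambda>) (iota_complex k \<Lambda>)"
proof -
  let ?m = "Poly_Mapping.map (ind_comb Z)"
  have i0: "ind_comb Z 0 = 0" by simp
  have "?m \<in> hom (additive_group (exterior_chains k ZV n)) (additive_group (exterior_chains k CX n))" for n
    using map_exterior_chains[where f = "ind_comb Z", OF i0 iota_closed, of ZV]
      additive_on_map[OF additive_on_ind_comb[of ZV Z] add_closed_zero[OF add_closed_ZV], of k n]
    unfolding hom_def additive_group_def by (auto simp: additive_on_def)
  moreover have "?m (exterior_bdry S (Suc n) c) = exterior_bdry T (Suc n) (?m c)" if "c \<in> exterior_chains k ZV (Suc n)" for n c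
    using exterior_bdry_map[where f = "ind_comb Z", OF commuting_endos_S commuting_endos_T additive_on_ind_comb iota_closed T_iota that]
    by simp
  ultimately show ?thesis
    unfolding chain_map_def vertex_complex_eq shift_complex_eq iota_complex_def iota_eq
    by (simp add: exterior_complex_def)
qed

end

section \<open>The nerve of the path groupoid\<close>

lemma degree_diff_add: "degree_diff (m + p) (n + p) = degree_diff m n"
  by (simp add: degree_diff_def)

lemma degree_diff_comp: "degree_diff l m + degree_diff m n = degree_diff l n"
  by (simp add: degree_diff_def fun_eq_iff)

lemma degree_diff_self: "degree_diff m m = 0"
  by (simp add: degree_diff_def fun_eq_iff)

lemma degree_diff_cancel: "degree_diff m n = degree_diff m n' \<Longrightarrow> n = n'"
  by (simp add: degree_diff_def fun_eq_iff)

lemma degree_diff_eqD: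
  assumes "degree_diff m n = degree_diff m' n'" "m' \<le> m"
  shows "n = n' + (m - m')"
proof
  fix i
  have "int (m i) - int (n i) = int (m' i) - int (n' i)"
    using fun_cong[OF assms(1), of i] by (simp add: degree_diff_def)
  moreover have "m' i \<le> m i" using assms(2) by (simp add: le_fun_def)
  ultimately show "n i = (n' + (m - m')) i" by simp
qed

context row_finite_k_graph
begin

abbreviation G :: "('a ipath \<times> (nat \<Rightarrow> int) \<times> 'a ipath) top_groupoid" where
  "G \<equiv> kgraph_groupoid k \<Lambda>"

definition arr :: "'a \<Rightarrow> 'a \<Rightarrow> 'a ipath \<Rightarrow> 'a ipath \<times> (nat \<Rightarrow> int) \<times> 'a ipath" where
  "arr \<mu> \<nu> z = (prepend \<mu> z, degree_diff (deg \<Lambda> \<mu>) (deg \<Lambda> \<nu>), prepend \<nu> z)"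

lemma bisection_eq: "bisection k \<Lambda> \<mu> \<nu> = arr \<mu> \<nu> ` Z (src \<Lambda> \<mu>)"
  by (simp add: bisection_def arr_def)

lemma groupoid_simps:
  "arrows G = kgraph_arrows k \<Lambda>"
  "grng G (x, a, y) = (x, 0, x)" "gsrc G (x, a, y) = (y, 0, y)"
  "gcomp G (x, a, y) (y', b, z) = (x, a + b, z)"
  by (simp_all add: kgraph_groupoid_def)

lemma openin_bisection:
  "\<lbrakk>\<mu> \<in> M; \<nu> \<in> M; src \<Lambda> \<mu> = src \<Lambda> \<nu>\<rbrakk> \<Longrightarrow> openin (arrow_top G) (bisection k \<Lambda> \<mu> \<nu>)"
  unfolding kgraph_groupoid_def by (simp, intro topology_generated_by_Basis) blast

text \<open>Membership becomes a condition on shifts of the two ends, so that neighbourhoods can be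
  compared without the parametrisation by \<open>path_prepend\<close>.\<close>

lemma bisection_iff:
  assumes \<mu>: "\<mu> \<in> M" and \<nu>: "\<nu> \<in> M" and s: "src \<Lambda> \<mu> = src \<Lambda> \<nu>"
  shows "(x, a, y) \<in> bisection k \<Lambda> \<mu> \<nu> \<longleftrightarrow>
    x \<in> Z \<mu> \<and> y \<in> Z \<nu> \<and> a = degree_diff (deg \<Lambda> \<mu>) (deg \<Lambda> \<nu>) \<and> sh (deg \<Lambda> \<mu>) x = sh (deg \<Lambda> \<nu>) y"
proof
  assume "(x, a, y) \<in> bisection k \<Lambda> \<mu> \<nu>"
  then obtain z where z: "z \<in> Z (src \<Lambda> \<mu>)" "(x, a, y) = arr \<mu> \<nu> z" by (auto simp: bisection_eq)
  then show "x \<in> Z \<mu> \<and> y \<in> Z \<nu> \<and> a = degree_diff (deg \<Lambda> \<mu>) (deg \<Lambda> \<nu>) \<and> sh (deg \<Lambda> \<mu>) x = sh (deg \<Lambda> \<nu>) y"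
    using prepend[OF \<mu>, of z] prepend[OF \<nu>, of z] s by (simp add: arr_def)
next
  assume *: "x \<in> Z \<mu> \<and> y \<in> Z \<nu> \<and> a = degree_diff (deg \<Lambda> \<mu>) (deg \<Lambda> \<nu>) \<and> sh (deg \<Lambda> \<mu>) x = sh (deg \<Lambda> \<nu>) y"
  then have "(x, a, y) = arr \<mu> \<nu> (sh (deg \<Lambda> \<mu>) x)"
    using prepend_shift[OF \<mu>, of x] prepend_shift[OF \<nu>, of y] by (simp add: arr_def)
  then show "(x, a, y) \<in> bisection k \<Lambda> \<mu> \<nu>"
    unfolding bisection_eq using shift_in_src[OF \<mu>, of x] * by (intro image_eqI) auto
qed

lemma arrow_iff:
  "(x, a, y) \<in> kgraph_arrows k \<Lambda> \<longleftrightarrow>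
    x \<in> IP \<and> y \<in> IP \<and> (\<exists>m\<in>Nk k. \<exists>n\<in>Nk k. a = degree_diff m n \<and> sh m x = sh n y)"
  unfolding kgraph_arrows_def by auto

lemma arr_in_arrows:
  assumes "\<mu> \<in> M" "\<nu> \<in> M" "src \<Lambda> \<mu> = src \<Lambda> \<nu>" "z \<in> Z (src \<Lambda> \<mu>)"
  shows "arr \<mu> \<nu> z \<in> kgraph_arrows k \<Lambda>"
proof -
  have "sh (deg \<Lambda> \<mu>) (prepend \<mu> z) = sh (deg \<Lambda> \<nu>) (prepend \<nu> z)"
    using prepend(2)[OF assms(1)] prepend(2)[OF assms(2)] assms(3,4) by simp
  then show ?thesis
    unfolding arr_def arrow_iff
    using cylinderD(1)[OF prepend(1)[OF assms(1)]] cylinderD(1)[OF prepend(1)[OF assms(2)]] assms(3,4)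
      deg_closed[OF assms(1)] deg_closed[OF assms(2)] by auto
qed

lemma src_initial: "\<lbrakk>x \<in> IP; m \<in> Nk k\<rbrakk> \<Longrightarrow> src \<Lambda> (x (0, m)) = sh m x (0, 0)"
  using path_segment(3)[of x 0 m] by (simp add: shift_initial le_fun_def)

lemma topspace_arrow_top: "topspace (arrow_top G) = kgraph_arrows k \<Lambda>"
proof -
  have "topspace (arrow_top G) = \<Union>{bisection k \<Lambda> \<mu> \<nu> | \<mu> \<nu>. \<mu> \<in> M \<and> \<nu> \<in> M \<and> src \<Lambda> \<mu> = src \<Lambda> \<nu>}"
    by (simp add: kgraph_groupoid_def)
  also have "\<dots> = kgraph_arrows k \<Lambda>"
  proof (intro Set.set_eqI iffI)
    fix g assume "g \<in> \<Union>{bisection k \<Lambda> \<mu> \<nu> | \<mu> \<nu>. \<mu> \<in> M \<and> \<nu> \<in> M \<and> src \<Lambda> \<mu> = src \<Lambda> \<nu>}"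
    then obtain \<mu> \<nu> where *: "\<mu> \<in> M" "\<nu> \<in> M" "src \<Lambda> \<mu> = src \<Lambda> \<nu>" "g \<in> arr \<mu> \<nu> ` Z (src \<Lambda> \<mu>)"
      unfolding bisection_eq by blast
    then show "g \<in> kgraph_arrows k \<Lambda>" using arr_in_arrows by blast
  next
    fix g assume g: "g \<in> kgraph_arrows k \<Lambda>"
    obtain x a y where xay: "g = (x, a, y)" by (cases g) auto
    then obtain m n where mn: "x \<in> IP" "y \<in> IP" "m \<in> Nk k" "n \<in> Nk k" "a = degree_diff m n" "sh m x = sh n y"
      using g arrow_iff by blast
    have s: "src \<Lambda> (x (0, m)) = src \<Lambda> (y (0, n))" using src_initial mn by metis
    have "g \<in> bisection k \<Lambda> (x (0, m)) (y (0, n))"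
      unfolding xay bisection_iff[OF initial_in_M[OF mn(1,3)] initial_in_M[OF mn(2,4)] s]
      using mn by (simp add: cylinder_initial deg_initial)
    then show "g \<in> \<Union>{bisection k \<Lambda> \<mu> \<nu> | \<mu> \<nu>. \<mu> \<in> M \<and> \<nu> \<in> M \<and> src \<Lambda> \<mu> = src \<Lambda> \<nu>}"
      using initial_in_M[OF mn(1,3)] initial_in_M[OF mn(2,4)] s by blast
  qed
  finally show ?thesis .
qed

text \<open>The degree condition makes \<open>m\<close> and \<open>n\<close> exceed the degrees of
  \<open>\<alpha>\<close> and \<open>\<beta>\<close> by the same \<open>p\<close>. As the tails of
  \<open>x\<close> and \<open>y\<close> agree, the new initial segments are
  \<open>\<alpha> \<cdot> \<gamma>\<close> and \<open>\<beta> \<cdot> \<gamma>\<close> with a common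
  \<open>\<gamma>\<close>.\<close>

lemma bisection_shrink:
  assumes \<alpha>: "\<alpha> \<in> M" and \<beta>: "\<beta> \<in> M" and s: "src \<Lambda> \<alpha> = src \<Lambda> \<beta>"
    and g: "(x, a, y) \<in> bisection k \<Lambda> \<alpha> \<beta>"
    and m: "m \<in> Nk k" "deg \<Lambda> \<alpha> \<le> m" and n: "n \<in> Nk k" and a: "degree_diff m n = a"
    and eq: "sh m x = sh n y"
  shows "bisection k \<Lambda> (x (0, m)) (y (0, n)) \<subseteq> bisection k \<Lambda> \<alpha> \<beta>"
proof -
  define p where "p = m - deg \<Lambda> \<alpha>"
  have p: "p \<in> Nk k" "m = deg \<Lambda> \<alpha> + p" using m by (simp_all add: p_def Nk_diff fun_add_diff_inverse)
  have gxy: "x \<in> Z \<alpha>" "y \<in> Z \<beta>" "a = degree_diff (deg \<Lambda> \<alpha>) (deg \<Lambda> \<beta>)" "sh (deg \<Lambda> \<alpha>) x = sh (deg \<Lambda> \<beta>) y"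
    using g bisection_iff[OF \<alpha> \<beta> s] by auto
  have n': "n = deg \<Lambda> \<beta> + p" using degree_diff_eqD[of m n "deg \<Lambda> \<alpha>" "deg \<Lambda> \<beta>"] a gxy(3) m(2) by (simp add: p_def)
  define \<gamma> where "\<gamma> = sh (deg \<Lambda> \<alpha>) x (0, p)"
  have x: "x (0, m) = \<alpha> \<cdot> \<gamma>" "composable \<alpha> \<gamma>"
    unfolding p(2) \<gamma>_def by (rule cylinder_apply_add[OF \<alpha> gxy(1) p(1)])+
  have y: "y (0, n) = \<beta> \<cdot> \<gamma>" "composable \<beta> \<gamma>"
    unfolding n' \<gamma>_def gxy(4) by (rule cylinder_apply_add[OF \<beta> gxy(2) p(1)])+
  have d\<gamma>: "deg \<Lambda> \<gamma> = p"
    unfolding \<gamma>_def using deg_initial shift_in_IP cylinderD(1)[OF gxy(1)] deg_closed[OF \<alpha>] p(1) by blast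
  have sx: "src \<Lambda> (\<alpha> \<cdot> \<gamma>) = src \<Lambda> (\<beta> \<cdot> \<gamma>)" using x(2) y(2) by (simp add: src_comp)
  have M: "\<alpha> \<cdot> \<gamma> \<in> M" "\<beta> \<cdot> \<gamma> \<in> M" using x(2) y(2) comp_closed by auto
  show ?thesis
  proof
    fix h assume h: "h \<in> bisection k \<Lambda> (x (0, m)) (y (0, n))"
    obtain x' a' y' where h': "h = (x', a', y')" by (cases h) auto
    have *: "x' \<in> Z (\<alpha> \<cdot> \<gamma>)" "y' \<in> Z (\<beta> \<cdot> \<gamma>)" "a' = degree_diff (deg \<Lambda> \<alpha> + p) (deg \<Lambda> \<beta> + p)"
      "sh (deg \<Lambda> \<alpha> + p) x' = sh (deg \<Lambda> \<beta> + p) y'"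
      using h x(2) y(2) unfolding h' x(1) y(1) bisection_iff[OF M sx] by (auto simp: deg_comp d\<gamma>)
    have x': "x' \<in> Z \<alpha>" "sh (deg \<Lambda> \<alpha>) x' \<in> Z \<gamma>" using *(1) cylinder_comp[OF x(2)] by auto
    have y': "y' \<in> Z \<beta>" "sh (deg \<Lambda> \<beta>) y' \<in> Z \<gamma>" using *(2) cylinder_comp[OF y(2)] by auto
    have "sh (deg \<Lambda> \<gamma>) (sh (deg \<Lambda> \<alpha>) x') = sh (deg \<Lambda> \<gamma>) (sh (deg \<Lambda> \<beta>) y')"
      using *(4) p(1) by (simp add: d\<gamma> shift_shift add.commute)
    then have "sh (deg \<Lambda> \<alpha>) x' = sh (deg \<Lambda> \<beta>) y'"
      using cylinder_shift_inj[OF _ x'(2) y'(2)] x(2) by blast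
    then show "h \<in> bisection k \<Lambda> \<alpha> \<beta>"
      unfolding h' bisection_iff[OF \<alpha> \<beta> s] using x' y' *(3) by (simp add: degree_diff_add)
  qed
qed

text \<open>As for paths, a claim about all large levels passes to intersections. A lower bound on
  \<open>m\<close> is enough, because \<open>m\<close> and the difference \<open>a\<close> determine
  \<open>n\<close>.\<close>

lemma arrow_base:
  assumes "openin (arrow_top G) U" "(x, a, y) \<in> U"
  shows "\<exists>m0\<in>Nk k. \<forall>m\<in>Nk k. \<forall>n\<in>Nk k. m0 \<le> m \<and> degree_diff m n = a \<and> sh m x = sh n y \<longrightarrow>
           bisection k \<Lambda> (x (0, m)) (y (0, n)) \<subseteq> U"
proof -
  define P where "P U m0 \<longleftrightarrow> (\<forall>m\<in>Nk k. \<forall>n\<in>Nk k. m0 \<le> m \<and> degree_diff m n = a \<and> sh m x = sh n y \<longrightarrow>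
           bisection k \<Lambda> (x (0, m)) (y (0, n)) \<subseteq> U)" for U m0
  have mono: "P U m0 \<Longrightarrow> m0 \<le> m1 \<Longrightarrow> U \<subseteq> V \<Longrightarrow> P V m1" for U V m0 m1
    unfolding P_def by (meson order_trans)
  have "generate_topology_on {bisection k \<Lambda> \<mu> \<nu> | \<mu> \<nu>. \<mu> \<in> M \<and> \<nu> \<in> M \<and> src \<Lambda> \<mu> = src \<Lambda> \<nu>} U"
    using assms(1) unfolding kgraph_groupoid_def by (simp add: openin_topology_generated_by)
  then have "\<exists>m0\<in>Nk k. P U m0" using assms(2)
  proof (induction U)
    case (Int b c)
    then obtain m0 m1 where m: "m0 \<in> Nk k" "m1 \<in> Nk k" "P b m0" "P c m1" by blast
    have "P b (m0 + m1)" "P c (m0 + m1)" using m mono fun_le_add by blast+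
    then have "P (b \<inter> c) (m0 + m1)" unfolding P_def by blast
    then show ?case using Nk_add[OF m(1,2)] by blast
  next
    case (UN K)
    then obtain b where b: "b \<in> K" "(x, a, y) \<in> b" by blast
    then obtain m0 where "m0 \<in> Nk k" "P b m0" using UN.IH by blast
    then show ?case using mono[of b m0 m0 "\<Union>K"] b(1) by blast
  next
    case (Basis b)
    then obtain \<alpha> \<beta> where \<alpha>: "\<alpha> \<in> M" "\<beta> \<in> M" "src \<Lambda> \<alpha> = src \<Lambda> \<beta>" "b = bisection k \<Lambda> \<alpha> \<beta>" by blast
    have "P b (deg \<Lambda> \<alpha>)"
      unfolding P_def \<alpha>(4) using bisection_shrink[OF \<alpha>(1-3) Basis.prems[unfolded \<alpha>(4)]] by blast
    then show ?case using deg_closed[OF \<alpha>(1)] by blast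
  qed simp
  then show ?thesis unfolding P_def .
qed

section \<open>Tuples of paths and a base of the nerve\<close>

definition tuples :: "nat \<Rightarrow> 'a list set" where
  "tuples n = {xs. length xs = Suc n \<and> set xs \<subseteq> M \<and> (\<forall>\<mu>\<in>set xs. src \<Lambda> \<mu> = src \<Lambda> (hd xs))}"

lemma tuplesD:
  assumes "xs \<in> tuples n"
  shows "length xs = Suc n" "i \<le> n \<Longrightarrow> xs ! i \<in> M" "i \<le> n \<Longrightarrow> src \<Lambda> (xs ! i) = src \<Lambda> (hd xs)"
    "hd xs = xs ! 0" "hd xs \<in> M" "xs \<noteq> []"
proof -
  show l: "length xs = Suc n" using assms by (simp add: tuples_def)
  then show ne: "xs \<noteq> []" by auto
  then show "hd xs = xs ! 0" by (simp add: hd_conv_nth)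
  have nth: "xs ! i \<in> set xs" if "i \<le> n" for i using l that by simp
  show "i \<le> n \<Longrightarrow> xs ! i \<in> M" "i \<le> n \<Longrightarrow> src \<Lambda> (xs ! i) = src \<Lambda> (hd xs)"
    using assms nth[of i] unfolding tuples_def by blast+
  show "hd xs \<in> M" using assms hd_in_set[OF ne] unfolding tuples_def by blast
qed

text \<open>The index \<open>min (Suc i) n\<close> makes the formula cover degree \<open>0\<close> as well, where the only entry of the
  point of the nerve is the unit arrow at \<open>\<mu>\<^sub>0 z\<close>.\<close>

definition nerve_point :: "'a list \<Rightarrow> 'a ipath \<Rightarrow> nat \<Rightarrow> 'a ipath \<times> (nat \<Rightarrow> int) \<times> 'a ipath" where
  "nerve_point xs z = (let n = length xs - 1 in (\<lambda>i\<in>{..<max 1 n}. arr (xs ! i) (xs ! min (Suc i) n) z))"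

definition tuple_cylinder :: "'a list \<Rightarrow> (nat \<Rightarrow> 'a ipath \<times> (nat \<Rightarrow> int) \<times> 'a ipath) set" where
  "tuple_cylinder xs = nerve_point xs ` Z (src \<Lambda> (hd xs))"

lemma nerve_point_eq:
  "length xs = Suc n \<Longrightarrow> nerve_point xs z = (\<lambda>i\<in>{..<max 1 n}. arr (xs ! i) (xs ! min (Suc i) n) z)"
  by (simp add: nerve_point_def Let_def)

lemma nerve_point_apply:
  "\<lbrakk>length xs = Suc n; i < max 1 n\<rbrakk> \<Longrightarrow> nerve_point xs z i = arr (xs ! i) (xs ! min (Suc i) n) z"
  by (simp add: nerve_point_eq)

lemma topspace_nerve:
  "topspace (nerve G n) = {t \<in> ({..<max 1 n} \<rightarrow>\<^sub>E kgraph_arrows k \<Lambda>).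
     (n = 0 \<longrightarrow> t 0 \<in> units G) \<and> (\<forall>i. Suc i < n \<longrightarrow> gsrc G (t i) = grng G (t (Suc i)))}"
proof (cases "n = 0")
  case True
  then show ?thesis by (auto simp: nerve_def topspace_arrow_top)
next
  case False
  then have "max 1 n = n" by simp
  then show ?thesis using False by (auto simp: nerve_def topspace_arrow_top groupoid_simps)
qed

lemma unit_arrow: "x \<in> IP \<Longrightarrow> (x, 0, x) \<in> kgraph_arrows k \<Lambda>"
  unfolding arrow_iff using degree_diff_self Nk_zero by (metis degree_diff_self)

lemma units_iff: "g \<in> units G \<longleftrightarrow> (\<exists>x\<in>IP. g = (x, 0, x))"
proof
  assume "g \<in> units G"
  then obtain h where h: "h \<in> kgraph_arrows k \<Lambda>" "g = gsrc G h" unfolding units_def groupoid_simps(1) by blast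
  obtain x a y where xay: "h = (x, a, y)" by (cases h) auto
  then have "y \<in> IP" using h(1) arrow_iff by blast
  then show "\<exists>x\<in>IP. g = (x, 0, x)" using h(2) xay groupoid_simps(3) by auto
next
  assume "\<exists>x\<in>IP. g = (x, 0, x)"
  then obtain x where x: "x \<in> IP" "g = (x, 0, x)" by blast
  then show "g \<in> units G"
    unfolding units_def groupoid_simps(1) using unit_arrow[OF x(1)] groupoid_simps(3)[of x 0 x]
    by (metis image_eqI)
qed

lemma openin_nerve_PiE:
  assumes "\<And>i. i < max 1 n \<Longrightarrow> openin (arrow_top G) (U i)"
  shows "openin (nerve G n) (topspace (nerve G n) \<inter> (\<Pi>\<^sub>E i\<in>{..<max 1 n}. U i))"
proof -
  have "openin (product_topology (\<lambda>_. arrow_top G) {..<max 1 n}) (\<Pi>\<^sub>E i\<in>{..<max 1 n}. U i)"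
    using assms finite_subset[of _ "{..<max 1 n}"] by (auto simp: openin_PiE_gen)
  then obtain S where S: "nerve G n = subtopology (product_topology (\<lambda>_. arrow_top G) {..<max 1 n}) S"
    "openin (product_topology (\<lambda>_. arrow_top G) {..<max 1 n}) (\<Pi>\<^sub>E i\<in>{..<max 1 n}. U i)"
    by (cases "n = 0") (auto simp: nerve_def max_def)
  have "topspace (nerve G n) \<inter> (\<Pi>\<^sub>E i\<in>{..<max 1 n}. U i) = (\<Pi>\<^sub>E i\<in>{..<max 1 n}. U i) \<inter> S"
    using openin_subset[OF S(2)] unfolding S(1) topspace_subtopology by blast
  then show ?thesis using S by (auto simp: openin_subtopology)
qed

lemma nerve_open_contains_PiE:
  assumes "openin (nerve G n) U" "t \<in> U"
  shows "\<exists>V. (\<forall>i<max 1 n. openin (arrow_top G) (V i) \<and> t i \<in> V i) \<and>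
    topspace (nerve G n) \<inter> (\<Pi>\<^sub>E i\<in>{..<max 1 n}. V i) \<subseteq> U"
proof -
  let ?P = "product_topology (\<lambda>_. arrow_top G) {..<max 1 n}"
  obtain S where S: "nerve G n = subtopology ?P S" by (cases "n = 0") (auto simp: nerve_def max_def)
  obtain W where W: "openin ?P W" "U = W \<inter> S" using assms(1) unfolding S openin_subtopology by blast
  then have "t \<in> W" using assms(2) by blast
  then obtain V where V: "\<forall>i\<in>{..<max 1 n}. openin (arrow_top G) (V i)" "t \<in> Pi\<^sub>E {..<max 1 n} V" "Pi\<^sub>E {..<max 1 n} V \<subseteq> W"
    using W(1) unfolding openin_product_topology_alt by blast
  show ?thesis
  proof (intro exI[of _ V] conjI)
    show "topspace (nerve G n) \<inter> (\<Pi>\<^sub>E i\<in>{..<max 1 n}. V i) \<subseteq> U"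
      using V(3) W(2) unfolding S topspace_subtopology by blast
  qed (use V in \<open>auto simp: PiE_iff\<close>)
qed

lemma nerve_point_in_nerve:
  assumes xs: "xs \<in> tuples n" and z: "z \<in> Z (src \<Lambda> (hd xs))"
  shows "nerve_point xs z \<in> topspace (nerve G n)"
    "i < max 1 n \<Longrightarrow> nerve_point xs z i \<in> bisection k \<Lambda> (xs ! i) (xs ! min (Suc i) n)"
proof -
  note l = tuplesD(1)[OF xs]
  have i: "i \<le> n" if "i < max 1 n" for i using that by auto
  have bis: "nerve_point xs z i \<in> bisection k \<Lambda> (xs ! i) (xs ! min (Suc i) n)" if "i < max 1 n" for i
    unfolding nerve_point_apply[OF l that] bisection_eq tuplesD(3)[OF xs i[OF that]] using z by blast
  have arrow: "nerve_point xs z i \<in> kgraph_arrows k \<Lambda>" if "i < max 1 n" for i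
    unfolding nerve_point_apply[OF l that]
    using tuplesD(2,3)[OF xs, of i] tuplesD(2,3)[OF xs, of "min (Suc i) n"] i[OF that] z
    by (intro arr_in_arrows) auto
  show "i < max 1 n \<Longrightarrow> nerve_point xs z i \<in> bisection k \<Lambda> (xs ! i) (xs ! min (Suc i) n)" by (rule bis)
  have "nerve_point xs z 0 \<in> units G" if "n = 0"
    using nerve_point_apply[OF l, of 0] that cylinderD(1)[OF prepend(1)[OF tuplesD(2)[OF xs]], of 0 z]
      tuplesD(3)[OF xs, of 0] z
    unfolding units_iff by (auto simp: arr_def degree_diff_self)
  moreover have "gsrc G (nerve_point xs z i) = grng G (nerve_point xs z (Suc i))" if "Suc i < n" for i
    using nerve_point_apply[OF l, of i] nerve_point_apply[OF l, of "Suc i"] that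
    by (simp add: arr_def groupoid_simps)
  moreover have "nerve_point xs z \<in> {..<max 1 n} \<rightarrow>\<^sub>E kgraph_arrows k \<Lambda>"
    using arrow by (auto simp: PiE_iff nerve_point_eq[OF l])
  ultimately show "nerve_point xs z \<in> topspace (nerve G n)" unfolding topspace_nerve by blast
qed

lemma tuple_cylinder_subset: "xs \<in> tuples n \<Longrightarrow> tuple_cylinder xs \<subseteq> topspace (nerve G n)"
  using nerve_point_in_nerve(1) unfolding tuple_cylinder_def by blast

text \<open>A point on the right comes with one parameter for each entry; composability makes
  consecutive entries share a path, so all parameters coincide.\<close>

lemma tuple_cylinder_eq:
  assumes xs: "xs \<in> tuples n"
  shows "tuple_cylinder xs = topspace (nerve G n) \<inter> (\<Pi>\<^sub>E i\<in>{..<max 1 n}. bisection k \<Lambda> (xs ! i) (xs ! min (Suc i) n))"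
proof (intro Set.set_eqI iffI)
  fix t assume "t \<in> tuple_cylinder xs"
  then obtain z where "t = nerve_point xs z" "z \<in> Z (src \<Lambda> (hd xs))" unfolding tuple_cylinder_def by blast
  then show "t \<in> topspace (nerve G n) \<inter> (\<Pi>\<^sub>E i\<in>{..<max 1 n}. bisection k \<Lambda> (xs ! i) (xs ! min (Suc i) n))"
    using nerve_point_in_nerve[OF xs] by (auto simp: PiE_iff nerve_point_eq[OF tuplesD(1)[OF xs]])
next
  fix t assume t: "t \<in> topspace (nerve G n) \<inter> (\<Pi>\<^sub>E i\<in>{..<max 1 n}. bisection k \<Lambda> (xs ! i) (xs ! min (Suc i) n))"
  have "\<exists>z. z \<in> Z (src \<Lambda> (hd xs)) \<and> t i = arr (xs ! i) (xs ! min (Suc i) n) z" if "i < max 1 n" for i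
  proof -
    have "t i \<in> bisection k \<Lambda> (xs ! i) (xs ! min (Suc i) n)" using t that by (auto simp: PiE_iff)
    moreover have "src \<Lambda> (xs ! i) = src \<Lambda> (hd xs)" using tuplesD(3)[OF xs, of i] that by auto
    ultimately show ?thesis unfolding bisection_eq by auto
  qed
  then obtain z where z: "\<And>i. i < max 1 n \<Longrightarrow> z i \<in> Z (src \<Lambda> (hd xs))"
    "\<And>i. i < max 1 n \<Longrightarrow> t i = arr (xs ! i) (xs ! min (Suc i) n) (z i)" by metis
  \<comment> \<open>The source of entry \<open>i\<close> and the range of entry \<open>Suc i\<close>
    both arise by prepending \<open>xs ! Suc i\<close>, which is injective.\<close>
  have step: "z (Suc i) = z i" if i: "Suc i < n" for i
  proof -
    have "gsrc G (t i) = grng G (t (Suc i))" using t i unfolding topspace_nerve by blast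
    then have eq: "prepend (xs ! Suc i) (z i) = prepend (xs ! Suc i) (z (Suc i))"
      using z(2)[of i] z(2)[of "Suc i"] i by (simp add: arr_def groupoid_simps)
    have M: "xs ! Suc i \<in> M" "src \<Lambda> (xs ! Suc i) = src \<Lambda> (hd xs)" using tuplesD(2,3)[OF xs] i by auto
    have "z i \<in> Z (src \<Lambda> (xs ! Suc i))" "z (Suc i) \<in> Z (src \<Lambda> (xs ! Suc i))" using z(1) i M(2) by auto
    then show ?thesis using prepend(2)[OF M(1)] eq by metis
  qed
  have const: "z i = z 0" if "i < max 1 n" for i
    using that
  proof (induction i)
    case (Suc i)
    then have "Suc i < n" by auto
    then show ?case using step[of i] Suc.IH by simp
  qed simp
  have "t = nerve_point xs (z 0)"
  proof (rule extensionalityI[of _ "{..<max 1 n}"])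
    show "t \<in> extensional {..<max 1 n}" using t by (auto simp: PiE_iff)
    show "nerve_point xs (z 0) \<in> extensional {..<max 1 n}" by (simp add: nerve_point_eq[OF tuplesD(1)[OF xs]])
    fix i assume "i \<in> {..<max 1 n}"
    then show "t i = nerve_point xs (z 0) i"
      using z(2)[of i] const[of i] nerve_point_apply[OF tuplesD(1)[OF xs], of i] by simp
  qed
  then show "t \<in> tuple_cylinder xs" using z(1)[of 0] unfolding tuple_cylinder_def by auto
qed

lemma openin_tuple_cylinder:
  assumes xs: "xs \<in> tuples n"
  shows "openin (nerve G n) (tuple_cylinder xs)"
  unfolding tuple_cylinder_eq[OF xs]
proof (rule openin_nerve_PiE)
  fix i assume "i < max 1 n"
  then have "i \<le> n" "min (Suc i) n \<le> n" by auto
  then show "openin (arrow_top G) (bisection k \<Lambda> (xs ! i) (xs ! min (Suc i) n))"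
    using tuplesD(2,3)[OF xs] by (intro openin_bisection) auto
qed

text \<open>Each arrow provides a pair of levels at which the tails of its ends agree. Levels may be
  raised simultaneously without changing degree differences; this makes the level at the junction
  the same for the earlier arrows and for the new one.\<close>

lemma common_levels:
  assumes "\<And>i. i \<le> n \<Longrightarrow> x i \<in> IP"
    and "\<And>i. i < n \<Longrightarrow> \<exists>m\<in>Nk k. \<exists>m'\<in>Nk k. a i = degree_diff m m' \<and> sh m (x i) = sh m' (x (Suc i))"
    and b: "b \<in> Nk k"
  shows "\<exists>N. (\<forall>i\<le>n. N i \<in> Nk k \<and> b \<le> N i \<and> sh (N i) (x i) = sh (N 0) (x 0)) \<and>
             (\<forall>i<n. a i = degree_diff (N i) (N (Suc i)))"
  using assms(1,2)
proof (induction n)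
  case 0
  then show ?case using b by (intro exI[of _ "\<lambda>_. b"]) simp
next
  case (Suc n)
  obtain N where N: "\<And>i. i \<le> n \<Longrightarrow> N i \<in> Nk k" "\<And>i. i \<le> n \<Longrightarrow> b \<le> N i"
    "\<And>i. i \<le> n \<Longrightarrow> sh (N i) (x i) = sh (N 0) (x 0)" "\<And>i. i < n \<Longrightarrow> a i = degree_diff (N i) (N (Suc i))"
    using Suc.IH Suc.prems by (metis le_SucI less_SucI)
  obtain m m' where m: "m \<in> Nk k" "m' \<in> Nk k" "a n = degree_diff m m'" "sh m (x n) = sh m' (x (Suc n))"
    using Suc.prems(2)[of n] by auto
  define p where "p = b + m"
  \<comment> \<open>At the junction \<open>n\<close> the raised level is \<open>b + m + N n\<close>.
    The new arrow, with levels \<open>m\<close> and \<open>m'\<close>, is raised by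
    \<open>b + N n\<close> to meet it, which puts its far end at
    \<open>b + N n + m'\<close>.\<close>
  define L where "L i = (if i \<le> n then p + N i else b + N n + m')" for i
  have p: "p \<in> Nk k" "b \<le> p" using b m(1) by (simp_all add: p_def Nk_add fun_le_add)
  have "L i \<in> Nk k" if "i \<le> Suc n" for i
    using N(1)[of i] N(1)[of n] p(1) b m(2) by (simp add: L_def Nk_add)
  moreover have "b \<le> L i" if "i \<le> Suc n" for i
    using N(2)[of i] p(2) by (auto simp: L_def le_fun_def intro: trans_le_add1)
  moreover have "sh (L i) (x i) = sh (L 0) (x 0)" if i: "i \<le> Suc n" for i
  proof -
    have old: "sh (L i) (x i) = sh p (sh (N 0) (x 0))" if "i \<le> n" for i
    proof -
      have "sh (L i) (x i) = sh p (sh (N i) (x i))" using that p(1) by (simp add: L_def shift_shift)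
      then show ?thesis using N(3)[OF that] by simp
    qed
    have "sh (L (Suc n)) (x (Suc n)) = sh (b + N n) (sh m' (x (Suc n)))"
      using b N(1)[of n] by (simp add: L_def shift_shift Nk_add)
    also have "\<dots> = sh (b + N n) (sh m (x n))" using m(4) by simp
    also have "\<dots> = sh (p + N n) (x n)"
      using b N(1)[of n] by (simp add: shift_shift Nk_add p_def ac_simps)
    also have "\<dots> = sh (L n) (x n)" by (simp add: L_def)
    finally have "sh (L (Suc n)) (x (Suc n)) = sh p (sh (N 0) (x 0))" using old[of n] by simp
    then show ?thesis using old[of i] old[of 0] i by (cases "i = Suc n") auto
  qed
  moreover have "a i = degree_diff (L i) (L (Suc i))" if i: "i < Suc n" for i
  proof (cases "i = n")
    case True
    have "degree_diff (L n) (L (Suc n)) = degree_diff m m'"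
      by (simp add: L_def p_def degree_diff_def fun_eq_iff)
    then show ?thesis using True m(3) by simp
  next
    case False
    then have i: "i < n" using i by simp
    then have "degree_diff (L i) (L (Suc i)) = degree_diff (N i) (N (Suc i))"
      by (simp add: L_def degree_diff_def fun_eq_iff)
    then show ?thesis using N(4)[OF i] by simp
  qed
  ultimately show ?case by (intro exI[of _ L]) blast
qed

text \<open>The vertices of the point are the ranges of its arrows followed by the source of the
  last one, and \<open>common_levels\<close> aligns their tails. Degree 0 is treated apart, because
  its only entry is a unit.\<close>

lemma nerve_coordinates:
  assumes "t \<in> topspace (nerve G n)" and b: "b \<in> Nk k"
  shows "\<exists>x N. (\<forall>i\<le>n. x i \<in> IP \<and> N i \<in> Nk k \<and> b \<le> N i \<and> sh (N i) (x i) = sh (N 0) (x 0)) \<and>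
     (\<forall>i<max 1 n. t i = (x i, degree_diff (N i) (N (min (Suc i) n)), x (min (Suc i) n)))"
proof (cases "n = 0")
  case True
  then have "t 0 \<in> units G" using assms(1) unfolding topspace_nerve by blast
  then obtain x where "x \<in> IP" "t 0 = (x, 0, x)" unfolding units_iff by blast
  then show ?thesis
    using True b by (intro exI[of _ "\<lambda>_. x"] exI[of _ "\<lambda>_. b"]) (simp add: degree_diff_self)
next
  case False
  then have max: "max 1 n = n" by simp
  have t: "t i \<in> kgraph_arrows k \<Lambda>" if "i < n" for i
    using assms(1) that max unfolding topspace_nerve by (auto simp: PiE_iff)
  have comp: "gsrc G (t i) = grng G (t (Suc i))" if "Suc i < n" for i
    using assms(1) that unfolding topspace_nerve by blast
  define x where "x i = (if i < n then fst (t i) else snd (snd (t (n - 1))))" for i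
  define a where "a i = fst (snd (t i))" for i
  have ti: "t i = (x i, a i, x (Suc i))" if i: "i < n" for i
  proof (cases "Suc i < n")
    case True
    obtain u c v u' c' v' where uv: "t i = (u, c, v)" "t (Suc i) = (u', c', v')" by (metis prod_cases3)
    have "v = u'" using comp[OF True] unfolding uv groupoid_simps by simp
    then show ?thesis using i True uv by (simp add: x_def a_def)
  next
    case False
    then have "n - 1 = i" using i by simp
    then show ?thesis using i False by (simp add: x_def a_def)
  qed
  have arrow: "(x i, a i, x (Suc i)) \<in> kgraph_arrows k \<Lambda>" if "i < n" for i using t[OF that] ti[OF that] by simp
  have xIP: "x i \<in> IP" if "i \<le> n" for i
  proof (cases "i < n")
    case True
    then show ?thesis using arrow[OF True] arrow_iff by blast
  next
    case False2: False
    then have "i = Suc (n - 1)" "n - 1 < n" using that False by auto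
    then show ?thesis using arrow[of "n - 1"] arrow_iff by metis
  qed
  have "\<exists>N. (\<forall>i\<le>n. N i \<in> Nk k \<and> b \<le> N i \<and> sh (N i) (x i) = sh (N 0) (x 0)) \<and>
             (\<forall>i<n. a i = degree_diff (N i) (N (Suc i)))"
    by (rule common_levels[OF xIP _ b]) (use arrow arrow_iff in blast)+
  then obtain N where N: "\<forall>i\<le>n. N i \<in> Nk k \<and> b \<le> N i \<and> sh (N i) (x i) = sh (N 0) (x 0)"
    "\<forall>i<n. a i = degree_diff (N i) (N (Suc i))" by blast
  have "t i = (x i, degree_diff (N i) (N (min (Suc i) n)), x (min (Suc i) n))" if "i < n" for i
  proof -
    have "min (Suc i) n = Suc i" using that by simp
    then show ?thesis using ti[OF that] N(2) that by simp
  qed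
  then show ?thesis unfolding max using N(1) xIP by blast
qed

text \<open>A neighbourhood contains a product of open sets, each of which contains the bisections
  around its entry at all sufficiently high levels. Common levels above all these bounds give one
  tuple that serves every entry.\<close>

lemma nerve_base:
  assumes U: "openin (nerve G n) U" "t \<in> U"
  shows "\<exists>xs\<in>tuples n. t \<in> tuple_cylinder xs \<and> tuple_cylinder xs \<subseteq> U"
proof -
  have tn: "t \<in> topspace (nerve G n)" using U openin_subset by blast
  from nerve_open_contains_PiE[OF U]
  obtain V where V': "\<forall>i<max 1 n. openin (arrow_top G) (V i) \<and> t i \<in> V i"
    and V3: "topspace (nerve G n) \<inter> (\<Pi>\<^sub>E i\<in>{..<max 1 n}. V i) \<subseteq> U" by (elim exE conjE)
  have V: "openin (arrow_top G) (V i)" "t i \<in> V i" if "i < max 1 n" for i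
    using V' that by simp_all
  have "\<exists>m0\<in>Nk k. \<forall>m\<in>Nk k. \<forall>m'\<in>Nk k. m0 \<le> m \<and> degree_diff m m' = fst (snd (t i)) \<and> sh m (fst (t i)) = sh m' (snd (snd (t i))) \<longrightarrow>
           bisection k \<Lambda> (fst (t i) (0, m)) (snd (snd (t i)) (0, m')) \<subseteq> V i" if "i < max 1 n" for i
    using arrow_base[OF V(1)[OF that], of "fst (t i)" "fst (snd (t i))" "snd (snd (t i))"] V(2)[OF that] by simp
  then obtain m0 where m0: "\<And>i. i < max 1 n \<Longrightarrow> m0 i \<in> Nk k"
    "\<And>i m m'. \<lbrakk>i < max 1 n; m \<in> Nk k; m' \<in> Nk k; m0 i \<le> m; degree_diff m m' = fst (snd (t i));
       sh m (fst (t i)) = sh m' (snd (snd (t i)))\<rbrakk> \<Longrightarrow> bisection k \<Lambda> (fst (t i) (0, m)) (snd (snd (t i)) (0, m')) \<subseteq> V i"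
    by metis
  \<comment> \<open>The sum dominates each of the bounds \<open>m0 i\<close>.\<close>
  define b where "b j = (\<Sum>i<max 1 n. m0 i j)" for j
  have bN: "b \<in> Nk k" using m0(1) by (simp add: Nk_def b_def)
  have b: "m0 i \<le> b" if "i < max 1 n" for i
    using that by (auto simp: le_fun_def b_def intro: member_le_sum)
  obtain x N where xN: "\<And>i. i \<le> n \<Longrightarrow> x i \<in> IP" "\<And>i. i \<le> n \<Longrightarrow> N i \<in> Nk k" "\<And>i. i \<le> n \<Longrightarrow> b \<le> N i"
    "\<And>i. i \<le> n \<Longrightarrow> sh (N i) (x i) = sh (N 0) (x 0)"
    "\<And>i. i < max 1 n \<Longrightarrow> t i = (x i, degree_diff (N i) (N (min (Suc i) n)), x (min (Suc i) n))"
    using nerve_coordinates[OF tn bN] by blast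
  \<comment> \<open>The tuple consists of the initial segments up to the common levels; the common
    tail will be the parameter.\<close>
  define xs where "xs = map (\<lambda>i. x i (0, N i)) [0..<Suc n]"
  have l: "length xs = Suc n" by (simp add: xs_def)
  have nth: "xs ! i = x i (0, N i)" if "i \<le> n" for i
  proof -
    have "i < Suc n" using that by simp
    then show ?thesis unfolding xs_def by (simp del: upt_Suc)
  qed
  have hd: "hd xs = x 0 (0, N 0)" using nth[of 0] l by (cases xs) auto
  have src: "src \<Lambda> (x i (0, N i)) = src \<Lambda> (hd xs)" if "i \<le> n" for i
    unfolding hd using src_initial[OF xN(1)[OF that] xN(2)[OF that]] src_initial[OF xN(1) xN(2), of 0 0] xN(4)[OF that] by simp
  have xs: "xs \<in> tuples n"
    unfolding tuples_def
  proof (intro CollectI conjI l subsetI ballI)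
    fix \<mu> assume "\<mu> \<in> set xs"
    then obtain i where i: "i \<le> n" "\<mu> = x i (0, N i)" using l nth by (metis in_set_conv_nth less_Suc_eq_le)
    show "\<mu> \<in> M" unfolding i(2) by (rule initial_in_M[OF xN(1)[OF i(1)] xN(2)[OF i(1)]])
    show "src \<Lambda> \<mu> = src \<Lambda> (hd xs)" unfolding i(2) by (rule src[OF i(1)])
  qed
  have deg: "deg \<Lambda> (xs ! i) = N i" if "i \<le> n" for i
    unfolding nth[OF that] by (rule deg_initial[OF xN(1)[OF that] xN(2)[OF that]])
  have cyl: "x i \<in> Z (xs ! i)" if "i \<le> n" for i
    unfolding nth[OF that] by (rule cylinder_initial[OF xN(1)[OF that] xN(2)[OF that]])
  define z where "z = sh (N 0) (x 0)"
  have pre: "prepend (xs ! i) z = x i" if "i \<le> n" for i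
    using prepend_shift[OF tuplesD(2)[OF xs that] cyl[OF that]] unfolding deg[OF that] xN(4)[OF that] z_def .
  have z: "z \<in> Z (src \<Lambda> (hd xs))"
    using shift_in_src[OF tuplesD(2)[OF xs le0] cyl[OF le0]]
    unfolding deg[OF le0] z_def tuplesD(4)[OF xs] .
  have "t = nerve_point xs z"
  proof (rule extensionalityI[of _ "{..<max 1 n}"])
    show "t \<in> extensional {..<max 1 n}" using tn unfolding topspace_nerve by (auto simp: PiE_iff)
    show "nerve_point xs z \<in> extensional {..<max 1 n}" by (simp add: nerve_point_eq[OF l])
    fix i assume "i \<in> {..<max 1 n}"
    then have i: "i < max 1 n" "i \<le> n" "min (Suc i) n \<le> n" by auto
    show "t i = nerve_point xs z i"
      unfolding nerve_point_apply[OF l i(1)] xN(5)[OF i(1)] arr_def deg[OF i(2)] deg[OF i(3)]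
      using pre[OF i(2)] pre[OF i(3)] by simp
  qed
  then have tz: "t \<in> tuple_cylinder xs" using z unfolding tuple_cylinder_def by blast
  have "bisection k \<Lambda> (xs ! i) (xs ! min (Suc i) n) \<subseteq> V i" if i: "i < max 1 n" for i
  proof -
    have le: "i \<le> n" "min (Suc i) n \<le> n" using i by auto
    have "bisection k \<Lambda> (fst (t i) (0, N i)) (snd (snd (t i)) (0, N (min (Suc i) n))) \<subseteq> V i"
    proof (rule m0(2)[OF i xN(2)[OF le(1)] xN(2)[OF le(2)]])
      show "m0 i \<le> N i" using b[OF i] xN(3)[OF le(1)] by (rule order_trans)
      show "degree_diff (N i) (N (min (Suc i) n)) = fst (snd (t i))" by (simp add: xN(5)[OF i])
      show "sh (N i) (fst (t i)) = sh (N (min (Suc i) n)) (snd (snd (t i)))"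
        using xN(4)[OF le(1)] xN(4)[OF le(2)] by (simp add: xN(5)[OF i])
    qed
    then show ?thesis unfolding nth[OF le(1)] nth[OF le(2)] xN(5)[OF i] by simp
  qed
  then have "tuple_cylinder xs \<subseteq> topspace (nerve G n) \<inter> (\<Pi>\<^sub>E i\<in>{..<max 1 n}. V i)"
    unfolding tuple_cylinder_eq[OF xs] by (intro Int_mono order_refl PiE_mono) auto
  then show ?thesis using V3 xs tz by blast
qed

section \<open>Extending tuples by a common path\<close>

abbreviation ext :: "'a list \<Rightarrow> 'a \<Rightarrow> 'a list" where
  "ext xs \<alpha> \<equiv> map (\<lambda>\<mu>. \<mu> \<cdot> \<alpha>) xs"

lemma ext_tuple:
  assumes xs: "xs \<in> tuples n" and \<alpha>: "\<alpha> \<in> paths_from \<Lambda> (src \<Lambda> (hd xs)) m"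
  shows "ext xs \<alpha> \<in> tuples n" "hd (ext xs \<alpha>) = hd xs \<cdot> \<alpha>" "src \<Lambda> (hd (ext xs \<alpha>)) = src \<Lambda> \<alpha>"
    "deg \<Lambda> (hd (ext xs \<alpha>)) = deg \<Lambda> (hd xs) + m" "\<alpha> \<in> M"
proof -
  show hd: "hd (ext xs \<alpha>) = hd xs \<cdot> \<alpha>" using tuplesD(6)[OF xs] by (simp add: hd_map)
  show "\<alpha> \<in> M" using \<alpha> by (simp add: paths_from_def)
  show src: "src \<Lambda> (hd (ext xs \<alpha>)) = src \<Lambda> \<alpha>" "deg \<Lambda> (hd (ext xs \<alpha>)) = deg \<Lambda> (hd xs) + m"
    unfolding hd using comp_paths_from[OF tuplesD(5)[OF xs] \<alpha>] by auto
  have *: "\<mu> \<cdot> \<alpha> \<in> M \<and> src \<Lambda> (\<mu> \<cdot> \<alpha>) = src \<Lambda> \<alpha>" if "\<mu> \<in> set xs" for \<mu>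
  proof -
    have "\<mu> \<in> M" "src \<Lambda> \<mu> = src \<Lambda> (hd xs)" using xs that unfolding tuples_def by blast+
    then show ?thesis using comp_paths_from(2,4)[of \<mu> \<alpha> m] \<alpha> by simp
  qed
  show "ext xs \<alpha> \<in> tuples n"
    unfolding tuples_def mem_Collect_eq src using tuplesD(1)[OF xs] * by auto
qed

lemma prepend_image: "\<alpha> \<in> M \<Longrightarrow> prepend \<alpha> ` Z (src \<Lambda> \<alpha>) = Z \<alpha>"
proof (intro Set.set_eqI iffI)
  fix y assume "\<alpha> \<in> M" "y \<in> Z \<alpha>"
  then show "y \<in> prepend \<alpha> ` Z (src \<Lambda> \<alpha>)"
    using prepend_shift[of \<alpha> y] shift_in_src[of \<alpha> y] by (intro image_eqI[of _ _ "sh (deg \<Lambda> \<alpha>) y"]) simp_all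
qed (use prepend(1) in blast)

text \<open>Prepending \<open>\<mu> \<cdot> \<alpha>\<close> means prepending
  \<open>\<alpha>\<close> and then \<open>\<mu>\<close>, and degree differences do not change when
  both paths are extended by \<open>\<alpha>\<close>.\<close>

lemma nerve_point_ext:
  assumes xs: "xs \<in> tuples n" and \<alpha>: "\<alpha> \<in> paths_from \<Lambda> (src \<Lambda> (hd xs)) m" and z: "z \<in> Z (src \<Lambda> \<alpha>)"
  shows "nerve_point (ext xs \<alpha>) z = nerve_point xs (prepend \<alpha> z)"
proof -
  note l = tuplesD(1)[OF xs]
  have l': "length (ext xs \<alpha>) = Suc n" using l by simp
  have 1: "prepend (ext xs \<alpha> ! i) z = prepend (xs ! i) (prepend \<alpha> z)" "deg \<Lambda> (ext xs \<alpha> ! i) = deg \<Lambda> (xs ! i) + m"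
    if "i \<le> n" for i
  proof -
    have nth: "ext xs \<alpha> ! i = xs ! i \<cdot> \<alpha>" using l that by simp
    have \<alpha>': "\<alpha> \<in> paths_from \<Lambda> (src \<Lambda> (xs ! i)) m" using \<alpha> tuplesD(3)[OF xs that] by simp
    show "prepend (ext xs \<alpha> ! i) z = prepend (xs ! i) (prepend \<alpha> z)" "deg \<Lambda> (ext xs \<alpha> ! i) = deg \<Lambda> (xs ! i) + m"
      unfolding nth using comp_paths_from(1,3)[OF tuplesD(2)[OF xs that] \<alpha>'] prepend_comp(1)[OF _ z] by auto
  qed
  have "arr (ext xs \<alpha> ! i) (ext xs \<alpha> ! min (Suc i) n) z = arr (xs ! i) (xs ! min (Suc i) n) (prepend \<alpha> z)"
    if "i < max 1 n" for i
  proof -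
    have "i \<le> n" "min (Suc i) n \<le> n" using that by auto
    then show ?thesis unfolding arr_def by (simp only: 1 degree_diff_add)
  qed
  then show ?thesis unfolding nerve_point_eq[OF l] nerve_point_eq[OF l'] by (intro restrict_ext) auto
qed

lemma tuple_cylinder_ext:
  assumes "xs \<in> tuples n" "\<alpha> \<in> paths_from \<Lambda> (src \<Lambda> (hd xs)) m"
  shows "tuple_cylinder (ext xs \<alpha>) = nerve_point xs ` Z \<alpha>"
proof -
  have "tuple_cylinder (ext xs \<alpha>) = (\<lambda>z. nerve_point xs (prepend \<alpha> z)) ` Z (src \<Lambda> \<alpha>)"
    unfolding tuple_cylinder_def ext_tuple(3)[OF assms] using nerve_point_ext[OF assms] by (intro image_cong) auto
  also have "\<dots> = nerve_point xs ` Z \<alpha>"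
    using prepend_image[OF ext_tuple(5)[OF assms]] by (metis image_image)
  finally show ?thesis .
qed

lemma cylinder_vertex_split:
  assumes \<eta>: "\<eta> \<in> M" and m: "m \<in> Nk k"
  shows "(\<Union>\<alpha>\<in>paths_from \<Lambda> (src \<Lambda> \<eta>) m. Z \<alpha>) = Z (src \<Lambda> \<eta>)"
proof -
  have "src \<Lambda> \<eta> \<cdot> \<alpha> = \<alpha>" if "\<alpha> \<in> paths_from \<Lambda> (src \<Lambda> \<eta>) m" for \<alpha>
    using that comp_rng[of \<alpha>] by (auto simp: paths_from_def)
  then show ?thesis using cylinder_split[OF src_closed[OF \<eta>] m] src_src[OF \<eta>] by simp
qed

lemma tuple_cylinder_split:
  assumes xs: "xs \<in> tuples n" and m: "m \<in> Nk k"
  shows "(\<Union>\<alpha>\<in>paths_from \<Lambda> (src \<Lambda> (hd xs)) m. tuple_cylinder (ext xs \<alpha>)) = tuple_cylinder xs"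
proof -
  have "(\<Union>\<alpha>\<in>paths_from \<Lambda> (src \<Lambda> (hd xs)) m. tuple_cylinder (ext xs \<alpha>)) =
      (\<Union>\<alpha>\<in>paths_from \<Lambda> (src \<Lambda> (hd xs)) m. nerve_point xs ` Z \<alpha>)"
    using tuple_cylinder_ext[OF xs] by (intro SUP_cong) auto
  also have "\<dots> = nerve_point xs ` (\<Union>\<alpha>\<in>paths_from \<Lambda> (src \<Lambda> (hd xs)) m. Z \<alpha>)" by (rule image_UN[symmetric])
  finally show ?thesis unfolding cylinder_vertex_split[OF tuplesD(5)[OF xs] m] tuple_cylinder_def .
qed

text \<open>Entry \<open>i\<close> contains the vertex with index \<open>i\<close> as its range; in
  positive degree the last vertex is the source of the last entry.\<close>

lemma tuple_coordinates:
  assumes xs: "xs \<in> tuples n" and ys: "ys \<in> tuples n" and eq: "nerve_point xs z = nerve_point ys z'" and i: "i \<le> n"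
  shows "prepend (xs ! i) z = prepend (ys ! i) z'"
proof (cases "i < max 1 n")
  case True
  have "nerve_point xs z i = nerve_point ys z' i" using eq by simp
  then show ?thesis
    unfolding nerve_point_apply[OF tuplesD(1)[OF xs] True] nerve_point_apply[OF tuplesD(1)[OF ys] True] arr_def by simp
next
  case False
  then have n: "n - 1 < max 1 n" "min (Suc (n - 1)) n = i" using i by auto
  have "nerve_point xs z (n - 1) = nerve_point ys z' (n - 1)" using eq by simp
  then show ?thesis
    unfolding nerve_point_apply[OF tuplesD(1)[OF xs] n(1)] nerve_point_apply[OF tuplesD(1)[OF ys] n(1)] arr_def n(2) by simp
qed

text \<open>The entries of \<open>t\<close> fix the differences of consecutive degrees, so the first
  degree determines the rest. Each path of the tuple is then the initial segment of known degree of
  a vertex of \<open>t\<close>.\<close>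

lemma tuple_eqI:
  assumes xs: "xs \<in> tuples n" and ys: "ys \<in> tuples n" and d: "deg \<Lambda> (hd xs) = deg \<Lambda> (hd ys)"
    and t: "t \<in> tuple_cylinder xs" "t \<in> tuple_cylinder ys"
  shows "xs = ys"
proof -
  obtain z z' where z: "t = nerve_point xs z" "z \<in> Z (src \<Lambda> (hd xs))" and z': "t = nerve_point ys z'" "z' \<in> Z (src \<Lambda> (hd ys))"
    using t unfolding tuple_cylinder_def by blast
  have eq: "nerve_point xs z = nerve_point ys z'" using z z' by simp
  have deg: "deg \<Lambda> (xs ! i) = deg \<Lambda> (ys ! i)" if "i \<le> n" for i
    using that
  proof (induction i)
    case 0
    show ?case using d tuplesD(4)[OF xs] tuplesD(4)[OF ys] by simp
  next
    case (Suc i)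
    then have i: "i < max 1 n" "min (Suc i) n = Suc i" by auto
    have "nerve_point xs z i = nerve_point ys z' i" using eq by simp
    then have "degree_diff (deg \<Lambda> (xs ! i)) (deg \<Lambda> (xs ! Suc i)) = degree_diff (deg \<Lambda> (ys ! i)) (deg \<Lambda> (ys ! Suc i))"
      unfolding nerve_point_apply[OF tuplesD(1)[OF xs] i(1)] nerve_point_apply[OF tuplesD(1)[OF ys] i(1)] arr_def i(2) by simp
    then show ?case using Suc degree_diff_cancel by auto
  qed
  have "xs ! i = ys ! i" if i: "i \<le> n" for i
  proof -
    have "prepend (xs ! i) z \<in> Z (xs ! i)" using prepend(1)[OF tuplesD(2)[OF xs i]] tuplesD(3)[OF xs i] z(2) by simp
    moreover have "prepend (ys ! i) z' \<in> Z (ys ! i)" using prepend(1)[OF tuplesD(2)[OF ys i]] tuplesD(3)[OF ys i] z'(2) by simp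
    ultimately show ?thesis using tuple_coordinates[OF xs ys eq i] deg[OF i] cylinder_disjoint[of "xs ! i" "ys ! i"] by auto
  qed
  then show ?thesis using tuplesD(1)[OF xs] tuplesD(1)[OF ys] by (intro nth_equalityI) auto
qed

lemma nerve_point_inj:
  assumes xs: "xs \<in> tuples n"
  shows "inj_on (nerve_point xs) (Z (src \<Lambda> (hd xs)))"
proof (rule inj_onI)
  fix z z' assume z: "z \<in> Z (src \<Lambda> (hd xs))" "z' \<in> Z (src \<Lambda> (hd xs))" and eq: "nerve_point xs z = nerve_point xs z'"
  have "prepend (hd xs) z = prepend (hd xs) z'" using tuple_coordinates[OF xs xs eq, of 0] tuplesD(4)[OF xs] by simp
  then show "z = z'" using prepend(2)[OF tuplesD(5)[OF xs]] z by metis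
qed

text \<open>Both tuples are extended until the degrees of their first paths agree, at the sum of the
  two; the common point then makes the extensions equal.\<close>

lemma tuple_cylinder_refinement:
  assumes xs: "xs \<in> tuples n" and ys: "ys \<in> tuples n" and \<alpha>: "\<alpha> \<in> paths_from \<Lambda> (src \<Lambda> (hd xs)) (deg \<Lambda> (hd ys))"
    and t: "t \<in> tuple_cylinder (ext xs \<alpha>)" "t \<in> tuple_cylinder ys"
  shows "tuple_cylinder (ext xs \<alpha>) \<subseteq> tuple_cylinder ys"
proof -
  have d: "deg \<Lambda> (hd xs) \<in> Nk k" using deg_closed tuplesD(5)[OF xs] by blast
  obtain \<beta> where \<beta>: "\<beta> \<in> paths_from \<Lambda> (src \<Lambda> (hd ys)) (deg \<Lambda> (hd xs))" "t \<in> tuple_cylinder (ext ys \<beta>)"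
    using t(2) tuple_cylinder_split[OF ys d] by blast
  have "ext xs \<alpha> = ext ys \<beta>"
    by (rule tuple_eqI[OF ext_tuple(1)[OF xs \<alpha>] ext_tuple(1)[OF ys \<beta>(1)] _ t(1) \<beta>(2)])
      (simp only: ext_tuple(4)[OF xs \<alpha>] ext_tuple(4)[OF ys \<beta>(1)] add.commute)
  then show ?thesis using tuple_cylinder_split[OF ys d] \<beta>(1) by auto
qed

text \<open>Compactness is inherited from the cylinder of the common source: an open cover is pulled
  back along \<open>nerve_point xs\<close> to a cover by cylinders \<open>Z \<alpha>\<close>. The
  refinement of \<open>xs\<close> extends it by the degree of the first path of
  \<open>ys\<close>.\<close>

lemma nerve_compact_open_base: "compact_open_base (nerve G n) (tuples n) tuple_cylinder"
proof
  fix xs assume xs: "xs \<in> tuples n"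
  let ?v = "src \<Lambda> (hd xs)"
  have hd: "hd xs \<in> M" by (rule tuplesD(5)[OF xs])
  show "openin (nerve G n) (tuple_cylinder xs)" by (rule openin_tuple_cylinder[OF xs])
  show "compactin (nerve G n) (tuple_cylinder xs)"
    unfolding compactin_def
  proof (intro conjI allI impI)
    show "tuple_cylinder xs \<subseteq> topspace (nerve G n)" by (rule tuple_cylinder_subset[OF xs])
    fix \<U> assume U: "Ball \<U> (openin (nerve G n)) \<and> tuple_cylinder xs \<subseteq> \<Union>\<U>"
    define S where "S = {\<alpha> \<in> M. \<exists>V\<in>\<U>. nerve_point xs ` Z \<alpha> \<subseteq> V}"
    have "\<exists>\<alpha>\<in>S. z \<in> Z \<alpha>" if z: "z \<in> Z ?v" for z
    proof -
      have t: "nerve_point xs z \<in> tuple_cylinder xs" using z unfolding tuple_cylinder_def by blast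
      then obtain V where V: "V \<in> \<U>" "nerve_point xs z \<in> V" using U by blast
      then obtain ys where ys: "ys \<in> tuples n" "nerve_point xs z \<in> tuple_cylinder ys" "tuple_cylinder ys \<subseteq> V"
        using nerve_base[of n V "nerve_point xs z"] U by blast
      obtain \<alpha> where \<alpha>: "\<alpha> \<in> paths_from \<Lambda> ?v (deg \<Lambda> (hd ys))" "z \<in> Z \<alpha>"
        using cylinder_vertex_split[OF hd deg_closed[OF tuplesD(5)[OF ys(1)]]] z by blast
      note ext = tuple_cylinder_ext[OF xs \<alpha>(1)]
      have "nerve_point xs z \<in> tuple_cylinder (ext xs \<alpha>)" unfolding ext using \<alpha>(2) by blast
      then have "nerve_point xs ` Z \<alpha> \<subseteq> V"
        using tuple_cylinder_refinement[OF xs ys(1) \<alpha>(1) _ ys(2)] ys(3) unfolding ext by blast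
      then show ?thesis using \<alpha>(2) V(1) ext_tuple(5)[OF xs \<alpha>(1)] unfolding S_def by blast
    qed
    then obtain F where F: "F \<subseteq> S" "finite F" "Z ?v \<subseteq> (\<Union>\<alpha>\<in>F. Z \<alpha>)"
      using cylinder_cover[OF src_closed[OF hd], of S] unfolding S_def by blast
    have "\<forall>\<alpha>\<in>F. \<exists>V. V \<in> \<U> \<and> nerve_point xs ` Z \<alpha> \<subseteq> V" using F(1) unfolding S_def by blast
    then obtain V where V: "\<And>\<alpha>. \<alpha> \<in> F \<Longrightarrow> V \<alpha> \<in> \<U> \<and> nerve_point xs ` Z \<alpha> \<subseteq> V \<alpha>" by metis
    have "tuple_cylinder xs \<subseteq> \<Union>(V ` F)"
    proof
      fix t assume "t \<in> tuple_cylinder xs"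
      then obtain z where "z \<in> Z ?v" "t = nerve_point xs z" unfolding tuple_cylinder_def by blast
      then obtain \<alpha> where "\<alpha> \<in> F" "t \<in> nerve_point xs ` Z \<alpha>" using F(3) by blast
      then show "t \<in> \<Union>(V ` F)" using V by blast
    qed
    moreover have "V ` F \<subseteq> \<U>" using V by blast
    ultimately show "\<exists>\<F>. finite \<F> \<and> \<F> \<subseteq> \<U> \<and> tuple_cylinder xs \<subseteq> \<Union>\<F>"
      using F(2) by (intro exI[of _ "V ` F"]) simp
  qed
  fix ys assume ys: "ys \<in> tuples n"
  let ?P = "paths_from \<Lambda> ?v (deg \<Lambda> (hd ys))"
  have d: "deg \<Lambda> (hd ys) \<in> Nk k" by (rule deg_closed[OF tuplesD(5)[OF ys]])
  show "\<exists>D\<subseteq>tuples n. finite D \<and> (\<Union>d\<in>D. tuple_cylinder d) = tuple_cylinder xs \<and>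
      (\<forall>d\<in>D. \<forall>e\<in>D. d \<noteq> e \<longrightarrow> tuple_cylinder d \<inter> tuple_cylinder e = {}) \<and>
      (\<forall>d\<in>D. tuple_cylinder d \<subseteq> tuple_cylinder ys \<or> tuple_cylinder d \<inter> tuple_cylinder ys = {})"
  proof (intro exI[of _ "ext xs ` ?P"] conjI)
    show "ext xs ` ?P \<subseteq> tuples n" using ext_tuple(1)[OF xs] by blast
    show "finite (ext xs ` ?P)" using paths_from_src(1)[OF hd d] by simp
    show "(\<Union>d\<in>ext xs ` ?P. tuple_cylinder d) = tuple_cylinder xs" using tuple_cylinder_split[OF xs d] by simp
    show "\<forall>d\<in>ext xs ` ?P. \<forall>e\<in>ext xs ` ?P. d \<noteq> e \<longrightarrow> tuple_cylinder d \<inter> tuple_cylinder e = {}"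
    proof (intro ballI impI)
      fix d e assume "d \<in> ext xs ` ?P" "e \<in> ext xs ` ?P" "d \<noteq> e"
      then obtain \<alpha> \<beta> where ab: "\<alpha> \<in> ?P" "\<beta> \<in> ?P" "d = ext xs \<alpha>" "e = ext xs \<beta>" by blast
      have "deg \<Lambda> (hd d) = deg \<Lambda> (hd e)"
        unfolding ab(3,4) ext_tuple(4)[OF xs ab(1)] ext_tuple(4)[OF xs ab(2)] ..
      then show "tuple_cylinder d \<inter> tuple_cylinder e = {}"
        using tuple_eqI[of d n e] ext_tuple(1)[OF xs ab(1)] ext_tuple(1)[OF xs ab(2)] ab(3,4) \<open>d \<noteq> e\<close> by blast
    qed
    show "\<forall>d\<in>ext xs ` ?P. tuple_cylinder d \<subseteq> tuple_cylinder ys \<or> tuple_cylinder d \<inter> tuple_cylinder ys = {}"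
      using tuple_cylinder_refinement[OF xs ys] by blast
  qed
next
  fix U t assume "openin (nerve G n) U" "t \<in> U"
  then show "\<exists>xs\<in>tuples n. t \<in> tuple_cylinder xs \<and> tuple_cylinder xs \<subseteq> U" by (rule nerve_base)
qed

end

section \<open>The double complex of tuples\<close>

definition omit :: "nat \<Rightarrow> 'v list \<Rightarrow> 'v list" where
  "omit i xs = take i xs @ drop (Suc i) xs"

text \<open>The alternating sum over omitted entries in recursive form, which reduces the identities
  for the boundary to short inductions. A one-element list is sent to the empty list.\<close>

primrec simplex_bdry :: "'v list \<Rightarrow> ('v list \<Rightarrow>\<^sub>0 int)" where
  "simplex_bdry [] = 0"
| "simplex_bdry (x # xs) = frag_of xs - frag_extend (\<lambda>ys. frag_of (x # ys)) (simplex_bdry xs)"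

definition sbd :: "('v list \<Rightarrow>\<^sub>0 int) \<Rightarrow> ('v list \<Rightarrow>\<^sub>0 int)" where
  "sbd = frag_extend simplex_bdry"

lemma sbd_diff: "sbd (a - b) = sbd a - sbd b"
  by (simp add: sbd_def frag_extend_diff)

lemma sbd_zero [simp]: "sbd 0 = 0"
  by (simp add: sbd_def)

lemma sbd_of [simp]: "sbd (frag_of xs) = simplex_bdry xs"
  by (simp add: sbd_def)

lemma additive_on_sbd: "additive_on A sbd"
  by (simp add: additive_on_def sbd_def frag_extend_add)

text \<open>Putting a fixed entry in front is a contracting homotopy for lists; it also drives the
  induction that shows that the boundary squares to zero.\<close>

lemma sbd_Cons: "sbd (frag_extend (\<lambda>ys. frag_of (x # ys)) c) = c - frag_extend (\<lambda>ys. frag_of (x # ys)) (sbd c)"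
  using subset_UNIV
  by (induction c rule: frag_induction) (simp_all add: frag_extend_diff sbd_diff)

lemma sbd_simplex_bdry: "sbd (simplex_bdry xs) = 0"
  by (induction xs) (simp_all add: sbd_diff sbd_Cons)

lemma sbd_sbd: "sbd (sbd c) = 0"
  using subset_UNIV
  by (induction c rule: frag_induction) (simp_all add: sbd_diff sbd_simplex_bdry)

lemma omit_Cons: "omit 0 (x # xs) = xs" "omit (Suc i) (x # xs) = x # omit i xs"
  by (simp_all add: omit_def)

lemma simplex_bdry_eq: "simplex_bdry xs = (\<Sum>i<length xs. frag_cmul ((- 1) ^ i) (frag_of (omit i xs)))"
proof (induction xs)
  case (Cons x xs)
  have "frag_extend (\<lambda>ys. frag_of (x # ys)) (simplex_bdry xs) =
      (\<Sum>i<length xs. frag_cmul ((- 1) ^ i) (frag_of (x # omit i xs)))"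
    by (simp add: Cons frag_extend_sum frag_extend_cmul)
  moreover have "(\<Sum>i<length xs. frag_cmul ((- 1) ^ Suc i) (frag_of (x # omit i xs))) =
      - (\<Sum>i<length xs. frag_cmul ((- 1) ^ i) (frag_of (x # omit i xs)))"
    by (simp add: sum_negf[symmetric])
  ultimately show ?case
    by (simp add: sum.lessThan_Suc_shift omit_Cons del: sum.lessThan_Suc power_Suc)
qed simp

lemma length_omit: "i < length xs \<Longrightarrow> length (omit i xs) = length xs - 1"
  by (simp add: omit_def)

lemma nth_omit: "\<lbrakk>i < length xs; j < length xs - 1\<rbrakk> \<Longrightarrow> omit i xs ! j = (if j < i then xs ! j else xs ! Suc j)"
  by (auto simp: omit_def nth_append)

lemma set_omit: "set (omit i xs) \<subseteq> set xs"
  unfolding omit_def using set_take_subset set_drop_subset by fastforce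

lemma map_omit: "map f (omit i xs) = omit i (map f xs)"
  by (simp add: omit_def take_map drop_map)

lemma sbd_eq:
  assumes "\<And>xs. xs \<in> Poly_Mapping.keys c \<Longrightarrow> length xs = m"
  shows "sbd c = (\<Sum>i<m. frag_cmul ((- 1) ^ i) (frag_extend (frag_of \<circ> omit i) c))"
proof -
  have "sbd b = (\<Sum>i<m. frag_cmul ((- 1) ^ i) (frag_extend (frag_of \<circ> omit i) b))"
    if "Poly_Mapping.keys b \<subseteq> Poly_Mapping.keys c" for b
    using that
  proof (induction b rule: frag_induction)
    case (one xs)
    then show ?case using assms by (simp add: simplex_bdry_eq)
  next
    case (diff a b)
    have "frag_cmul n (a - b) = frag_cmul n a - frag_cmul n b" for n and a b :: "'a list \<Rightarrow>\<^sub>0 int"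
      by (intro poly_mapping_eqI) (simp add: lookup_minus right_diff_distrib)
    then show ?case using diff by (simp add: sbd_diff frag_extend_diff sum_subtractf)
  qed simp
  then show ?thesis by simp
qed

lemma ind_comb_cmul: "ind_comb Z (frag_cmul m c) x = m * ind_comb Z c x"
  by (subst ind_comb_superset[of "Poly_Mapping.keys c"])
    (auto simp: keys_cmul ind_comb_def sum_distrib_left mult.assoc)

lemma ind_comb_sum: "ind_comb Z (\<Sum>i\<in>F. g i) x = (\<Sum>i\<in>F. ind_comb Z (g i) x)"
  by (induction F rule: infinite_finite_induct) (simp_all add: ind_comb_add)

context row_finite_k_graph
begin

definition tuple_frags :: "nat \<Rightarrow> ('a list \<Rightarrow>\<^sub>0 int) set" where
  "tuple_frags n = {c. Poly_Mapping.keys c \<subseteq> tuples n}"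

definition \<tau> :: "nat \<Rightarrow> ('a list \<Rightarrow>\<^sub>0 int) \<Rightarrow> ('a list \<Rightarrow>\<^sub>0 int)" where
  "\<tau> i = frag_extend (\<lambda>xs. \<Sum>\<alpha>\<in>paths_from \<Lambda> (src \<Lambda> (hd xs)) (unit_vec i). frag_of (ext xs \<alpha>))"

abbreviation \<epsilon> :: "('a list \<Rightarrow>\<^sub>0 int) \<Rightarrow> (nat \<Rightarrow> 'a ipath \<times> (nat \<Rightarrow> int) \<times> 'a ipath) \<Rightarrow> int" where
  "\<epsilon> \<equiv> ind_comb tuple_cylinder"

definition \<eta> :: "('a list \<Rightarrow>\<^sub>0 int) \<Rightarrow> ('a \<Rightarrow>\<^sub>0 int)" where
  "\<eta> = frag_extend (frag_of \<circ> (\<lambda>xs. src \<Lambda> (hd xs)))"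

lemma \<tau>_of: "\<tau> i (frag_of xs) = (\<Sum>\<alpha>\<in>paths_from \<Lambda> (src \<Lambda> (hd xs)) (unit_vec i). frag_of (ext xs \<alpha>))"
  by (simp add: \<tau>_def)

lemma \<tau>_diff: "\<tau> i (a - b) = \<tau> i a - \<tau> i b"
  by (simp add: \<tau>_def frag_extend_diff)

text \<open>The cylinders of the extensions of a tuple by all paths of degree \<open>e_i\<close>
  partition the cylinder of the tuple.\<close>

lemma \<epsilon>_\<tau>_of:
  assumes xs: "xs \<in> tuples n" and i: "i < k"
  shows "\<epsilon> (\<tau> i (frag_of xs)) = \<epsilon> (frag_of xs)"
proof
  fix t
  let ?P = "paths_from \<Lambda> (src \<Lambda> (hd xs)) (unit_vec i)"
  have fin: "finite ?P" by (rule paths_from_src(1)[OF tuplesD(5)[OF xs] Nk_unit_vec[OF i]])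
  have "\<epsilon> (\<tau> i (frag_of xs)) t = (\<Sum>\<alpha>\<in>?P. indicator (tuple_cylinder (ext xs \<alpha>)) t)"
    unfolding \<tau>_of by (rule ind_comb_frag_sum[OF fin])
  also have "\<dots> = indicator (\<Union>\<alpha>\<in>?P. tuple_cylinder (ext xs \<alpha>)) t"
  proof (rule indicator_disjoint_UN[symmetric, OF fin])
    fix \<alpha> \<beta> assume ab: "\<alpha> \<in> ?P" "\<beta> \<in> ?P" "\<alpha> \<noteq> \<beta>"
    have "ext xs \<alpha> \<noteq> ext xs \<beta>"
    proof
      assume "ext xs \<alpha> = ext xs \<beta>"
      then have "hd (ext xs \<alpha>) = hd (ext xs \<beta>)" by (rule arg_cong)
      then have "hd xs \<cdot> \<alpha> = hd xs \<cdot> \<beta>" unfolding ext_tuple(2)[OF xs ab(1)] ext_tuple(2)[OF xs ab(2)] .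
      then show False using comp_inj[OF tuplesD(5)[OF xs] ab(1,2)] ab(3) by blast
    qed
    moreover have "deg \<Lambda> (hd (ext xs \<alpha>)) = deg \<Lambda> (hd (ext xs \<beta>))"
      unfolding ext_tuple(4)[OF xs ab(1)] ext_tuple(4)[OF xs ab(2)] ..
    ultimately show "tuple_cylinder (ext xs \<alpha>) \<inter> tuple_cylinder (ext xs \<beta>) = {}"
      using tuple_eqI[OF ext_tuple(1)[OF xs ab(1)] ext_tuple(1)[OF xs ab(2)]] by blast
  qed
  finally show "\<epsilon> (\<tau> i (frag_of xs)) t = \<epsilon> (frag_of xs) t"
    unfolding tuple_cylinder_split[OF xs Nk_unit_vec[OF i]] by simp
qed

lemma tuple_cylinder_nonempty: "xs \<in> tuples n \<Longrightarrow> tuple_cylinder xs \<noteq> {}"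
  unfolding tuple_cylinder_def using cylinder_nonempty[OF src_closed[OF tuplesD(5)]] by blast

text \<open>Within one degree of the first path the tuple cylinders are nonempty and pairwise
  disjoint, which gives the independence.\<close>

lemma graded_tuples: "graded_frags k (tuples n) (\<lambda>xs. deg \<Lambda> (hd xs)) \<tau> \<epsilon>"
proof
  show "\<tau> i (a - b) = \<tau> i a - \<tau> i b" for i a b by (rule \<tau>_diff)
  show "\<epsilon> (a - b) = \<epsilon> a - \<epsilon> b" for a b by (rule ind_comb_diff)
  fix i xs assume i: "i < k" and xs: "xs \<in> tuples n"
  show "\<epsilon> (\<tau> i (frag_of xs)) = \<epsilon> (frag_of xs)" by (rule \<epsilon>_\<tau>_of[OF xs i])
  show "Poly_Mapping.keys (\<tau> i (frag_of xs)) \<subseteq>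
    {ys \<in> tuples n. deg \<Lambda> (hd ys) = (deg \<Lambda> (hd xs))(i := Suc (deg \<Lambda> (hd xs) i))}"
  proof
    fix ys assume "ys \<in> Poly_Mapping.keys (\<tau> i (frag_of xs))"
    then obtain \<alpha> where \<alpha>: "\<alpha> \<in> paths_from \<Lambda> (src \<Lambda> (hd xs)) (unit_vec i)" "ys = ext xs \<alpha>"
      unfolding \<tau>_of using keys_sum by (auto dest!: subsetD[OF keys_sum])
    have "deg \<Lambda> (hd xs) + unit_vec i = (deg \<Lambda> (hd xs))(i := Suc (deg \<Lambda> (hd xs) i))"
      by (simp add: fun_eq_iff unit_vec_def)
    then show "ys \<in> {ys \<in> tuples n. deg \<Lambda> (hd ys) = (deg \<Lambda> (hd xs))(i := Suc (deg \<Lambda> (hd xs) i))}"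
      using ext_tuple(1,4)[OF xs \<alpha>(1)] \<alpha>(2) by simp
  qed
next
  fix c q assume c: "Poly_Mapping.keys c \<subseteq> {xs \<in> tuples n. deg \<Lambda> (hd xs) = q}" "\<epsilon> c = 0"
  show "c = 0"
  proof (rule ind_comb_eq_zeroD[OF c(2)])
    show "tuple_cylinder xs \<noteq> {}" if "xs \<in> Poly_Mapping.keys c" for xs
      using tuple_cylinder_nonempty c(1) that by blast
    fix xs ys assume *: "xs \<in> Poly_Mapping.keys c" "ys \<in> Poly_Mapping.keys c" "xs \<noteq> ys"
    then have "xs \<in> tuples n" "ys \<in> tuples n" "deg \<Lambda> (hd xs) = deg \<Lambda> (hd ys)" using c(1) by auto
    then show "tuple_cylinder xs \<inter> tuple_cylinder ys = {}" using tuple_eqI *(3) by blast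
  qed
next
  fix i xs assume "xs \<in> tuples n" "k \<le> i"
  then show "deg \<Lambda> (hd xs) i = 0" using deg_closed[OF tuplesD(5)] by (simp add: Nk_def)
qed

lemma K_eq: "graded_frags.K (tuples n) = tuple_frags n"
  by (simp add: graded_frags.K_def[OF graded_tuples] tuple_frags_def)

lemmas commuting_endos_\<tau> = graded_frags.commuting_endos_K[OF graded_tuples, unfolded K_eq]
lemmas regular_\<tau> = graded_frags.regular_K[OF graded_tuples, unfolded K_eq]
lemmas kernel_\<epsilon> = graded_frags.kernel_\<epsilon>[OF graded_tuples, unfolded K_eq]
lemmas \<epsilon>_\<tau> = graded_frags.\<epsilon>_\<tau>[OF graded_tuples, unfolded K_eq]
lemmas add_closed_tuple_frags = graded_frags.add_closed_K[OF graded_tuples, unfolded K_eq]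

section \<open>Boundary, augmentation and contraction for tuples\<close>

lemma omit_tuple:
  assumes xs: "xs \<in> tuples (Suc n)" and i: "i \<le> Suc n"
  shows "omit i xs \<in> tuples n" "src \<Lambda> (hd (omit i xs)) = src \<Lambda> (hd xs)"
proof -
  have l: "length (omit i xs) = Suc n" using length_omit[of i xs] tuplesD(1)[OF xs] i by simp
  have sub: "\<mu> \<in> M \<and> src \<Lambda> \<mu> = src \<Lambda> (hd xs)" if "\<mu> \<in> set (omit i xs)" for \<mu>
    using xs subsetD[OF set_omit that] unfolding tuples_def by blast
  have "omit i xs \<noteq> []" using l by auto
  then show src: "src \<Lambda> (hd (omit i xs)) = src \<Lambda> (hd xs)" using sub[OF hd_in_set] by blast
  show "omit i xs \<in> tuples n"
    unfolding tuples_def mem_Collect_eq src using l sub by blast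
qed

lemma keys_simplex_bdry:
  assumes "xs \<in> tuples (Suc n)"
  shows "Poly_Mapping.keys (simplex_bdry xs) \<subseteq> tuples n"
proof
  fix ys assume "ys \<in> Poly_Mapping.keys (simplex_bdry xs)"
  then obtain i where i: "i < length xs" "ys \<in> Poly_Mapping.keys (frag_cmul ((- 1) ^ i) (frag_of (omit i xs)))"
    unfolding simplex_bdry_eq by (blast dest: subsetD[OF keys_sum])
  then have "ys = omit i xs" by (simp add: keys_cmul_iff split: if_splits)
  then show "ys \<in> tuples n" using omit_tuple(1)[OF assms] i(1) tuplesD(1)[OF assms] by simp
qed

lemma sbd_closed: "c \<in> tuple_frags (Suc n) \<Longrightarrow> sbd c \<in> tuple_frags n"
  unfolding sbd_def tuple_frags_def mem_Collect_eq
  using keys_frag_extend[of simplex_bdry c] keys_simplex_bdry by blast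

lemma sbd_\<tau>:
  assumes i: "i < k" and c: "c \<in> tuple_frags (Suc n)"
  shows "sbd (\<tau> i c) = \<tau> i (sbd c)"
  using c[unfolded tuple_frags_def mem_Collect_eq]
proof (induction c rule: frag_induction)
  case zero
  show ?case by (simp add: \<tau>_def)
next
  case (one xs)
  let ?P = "paths_from \<Lambda> (src \<Lambda> (hd xs)) (unit_vec i)"
  have fin: "finite ?P" by (rule paths_from_src(1)[OF tuplesD(5)[OF one] Nk_unit_vec[OF i]])
  have "sbd (\<tau> i (frag_of xs)) = (\<Sum>\<alpha>\<in>?P. simplex_bdry (ext xs \<alpha>))"
    unfolding \<tau>_of sbd_def by (simp add: frag_extend_sum[OF fin])
  also have "\<dots> = (\<Sum>\<alpha>\<in>?P. \<Sum>j<length xs. frag_cmul ((- 1) ^ j) (frag_of (ext (omit j xs) \<alpha>)))"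
    by (simp add: simplex_bdry_eq map_omit)
  also have "\<dots> = (\<Sum>j<length xs. \<Sum>\<alpha>\<in>?P. frag_cmul ((- 1) ^ j) (frag_of (ext (omit j xs) \<alpha>)))"
    by (rule sum.swap)
  also have "\<dots> = (\<Sum>j<length xs. frag_cmul ((- 1) ^ j) (\<tau> i (frag_of (omit j xs))))"
  proof (rule sum.cong[OF refl])
    fix j assume "j \<in> {..<length xs}"
    then have "src \<Lambda> (hd (omit j xs)) = src \<Lambda> (hd xs)"
      using omit_tuple(2)[OF one, of j] tuplesD(1)[OF one] by simp
    then show "(\<Sum>\<alpha>\<in>?P. frag_cmul ((- 1) ^ j) (frag_of (ext (omit j xs) \<alpha>))) = frag_cmul ((- 1) ^ j) (\<tau> i (frag_of (omit j xs)))"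
      by (simp add: \<tau>_of frag_cmul_sum)
  qed
  also have "\<dots> = \<tau> i (sbd (frag_of xs))"
    unfolding sbd_of simplex_bdry_eq \<tau>_def by (simp add: frag_extend_sum frag_extend_cmul)
  finally show ?case .
next
  case (diff a b)
  then show ?case by (simp add: \<tau>_diff sbd_diff)
qed

lemma \<eta>_diff: "\<eta> (a - b) = \<eta> a - \<eta> b"
  by (simp add: \<eta>_def frag_extend_diff)

lemma \<eta>_of: "\<eta> (frag_of xs) = frag_of (src \<Lambda> (hd xs))"
  by (simp add: \<eta>_def)

lemma additive_on_\<eta>: "additive_on A \<eta>"
  by (simp add: additive_on_def \<eta>_def frag_extend_add)

lemma \<eta>_closed:
  assumes "c \<in> tuple_frags n"
  shows "\<eta> c \<in> ZV"
proof -
  have "src \<Lambda> (hd xs) \<in> vertices \<Lambda>" if "xs \<in> Poly_Mapping.keys c" for xs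
    using assms that verticesI[OF tuplesD(5)] unfolding tuple_frags_def by blast
  then show ?thesis
    using keys_frag_extend[of "frag_of \<circ> (\<lambda>xs. src \<Lambda> (hd xs))" c] unfolding \<eta>_def ZV_def by fastforce
qed

lemma \<eta>_\<tau>:
  assumes i: "i < k" and c: "c \<in> tuple_frags n"
  shows "\<eta> (\<tau> i c) = S i (\<eta> c)"
  using c[unfolded tuple_frags_def mem_Collect_eq]
proof (induction c rule: frag_induction)
  case zero
  show ?case by (simp add: \<tau>_def \<eta>_def S_zero)
next
  case (one xs)
  let ?P = "paths_from \<Lambda> (src \<Lambda> (hd xs)) (unit_vec i)"
  have fin: "finite ?P" by (rule paths_from_src(1)[OF tuplesD(5)[OF one] Nk_unit_vec[OF i]])
  have "\<eta> (\<tau> i (frag_of xs)) = (\<Sum>\<alpha>\<in>?P. frag_of (src \<Lambda> (hd (ext xs \<alpha>))))"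
    unfolding \<tau>_of \<eta>_def by (simp add: frag_extend_sum[OF fin])
  also have "\<dots> = (\<Sum>\<alpha>\<in>?P. frag_of (src \<Lambda> \<alpha>))"
    by (intro sum.cong refl) (simp only: ext_tuple(3)[OF one])
  also have "\<dots> = S i (\<eta> (frag_of xs))"
    unfolding \<eta>_of by (rule vertex_matrix_transpose_of[OF verticesI[OF tuplesD(5)[OF one]] i, symmetric])
  finally show ?case .
next
  case (diff a b)
  then show ?case by (simp add: \<tau>_diff \<eta>_diff S_diff)
qed

lemma \<eta>_sbd:
  assumes "c \<in> tuple_frags 1"
  shows "\<eta> (sbd c) = 0"
  using assms[unfolded tuple_frags_def mem_Collect_eq]
proof (induction c rule: frag_induction)
  case zero
  show ?case by (simp add: \<eta>_def)
next
  case (one xs)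
  have l: "length xs = 2" using tuplesD(1)[OF one] by simp
  then obtain \<mu> \<nu> where xs: "xs = [\<mu>, \<nu>]" by (auto simp: length_Suc_conv numeral_2_eq_2)
  have "src \<Lambda> \<nu> = src \<Lambda> \<mu>" using tuplesD(3)[OF one, of 1] unfolding xs by simp
  then show ?case by (simp add: xs \<eta>_diff \<eta>_of)
next
  case (diff a b)
  then show ?case by (simp add: sbd_diff \<eta>_diff)
qed

definition cone :: "('a list \<Rightarrow>\<^sub>0 int) \<Rightarrow> ('a list \<Rightarrow>\<^sub>0 int)" where
  "cone = frag_extend (\<lambda>xs. frag_of (src \<Lambda> (hd xs) # xs))"

lemma cone_tuple:
  assumes "xs \<in> tuples n"
  shows "src \<Lambda> (hd xs) # xs \<in> tuples (Suc n)"
  using assms src_src[OF tuplesD(5)[OF assms]] src_closed[OF tuplesD(5)[OF assms]]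
  unfolding tuples_def by simp

lemma cone_closed:
  assumes "c \<in> tuple_frags n"
  shows "cone c \<in> tuple_frags (Suc n)"
proof -
  have "src \<Lambda> (hd xs) # xs \<in> tuples (Suc n)" if "xs \<in> Poly_Mapping.keys c" for xs
    using assms that cone_tuple unfolding tuple_frags_def by blast
  then show ?thesis
    using keys_frag_extend[of "\<lambda>xs. frag_of (src \<Lambda> (hd xs) # xs)" c] unfolding cone_def tuple_frags_def by fastforce
qed

lemma cone_diff: "cone (a - b) = cone a - cone b"
  by (simp add: cone_def frag_extend_diff)

text \<open>All faces of a tuple have its common source, so the cone of each face puts the same
  vertex in front.\<close>

lemma sbd_cone:
  assumes "c \<in> tuple_frags (Suc n)"
  shows "sbd (cone c) = c - cone (sbd c)"
  using assms[unfolded tuple_frags_def mem_Collect_eq]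
proof (induction c rule: frag_induction)
  case zero
  show ?case by (simp add: cone_def)
next
  case (one xs)
  let ?v = "src \<Lambda> (hd xs)"
  have "cone (simplex_bdry xs) = frag_extend (\<lambda>ys. frag_of (?v # ys)) (simplex_bdry xs)"
  proof -
    have "cone (frag_of (omit i xs)) = frag_extend (\<lambda>ys. frag_of (?v # ys)) (frag_of (omit i xs))" if "i < length xs" for i
      using omit_tuple(2)[OF one, of i] tuplesD(1)[OF one] that by (simp add: cone_def)
    then show ?thesis
      unfolding simplex_bdry_eq cone_def by (simp add: frag_extend_sum frag_extend_cmul)
  qed
  then show ?case by (simp add: cone_def)
next
  case (diff a b)
  then show ?case by (simp add: cone_diff sbd_diff)
qed

text \<open>The boundary of the cone of \<open>[\<mu>]\<close> is \<open>[\<mu>]\<close> minus the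
  one-element tuple of its source, and the second term depends only on the image under
  \<open>\<eta>\<close>.\<close>

lemma sbd_cone_0:
  assumes "c \<in> tuple_frags 0" "\<eta> c = 0"
  shows "sbd (cone c) = c"
proof -
  have "sbd (cone c) = c - frag_extend ((\<lambda>v. frag_of [v]) \<circ> (\<lambda>xs. src \<Lambda> (hd xs))) c"
    using assms(1)[unfolded tuple_frags_def mem_Collect_eq]
  proof (induction c rule: frag_induction)
    case zero
    show ?case by (simp add: cone_def)
  next
    case (one xs)
    then obtain \<mu> where "xs = [\<mu>]" using tuplesD(1)[OF one] by (auto simp: length_Suc_conv)
    then show ?case by (simp add: cone_def)
  next
    case (diff a b)
    then show ?case by (simp add: cone_diff sbd_diff frag_extend_diff)
  qed
  also have "frag_extend ((\<lambda>v. frag_of [v]) \<circ> (\<lambda>xs. src \<Lambda> (hd xs))) c = frag_extend (\<lambda>v. frag_of [v]) (\<eta> c)"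
    unfolding \<eta>_def by (rule frag_extend_compose[symmetric])
  finally show ?thesis using assms(2) by simp
qed

section \<open>Comparison with the differential of the groupoid\<close>

lemma face_nerve_point:
  assumes xs: "xs \<in> tuples (Suc n)" and n: "n \<noteq> 0" and i: "i \<le> Suc n"
  shows "face G (Suc n) i (nerve_point xs z) = nerve_point (omit i xs) z"
proof (rule extensionalityI[of _ "{..<n}"])
  show "face G (Suc n) i (nerve_point xs z) \<in> extensional {..<n}" by (simp add: face_def)
  have l: "length (omit i xs) = Suc n" by (rule tuplesD(1)[OF omit_tuple(1)[OF xs i]])
  have lx: "length xs = Suc (Suc n)" by (rule tuplesD(1)[OF xs])
  have max: "max 1 n = n" using n by simp
  show "nerve_point (omit i xs) z \<in> extensional {..<n}" using nerve_point_eq[OF l] max by simp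
  fix j assume "j \<in> {..<n}"
  then have j: "j < n" by simp
  have om: "omit i xs ! m = (if m < i then xs ! m else xs ! Suc m)" if "m \<le> n" for m
    using nth_omit[of i xs m] lx i that by simp
  have np: "nerve_point xs z m = arr (xs ! m) (xs ! Suc m) z" if "m \<le> n" for m
  proof -
    have "m < max 1 (Suc n)" "min (Suc m) (Suc n) = Suc m" using that by auto
    then show ?thesis using nerve_point_apply[OF lx, of m z] by simp
  qed
  have R: "nerve_point (omit i xs) z j = arr (omit i xs ! j) (omit i xs ! Suc j) z"
  proof -
    have "j < max 1 n" "min (Suc j) n = Suc j" using j by auto
    then show ?thesis using nerve_point_apply[OF l, of j z] by simp
  qed
  \<comment> \<open>An inner face composes two consecutive arrows, which removes the path between
    them; the outer faces drop the first or the last arrow and with it an end path.\<close>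
  have comp: "gcomp G (arr \<mu> \<nu> z) (arr \<nu> \<rho> z) = arr \<mu> \<rho> z" for \<mu> \<nu> \<rho>
    by (simp add: arr_def groupoid_simps degree_diff_comp)
  consider "i = 0" | "i = Suc n" | "i \<noteq> 0" "i \<noteq> Suc n" by blast
  then show "face G (Suc n) i (nerve_point xs z) j = nerve_point (omit i xs) z j"
  proof cases
    case 1
    then show ?thesis using j np[of "Suc j"] om[of j] om[of "Suc j"] unfolding R by (simp add: face_def)
  next
    case 2
    then show ?thesis using j np[of j] om[of j] om[of "Suc j"] unfolding R by (simp add: face_def)
  next
    case 3
    then obtain l where l: "i = Suc l" by (cases i) auto
    have ln: "l < n" using 3(2) i l by simp
    consider "j < l" | "j = l" | "l < j" by linarith
    then show ?thesis
    proof cases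
      case 1
      then show ?thesis using j l 3(2) np[of j] om[of j] om[of "Suc j"] unfolding R by (simp add: face_def)
    next
      case 2
      then show ?thesis
        using j l 3(2) np[of l] np[of "Suc l"] om[of j] om[of "Suc j"] comp unfolding R by (simp add: face_def)
    next
      case 3
      then show ?thesis using j l ln np[of "Suc j"] om[of j] om[of "Suc j"] unfolding R by (simp add: face_def)
    qed
  qed
qed

text \<open>In degree 1 the source map omits the first path and the range map the second, so source
  minus range has the signs of the alternating sum.\<close>

lemma src_nerve_point:
  assumes xs: "xs \<in> tuples 1"
  shows "(\<lambda>j\<in>{..<1}. gsrc G (nerve_point xs z 0)) = nerve_point (omit 0 xs) z"
    "(\<lambda>j\<in>{..<1}. grng G (nerve_point xs z 0)) = nerve_point (omit 1 xs) z"
proof -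
  have lx: "length xs = Suc 1" using tuplesD(1)[OF xs] by simp
  then obtain \<mu> \<nu> where xs': "xs = [\<mu>, \<nu>]" by (auto simp: length_Suc_conv)
  have "nerve_point xs z 0 = arr \<mu> \<nu> z" using nerve_point_apply[OF lx, of 0 z] by (simp add: xs')
  moreover have "nerve_point [\<kappa>] z = (\<lambda>j\<in>{..<1}. (prepend \<kappa> z, 0, prepend \<kappa> z))" for \<kappa>
    using nerve_point_eq[of "[\<kappa>]" 0 z] by (auto simp: arr_def degree_diff_self)
  moreover have "omit 0 xs = [\<nu>]" "omit 1 xs = [\<mu>]" by (simp_all add: xs' omit_def)
  ultimately show "(\<lambda>j\<in>{..<1}. gsrc G (nerve_point xs z 0)) = nerve_point (omit 0 xs) z"
    "(\<lambda>j\<in>{..<1}. grng G (nerve_point xs z 0)) = nerve_point (omit 1 xs) z"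
    by (simp_all add: arr_def groupoid_simps)
qed

text \<open>A tuple cylinder is parametrised by the cylinder of the common source, and after one
  path is omitted the remaining ones still determine the parameter; hence \<open>\<psi>\<close> is
  injective on it.\<close>

lemma pushforward_omit:
  assumes c: "c \<in> tuple_frags (Suc n)" and i: "i \<le> Suc n"
    and \<psi>: "\<And>xs z. xs \<in> tuples (Suc n) \<Longrightarrow> \<psi> (nerve_point xs z) = nerve_point (omit i xs) z"
  shows "pushforward (nerve G (Suc n)) \<psi> (\<epsilon> c) = \<epsilon> (frag_extend (frag_of \<circ> omit i) c)"
proof -
  have keys: "xs \<in> tuples (Suc n)" if "xs \<in> Poly_Mapping.keys c" for xs
    using c that unfolding tuple_frags_def by blast
  have img: "\<psi> ` tuple_cylinder xs = tuple_cylinder (omit i xs)" if xs: "xs \<in> tuples (Suc n)" for xs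
    unfolding tuple_cylinder_def omit_tuple(2)[OF xs i] image_image using \<psi>[OF xs] by simp
  have inj: "inj_on \<psi> (tuple_cylinder xs)" if xs: "xs \<in> tuples (Suc n)" for xs
    unfolding tuple_cylinder_def
  proof (intro inj_onI, elim imageE)
    fix t t' z z' assume t: "t = nerve_point xs z" "t' = nerve_point xs z'" "z \<in> Z (src \<Lambda> (hd xs))" "z' \<in> Z (src \<Lambda> (hd xs))"
      and "\<psi> t = \<psi> t'"
    then have eq: "nerve_point (omit i xs) z = nerve_point (omit i xs) z'" using \<psi>[OF xs] by simp
    have "z = z'"
      using nerve_point_inj[OF omit_tuple(1)[OF xs i]] eq t(3,4)
      unfolding inj_on_def omit_tuple(2)[OF xs i] by blast
    then show "t = t'" using t by simp
  qed
  have "pushforward (nerve G (Suc n)) \<psi> (\<epsilon> c) = ind_comb (\<lambda>xs. \<psi> ` tuple_cylinder xs) c"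
    using keys tuple_cylinder_subset inj by (intro pushforward_ind_comb) blast+
  also have "\<dots> = ind_comb (\<lambda>xs. tuple_cylinder (omit i xs)) c"
    using keys img by (intro ind_comb_cong) blast
  also have "\<dots> = \<epsilon> (frag_extend (frag_of \<circ> omit i) c)"
    by (rule ind_comb_frag_extend[symmetric]) simp
  finally show ?thesis .
qed

lemma groupoid_bdry_\<epsilon>:
  assumes c: "c \<in> tuple_frags (Suc n)"
  shows "groupoid_bdry G (Suc n) (\<epsilon> c) = \<epsilon> (sbd c)"
proof
  fix t
  have "length xs = Suc (Suc n)" if "xs \<in> Poly_Mapping.keys c" for xs
    using c that tuplesD(1) unfolding tuple_frags_def by blast
  then have sbd: "sbd c = (\<Sum>i<Suc (Suc n). frag_cmul ((- 1) ^ i) (frag_extend (frag_of \<circ> omit i) c))"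
    by (rule sbd_eq)
  have eq: "\<epsilon> (sbd c) t = (\<Sum>i<Suc (Suc n). (- 1) ^ i * \<epsilon> (frag_extend (frag_of \<circ> omit i) c) t)"
    unfolding sbd ind_comb_sum by (simp only: ind_comb_cmul)
  show "groupoid_bdry G (Suc n) (\<epsilon> c) t = \<epsilon> (sbd c) t"
  proof (cases "n = 0")
    case True
    have c1: "c \<in> tuple_frags (Suc 0)" using c True by simp
    have s: "pushforward (nerve G 1) (\<lambda>g. \<lambda>j\<in>{..<1}. gsrc G (g 0)) (\<epsilon> c) = \<epsilon> (frag_extend (frag_of \<circ> omit 0) c)"
      using pushforward_omit[OF c1, of 0 "\<lambda>g. \<lambda>j\<in>{..<1}. gsrc G (g 0)"] src_nerve_point(1) by simp
    have r: "pushforward (nerve G 1) (\<lambda>g. \<lambda>j\<in>{..<1}. grng G (g 0)) (\<epsilon> c) = \<epsilon> (frag_extend (frag_of \<circ> omit 1) c)"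
      using pushforward_omit[OF c1, of 1 "\<lambda>g. \<lambda>j\<in>{..<1}. grng G (g 0)"] src_nerve_point(2) by simp
    have "groupoid_bdry G (Suc n) (\<epsilon> c) = \<epsilon> (frag_extend (frag_of \<circ> omit 0) c) - \<epsilon> (frag_extend (frag_of \<circ> omit 1) c)"
      unfolding s[symmetric] r[symmetric] using True by (simp add: groupoid_bdry_def)
    then show ?thesis unfolding eq using True by simp
  next
    case False
    have "pushforward (nerve G (Suc n)) (face G (Suc n) i) (\<epsilon> c) = \<epsilon> (frag_extend (frag_of \<circ> omit i) c)" if "i \<le> Suc n" for i
      using face_nerve_point[OF _ False that] by (intro pushforward_omit[OF c that])
    then have "groupoid_bdry G (Suc n) (\<epsilon> c) t = (\<Sum>i\<le>Suc n. (- 1) ^ i * \<epsilon> (frag_extend (frag_of \<circ> omit i) c) t)"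
      unfolding groupoid_bdry_def using False by simp
    then show ?thesis unfolding eq lessThan_Suc_atMost .
  qed
qed

section \<open>The double complex and its two augmentations\<close>

abbreviation DK :: "nat \<Rightarrow> nat \<Rightarrow> (nat set \<Rightarrow>\<^sub>0 ('a list \<Rightarrow>\<^sub>0 int)) set" where
  "DK p n \<equiv> exterior_chains k (tuple_frags n) p"

text \<open>In exterior degree 0 the empty set is the only index, so its coefficient is the whole
  chain.\<close>

abbreviation \<epsilon>c :: "(nat set \<Rightarrow>\<^sub>0 ('a list \<Rightarrow>\<^sub>0 int)) \<Rightarrow> (nat \<Rightarrow> 'a ipath \<times> (nat \<Rightarrow> int) \<times> 'a ipath) \<Rightarrow> int" where
  "\<epsilon>c c \<equiv> \<epsilon> (Poly_Mapping.lookup c {})"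

lemma Cc_nerve: "Cc (nerve G n) = \<epsilon> ` tuple_frags n"
  using compact_open_base.Cc_eq[OF nerve_compact_open_base] unfolding tuple_frags_def .

lemma additive_groupoid_complex: "additive_complex (groupoid_complex G)"
  unfolding additive_complex_def groupoid_complex_def chain_complex.simps
proof (intro conjI allI ballI)
  fix n
  show "add_closed (Cc (nerve G n))" by (rule add_closed_Cc)
  show "additive_on (Cc (nerve G n)) (groupoid_bdry G n)"
  proof (cases n)
    case 0
    then show ?thesis by (simp add: additive_on_def groupoid_bdry_def)
  next
    case (Suc m)
    show ?thesis
      unfolding additive_on_def Cc_nerve Suc
    proof (intro ballI, elim imageE)
      fix f g a b assume a: "f = \<epsilon> a" "g = \<epsilon> b" "a \<in> tuple_frags (Suc m)" "b \<in> tuple_frags (Suc m)"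
      have "groupoid_bdry G (Suc m) (\<epsilon> (a + b)) = \<epsilon> (sbd (a + b))"
        by (rule groupoid_bdry_\<epsilon>[OF add_closed_add[OF add_closed_tuple_frags a(3,4)]])
      then show "groupoid_bdry G (Suc m) (f + g) = groupoid_bdry G (Suc m) f + groupoid_bdry G (Suc m) g"
        unfolding a(1,2) groupoid_bdry_\<epsilon>[OF a(3)] groupoid_bdry_\<epsilon>[OF a(4)] ind_comb_add[symmetric]
        by (simp only: sbd_def frag_extend_add)
    qed
  qed
  show "groupoid_bdry G (Suc n) ` Cc (nerve G (Suc n)) \<subseteq> Cc (nerve G n)"
    unfolding Cc_nerve using groupoid_bdry_\<epsilon> sbd_closed by auto
next
  fix n f assume "f \<in> Cc (nerve G (Suc (Suc n)))"
  then obtain c where c: "f = \<epsilon> c" "c \<in> tuple_frags (Suc (Suc n))" unfolding Cc_nerve by blast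
  show "groupoid_bdry G (Suc n) (groupoid_bdry G (Suc (Suc n)) f) = 0"
    unfolding c(1) groupoid_bdry_\<epsilon>[OF c(2)] groupoid_bdry_\<epsilon>[OF sbd_closed[OF c(2)]] sbd_sbd by simp
next
  fix f show "groupoid_bdry G 0 f = 0" by (simp add: groupoid_bdry_def)
qed

lemma DK_lookup: "c \<in> DK p n \<Longrightarrow> Poly_Mapping.lookup c J \<in> tuple_frags n"
  by (simp add: exterior_chains_def)

lemma map_sbd_closed: "c \<in> DK p (Suc n) \<Longrightarrow> Poly_Mapping.map sbd c \<in> DK p n"
  by (rule map_exterior_chains[where f = sbd, OF sbd_zero sbd_closed])

lemma lookup_map_sbd: "Poly_Mapping.lookup (Poly_Mapping.map sbd c) J = sbd (Poly_Mapping.lookup c J)"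
  by (rule lookup_map_zero[where f = sbd]) simp

lemma \<eta>_zero: "\<eta> 0 = 0"
  by (simp add: \<eta>_def)

lemma lookup_map_\<eta>: "Poly_Mapping.lookup (Poly_Mapping.map \<eta> c) J = \<eta> (Poly_Mapping.lookup c J)"
  by (rule lookup_map_zero[where f = \<eta>]) (rule \<eta>_zero)

lemma exterior_bdry_sbd:
  "c \<in> DK p (Suc n) \<Longrightarrow> exterior_bdry \<tau> p (Poly_Mapping.map sbd c) = Poly_Mapping.map sbd (exterior_bdry \<tau> p c)"
  by (rule exterior_bdry_map[where f = sbd and A = "tuple_frags (Suc n)" and A' = "tuple_frags n",
        OF commuting_endos_\<tau> commuting_endos_\<tau> additive_on_sbd sbd_closed sbd_\<tau>])

lemma exterior_bdry_\<eta>: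
  "c \<in> DK p n \<Longrightarrow> exterior_bdry S p (Poly_Mapping.map \<eta> c) = Poly_Mapping.map \<eta> (exterior_bdry \<tau> p c)"
  by (rule exterior_bdry_map[where f = \<eta> and A = "tuple_frags n" and A' = ZV,
        OF commuting_endos_\<tau> commuting_endos_S additive_on_\<eta> \<eta>_closed \<eta>_\<tau>])

lemma map_\<eta>_closed: "c \<in> DK p n \<Longrightarrow> Poly_Mapping.map \<eta> c \<in> exterior_chains k ZV p"
  by (rule map_exterior_chains[where f = \<eta>, OF \<eta>_zero \<eta>_closed])

lemma map_\<eta>_sbd:
  assumes "c \<in> DK p 1"
  shows "Poly_Mapping.map \<eta> (Poly_Mapping.map sbd c) = 0"
  using DK_lookup[OF assms] by (intro poly_mapping_eqI) (simp add: lookup_map_\<eta> lookup_map_sbd \<eta>_sbd)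

lemma map_sbd_sbd: "Poly_Mapping.map sbd (Poly_Mapping.map sbd c) = 0"
  by (intro poly_mapping_eqI) (simp add: lookup_map_sbd sbd_sbd)

lemma \<epsilon>c_exterior_bdry:
  assumes c: "c \<in> DK 1 n"
  shows "\<epsilon>c (exterior_bdry \<tau> 1 c) = 0"
proof -
  interpret commuting_endos k "tuple_frags n" \<tau> by (rule commuting_endos_\<tau>)
  have "Poly_Mapping.lookup (exterior_bdry \<tau> 1 c) {} = (\<Sum>i<k. Poly_Mapping.lookup c {i} - \<tau> i (Poly_Mapping.lookup c {i}))"
    using lookup_bdry[OF c] by (simp add: kdiff_def)
  moreover have "\<epsilon> (\<Sum>i<k. Poly_Mapping.lookup c {i} - \<tau> i (Poly_Mapping.lookup c {i})) t = 0" for t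
    unfolding ind_comb_sum ind_comb_diff using \<epsilon>_\<tau>[OF _ DK_lookup[OF c]] by simp
  ultimately show ?thesis by (simp add: fun_eq_iff)
qed

lemma additive_on_\<epsilon>c: "additive_on (DK 0 n) \<epsilon>c"
  by (simp add: additive_on_def lookup_add ind_comb_add)

text \<open>A row is the Koszul complex of the \<open>\<tau> i\<close> on tuples of a fixed length.
  It is exact in positive exterior degree by regularity, and in degree 0 by the description of the
  kernel of \<open>\<epsilon>\<close>.\<close>

lemma row_exact:
  "row_exact_double_complex (groupoid_complex G) (vertex_complex k \<Lambda>) DK
     (\<lambda>p n. exterior_bdry \<tau> p) (\<lambda>p n. Poly_Mapping.map sbd) (\<lambda>n. \<epsilon>c) (\<lambda>p. Poly_Mapping.map \<eta>)"
  unfolding vertex_complex_eq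
proof
  note endos = commuting_endos_\<tau>
  show "additive_complex (groupoid_complex G)" by (rule additive_groupoid_complex)
  show "additive_complex (exterior_complex k ZV S)"
    by (rule commuting_endos.additive_exterior_complex[OF commuting_endos_S])
  show "add_closed (DK p n)" for p n by (rule commuting_endos.add_closed_exterior_chains[OF endos])
  show "exterior_bdry \<tau> (Suc p) c \<in> DK p n" if "c \<in> DK (Suc p) n" for p n c
    by (rule commuting_endos.exterior_bdry_closed[OF endos that])
  show "Poly_Mapping.map sbd c \<in> DK p n" if "c \<in> DK p (Suc n)" for p n c by (rule map_sbd_closed[OF that])
  show "additive_on (DK p (Suc n)) (Poly_Mapping.map sbd)" for p n
    by (rule additive_on_map[OF additive_on_sbd add_closed_zero[OF add_closed_tuple_frags]])
  show "additive_on (DK (Suc p) n) (exterior_bdry \<tau> (Suc p))" for p n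
    by (rule commuting_endos.exterior_bdry_additive[OF endos])
  show "Poly_Mapping.map sbd (Poly_Mapping.map sbd c) = 0" for c by (rule map_sbd_sbd)
  show "exterior_bdry \<tau> (Suc p) (Poly_Mapping.map sbd c) = Poly_Mapping.map sbd (exterior_bdry \<tau> (Suc p) c)"
    if "c \<in> DK (Suc p) (Suc n)" for p n c by (rule exterior_bdry_sbd[OF that])
  show "\<epsilon>c c \<in> chains (groupoid_complex G) n" if "c \<in> DK 0 n" for n c
    using DK_lookup[OF that] by (simp add: groupoid_complex_def Cc_nerve)
  show "Poly_Mapping.map \<eta> c \<in> chains (exterior_complex k ZV S) p" if "c \<in> DK p 0" for p c
    using map_\<eta>_closed[OF that] by (simp add: exterior_complex_def)
  show "additive_on (DK 0 n) \<epsilon>c" for n by (rule additive_on_\<epsilon>c)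
  show "additive_on (DK p 0) (Poly_Mapping.map \<eta>)" for p
    by (rule additive_on_map[OF additive_on_\<eta> add_closed_zero[OF add_closed_tuple_frags]])
  show "\<epsilon>c (Poly_Mapping.map sbd c) = bdry (groupoid_complex G) (Suc n) (\<epsilon>c c)" if "c \<in> DK 0 (Suc n)" for n c
    using groupoid_bdry_\<epsilon>[OF DK_lookup[OF that]] by (simp add: groupoid_complex_def lookup_map_sbd)
  show "Poly_Mapping.map \<eta> (exterior_bdry \<tau> (Suc p) c) = bdry (exterior_complex k ZV S) (Suc p) (Poly_Mapping.map \<eta> c)"
    if "c \<in> DK (Suc p) 0" for p c
    using exterior_bdry_\<eta>[OF that] by (simp add: exterior_complex_def)
  show "Poly_Mapping.map \<eta> (Poly_Mapping.map sbd c) = 0" if "c \<in> DK p 1" for p c by (rule map_\<eta>_sbd[OF that])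
  show "chains (groupoid_complex G) n \<subseteq> \<epsilon>c ` DK 0 n" for n
  proof
    fix f assume "f \<in> chains (groupoid_complex G) n"
    then obtain c where c: "f = \<epsilon> c" "c \<in> tuple_frags n" by (auto simp: groupoid_complex_def Cc_nerve)
    have "Poly_Mapping.single {} c \<in> DK 0 n"
      using c(2) add_closed_zero[OF add_closed_tuple_frags] by (auto simp: exterior_chains_def lookup_single when_def)
    then show "f \<in> \<epsilon>c ` DK 0 n" using c(1) by (intro image_eqI[of _ _ "Poly_Mapping.single {} c"]) simp_all
  qed
  show "c \<in> exterior_bdry \<tau> 1 ` DK 1 n" if c: "c \<in> DK 0 n" "\<epsilon>c c = 0" for n c
  proof -
    obtain x where "\<forall>i. x i \<in> tuple_frags n" "Poly_Mapping.lookup c {} = (\<Sum>i<k. x i - \<tau> i (x i))"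
      using kernel_\<epsilon>[OF DK_lookup[OF c(1)] c(2)] by blast
    then show ?thesis by (intro commuting_endos.exterior_exact_0[OF endos c(1)]) blast+
  qed
  show "c \<in> exterior_bdry \<tau> (Suc (Suc p)) ` DK (Suc (Suc p)) n"
    if "c \<in> DK (Suc p) n" "exterior_bdry \<tau> (Suc p) c = 0" for p n c
    by (rule commuting_endos.exterior_exact_Suc[OF endos regular_\<tau> that])
qed

lemma map_cone:
  assumes "c \<in> DK p n"
  shows "Poly_Mapping.map cone c \<in> DK p (Suc n)"
    "Poly_Mapping.lookup (Poly_Mapping.map cone c) J = cone (Poly_Mapping.lookup c J)"
proof -
  have 0: "cone 0 = 0" by (simp add: cone_def)
  show "Poly_Mapping.map cone c \<in> DK p (Suc n)"
    by (rule map_exterior_chains[where f = cone, OF 0 cone_closed assms])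
  show "Poly_Mapping.lookup (Poly_Mapping.map cone c) J = cone (Poly_Mapping.lookup c J)"
    by (rule lookup_map_zero[where f = cone, OF 0])
qed

text \<open>The contraction acts on each coefficient separately. Exactness concerns single columns,
  so the contraction need not commute with the horizontal differential.\<close>

lemma column_exact:
  "row_exact_double_complex (vertex_complex k \<Lambda>) (groupoid_complex G) (\<lambda>p n. DK n p)
     (\<lambda>p n. Poly_Mapping.map sbd) (\<lambda>p n. exterior_bdry \<tau> n) (\<lambda>p. Poly_Mapping.map \<eta>) (\<lambda>n. \<epsilon>c)"
proof -
  interpret r: row_exact_double_complex "groupoid_complex G" "vertex_complex k \<Lambda>" DK
     "\<lambda>p n. exterior_bdry \<tau> p" "\<lambda>p n. Poly_Mapping.map sbd" "\<lambda>n. \<epsilon>c" "\<lambda>p. Poly_Mapping.map \<eta>"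
    by (rule row_exact)
  show ?thesis
  proof
    show "additive_complex (vertex_complex k \<Lambda>)" "additive_complex (groupoid_complex G)" by (fact r.B r.A)+
    show "exterior_bdry \<tau> (Suc n) (exterior_bdry \<tau> (Suc (Suc n)) c) = 0" if "c \<in> DK (Suc (Suc n)) p" for p n c
      by (rule commuting_endos.exterior_bdry_bdry[OF commuting_endos_\<tau> that])
    show "Poly_Mapping.map sbd (exterior_bdry \<tau> (Suc n) c) = exterior_bdry \<tau> (Suc n) (Poly_Mapping.map sbd c)"
      if "c \<in> DK (Suc n) (Suc p)" for p n c using exterior_bdry_sbd[OF that] by simp
    show "\<epsilon>c (exterior_bdry \<tau> 1 c) = 0" if "c \<in> DK 1 p" for p c by (rule \<epsilon>c_exterior_bdry[OF that])
    show "chains (vertex_complex k \<Lambda>) n \<subseteq> Poly_Mapping.map \<eta> ` DK n 0" for n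
    proof
      fix b assume "b \<in> chains (vertex_complex k \<Lambda>) n"
      then have b: "b \<in> exterior_chains k ZV n" by (simp add: vertex_complex_eq exterior_complex_def)
      \<comment> \<open>A section of \<open>\<eta>\<close>: a vertex is its own source and is
        regarded as a tuple with one entry.\<close>
      define \<sigma> :: "('a \<Rightarrow>\<^sub>0 int) \<Rightarrow> ('a list \<Rightarrow>\<^sub>0 int)" where "\<sigma> = frag_extend (\<lambda>v. frag_of [v])"
      have \<sigma>0: "\<sigma> 0 = 0" by (simp add: \<sigma>_def)
      have \<sigma>: "\<sigma> c \<in> tuple_frags 0 \<and> \<eta> (\<sigma> c) = c" if "c \<in> ZV" for c
        using that[unfolded ZV_def mem_Collect_eq]
      proof (induction c rule: frag_induction)
        case zero
        then show ?case by (simp add: \<sigma>_def \<eta>_zero add_closed_zero[OF add_closed_tuple_frags])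
      next
        case (one v)
        then have "[v] \<in> tuples 0" using vertexD[OF one] by (simp add: tuples_def)
        then show ?case using vertexD(3)[OF one] by (simp add: \<sigma>_def \<eta>_of tuple_frags_def)
      next
        case (diff a b)
        then show ?case
          by (simp add: \<sigma>_def frag_extend_diff \<eta>_diff add_closed_diff[OF add_closed_tuple_frags])
      qed
      have "Poly_Mapping.map \<sigma> b \<in> DK n 0"
        by (rule map_exterior_chains[where f = \<sigma>, OF \<sigma>0 _ b]) (use \<sigma> in blast)
      moreover have "Poly_Mapping.map \<eta> (Poly_Mapping.map \<sigma> b) = b"
      proof (rule poly_mapping_eqI)
        fix J
        have "Poly_Mapping.lookup b J \<in> ZV" using b by (simp add: exterior_chains_def)
        then show "Poly_Mapping.lookup (Poly_Mapping.map \<eta> (Poly_Mapping.map \<sigma> b)) J = Poly_Mapping.lookup b J"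
          using \<sigma> by (simp add: lookup_map_\<eta> lookup_map_zero[where f = \<sigma>, OF \<sigma>0])
      qed
      ultimately show "b \<in> Poly_Mapping.map \<eta> ` DK n 0" by (metis image_eqI)
    qed
    show "c \<in> Poly_Mapping.map sbd ` DK n 1" if c: "c \<in> DK n 0" "Poly_Mapping.map \<eta> c = 0" for n c
    proof -
      have \<eta>0: "\<eta> (Poly_Mapping.lookup c J) = 0" for J
        using c(2) lookup_map_\<eta>[of c J] by simp
      have "c = Poly_Mapping.map sbd (Poly_Mapping.map cone c)"
        using sbd_cone_0[OF DK_lookup[OF c(1)] \<eta>0]
        by (intro poly_mapping_eqI) (simp add: lookup_map_sbd map_cone(2)[OF c(1)])
      moreover have "Poly_Mapping.map cone c \<in> DK n 1" using map_cone(1)[OF c(1)] by simp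
      ultimately show ?thesis by blast
    qed
    show "c \<in> Poly_Mapping.map sbd ` DK n (Suc (Suc p))"
      if c: "c \<in> DK n (Suc p)" "Poly_Mapping.map sbd c = 0" for p n c
    proof -
      have 0: "sbd (Poly_Mapping.lookup c J) = 0" for J
        using c(2) lookup_map_sbd[of c J] by simp
      have "sbd (cone (Poly_Mapping.lookup c J)) = Poly_Mapping.lookup c J" for J
        using sbd_cone[OF DK_lookup[OF c(1)], of J] 0[of J] by (simp add: cone_def)
      then have "c = Poly_Mapping.map sbd (Poly_Mapping.map cone c)"
        by (intro poly_mapping_eqI) (simp add: lookup_map_sbd map_cone(2)[OF c(1)])
      then show ?thesis using map_cone(1)[OF c(1)] by blast
    qed
  qed (fact r.K r.dh r.dv r.dv_additive r.dh_additive r.\<epsilon> r.\<eta> r.\<epsilon>_additive r.\<eta>_additive r.\<epsilon>_dv r.\<eta>_dh)+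
qed

end

theorem proposition7p6:
  fixes k :: nat and \<Lambda> :: "'a graded_cat"
  assumes "k_graph k \<Lambda>"
    and "row_finite_no_sources k \<Lambda>"
  shows "chain_map (vertex_complex k \<Lambda>) (shift_complex k \<Lambda>) (iota_complex k \<Lambda>) \<and>
         (\<forall>p. homology_iso_via (vertex_complex k \<Lambda>) (shift_complex k \<Lambda>) (iota_complex k \<Lambda>) p) \<and>
         (\<forall>p. homology (groupoid_complex (kgraph_groupoid k \<Lambda>)) p \<cong> homology (vertex_complex k \<Lambda>) p)"
proof -
  interpret row_finite_k_graph k \<Lambda>
    using assms by (simp add: row_finite_k_graph_def row_finite_k_graph_axioms_def)
  show ?thesis
    using iota_chain_map iota_homology_iso double_complex_homology_iso[OF row_exact column_exact] by blast
qed

end
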